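(* Let $K$ be an imaginary quadratic field of class number one and let $h\in\mathbb{Z}$. Then, as $x\to\infty$, \[ \sum_{n\leq x} b_K(n)\,b_K(n+h)\gg_{K,h}\frac{x}{\log x}. \]
   Context: For a positive integer $n$, $b_K(n)=1$ if $n$ is the norm of an ideal of $\mathcal{O}_K$ (equivalently, since the class number is one, of an element of $\mathcal{O}_K$), and $b_K(n)=0$ otherwise; set $b_K(m)=0$ for $m\leq 0$. The sum runs over positive integers $n\le x$. *)

theory Defs
  imports "HOL-Analysis.Analysis" "HOL-Computational_Algebra.Polynomial" "HOL-Computational_Algebra.Squarefree"
begin

text \<open>The imaginary quadratic field K = Q(sqrt d), d a negative squarefree integer,
  realised as a subfield of the complex numbers.\<close>
definition imag_quad_field :: "int \<Rightarrow> complex set" where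
  "imag_quad_field d =
     {of_real (of_rat p) + of_real (of_rat q) * \<i> * of_real (sqrt (of_int (- d))) | p q. True}"

definition ring_of_integers :: "int \<Rightarrow> complex set" where
  "ring_of_integers d = {z \<in> imag_quad_field d. algebraic_int z}"

definition is_ideal :: "complex set \<Rightarrow> complex set \<Rightarrow> bool" where
  "is_ideal R I \<longleftrightarrow> I \<subseteq> R \<and> 0 \<in> I \<and> (\<forall>x\<in>I. \<forall>y\<in>I. x + y \<in> I)
      \<and> (\<forall>r\<in>R. \<forall>x\<in>I. r * x \<in> I)"

definition is_principal_ideal :: "complex set \<Rightarrow> complex set \<Rightarrow> bool" where
  "is_principal_ideal R I \<longleftrightarrow> (\<exists>a\<in>R. I = {a * r | r. r \<in> R})"

definition class_number_one :: "int \<Rightarrow> bool" where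
  "class_number_one d \<longleftrightarrow>
     (\<forall>I. is_ideal (ring_of_integers d) I \<longrightarrow> is_principal_ideal (ring_of_integers d) I)"

definition field_norm :: "complex \<Rightarrow> real" where
  "field_norm z = Re (z * cnj z)"

text \<open>b_K(n) = 1 iff n > 0 is the norm of an element of O_K (equivalently of an ideal,
  as the class number is one); b_K(m) = 0 for m \<le> 0.\<close>
definition bK :: "int \<Rightarrow> int \<Rightarrow> real" where
  "bK d n = (if n > 0 \<and> (\<exists>z\<in>ring_of_integers d. field_norm z = of_int n) then 1 else 0)"

end

theory Submission
  imports Defs "HOL-Number_Theory.Number_Theory" "HOL-Real_Asymp.Real_Asymp"
begin

text \<open>Class number one forces the discriminant to be special, so that the splitting of primes is governed by an explicit
 real character chi of conductor q, and every split prime is a norm. For h > 0 one fixes a solution of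
 u0^2 + D + h = a^2 + D b^2 and considers values n = u^2 + D v^2 with (u, v) congruent to (u0, 1) modulo a
 large M. It suffices that no prime with chi = -1 divides the cofactor m1 of n + h to an odd power. A sieve removes all inert
 primes up to z, and all primes between z and a power y of z, from m1; for its y-rough part r the sum of chi over the divisors of r
 is nonnegative, bounded, and nonzero only if r is acceptable. Dirichlet's hyperbola method opens this sum with divisors
 of size about the square root of r, i.e. about the size L of the variables; the level of distribution needed is
 supplied by a fourth moment bound for the Fourier coefficients of the conics u^2 + D v^2 = c modulo p. Each n is
 weighted by the inverse of its number of representations, so the weighted count of pairs bounds the number of n.\<close>

section \<open>The Brun--Hooley sieve\<close>

text \<open>The order x / log x comes from the local means of the weight: up to z a split prime p
  costs half of the proportion 2/p of pairs at which it divides the form, an inert prime costs the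
  proportion 1/p removed from the shifted value. So every prime costs about 1/p, the total mass is
  of order 1 / log z, and z is a fixed power of L. A sieve alone cannot see the parity of the
  exponents of inert primes; the divisor sum of chi over the rough part can. Its large divisors may
  be folded onto small ones because chi of the rough part is 1: the class modulo \<open>M\<close>
  fixes chi of the cofactor, and its smooth part has only split primes. After folding, the moduli
  reach the side L of the box, exactly where the trivial bound p for a Fourier coefficient of the
  conic fails. Any power saving is enough there, and an elementary 2*p^(3/4) is used. Sums over
  these moduli are bounded by a constant exponential in log L / log y, a ratio that grows with the
  depth of the sieve; the factorial decay of the sieve error in that depth wins.\<close>

definition set_poly :: "'a set => ('a set => real) => ('a => real) => real" where
 "set_poly S c f = (\<Sum>E\<in>Pow S. c E*prod f E)"

lemma sum_Pow_insert:
 assumes "finite S" "a \<notin> S"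
 shows "(\<Sum>E\<in>Pow (insert a S). F E) = (\<Sum>E\<in>Pow S. F E) + (\<Sum>E\<in>Pow S. F (insert a E))"
proof -
 have inj: "inj_on (insert a) (Pow S)"
  using assms(2) by (auto simp: inj_on_def)
 have "(\<Sum>E\<in>Pow (insert a S). F E) = (\<Sum>E\<in>Pow S. F E) + (\<Sum>E\<in>insert a ` Pow S. F E)"
  unfolding Pow_insert using assms by (intro sum.union_disjoint) auto
 also have "(\<Sum>E\<in>insert a ` Pow S. F E) = (\<Sum>E\<in>Pow S. F (insert a E))"
  using sum.reindex[OF inj, of F] by simp
 finally show ?thesis .
qed

lemma set_poly_insert:
 assumes "finite S" "a \<notin> S"
 shows "set_poly (insert a S) c f = set_poly S c f + f a * set_poly S (%E. c (insert a E)) f"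
proof -
 have "(\<Sum>E\<in>Pow S. c (insert a E)*prod f (insert a E)) = (\<Sum>E\<in>Pow S. f a*(c (insert a E)*prod f E))"
  using assms by (intro sum.cong refl) (auto simp: finite_subset prod.insert_if dest: finite_subset)
 thus ?thesis
  unfolding set_poly_def sum_Pow_insert[OF assms] by (simp add: sum_distrib_left)
qed

text \<open>Inclusion-exclusion for the product of the \<open>1 - f p\<close>, cut off at sets of
  size r. In \<open>set_poly\<close> a set of primes stands for its squarefree product, and c for
  the sieve weights.\<close>

definition bonf :: "'a set => nat => ('a => real) => real" where
 "bonf S r f = set_poly S (%E. if card E <= r then (-1)^card E else 0) f"

definition elem_sym :: "'a set => nat => ('a => real) => real" where
 "elem_sym S r f = set_poly S (%E. if card E = r then 1 else 0) f"

lemma bonf_insert: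
 assumes "finite S" "a \<notin> S"
 shows "bonf (insert a S) (Suc r) f = bonf S (Suc r) f - f a*bonf S r f"
proof -
 have "set_poly S (%E. if card (insert a E) <= Suc r then (-1)^card (insert a E) else 0) f
   = - bonf S r f"
  unfolding bonf_def set_poly_def sum_negf[symmetric]
  using assms by (intro sum.cong refl) (auto simp: card_insert_if finite_subset dest: finite_subset)
 thus ?thesis
  unfolding bonf_def set_poly_insert[OF assms] by (simp add: algebra_simps)
qed

lemma elem_sym_insert:
 assumes "finite S" "a \<notin> S"
 shows "elem_sym (insert a S) (Suc r) f = elem_sym S (Suc r) f + f a*elem_sym S r f"
proof -
 have "set_poly S (%E. if card (insert a E) = Suc r then 1 else 0) f = elem_sym S r f"
  unfolding elem_sym_def set_poly_def
  using assms by (intro sum.cong refl) (auto simp: card_insert_if finite_subset dest: finite_subset)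
 thus ?thesis
  unfolding elem_sym_def set_poly_insert[OF assms] by simp
qed

lemma set_poly_only_empty:
 assumes "finite S" "!!E. E <= S ==> E ~= {} ==> c E = 0"
 shows "set_poly S c f = c {}"
proof -
 have "set_poly S c f = (\<Sum>E\<in>{{}}. c E*prod f E)"
  unfolding set_poly_def using assms by (intro sum.mono_neutral_right) auto
 thus ?thesis by simp
qed

lemma bonf_0: "finite S ==> bonf S 0 f = 1"
 unfolding bonf_def by (subst set_poly_only_empty) (auto simp: finite_subset)

lemma elem_sym_0: "finite S ==> elem_sym S 0 f = 1"
 unfolding elem_sym_def by (subst set_poly_only_empty) (auto simp: finite_subset)

lemma bonf_empty [simp]: "bonf {} r f = 1"
 by (simp add: bonf_def set_poly_def)

lemma elem_sym_nonneg: "(!!p. p \<in> S ==> 0 <= f p) ==> 0 <= elem_sym S r f"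
 unfolding elem_sym_def set_poly_def by (intro sum_nonneg mult_nonneg_nonneg prod_nonneg) auto

text \<open>Splitting off one element, the signed error at depth r is that of the smaller set at
  depth r plus \<open>f a\<close> times that at depth r - 1, so the signs agree. Weights in the unit
  interval are allowed, not only indicators, because the local factors take the value 1/2.\<close>

lemma bonferroni:
 assumes "finite S" "!!p. p \<in> S ==> 0 <= f p & f p <= 1"
 shows "0 <= (-1)^r*(bonf S r f - (\<Prod>p\<in>S. 1 - f p)) &
  (-1)^r*(bonf S r f - (\<Prod>p\<in>S. 1 - f p)) <= elem_sym S (Suc r) f"
 using assms
proof (induction S arbitrary: r rule: finite_induct)
 case empty
 thus ?case by (simp add: elem_sym_def set_poly_def)
next
 case (insert a S)
 let ?P = "\<Prod>p\<in>S. 1 - f p"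
 have a01: "0 <= f a" "f a <= 1" using insert.prems by auto
 have IH: "0 <= (-1)^r*(bonf S r f - ?P)" "(-1)^r*(bonf S r f - ?P) <= elem_sym S (Suc r) f" for r
  using insert.IH[of r] insert.prems by auto
 have P01: "0 <= ?P" "?P <= 1" using insert.prems by (auto intro!: prod_nonneg prod_le_1)
 show ?case
 proof (cases r)
  case 0
  have "1 - (1 - f a) * ?P = (1 - ?P) + f a * ?P" by (simp add: algebra_simps)
  moreover have "1 - ?P <= elem_sym S (Suc 0) f" using IH[of 0] insert.hyps by (simp add: bonf_0)
  moreover have "f a * ?P <= f a" using a01 P01 by (simp add: mult_left_le)
  moreover have "0 <= f a * ?P" using a01 P01 by simp
  ultimately show ?thesis using 0 insert.hyps P01
   by (simp add: bonf_0 elem_sym_insert elem_sym_0)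
 next
  case (Suc k)
  have "(-1)^r*(bonf (insert a S) r f - (\<Prod>p\<in>insert a S. 1 - f p))
    = (-1)^Suc k*(bonf S (Suc k) f - ?P) + f a*((-1)^k*(bonf S k f - ?P))"
   using insert.hyps unfolding Suc by (simp add: bonf_insert algebra_simps)
  moreover have "f a*((-1)^k*(bonf S k f - ?P)) <= f a*elem_sym S (Suc k) f"
   using IH(2)[of k] a01(1) by (rule mult_left_mono)
  moreover have "0 <= f a*((-1)^k*(bonf S k f - ?P))"
   using IH(1)[of k] a01(1) by (rule mult_nonneg_nonneg[rotated])
  ultimately show ?thesis using IH[of "Suc k"] insert.hyps
   by (simp add: elem_sym_insert Suc)
 qed
qed

text \<open>Expanding the r-th power produces every r-subset exactly r! times.\<close>

lemma elem_sym_le: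
 assumes "finite S" "!!p. p \<in> S ==> 0 <= f p"
 shows "elem_sym S r f <= (\<Sum>p\<in>S. f p)^r/fact r"
 using assms
proof (induction S arbitrary: r rule: finite_induct)
 case empty
 thus ?case by (cases r) (auto simp: elem_sym_def set_poly_def)
next
 case (insert a S)
 let ?s = "\<Sum>p\<in>S. f p"
 have s0: "0 <= ?s" and a0: "0 <= f a" using insert.prems by (auto intro!: sum_nonneg)
 show ?case
 proof (cases r)
  case 0
  thus ?thesis using insert.hyps by (simp add: elem_sym_0)
 next
  case (Suc k)
  have IH: "elem_sym S r f <= ?s^r/fact r" for r using insert by auto
  \<comment> \<open>Only the two leading terms of the binomial expansion are kept; the rest is
    nonnegative.\<close>
  have bern: "?s^Suc k + real (Suc k) * ?s^k*f a <= (?s + f a)^Suc k"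
  proof (induction k)
   case (Suc k)
   have "(?s + f a)^Suc (Suc k) >= (?s + f a)*(?s^Suc k + real (Suc k) * ?s^k*f a)"
    using mult_left_mono[OF Suc, of "?s + f a"] s0 a0 by simp
   moreover have "(?s + f a)*(?s^Suc k + real (Suc k) * ?s^k*f a) >=
     ?s^Suc (Suc k) + real (Suc (Suc k)) * ?s^Suc k*f a"
   proof -
    have "(?s + f a)*(?s^Suc k + real (Suc k) * ?s^k*f a) =
     ?s^Suc (Suc k) + real (Suc (Suc k)) * ?s^Suc k*f a + real (Suc k) * ?s^k*f a*f a"
     by (simp add: algebra_simps)
    thus ?thesis using s0 a0 by simp
   qed
   ultimately show ?case by linarith
  qed simp
  have "elem_sym (insert a S) (Suc k) f <= ?s^Suc k/fact (Suc k) + f a*(?s^k/fact k)"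
   using insert.hyps IH[of "Suc k"] mult_left_mono[OF IH[of k] a0]
   by (simp add: elem_sym_insert)
  also have "f a*(?s^k/fact k) = real (Suc k) * ?s^k*f a/fact (Suc k)"
   by (simp add: fact_Suc del: of_nat_Suc)
  also have "?s^Suc k/fact (Suc k) + ... = (?s^Suc k + real (Suc k) * ?s^k*f a)/fact (Suc k)"
   by (simp only: add_divide_distrib)
  also have "... <= (?s + f a)^Suc k/fact (Suc k)"
   using bern by (intro divide_right_mono) auto
  finally show ?thesis using insert.hyps Suc by (simp add: add.commute)
 qed
qed

lemma set_poly_mult:
 assumes "finite S" "finite T" "S \<inter> T = {}"
 shows "set_poly S c f * set_poly T e f = set_poly (S \<union> T) (%E. c (E \<inter> S)*e (E \<inter> T)) f"
proof -
 have "set_poly S c f * set_poly T e f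
   = (\<Sum>(A, B)\<in>Pow S \<times> Pow T. (c A*prod f A)*(e B*prod f B))"
  unfolding set_poly_def sum_product sum.cartesian_product ..
 also have "... = (\<Sum>E\<in>Pow (S \<union> T). c (E \<inter> S)*e (E \<inter> T)*prod f E)"
 proof (rule sum.reindex_bij_witness[of _ "%E. (E \<inter> S, E \<inter> T)" "%(A, B). A \<union> B"], goal_cases)
  case (1 x)
  then obtain A B where x: "x = (A, B)" "A <= S" "B <= T" by auto
  have "(A \<union> B) \<inter> S = A" "(A \<union> B) \<inter> T = B" using x assms by auto
  thus ?case by (simp add: x)
 next
  case (5 x)
  then obtain A B where x: "x = (A, B)" "A <= S" "B <= T" by auto
  have "(A \<union> B) \<inter> S = A" "(A \<union> B) \<inter> T = B" using x assms by auto
  moreover have "prod f (A \<union> B) = prod f A*prod f B"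
   using x assms by (intro prod.union_disjoint) (auto intro: finite_subset)
  ultimately show ?case by (simp add: x)
 qed auto
 finally show ?thesis by (simp add: set_poly_def)
qed

lemma set_poly_diff: "set_poly S c f - set_poly S e f = set_poly S (%E. c E - e E) f"
 by (simp add: set_poly_def sum_subtractf algebra_simps)

text \<open>The Brun--Hooley construction: the upper coefficients of the union of the blocks are products of
 even Bonferroni truncations; a lower bound loses one elementary symmetric function of odd degree per
 block.\<close>
definition bh_coeffs :: "(nat => 'a set) => (nat => nat) => nat => ('a set => real) => ('a set => real) => bool" where
 "bh_coeffs S b t lp lm \<longleftrightarrow> (\<forall>E. \<bar>lp E\<bar> <= 1 & \<bar>lm E\<bar> <= 1 &
   (lp E ~= 0 \<or> lm E ~= 0 --> (\<forall>j<t. card (E \<inter> S j) <= 2*b j + 1)) &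
   (lp E ~= 0 --> (\<forall>j<t. card (E \<inter> S j) <= 2*b j))) &
  (\<forall>f. (\<forall>p\<in>(\<Union>j<t. S j). 0 <= f p & f p <= 1) -->
    set_poly (\<Union>j<t. S j) lm f <= (\<Prod>p\<in>(\<Union>j<t. S j). 1 - f p) &
    (\<Prod>p\<in>(\<Union>j<t. S j). 1 - f p) <= set_poly (\<Union>j<t. S j) lp f &
    (\<forall>\<delta>. (\<forall>j<t. 0 <= \<delta> j & elem_sym (S j) (2*b j + 1) f <= \<delta> j*(\<Prod>p\<in>S j. 1 - f p)) -->
     set_poly (\<Union>j<t. S j) lp f <= (\<Prod>p\<in>(\<Union>j<t. S j). 1 - f p)*(\<Prod>j<t. 1 + \<delta> j) &
     set_poly (\<Union>j<t. S j) lp f - set_poly (\<Union>j<t. S j) lm f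
      <= (\<Prod>p\<in>(\<Union>j<t. S j). 1 - f p)*(\<Prod>j<t. 1 + \<delta> j)*(\<Sum>j<t. \<delta> j)))"

lemma brun_hooley:
 fixes S :: "nat => 'a set" and b :: "nat => nat"
 assumes fin: "!!j. finite (S j)" and disj: "!!i j. i ~= j ==> S i \<inter> S j = {}"
 shows "\<exists>lp lm. bh_coeffs S b t lp lm"
proof (induction t)
 case 0
 show ?case
  by (rule exI[of _ "%E. 1"], rule exI[of _ "%E. 1"]) (simp add: set_poly_def bh_coeffs_def)
next
 case (Suc t)
 define T where "T = (\<Union>j<t. S j)"
 from Suc obtain lp lm where H: "bh_coeffs S b t lp lm" by blast
 note H = H[unfolded bh_coeffs_def T_def[symmetric]]
 note H1 = conjunct1[OF H, rule_format]
 have c: "!!E. \<bar>lp E\<bar> <= 1" "!!E. \<bar>lm E\<bar> <= 1"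
    "!!E j. lp E ~= 0 \<or> lm E ~= 0 ==> j < t ==> card (E \<inter> S j) <= 2*b j + 1"
    "!!E j. lp E ~= 0 ==> j < t ==> card (E \<inter> S j) <= 2*b j"
  using H1 by blast+
 note H2 = mp[OF spec[OF conjunct2[OF H]]]
 note f1 = conjunct1[OF H2] and f2 = conjunct1[OF conjunct2[OF H2]]
  and f3 = conjunct1[OF mp[OF spec[OF conjunct2[OF conjunct2[OF H2]]]]]
  and f4 = conjunct2[OF mp[OF spec[OF conjunct2[OF conjunct2[OF H2]]]]]
 define N where "N = S t"
 have finT: "finite T" and finN: "finite N" using fin by (auto simp: T_def N_def)
 have TN: "T \<inter> N = {}" using disj 
 proof -
  have "S j \<inter> S t = {}" if "j < t" for j using disj[of j t] that by auto
  thus ?thesis unfolding T_def N_def by blast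
 qed
 have un: "(\<Union>j<Suc t. S j) = T \<union> N" by (auto simp: T_def N_def lessThan_Suc)
 define u where "u = (%E::'a set. if card E <= 2*b t then (-1)^card E else (0::real))"
 define v where "v = (%E::'a set. if card E = 2*b t + 1 then 1 else (0::real))"
 \<comment> \<open>Coefficients multiply because a subset of the union splits uniquely. The lower
   ones come from \<open>x * y >= x * (U - D) >= M * U - P * D\<close>, where U is the even
   truncation on the new block, D its first omitted elementary symmetric function, and P, M are the
   previous bounds.\<close>
 define lp' where "lp' = (%E. lp (E \<inter> T)*u (E \<inter> N))"
 define lm' where "lm' = (%E. lm (E \<inter> T)*u (E \<inter> N) - lp (E \<inter> T) * v (E \<inter> N))"
 have poly_p: "set_poly (T \<union> N) lp' f = set_poly T lp f*bonf N (2*b t) f" for f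
  unfolding lp'_def bonf_def u_def by (rule set_poly_mult[symmetric, OF finT finN TN])
 have poly_m: "set_poly (T \<union> N) lm' f = set_poly T lm f*bonf N (2*b t) f
   - set_poly T lp f*elem_sym N (2*b t + 1) f" for f
  unfolding lm'_def bonf_def elem_sym_def u_def v_def set_poly_diff[symmetric]
  by (simp only: set_poly_mult[OF finT finN TN])
 have prodTN: "(\<Prod>p\<in>T \<union> N. 1 - f p) = (\<Prod>p\<in>T. 1 - f p)*(\<Prod>p\<in>N. 1 - f p)" for f :: "'a => real"
  by (rule prod.union_disjoint[OF finT finN TN])
 have subT: "E \<inter> T \<inter> S j = E \<inter> S j" if "j < t" for E j using that by (auto simp: T_def)
 have A: "\<bar>lp' E\<bar> <= 1" for E
  using c(1)[of "E \<inter> T"] by (auto simp: lp'_def u_def abs_mult power_abs)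
 have B: "\<bar>lm' E\<bar> <= 1" for E
  using c(1,2)[of "E \<inter> T"] by (auto simp: lm'_def u_def v_def abs_mult power_abs)
 have C1: "card (E \<inter> S j) <= 2*b j" if "lp' E ~= 0" "j < Suc t" for E j
 proof (cases "j = t")
  case True
  thus ?thesis using that by (auto simp: lp'_def u_def N_def split: if_splits)
 next
  case False
  thus ?thesis using that c(4)[of "E \<inter> T" j] subT[of j E] by (auto simp: lp'_def)
 qed
 have C2: "card (E \<inter> S j) <= 2*b j + 1" if "lm' E ~= 0" "j < Suc t" for E j
 proof (cases "j = t")
  case True
  thus ?thesis using that by (auto simp: lm'_def u_def v_def N_def split: if_splits)
 next
  case False
  moreover have "lp (E \<inter> T) ~= 0 \<or> lm (E \<inter> T) ~= 0" using that by (auto simp: lm'_def)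
  ultimately show ?thesis using that c(3)[of "E \<inter> T" j] subT[of j E] by auto
 qed
 have D: "set_poly (T \<union> N) lm' f <= (\<Prod>p\<in>T \<union> N. 1 - f p)"
     "(\<Prod>p\<in>T \<union> N. 1 - f p) <= set_poly (T \<union> N) lp' f"
     "(\<forall>j<Suc t. 0 <= \<delta> j & elem_sym (S j) (2*b j + 1) f <= \<delta> j*(\<Prod>p\<in>S j. 1 - f p)) ==>
       set_poly (T \<union> N) lp' f <= (\<Prod>p\<in>T \<union> N. 1 - f p)*(\<Prod>j<Suc t. 1 + \<delta> j)"
     "(\<forall>j<Suc t. 0 <= \<delta> j & elem_sym (S j) (2*b j + 1) f <= \<delta> j*(\<Prod>p\<in>S j. 1 - f p)) ==>
       set_poly (T \<union> N) lp' f - set_poly (T \<union> N) lm' f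
       <= (\<Prod>p\<in>T \<union> N. 1 - f p)*(\<Prod>j<Suc t. 1 + \<delta> j)*(\<Sum>j<Suc t. \<delta> j)"
  if f01: "\<forall>p\<in>T \<union> N. 0 <= f p & f p <= 1" for f \<delta>
 proof -
  let ?x = "\<Prod>p\<in>T. 1 - f p" and ?y = "\<Prod>p\<in>N. 1 - f p"
  let ?U = "bonf N (2*b t) f" and ?D = "elem_sym N (2*b t + 1) f"
  let ?P = "set_poly T lp f" and ?M = "set_poly T lm f"
  have fT: "\<forall>p\<in>T. 0 <= f p & f p <= 1" using f01 by auto
  have bo: "?y <= ?U" "?U <= ?y + ?D"
   using bonferroni[OF finN, of f "2*b t"] f01 by auto
  have x0: "0 <= ?x" and y0: "0 <= ?y" using f01 by (auto intro!: prod_nonneg)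
  have D0: "0 <= ?D" using f01 by (intro elem_sym_nonneg) auto
  note g1 = f1[OF fT] and g2 = f2[OF fT]
  have P0: "0 <= ?P" using g2 x0 by linarith
  have "?x * ?y >= ?x*(?U - ?D)" using bo x0 by (intro mult_left_mono) auto
  moreover have "?x * ?U >= ?M * ?U" using g1 bo y0 by (intro mult_right_mono) auto
  moreover have "?x * ?D <= ?P * ?D" using g2 D0 by (intro mult_right_mono) auto
  ultimately show "set_poly (T \<union> N) lm' f <= (\<Prod>p\<in>T \<union> N. 1 - f p)"
   unfolding poly_m prodTN by (simp add: algebra_simps)
  show "(\<Prod>p\<in>T \<union> N. 1 - f p) <= set_poly (T \<union> N) lp' f"
   unfolding poly_p prodTN using g2 bo x0 y0 P0 by (intro mult_mono) auto
  assume "\<forall>j<Suc t. 0 <= \<delta> j & elem_sym (S j) (2*b j + 1) f <= \<delta> j*(\<Prod>p\<in>S j. 1 - f p)"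
  hence d: "\<forall>j<t. 0 <= \<delta> j & elem_sym (S j) (2*b j + 1) f <= \<delta> j*(\<Prod>p\<in>S j. 1 - f p)"
   and dt: "0 <= \<delta> t" "?D <= \<delta> t * ?y" by (auto simp: N_def)
  let ?E = "\<Prod>j<t. 1 + \<delta> j" and ?s = "\<Sum>j<t. \<delta> j"
  have E0: "0 <= ?E" using d by (intro prod_nonneg) auto
  have s0: "0 <= ?s" using d by (intro sum_nonneg) auto
  note g3 = f3[OF fT d] and g4 = f4[OF fT d]
  have U1: "?U <= ?y*(1 + \<delta> t)" using bo dt by (simp add: algebra_simps)
  have U0: "0 <= ?U" using bo y0 by linarith
  have "?P * ?U <= (?x * ?E)*(?y*(1 + \<delta> t))"
   using g3 U1 P0 U0 x0 E0 by (intro mult_mono) auto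
  thus "set_poly (T \<union> N) lp' f <= (\<Prod>p\<in>T \<union> N. 1 - f p)*(\<Prod>j<Suc t. 1 + \<delta> j)"
   unfolding poly_p prodTN by (simp add: algebra_simps)
  have "(?P - ?M) * ?U <= (?x * ?E * ?s)*(?y*(1 + \<delta> t))"
   using g4 U1 U0 x0 E0 s0 by (intro mult_mono) auto
  moreover have "?P * ?D <= (?x * ?E)*(\<delta> t * ?y)"
   using g3 dt D0 P0 x0 E0 by (intro mult_mono) auto
  moreover have "(?x * ?E)*(\<delta> t * ?y) <= (?x * ?E)*(\<delta> t * ?y)*(1 + \<delta> t)"
  proof -
   have "0 <= (?x * ?E)*(\<delta> t * ?y)" using x0 y0 E0 dt(1) by simp
   thus ?thesis using dt(1) by (simp add: mult_le_cancel_left1)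
  qed
  ultimately show "set_poly (T \<union> N) lp' f - set_poly (T \<union> N) lm' f
       <= (\<Prod>p\<in>T \<union> N. 1 - f p)*(\<Prod>j<Suc t. 1 + \<delta> j)*(\<Sum>j<Suc t. \<delta> j)"
   unfolding poly_p poly_m prodTN by (simp add: algebra_simps)
 qed
 have "bh_coeffs S b (Suc t) lp' lm'"
  unfolding bh_coeffs_def un
 proof (rule conjI[OF allI allI[OF impI]], goal_cases)
  case (1 E)
  show ?case using A[of E] B[of E] C1[of E] C2[of E] by (auto intro: le_SucI)
 next
  case (2 f)
  show ?case using D[OF 2] by blast
 qed
 thus ?case by blast
qed

text \<open>Here s bounds the sum of the relative errors of all blocks: exp (2*G) bounds the inverse
  of the product of \<open>1 - f\<close> over a block, and exp (G^2) comes from summing over the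
  blocks. The factor exp s bounds the product of the terms 1 + delta.\<close>

definition sieve_error :: "real => nat => real" where
 "sieve_error G b = (let s = exp (2*G + G^2)*(G^(2*b + 1)/fact (2*b + 1)) in s*exp s)"

lemma exp_neg_two_le: "0 <= x ==> x <= 1/2 ==> exp (- 2*x) <= 1 - (x::real)"
proof -
 assume x: "0 <= x" "x <= 1/2"
 have "1 + 2*x <= exp (2*x)" using exp_ge_add_one_self[of "2*x"] by simp
 hence "1 <= (1 - x)*exp (2*x)"
 proof -
  have "1 <= (1 - x)*(1 + 2*x)" using x mult_left_mono[of "2*x" 1 x] by (simp add: algebra_simps)
  also have "... <= (1 - x)*exp (2*x)" using x exp_ge_add_one_self[of "2*x"] by (intro mult_left_mono) auto
  finally show ?thesis .
 qed
 thus ?thesis by (simp add: exp_minus field_simps)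
qed

lemma prod_one_plus_le_exp:
 "(!!j. j \<in> A ==> 0 <= (d j :: real)) ==> finite A ==> (\<Prod>j\<in>A. 1 + d j) <= exp (\<Sum>j\<in>A. d j)"
 unfolding exp_sum by (intro prod_mono) (auto simp: add.commute)

lemma exp_sum_le_prod_one_minus:
 assumes "finite A" "!!p. p \<in> A ==> 0 <= f p & f p <= (1/2 :: real)"
 shows "exp (- 2*(\<Sum>p\<in>A. f p)) <= (\<Prod>p\<in>A. 1 - f p)"
proof -
 have "exp (- 2*(\<Sum>p\<in>A. f p)) = (\<Prod>p\<in>A. exp (- 2*f p))"
  using assms(1) by (simp add: exp_sum sum_distrib_left)
 also have "... <= (\<Prod>p\<in>A. 1 - f p)"
  using assms by (intro prod_mono conjI exp_neg_two_le) auto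
 finally show ?thesis .
qed

lemma sum_power_fact_le_exp: "0 <= (x::real) ==> (\<Sum>j<J. x^j/fact j) <= exp x"
proof -
 assume x: "0 <= x"
 have "(\<Sum>j<J. inverse (fact j) *\<^sub>R x^j) <= (\<Sum>j. inverse (fact j) *\<^sub>R x^j)"
  using x by (intro sum_le_suminf summable_exp_generic) auto
 thus ?thesis by (simp add: exp_def field_simps)
qed

text \<open>The blocks lie between successive square roots \<open>y powr (1/2^j)\<close>, so each
  has mass at most G, and the truncation depth b + j grows with j. Growing depth makes the block
  errors summable; the halving of the exponents pays for it, since the sum of (2*(b + j) + 1)/2^j is
  4*b + 6. Primes from 8 on keep f at most 3/8, where 1 - f >= exp (- 2*f).\<close>

lemma fundamental_lemma:
 fixes P :: "nat set" and y G :: real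
 assumes fin: "finite P" and P8: "!!p. p \<in> P ==> 8 <= p & real p <= y" and y1: "1 < y" and G0: "0 <= G"
  and hG: "!!t. 1 <= t ==> (\<Sum>p\<in>{p\<in>P. t < real p & real p <= t^2}. 3/real p) <= G"
 shows "\<exists>lp lm. (\<forall>E\<subseteq>P. \<bar>lp E\<bar> <= 1 & \<bar>lm E\<bar> <= 1 &
    (lp E ~= 0 \<or> lm E ~= 0 --> real (\<Prod>E) <= y powr (4*real b + 6))) &
   (\<forall>f. (\<forall>p\<in>P. 0 <= f p & f p <= 1) -->
    set_poly P lm f <= (\<Prod>p\<in>P. 1 - f p) & (\<Prod>p\<in>P. 1 - f p) <= set_poly P lp f &
    ((\<forall>p\<in>P. f p <= 3/real p) -->
     set_poly P lp f <= (\<Prod>p\<in>P. 1 - f p)*(1 + sieve_error G b) &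
     (\<Prod>p\<in>P. 1 - f p)*(1 - sieve_error G b) <= set_poly P lm f))"
proof -
 define t where "t = (%j::nat. y powr (1/2^j))"
 define S where "S = (%j. {p\<in>P. t (Suc j) < real p & real p <= t j})"
 \<comment> \<open>Large enough that \<open>y powr (1/2^J)\<close> <= exp 1 < 8, so that the first J
   blocks exhaust P.\<close>
 define J where "J = Suc (nat \<lceil>ln y\<rceil>)"
 have tmono: "t j <= t i" if "i <= j" for i j
  unfolding t_def using y1 that by (intro powr_mono divide_left_mono power_increasing) auto
 have t1: "1 <= t j" for j unfolding t_def using y1 by (intro ge_one_powr_ge_zero) auto
 have tsq: "(t (Suc j))^2 = t j" for j
  unfolding t_def using y1 by (simp add: powr_powr power2_eq_square powr_add[symmetric])
 have tJ: "t J < 8"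
 proof -
  have "ln y <= real J" unfolding J_def using y1 by linarith
  also have "real J <= 2^J" using of_nat_mono[OF less_imp_le[OF less_exp[of J]], where ?'a = real] by simp
  finally have "ln y/2^J <= 1" by simp
  moreover have "t J = exp (ln y/2^J)" unfolding t_def powr_def using y1 by simp
  ultimately have "t J <= exp 1" by simp
  thus ?thesis using exp_le by linarith
 qed
 have finS: "finite (S j)" for j using fin by (auto simp: S_def)
 have disj: "S i \<inter> S j = {}" if "i ~= j" for i j
 proof -
  have "S i \<inter> S j = {}" if "i < j" for i j
  proof -
   have "t j <= t (Suc i)" using that by (intro tmono) auto
   thus ?thesis by (auto simp: S_def)
  qed
  thus ?thesis using \<open>i ~= j\<close> by (metis Int_commute nat_neq_iff)
 qed
 have un: "(\<Union>j<J. S j) = P"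
 proof (intro equalityI subsetI)
  fix p assume p: "p \<in> P"
  define j where "j = (LEAST j. t j < real p)"
  have "t J < real p" using P8[OF p] tJ by linarith
  hence j: "t j < real p" "j <= J" unfolding j_def by (auto intro: LeastI Least_le)
  have "t 0 = y" using y1 by (simp add: t_def)
  hence "j ~= 0" using P8[OF p] j by (auto intro!: Nat.gr0I)
  then obtain i where i: "j = Suc i" by (cases j) auto
  have "~ t i < real p" using not_less_Least[of i "%j. t j < real p"] i j_def by auto
  hence "p \<in> S i" using p i j by (auto simp: S_def)
  thus "p \<in> (\<Union>j<J. S j)" using i j by auto
 qed (auto simp: S_def)
 obtain lp lm where H: "bh_coeffs S (%j. b + j) J lp lm" using brun_hooley[of S "%j. b + j" J, OF finS disj] by blast
 note H = H[unfolded bh_coeffs_def un]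
 note H1 = conjunct1[OF H, rule_format]
 note H2 = mp[OF spec[OF conjunct2[OF H]]]
 have level: "real (\<Prod>E) <= y powr (4*real b + 6)"
  if E: "E <= P" and nz: "lp E ~= 0 \<or> lm E ~= 0" for E
 proof -
  have c: "card (E \<inter> S j) <= 2*(b + j) + 1" if "j < J" for j using H1[of E] nz that by blast
  have "E = (\<Union>j<J. E \<inter> S j)" using E un by auto
  moreover have "\<forall>i\<in>{..<J}. \<forall>j\<in>{..<J}. i ~= j --> (E \<inter> S i) \<inter> (E \<inter> S j) = {}"
   using disj by blast
  ultimately have "\<Prod>E = (\<Prod>j<J. \<Prod>(E \<inter> S j))"
   using prod.UNION_disjoint[of "{..<J}" "%j. E \<inter> S j" "%x. x"] finS by simp
  hence "real (\<Prod>E) = (\<Prod>j<J. real (\<Prod>(E \<inter> S j)))" by simp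
  also have "... <= (\<Prod>j<J. y powr ((2*real b + 1 + 2*real j)/2^j))"
  proof (intro prod_mono conjI)
   fix j assume j: "j \<in> {..<J}"
   have "real (\<Prod>(E \<inter> S j)) = (\<Prod>p\<in>E \<inter> S j. real p)" by simp
   also have "... <= (\<Prod>p\<in>E \<inter> S j. t j)" by (intro prod_mono) (auto simp: S_def)
   also have "... = t j^card (E \<inter> S j)" by simp
   also have "... <= t j^(2*(b + j) + 1)" using c[of j] j t1[of j] by (intro power_increasing) auto
   also have "... = y powr ((2*real b + 1 + 2*real j)/2^j)"
   proof -
    have "t j^(2*(b + j) + 1) = t j powr real (2*(b + j) + 1)"
     using t1[of j] by (subst powr_realpow) auto
    also have "... = y powr (1/2^j*real (2*(b + j) + 1))"
     unfolding t_def by (simp only: powr_powr)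
    also have "1/2^j*real (2*(b + j) + 1) = (2*real b + 1 + 2*real j)/2^j"
     by (simp add: add_divide_distrib)
    finally show ?thesis .
   qed
   finally show "real (\<Prod>(E \<inter> S j)) <= y powr ((2*real b + 1 + 2*real j)/2^j)" .
  qed (auto intro: prod_nonneg)
  also have "... = y powr (\<Sum>j<J. (2*real b + 1 + 2*real j)/2^j)"
   using y1 by (simp add: powr_sum)
  also have "(\<Sum>j<J. (2*real b + 1 + 2*real j)/2^j)
    = 4*real b + 6 - (4*real b + 6 + 4*real J)/2^J" for J :: nat
  proof (induction J)
   case (Suc J)
   have "(4*real b + 6 + 4*real (Suc J))/2^Suc J = (2*real b + 5 + 2*real J)/2^J"
    by (simp add: field_simps)
   thus ?case unfolding sum.lessThan_Suc Suc.IH by (simp add: diff_divide_distrib add_divide_distrib)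
  qed simp
  also have "y powr (4*real b + 6 - (4*real b + 6 + 4*real J)/2^J) <= y powr (4*real b + 6)"
   using y1 by (intro powr_mono) auto
  finally show ?thesis .
 qed
 have main: "set_poly P lp f <= (\<Prod>p\<in>P. 1 - f p)*(1 + sieve_error G b) &
     (\<Prod>p\<in>P. 1 - f p)*(1 - sieve_error G b) <= set_poly P lm f"
  if f01: "\<forall>p\<in>P. 0 <= f p & f p <= 1" and f3: "\<forall>p\<in>P. f p <= 3/real p" for f
 proof -
  let ?V = "\<Prod>p\<in>P. 1 - f p"
  define r where "r = (%j. 2*(b + j) + 1)"
  define d where "d = (%j. exp (2*G)*(G^r j/fact (r j)))"
  have d0: "0 <= d j" for j using G0 by (simp add: d_def)
  have dS: "elem_sym (S j) (2*(b + j) + 1) f <= d j*(\<Prod>p\<in>S j. 1 - f p)" for j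
  proof -
   have SP: "S j <= P" by (auto simp: S_def)
   have half: "f p <= 1/2" if "p \<in> S j" for p
   proof -
    have "f p <= 3/real p" "8 <= real p" using f3 P8[of p] SP that by auto
    moreover have "3/real p <= 3/8" using \<open>8 <= real p\<close> by (intro divide_left_mono) auto
    ultimately show ?thesis by linarith
   qed
   have "(\<Sum>p\<in>S j. f p) <= (\<Sum>p\<in>S j. 3/real p)" using f3 SP by (intro sum_mono) auto
   also have "... <= G" using hG[OF t1, of "Suc j"] by (simp add: S_def tsq)
   finally have sG: "(\<Sum>p\<in>S j. f p) <= G" .
   have s0: "0 <= (\<Sum>p\<in>S j. f p)" using f01 SP by (intro sum_nonneg) auto
   have "elem_sym (S j) (r j) f <= (\<Sum>p\<in>S j. f p)^r j/fact (r j)"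
    using f01 SP by (intro elem_sym_le finS) auto
   also have "... <= G^r j/fact (r j)" using sG s0 by (intro divide_right_mono power_mono) auto
   also have "... = d j*exp (- 2*G)" by (simp add: d_def exp_minus)
   also have "... <= d j*exp (- 2*(\<Sum>p\<in>S j. f p))" using sG d0 by (intro mult_left_mono) auto
   also have "... <= d j*(\<Prod>p\<in>S j. 1 - f p)"
    using half f01 SP d0 by (intro mult_left_mono exp_sum_le_prod_one_minus finS) auto
   finally show ?thesis by (simp add: r_def)
  qed
  define s where "s = exp (2*G + G^2)*(G^(2*b + 1)/fact (2*b + 1))"
  have s0: "0 <= s" using G0 by (simp add: s_def)
  have "(\<Sum>j<J. d j) <= (\<Sum>j<J. exp (2*G)*(G^(2*b + 1)/fact (2*b + 1))*((G^2)^j/fact j))"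
  proof (intro sum_mono)
   fix j
   \<comment> \<open>Superadditivity of factorials dominates the block errors by an exponential
     series in G^2.\<close>
   have "fact (2*b + 1)*fact j <= (fact (2*b + 1)*fact (2*j) :: nat)"
    by (intro mult_left_mono fact_mono) auto
   also have "... <= fact (2*b + 1 + 2*j)"
    by (intro dvd_imp_le fact_fact_dvd_fact) auto
   finally have "real (fact (2*b + 1)*fact j) <= real (fact (r j))"
    unfolding r_def by (intro of_nat_mono) (simp add: algebra_simps)
   hence "fact (2*b + 1)*fact j <= (fact (r j) :: real)" by (simp only: of_nat_mult of_nat_fact)
   hence "G^r j/fact (r j) <= G^r j/(fact (2*b + 1)*fact j)"
    using G0 by (intro divide_left_mono) (auto intro: mult_pos_pos)
   moreover have "G^r j = G^(2*b + 1)*(G^2)^j"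
    by (simp add: r_def power_add power_mult[symmetric] algebra_simps)
   ultimately have "G^r j/fact (r j) <= G^(2*b + 1)/fact (2*b + 1)*((G^2)^j/fact j)"
    by (simp only: times_divide_times_eq)
   from mult_left_mono[OF this, of "exp (2*G)"]
   show "d j <= exp (2*G)*(G^(2*b + 1)/fact (2*b + 1))*((G^2)^j/fact j)"
    unfolding d_def by (simp only: mult.assoc exp_ge_zero simp_thms)
  qed
  also have "... <= exp (2*G)*(G^(2*b + 1)/fact (2*b + 1))*exp (G^2)"
   unfolding sum_distrib_left[symmetric] using G0
   by (intro mult_left_mono sum_power_fact_le_exp) auto
  also have "... = s" by (simp add: s_def exp_add)
  finally have ds: "(\<Sum>j<J. d j) <= s" .
  have E: "(\<Prod>j<J. 1 + d j) <= exp s"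
   using prod_one_plus_le_exp[of "{..<J}" d] d0 ds by (meson exp_le_cancel_iff finite_lessThan order_trans)
  have V0: "0 <= ?V" using f01 by (intro prod_nonneg) auto
  have dd: "\<forall>j<J. 0 <= d j & elem_sym (S j) (2*(b + j) + 1) f <= d j*(\<Prod>p\<in>S j. 1 - f p)"
   using d0 dS by auto
  note K = mp[OF spec[OF conjunct2[OF conjunct2[OF H2[OF f01]]]] dd]
  have se: "sieve_error G b = s*exp s" by (simp add: sieve_error_def s_def Let_def)
  \<comment> \<open>Brings the upper bound exp s into the form 1 + error that the lower bound also
    has.\<close>
  have "exp s <= 1 + s*exp s"
  proof -
   have "1 - s <= exp (- s)" using exp_ge_add_one_self[of "- s"] by simp
   hence "(1 - s)*exp s <= exp (- s)*exp s" by (intro mult_right_mono) auto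
   thus ?thesis by (simp add: exp_minus algebra_simps)
  qed
  hence "?V*(\<Prod>j<J. 1 + d j) <= ?V*(1 + sieve_error G b)"
   using E V0 se by (intro mult_left_mono) auto
  moreover have "?V*(\<Prod>j<J. 1 + d j)*(\<Sum>j<J. d j) <= ?V*exp s * s"
   using E V0 d0 ds by (intro mult_mono) (auto intro!: prod_nonneg sum_nonneg add_nonneg_nonneg)
  moreover have "?V <= set_poly P lp f" using H2[OF f01] by blast
  ultimately show ?thesis using K unfolding se by (auto simp: algebra_simps)
 qed
 show ?thesis
  by (rule exI[of _ lp], rule exI[of _ lm]) (use H1 H2 level main in blast)
qed

section \<open>Fourier analysis modulo N\<close>

text \<open>The additive character e(a/N) on the integers.\<close>

definition ex :: "nat => int => complex" where
 "ex N a = cis (2*pi * of_int a / of_nat N)"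

lemma ex_0 [simp]: "ex N 0 = 1"
 by (simp add: ex_def)

lemma ex_add: "ex N (a + b) = ex N a*ex N b"
 by (simp add: ex_def cis_mult algebra_simps add_divide_distrib)

lemma norm_ex [simp]: "norm (ex N a) = 1"
 by (simp add: ex_def)

lemma cnj_ex: "cnj (ex N a) = ex N (- a)"
 by (simp add: ex_def cis_cnj)

lemma ex_mult_N: "N > 0 ==> ex N (int N*a) = 1"
proof -
 assume "N > 0"
 hence "2*pi * of_int (int N*a) / of_nat N = 2*pi * of_int a" by simp
 thus ?thesis unfolding ex_def by (simp only:) (rule cis_multiple_2pi, simp)
qed

lemma ex_mod: "N > 0 ==> ex N (a mod int N) = ex N a"
 using ex_add[of N "int N*(a div int N)" "a mod int N"] by (simp add: ex_mult_N)

lemma ex_cong: "N > 0 ==> [a = b] (mod int N) ==> ex N a = ex N b"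
 by (metis ex_mod cong_def)

lemma ex_cancel: "M > 0 ==> ex (N*M) (int M*a) = ex N a"
 unfolding ex_def by (rule arg_cong[of _ _ cis]) (simp add: field_simps)

lemma ex_eq_1_iff:
 assumes "N > 0" shows "ex N a = 1 \<longleftrightarrow> int N dvd a"
proof
 assume "ex N a = 1"
 hence "cos (2*pi * of_int a / of_nat N) = 1"
  unfolding ex_def by (metis cis.sel(1) one_complex.sel(1))
 then obtain n :: int where "2*pi * of_int a / of_nat N = of_int n*2*pi"
  using cos_one_2pi_int by auto
 hence "of_int a = (of_int (n*int N) :: real)" using assms by (simp add: field_simps)
 thus "int N dvd a" by (metis dvd_triv_right of_int_eq_iff)
next
 assume "int N dvd a"
 thus "ex N a = 1" using ex_mult_N[OF assms] by auto
qed

lemma sum_residues_shift: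
 fixes F :: "int => 'a::comm_monoid_add"
 assumes N: "N > 0" and per: "!!x. F (x mod int N) = F x"
 shows "(\<Sum>x\<in>{0..<int N}. F (x + c)) = (\<Sum>x\<in>{0..<int N}. F x)"
proof -
 have "(\<Sum>x\<in>{0..<int N}. F (x + c)) = (\<Sum>x\<in>{0..<int N}. F ((x + c) mod int N))"
  using per by simp
 also have "... = (\<Sum>x\<in>{0..<int N}. F x)"
 proof (rule sum.reindex_bij_witness[of _ "%x. (x - c) mod int N" "%x. (x + c) mod int N"])
  fix a assume "a \<in> {0..<int N}"
  thus "((a + c) mod int N - c) mod int N = a" "((a - c) mod int N + c) mod int N = a"
   by (simp_all add: mod_simps)
 qed (use N in auto)
 finally show ?thesis .
qed

lemma ex_orthogonality:
 assumes N: "N > 0"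
 shows "(\<Sum>f\<in>{0..<int N}. ex N (f*a)) = (if int N dvd a then of_nat N else 0)"
proof (cases "int N dvd a")
 case True
 hence "ex N (f*a) = 1" for f using ex_eq_1_iff[OF N, of "f*a"] by auto
 thus ?thesis using True by simp
next
 case False
 let ?S = "\<Sum>f\<in>{0..<int N}. ex N (f*a)"
 have "(\<Sum>f\<in>{0..<int N}. ex N ((f + 1)*a)) = ?S"
 proof (rule sum_residues_shift[OF N, of "%f. ex N (f*a)"])
  show "ex N (x mod int N*a) = ex N (x*a)" for x
   by (rule ex_cong[OF N]) (simp add: cong_def mod_mult_left_eq)
 qed
 moreover have "(\<Sum>f\<in>{0..<int N}. ex N ((f + 1)*a)) = ex N a * ?S"
  by (simp add: ex_add algebra_simps sum_distrib_left)
 ultimately have "(ex N a - 1) * ?S = 0" by (simp add: algebra_simps)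
 thus ?thesis using False ex_eq_1_iff[OF N, of a] by simp
qed

text \<open>Functions on pairs of residues are represented by periodic functions on pairs of
  integers, so that one function can be used with several moduli.\<close>

definition per :: "nat => (int => int => 'a) => bool" where
 "per N F \<longleftrightarrow> (\<forall>u v. F (u mod int N) (v mod int N) = F u v)"

lemma perD: "per N F ==> F (u mod int N) (v mod int N) = F u v"
 by (simp add: per_def)

lemma per_cong: "per N F ==> [u = u'] (mod int N) ==> [v = v'] (mod int N) ==> F u v = F u' v'"
 by (metis perD cong_def)

lemma per_mult_period:
 assumes "per N F" shows "per (N*M) F"
 unfolding per_def
proof (intro allI)
 fix u v
 have "[x mod int (N*M) = x] (mod int N)" for x
  by (simp add: cong_def mod_mod_cancel)
 thus "F (u mod int (N*M)) (v mod int (N*M)) = F u v"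
  by (intro per_cong[OF assms]) auto
qed

lemma per_times_coprime:
 "per N F ==> per M G ==> per (N*M) (%u v. F u v * G u v)"
 using per_mult_period[of N F M] per_mult_period[of M G N] by (simp add: per_def mult.commute)

lemma sum_crt:
 fixes H :: "int => int => 'a::comm_monoid_add"
 assumes co: "coprime N M" and pos: "N > 0" "M > 0"
 shows "(\<Sum>x\<in>{0..<int (N*M)}. H (x mod int N) (x mod int M)) = (\<Sum>a\<in>{0..<int N}. \<Sum>b\<in>{0..<int M}. H a b)"
proof -
 let ?f = "%x. (x mod int N, x mod int M)"
 have inj: "inj_on ?f {0..<int (N*M)}"
 proof (rule inj_onI)
  fix x y assume x: "x \<in> {0..<int (N*M)}" and y: "y \<in> {0..<int (N*M)}" and "?f x = ?f y"
  hence "[x = y] (mod int N)" "[x = y] (mod int M)" by (auto simp: cong_def)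
  hence "[x = y] (mod int N*int M)" using co by (intro coprime_cong_mult) auto
  thus "x = y" using x y by (simp add: cong_def)
 qed
 have "?f ` {0..<int (N*M)} = {0..<int N} \<times> {0..<int M}"
 proof (rule card_subset_eq)
  show "?f ` {0..<int (N*M)} <= {0..<int N} \<times> {0..<int M}" using pos by auto
  show "card (?f ` {0..<int (N*M)}) = card ({0..<int N} \<times> {0..<int M})"
   using card_image[OF inj] by (simp add: card_cartesian_product nat_mult_distrib)
 qed auto
 hence "(\<Sum>z\<in>{0..<int N} \<times> {0..<int M}. case_prod H z) = (\<Sum>x\<in>{0..<int (N*M)}. case_prod H (?f x))"
  using sum.reindex[OF inj, of "case_prod H"] by simp
 thus ?thesis by (simp add: sum.cartesian_product)
qed

definition hat :: "nat => (int => int => real) => int => int => complex" where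
 "hat N F f g = (\<Sum>u\<in>{0..<int N}. \<Sum>v\<in>{0..<int N}. of_real (F u v)*ex N (f*u + g * v))"

text \<open>Frequencies of the form M*a + N*b separate the two characters, and the Chinese remainder
  theorem separates the variables. By Bezout every frequency has this form, which gives the bound
  for products below.\<close>

lemma hat_mult:
 assumes co: "coprime N M" and pos: "N > 0" "M > 0" and F: "per N F" and G: "per M G"
 shows "hat (N*M) (%u v. F u v * G u v) (int M*a + int N*b) (int M * c + int N*d)
    = hat N F a c*hat M G b d"
proof -
 define A where "A = (%u v. complex_of_real (F u v)*ex N (a*u + c * v))"
 define B where "B = (%u v. complex_of_real (G u v)*ex M (b*u + d * v))"
 have A: "A (u mod int N) (v mod int N) = A u v" for u v
 proof -
  have "[a*(u mod int N) + c*(v mod int N) = a*u + c * v] (mod int N)"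
   by (intro cong_add cong_mult cong_refl) (auto simp: cong_def)
  thus ?thesis using ex_cong[OF pos(1)] by (simp add: A_def perD[OF F])
 qed
 have B: "B (u mod int M) (v mod int M) = B u v" for u v
 proof -
  have "[b*(u mod int M) + d*(v mod int M) = b*u + d * v] (mod int M)"
   by (intro cong_add cong_mult cong_refl) (auto simp: cong_def)
  thus ?thesis using ex_cong[OF pos(2)] by (simp add: B_def perD[OF G])
 qed
 have e: "ex (N*M) ((int M*a + int N*b)*u + (int M * c + int N*d) * v)
   = ex N (a*u + c * v)*ex M (b*u + d * v)" for u v
 proof -
  have "ex (N*M) ((int M*a + int N*b)*u + (int M * c + int N*d) * v)
    = ex (N*M) (int M*(a*u + c * v) + int N*(b*u + d * v))" by (simp add: algebra_simps)
  also have "... = ex N (a*u + c * v)*ex M (b*u + d * v)"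
   using ex_cancel[OF pos(2), of N] ex_cancel[OF pos(1), of M] by (simp only: ex_add[of _ "int M * _"] mult.commute[of N M])
  finally show ?thesis .
 qed
 have "hat (N*M) (%u v. F u v * G u v) (int M*a + int N*b) (int M * c + int N*d)
   = (\<Sum>u\<in>{0..<int (N*M)}. \<Sum>v\<in>{0..<int (N*M)}. A (u mod int N) (v mod int N)*B (u mod int M) (v mod int M))"
  unfolding hat_def A B e by (simp add: A_def B_def mult_ac)
 also have "... = (\<Sum>u\<in>{0..<int (N*M)}. \<Sum>x\<in>{0..<int N}. \<Sum>y\<in>{0..<int M}. A (u mod int N) x*B (u mod int M) y)"
  by (intro sum.cong refl sum_crt[OF co pos, of "%x y. A (u mod int N) x*B (u mod int M) y" for u])
 also have "... = (\<Sum>u\<in>{0..<int N}. \<Sum>t\<in>{0..<int M}. \<Sum>x\<in>{0..<int N}. \<Sum>y\<in>{0..<int M}. A u x*B t y)"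
  by (rule sum_crt[OF co pos, of "%u t. \<Sum>x\<in>{0..<int N}. \<Sum>y\<in>{0..<int M}. A u x*B t y"])
 also have "... = (\<Sum>u\<in>{0..<int N}. \<Sum>x\<in>{0..<int N}. A u x)*(\<Sum>t\<in>{0..<int M}. \<Sum>y\<in>{0..<int M}. B t y)"
 proof -
  have "(\<Sum>x\<in>{0..<int N}. \<Sum>y\<in>{0..<int M}. A u x*B t y) = (\<Sum>x\<in>{0..<int N}. A u x)*(\<Sum>y\<in>{0..<int M}. B t y)" for u t
   by (simp add: sum_product)
  thus ?thesis by (simp add: sum_product)
 qed
 finally show ?thesis by (simp add: hat_def A_def B_def)
qed

lemma hat_mult_bound:
 assumes co: "coprime N M" and pos: "N > 0" "M > 0" and F: "per N F" and G: "per M G"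
  and "!!f g. norm (hat N F f g) <= B" "!!f g. norm (hat M G f g) <= C"
 shows "norm (hat (N*M) (%u v. F u v * G u v) f g) <= B*C"
proof -
 have "\<exists>a b. x = int M*a + int N*b" for x
 proof -
  have "gcd (int M) (int N) = 1"
   using co by (intro coprime_imp_gcd_eq_1) (simp add: coprime_commute)
  then obtain s t where st: "s*int M + t*int N = 1"
   using bezout_int[of "int M" "int N"] by (elim exE) simp
  have "int M*(s*x) + int N*(t*x) = (s*int M + t*int N)*x"
   by (simp only: distrib_right mult.assoc mult.left_commute[of "int M"] mult.left_commute[of "int N"])
  hence "x = int M*(s*x) + int N*(t*x)" unfolding st by simp
  thus ?thesis by blast
 qed
 then obtain a b c d where f: "f = int M*a + int N*b" and g: "g = int M * c + int N*d" by blast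
 have "0 <= B" using order_trans[OF norm_ge_zero assms(6)[of 0 0]] .
 thus ?thesis unfolding f g hat_mult[OF co pos F G] norm_mult
  by (intro mult_mono assms) auto
qed

lemma hat_prod:
 fixes F :: "nat => int => int => real"
 assumes "finite K" "!!p. p \<in> K ==> prime p" "!!p. p \<in> K ==> per p (F p)"
  "!!p f g. p \<in> K ==> norm (hat p (F p) f g) <= B p"
 shows "per (\<Prod>K) (%u v. \<Prod>p\<in>K. F p u v) &
  (\<forall>f g. norm (hat (\<Prod>K) (%u v. \<Prod>p\<in>K. F p u v) f g) <= (\<Prod>p\<in>K. B p)) &
  hat (\<Prod>K) (%u v. \<Prod>p\<in>K. F p u v) 0 0 = (\<Prod>p\<in>K. hat p (F p) 0 0)"
 using assms
proof (induction K rule: finite_induct)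
 case empty
 show ?case by (simp add: per_def hat_def ex_def)
next
 case (insert p K)
 note IH' = insert.IH[OF insert.prems(1)[OF insertI2] insert.prems(2)[OF insertI2] insert.prems(3)[OF insertI2]]
 note IH = conjunct1[OF IH'] conjunct1[OF conjunct2[OF IH'], rule_format] conjunct2[OF conjunct2[OF IH']]
 have p: "prime p" "per p (F p)" "!!f g. norm (hat p (F p) f g) <= B p"
  using insert.prems(1,2,3)[OF insertI1] by blast+
 have pos: "p > 0" "\<Prod>K > 0" using insert.prems(1) by (auto intro!: prod_pos simp: prime_gt_0_nat)
 have co: "coprime p (\<Prod>K)"
  using insert.hyps insert.prems(1) by (intro prod_coprime_right primes_coprime) auto
 have eq: "(%u v. \<Prod>p\<in>insert p K. F p u v) = (%u v. F p u v * (\<Prod>p\<in>K. F p u v))"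
  using insert.hyps by (intro ext) (rule prod.insert)
 have hyps: "(\<Prod>p\<in>insert p K. G p) = G p*(\<Prod>p\<in>K. G p)" for G :: "nat => real"
  using insert.hyps by (rule prod.insert)
 have hyps': "(\<Prod>p\<in>insert p K. G p) = G p*(\<Prod>p\<in>K. G p)" for G :: "nat => complex"
  using insert.hyps by (rule prod.insert)
 have hyps'': "\<Prod>(insert p K) = p*\<Prod>K"
  using insert.hyps by (rule prod.insert)
 have 0: "hat (p*\<Prod>K) (%u v. F p u v * (\<Prod>p\<in>K. F p u v)) 0 0 = hat p (F p) 0 0*(\<Prod>p\<in>K. hat p (F p) 0 0)"
  using hat_mult[OF co pos p(2) IH(1), of 0 0 0 0] IH(3) by simp
 show ?case unfolding eq hyps hyps' hyps''
  using per_times_coprime[OF p(2) IH(1)] hat_mult_bound[OF co pos p(2) IH(1) p(3) IH(2)] 0 by blast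
qed

lemma hat_trivial_bound:
 assumes "!!u v. \<bar>F u v\<bar> <= 1"
 shows "norm (hat N F f g) <= (real N)^2"
proof -
 have "norm (hat N F f g) <= (\<Sum>u\<in>{0..<int N}. \<Sum>v\<in>{0..<int N}. 1)"
  unfolding hat_def by (rule sum_norm_le, rule sum_norm_le) (simp add: norm_mult assms)
 thus ?thesis by (simp add: power2_eq_square)
qed

lemma sum_swap4:
 "(\<Sum>f\<in>A. \<Sum>g\<in>B. \<Sum>u\<in>C. \<Sum>v\<in>D. X f g u v) = (\<Sum>u\<in>C. \<Sum>v\<in>D. \<Sum>f\<in>A. \<Sum>g\<in>B. X f g u v)"
proof -
 have "(\<Sum>f\<in>A. \<Sum>g\<in>B. \<Sum>u\<in>C. \<Sum>v\<in>D. X f g u v) = (\<Sum>f\<in>A. \<Sum>u\<in>C. \<Sum>g\<in>B. \<Sum>v\<in>D. X f g u v)"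
  by (rule sum.cong[OF refl], rule sum.swap)
 also have "... = (\<Sum>u\<in>C. \<Sum>f\<in>A. \<Sum>g\<in>B. \<Sum>v\<in>D. X f g u v)" by (rule sum.swap)
 also have "... = (\<Sum>u\<in>C. \<Sum>f\<in>A. \<Sum>v\<in>D. \<Sum>g\<in>B. X f g u v)"
  by (rule sum.cong[OF refl], rule sum.cong[OF refl], rule sum.swap)
 also have "... = (\<Sum>u\<in>C. \<Sum>v\<in>D. \<Sum>f\<in>A. \<Sum>g\<in>B. X f g u v)"
  by (rule sum.cong[OF refl], rule sum.swap)
 finally show ?thesis .
qed

lemma hat_inversion:
 assumes N: "N > 0" and F: "per N F"
 shows "complex_of_real (F x y) = (\<Sum>f\<in>{0..<int N}. \<Sum>g\<in>{0..<int N}. hat N F f g*ex N (- (f*x + g*y)))/(of_nat N)^2"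
proof -
 have eN: "(\<Sum>f\<in>{0..<int N}. ex N (f*(u - x))) = (if u = x mod int N then of_nat N else 0)"
  if "u \<in> {0..<int N}" for u x
 proof -
  have "int N dvd u - x \<longleftrightarrow> u = x mod int N"
   using that by (simp add: mod_eq_dvd_iff[symmetric])
  thus ?thesis using ex_orthogonality[OF N, of "u - x"] by simp
 qed
 have "(\<Sum>f\<in>{0..<int N}. \<Sum>g\<in>{0..<int N}. hat N F f g*ex N (- (f*x + g*y)))
   = (\<Sum>f\<in>{0..<int N}. \<Sum>g\<in>{0..<int N}. \<Sum>u\<in>{0..<int N}. \<Sum>v\<in>{0..<int N}.
     of_real (F u v)*(ex N (f*(u - x))*ex N (g*(v - y))))"
  unfolding hat_def sum_distrib_right
  by (intro sum.cong refl) (simp add: ex_add[symmetric] mult.assoc algebra_simps)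
 also have "... = (\<Sum>u\<in>{0..<int N}. \<Sum>v\<in>{0..<int N}. \<Sum>f\<in>{0..<int N}. \<Sum>g\<in>{0..<int N}.
     of_real (F u v)*(ex N (f*(u - x))*ex N (g*(v - y))))"
  by (rule sum_swap4)
 also have "... = (\<Sum>u\<in>{0..<int N}. \<Sum>v\<in>{0..<int N}. of_real (F u v) *
    ((\<Sum>f\<in>{0..<int N}. ex N (f*(u - x)))*(\<Sum>g\<in>{0..<int N}. ex N (g*(v - y)))))"
  unfolding sum_product by (simp only: sum_distrib_left)
 also have "... = (\<Sum>u\<in>{0..<int N}. \<Sum>v\<in>{0..<int N}. if u = x mod int N then if v = y mod int N then of_real (F u v)*(of_nat N)^2 else 0 else 0)"
  by (intro sum.cong refl) (simp add: eN power2_eq_square)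
 also have "... = (\<Sum>u\<in>{0..<int N}. if u = x mod int N then of_real (F u (y mod int N))*(of_nat N)^2 else 0)"
  using N by (intro sum.cong refl) simp
 also have "... = of_real (F x y)*(of_nat N)^2"
  using N by (simp add: perD[OF F])
 finally show ?thesis using N by simp
qed

lemma card_residue_le:
 assumes "N > 0"
 shows "real (card {i\<in>{..<L}. int N dvd int i - r}) <= real L/real N + 1"
proof -
 let ?A = "{i\<in>{..<L}. int N dvd int i - r}"
 have "inj_on (%i. i div N) ?A"
 proof (rule inj_onI)
  fix i j assume i: "i \<in> ?A" and j: "j \<in> ?A" and d: "i div N = j div N"
  have "int N dvd int i - int j" using dvd_diff[of "int N" "int i - r" "int j - r"] i j by simp
  hence "int i mod int N = int j mod int N" by (simp only: mod_eq_dvd_iff)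
  hence "i mod N = j mod N" by (metis of_nat_eq_iff of_nat_mod)
  thus "i = j" using d by (metis div_mult_mod_eq)
 qed
 hence "card ?A = card ((%i. i div N) ` ?A)" by (simp add: card_image)
 also have "... <= card {..L div N}"
  by (intro card_mono) (auto intro!: div_le_mono)
 finally have "real (card ?A) <= real (L div N) + 1" by simp
 also have "real (L div N) <= real L/real N" by (rule of_nat_div_le_of_nat)
 finally show ?thesis by simp
qed

text \<open>Adding two variables in each coordinate squares the exponential sums over the box, so that the Fourier
 expansion is controlled by Parseval alone.\<close>
definition box_sum :: "nat => (int => int => 'a::comm_monoid_add) => 'a" where
 "box_sum L F = (\<Sum>i<L. \<Sum>i'<L. \<Sum>j<L. \<Sum>j'<L. F (int L + int i + int i') (int L + int j + int j'))"

definition box_exp :: "nat => nat => int => complex" where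
 "box_exp N L f = (\<Sum>i<L. ex N (- (f*int i)))"

text \<open>Orthogonality turns the second moment into N times the number of pairs in the range that
  are congruent modulo N, at most L*(L/N + 1).\<close>

lemma box_exp_parseval:
 assumes N: "N > 0"
 shows "(\<Sum>f\<in>{0..<int N}. (norm (box_exp N L f))^2) <= (real L)^2 + real N*real L"
proof -
 have "complex_of_real (\<Sum>f\<in>{0..<int N}. (norm (box_exp N L f))^2)
   = (\<Sum>f\<in>{0..<int N}. \<Sum>i<L. \<Sum>j<L. ex N (f*(int j - int i)))"
  unfolding of_real_sum complex_norm_square box_exp_def
  by (rule sum.cong[OF refl], simp add: sum_product cnj_ex ex_add[symmetric] algebra_simps) (rule sum.swap)
 also have "... = (\<Sum>i<L. \<Sum>f\<in>{0..<int N}. \<Sum>j<L. ex N (f*(int j - int i)))"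
  by (rule sum.swap)
 also have "... = (\<Sum>i<L. \<Sum>j<L. \<Sum>f\<in>{0..<int N}. ex N (f*(int j - int i)))"
  by (rule sum.cong[OF refl], rule sum.swap)
 also have "... = (\<Sum>i<L. \<Sum>j<L. if int N dvd int j - int i then of_nat N else 0)"
  by (simp add: ex_orthogonality[OF N])
 also have "... = of_real (\<Sum>i<L. real N*real (card {j\<in>{..<L}. int N dvd int j - int i}))"
  by (simp add: sum.If_cases Int_def conj_commute mult.commute)
 finally have "(\<Sum>f\<in>{0..<int N}. (norm (box_exp N L f))^2) = (\<Sum>i<L. real N*real (card {j\<in>{..<L}. int N dvd int j - int i}))"
  by (simp only: of_real_eq_iff)
 also have "... <= (\<Sum>i<L. real N*(real L/real N + 1))"
  using card_residue_le[OF N] by (intro sum_mono mult_left_mono) auto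
 also have "... = (real L)^2 + real N*real L" using N by (simp add: algebra_simps power2_eq_square)
 finally show ?thesis .
qed

lemma box_sum_sum: "box_sum L (%u v. \<Sum>x\<in>A. H x u v) = (\<Sum>x\<in>A. box_sum L (H x))"
proof -
 have sw: "(\<Sum>j<L. \<Sum>x\<in>A. G x j) = (\<Sum>x\<in>A. \<Sum>j<L. G x j)" for G :: "'b => nat => 'a"
  by (rule sum.swap)
 show ?thesis unfolding box_sum_def sw ..
qed

lemma box_sum_mult: "box_sum L (%u v. c*H u v) = c*box_sum L (H :: int => int => 'a::semiring_0)"
 by (simp add: box_sum_def sum_distrib_left)

lemma box_sum_divide: "box_sum L (%u v. H u v / c) = box_sum L (H :: int => int => 'a::field) / c"
 by (simp add: box_sum_def sum_divide_distrib)

lemma box_sum_of_real: "complex_of_real (box_sum L H) = box_sum L (%u v. complex_of_real (H u v))"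
 by (simp add: box_sum_def)

lemma box_sum_exp: "box_sum L (%u v. ex N (- (f*u + g * v)))
 = ex N (- ((f + g)*int L))*(box_exp N L f)^2*(box_exp N L g)^2"
proof -
 have "ex N (- (f*(int L + int i + int i') + g*(int L + int j + int j')))
  = ex N (- ((f + g)*int L))*((ex N (- (f*int i))*ex N (- (f*int i')))*(ex N (- (g*int j))*ex N (- (g*int j'))))"
  for i i' j j' by (simp add: ex_add[symmetric] algebra_simps)
 moreover have "(box_exp N L f)^2*(box_exp N L g)^2 = (\<Sum>i<L. \<Sum>i'<L. \<Sum>j<L. \<Sum>j'<L.
   (ex N (- (f*int i))*ex N (- (f*int i')))*(ex N (- (g*int j))*ex N (- (g*int j'))))"
  by (simp only: power2_eq_square box_exp_def sum_product[of "%i. ex N (- (f*int i))"]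
   sum_product[of "%i. ex N (- (g*int i))"])
    (simp only: sum_distrib_left sum_distrib_right, rule sum_swap4)
 ultimately show ?thesis
  by (simp only: box_sum_def sum_distrib_left[symmetric] mult.assoc)
qed

lemma box_sum_fourier:
 assumes N: "N > 0" and F: "per N F"
 shows "complex_of_real (box_sum L F) = (\<Sum>f\<in>{0..<int N}. \<Sum>g\<in>{0..<int N}.
   hat N F f g*ex N (- ((f + g)*int L))*(box_exp N L f)^2*(box_exp N L g)^2)/(of_nat N)^2"
 unfolding box_sum_of_real hat_inversion[OF N F] box_sum_divide box_sum_sum box_sum_mult box_sum_exp
 by (simp only: mult.assoc)

text \<open>The zero frequency is the main term. All frequencies together have absolute mass (L^2 +
  N*L)^2; removing the zero frequency takes away L^4 and leaves N^2*L^2 + 2*N*L^3, to be divided by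
  N^2.\<close>

lemma box_sum_estimate:
 assumes N: "N > 0" and F: "per N F" and B: "!!f g. norm (hat N F f g) <= B"
 shows "norm (complex_of_real (box_sum L F) - hat N F 0 0/(of_nat N)^2 * of_nat L^4)
   <= B*((real L)^2 + 2*real L^3/real N)"
proof -
 define I where "I = {0..<int N} \<times> {0..<int N}"
 define t where "t = (%(f, g). hat N F f g*ex N (- ((f + g)*int L))*(box_exp N L f)^2*(box_exp N L g)^2)"
 define s where "s = (%(f, g). (norm (box_exp N L f))^2*(norm (box_exp N L g))^2)"
 have I0: "(0, 0) \<in> I" "finite I" using N by (auto simp: I_def)
 have e0: "box_exp N L 0 = of_nat L" by (simp add: box_exp_def)
 have B0: "0 <= B" using order_trans[OF norm_ge_zero B[of 0 0]] .
 have "(\<Sum>x\<in>I. t x) = t (0, 0) + (\<Sum>x\<in>I - {(0, 0)}. t x)" using I0 by (simp add: sum.remove)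
 hence "complex_of_real (box_sum L F) = (t (0, 0) + (\<Sum>x\<in>I - {(0, 0)}. t x))/(of_nat N)^2"
  unfolding box_sum_fourier[OF N F] by (simp add: I_def t_def sum.cartesian_product)
 moreover have "t (0, 0) = hat N F 0 0 * of_nat L^4"
  by (simp add: t_def e0 power4_eq_xxxx power2_eq_square)
 ultimately have "norm (complex_of_real (box_sum L F) - hat N F 0 0/(of_nat N)^2 * of_nat L^4)
   = norm (\<Sum>x\<in>I - {(0, 0)}. t x)/(real N)^2"
  by (simp add: add_divide_distrib norm_divide norm_power)
 also have "norm (\<Sum>x\<in>I - {(0, 0)}. t x) <= (\<Sum>x\<in>I - {(0, 0)}. B * s x)"
 proof (rule sum_norm_le)
  fix x :: "int \<times> int"
  obtain f g where x: "x = (f, g)" by (cases x)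
  have "norm (t x) = norm (hat N F f g) * s x" by (simp add: x t_def s_def norm_mult norm_power)
  thus "norm (t x) <= B * s x" using B[of f g] by (simp add: x s_def mult_right_mono)
 qed
 also have "... = B*((\<Sum>x\<in>I. s x) - s (0, 0))"
  using I0 by (simp add: sum_distrib_left sum_diff1 right_diff_distrib)
 also have "(\<Sum>x\<in>I. s x) = (\<Sum>f\<in>{0..<int N}. (norm (box_exp N L f))^2)^2"
  by (simp add: I_def s_def sum.cartesian_product[symmetric] sum_product power2_eq_square)
 also have "s (0, 0) = real L^4" by (simp add: s_def e0 power4_eq_xxxx power2_eq_square)
 finally have "norm (complex_of_real (box_sum L F) - hat N F 0 0/(of_nat N)^2 * of_nat L^4)
   <= B*((\<Sum>f\<in>{0..<int N}. (norm (box_exp N L f))^2)^2 - real L^4)/(real N)^2"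
  by (simp add: divide_right_mono)
 also have "... <= B*(((real L)^2 + real N*real L)^2 - real L^4)/(real N)^2"
  using box_exp_parseval[OF N, of L] B0
  by (intro divide_right_mono mult_left_mono diff_right_mono power_mono sum_nonneg) auto
 also have "... = B*((real L)^2 + 2*real L^3/real N)"
  using N by (simp add: field_simps power2_eq_square power3_eq_cube power4_eq_xxxx)
 finally show ?thesis .
qed

text \<open>Its Fourier transform is the squared modulus of that of F, so Parseval for it yields a
  fourth moment of F; for the indicator of a conic it counts chords with a given direction
  vector.\<close>

definition autocorr :: "nat => (int => int => real) => int => int => real" where
 "autocorr N F x y = (\<Sum>u\<in>{0..<int N}. \<Sum>v\<in>{0..<int N}. F u v * F (u + x) (v + y))"

lemma per_autocorr:
 assumes "per N F" shows "per N (autocorr N F)"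
proof -
 have "F (u + x mod int N) (v + y mod int N) = F (u + x) (v + y)" for u v x y
  by (rule per_cong[OF assms]) (auto simp: cong_def mod_add_right_eq)
 thus ?thesis by (simp add: per_def autocorr_def)
qed

lemma hat_shift:
 assumes N: "N > 0" and F: "per N F"
 shows "(\<Sum>x\<in>{0..<int N}. \<Sum>y\<in>{0..<int N}. of_real (F (u + x) (v + y))*ex N (f*(u + x) + g*(v + y))) = hat N F f g"
proof -
 define H where "H = (%u v. complex_of_real (F u v)*ex N (f*u + g * v))"
 have c: "H x y = H x' y'" if "[x = x'] (mod int N)" "[y = y'] (mod int N)" for x y x' y'
 proof -
  have "[f*x + g*y = f*x' + g*y'] (mod int N)" using that by (intro cong_add cong_mult cong_refl)
  thus ?thesis unfolding H_def using ex_cong[OF N] per_cong[OF F that] by simp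
 qed
 have m2: "H x (y mod int N) = H x y" and m1: "H (x mod int N) y = H x y" for x y
  by (rule c; simp add: cong_def)+
 have "(\<Sum>x\<in>{0..<int N}. \<Sum>y\<in>{0..<int N}. H (u + x) (v + y)) = (\<Sum>x\<in>{0..<int N}. \<Sum>y\<in>{0..<int N}. H (x + u) (y + v))"
  by (simp only: add.commute[of u] add.commute[of v])
 also have "... = (\<Sum>x\<in>{0..<int N}. \<Sum>y\<in>{0..<int N}. H (x + u) y)"
  by (rule sum.cong[OF refl], rule sum_residues_shift[OF N], rule m2)
 also have "... = (\<Sum>x\<in>{0..<int N}. \<Sum>y\<in>{0..<int N}. H x y)"
  by (rule sum_residues_shift[OF N, of "%x. \<Sum>y\<in>{0..<int N}. H x y" u]) (simp only: m1)
 finally show ?thesis by (simp add: H_def hat_def)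
qed

lemma hat_autocorr:
 assumes N: "N > 0" and F: "per N F"
 shows "hat N (autocorr N F) f g = hat N F f g * cnj (hat N F f g)"
proof -
 let ?I = "{0..<int N}"
 have "hat N (autocorr N F) f g = (\<Sum>x\<in>?I. \<Sum>y\<in>?I. \<Sum>u\<in>?I. \<Sum>v\<in>?I.
   of_real (F u v)*ex N (- (f*u + g * v))*(of_real (F (u + x) (v + y))*ex N (f*(u + x) + g*(v + y))))"
  unfolding hat_def autocorr_def of_real_sum sum_distrib_right
 proof (intro sum.cong refl)
  fix x y u v
  have "ex N (f*x + g*y) = ex N (- (f*u + g * v))*ex N (f*(u + x) + g*(v + y))"
   by (simp add: ex_add[symmetric] algebra_simps)
  thus "complex_of_real (F u v * F (u + x) (v + y))*ex N (f*x + g*y)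
   = of_real (F u v)*ex N (- (f*u + g * v))*(of_real (F (u + x) (v + y))*ex N (f*(u + x) + g*(v + y)))"
   by (simp add: mult_ac)
 qed
 also have "... = (\<Sum>u\<in>?I. \<Sum>v\<in>?I. \<Sum>x\<in>?I. \<Sum>y\<in>?I.
   of_real (F u v)*ex N (- (f*u + g * v))*(of_real (F (u + x) (v + y))*ex N (f*(u + x) + g*(v + y))))"
  by (rule sum_swap4)
 also have "... = (\<Sum>u\<in>?I. \<Sum>v\<in>?I. of_real (F u v)*ex N (- (f*u + g * v))*hat N F f g)"
  by (simp only: sum_distrib_left[symmetric] hat_shift[OF N F])
 also have "... = hat N F f g * cnj (hat N F f g)"
  by (simp add: hat_def cnj_ex sum_distrib_left[symmetric] sum_distrib_right[symmetric] mult.commute)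
 finally show ?thesis .
qed

lemma hat_parseval:
 assumes N: "N > 0" and F: "per N F"
 shows "(\<Sum>f\<in>{0..<int N}. \<Sum>g\<in>{0..<int N}. (norm (hat N F f g))^2)
   = (real N)^2*(\<Sum>u\<in>{0..<int N}. \<Sum>v\<in>{0..<int N}. (F u v)^2)"
proof -
 let ?I = "{0..<int N}"
 have "complex_of_real (\<Sum>f\<in>?I. \<Sum>g\<in>?I. (norm (hat N F f g))^2)
  = (\<Sum>f\<in>?I. \<Sum>g\<in>?I. \<Sum>u\<in>?I. \<Sum>v\<in>?I. of_real (F u v)*(hat N F f g*ex N (- (f*u + g * v))))"
  unfolding of_real_sum complex_norm_square
 proof (intro sum.cong refl)
  fix f g
  have "cnj (hat N F f g) = (\<Sum>u\<in>?I. \<Sum>v\<in>?I. of_real (F u v)*ex N (- (f*u + g * v)))"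
   by (simp add: hat_def cnj_ex)
  thus "hat N F f g * cnj (hat N F f g) = (\<Sum>u\<in>?I. \<Sum>v\<in>?I. of_real (F u v)*(hat N F f g*ex N (- (f*u + g * v))))"
   by (simp add: sum_distrib_left mult_ac)
 qed
 also have "... = (\<Sum>u\<in>?I. \<Sum>v\<in>?I. \<Sum>f\<in>?I. \<Sum>g\<in>?I. of_real (F u v)*(hat N F f g*ex N (- (f*u + g * v))))"
  by (rule sum_swap4)
 also have "... = (\<Sum>u\<in>?I. \<Sum>v\<in>?I. of_real (F u v)*(of_real (F u v)*(of_nat N)^2))"
 proof -
  have "(\<Sum>f\<in>?I. \<Sum>g\<in>?I. hat N F f g*ex N (- (f*u + g * v))) = of_real (F u v)*(of_nat N)^2" for u v
   using N by (simp add: hat_inversion[OF N F])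
  thus ?thesis by (simp only: sum_distrib_left[symmetric])
 qed
 also have "... = complex_of_real ((real N)^2*(\<Sum>u\<in>?I. \<Sum>v\<in>?I. (F u v)^2))"
  by (simp add: sum_distrib_left power2_eq_square mult_ac)
 finally show ?thesis by (simp only: of_real_eq_iff)
qed

section \<open>Sums over primes\<close>

lemma sum_divisors_swap:
 fixes F :: "nat => nat => 'a::comm_monoid_add"
 shows "(\<Sum>n\<in>{1..N}. \<Sum>d | d dvd n. F d (n div d)) = (\<Sum>d\<in>{1..N}. \<Sum>e\<in>{1..N div d}. F d e)"
proof -
 have "(\<Sum>n\<in>{1..N}. \<Sum>d | d dvd n. F d (n div d)) = (\<Sum>(n, d)\<in>(SIGMA n:{1..N}. {d. d dvd n}). F d (n div d))"
  by (subst sum.Sigma) auto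
 also have "... = (\<Sum>(d, e)\<in>(SIGMA d:{1..N}. {1..N div d}). F d e)"
 proof (rule sum.reindex_bij_witness[of _ "%(d, e). (d*e, d)" "%(n, d). (d, n div d)"], goal_cases)
  case (2 x)
  then obtain n d where x: "x = (n, d)" "1 <= n" "n <= N" "d dvd n" by auto
  hence "d >= 1" "n div d >= 1" "n div d <= N div d" "d <= N"
   by (auto simp: div_le_mono Suc_le_eq div_greater_zero_iff dvd_imp_le intro: dvd_pos_nat order_trans[OF dvd_imp_le])
  thus ?case by (simp add: x)
 next
  case (4 x)
  then obtain d e where x: "x = (d, e)" "1 <= d" "1 <= e" "e <= N div d" by auto
  hence "d*e <= d*(N div d)" by simp
  also have "... <= N" by simp
  finally show ?case using x by auto
 qed auto
 also have "... = (\<Sum>d\<in>{1..N}. \<Sum>e\<in>{1..N div d}. F d e)"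
  by (subst sum.Sigma) auto
 finally show ?thesis .
qed

text \<open>Chebyshev's identity: the logarithm is the divisor sum of the von Mangoldt function, and
  d has n div d multiples up to n.\<close>

lemma ln_fact_eq: "ln (fact n) = (\<Sum>d\<in>{1..n}. mangoldt d*real (n div d))"
proof -
 have "ln (fact n) = (\<Sum>k\<in>{1..n}. ln (real k))"
  by (induction n) (auto simp: ln_mult)
 also have "... = (\<Sum>k\<in>{1..n}. \<Sum>d | d dvd k. mangoldt d)"
  by (intro sum.cong refl) (simp add: mangoldt_sum)
 also have "... = (\<Sum>d\<in>{1..n}. \<Sum>e\<in>{1..n div d}. mangoldt d)"
  by (rule sum_divisors_swap)
 finally show ?thesis by (simp add: mult.commute)
qed

definition psi :: "nat => real" where "psi n = (\<Sum>k\<in>{1..n}. mangoldt k)"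

text \<open>In the logarithm of the central binomial coefficient the von Mangoldt value at d has a
  coefficient that is never negative and is at least 1 for m < d <= 2*m.\<close>

lemma psi_double: "psi (2*m) - psi m <= 2*real m*ln 2"
proof -
 have "psi (2*m) - psi m = (\<Sum>d\<in>{m<..2*m}. mangoldt d)"
 proof -
  have "{1..2*m} = {1..m} \<union> {m<..2*m}" by auto
  thus ?thesis unfolding psi_def by (simp add: sum.union_disjoint ivl_disj_int)
 qed
 also have "... <= (\<Sum>d\<in>{1..2*m}. mangoldt d*(real (2*m div d) - 2*real (m div d)))"
 proof -
  have "(\<Sum>d\<in>{m<..2*m}. mangoldt d) <= (\<Sum>d\<in>{m<..2*m}. mangoldt d*(real (2*m div d) - 2*real (m div d)))"
  proof (intro sum_mono)
   fix d assume d: "d \<in> {m<..2*m}"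
   hence "m div d = 0" "2*m div d >= 1" by (auto simp: Suc_le_eq div_greater_zero_iff)
   thus "mangoldt d <= mangoldt d*(real (2*m div d) - 2*real (m div d))"
    using mangoldt_nonneg[of d] by (simp add: mult_le_cancel_left1)
  qed
  also have "... <= (\<Sum>d\<in>{1..2*m}. mangoldt d*(real (2*m div d) - 2*real (m div d)))"
  proof (intro sum_mono2)
   fix d assume "d \<in> {1..2*m} - {m<..2*m}"
   have "2*(m div d) <= 2*m div d"
    by (cases "d = 0") (auto simp: less_eq_div_iff_mult_less_eq)
   hence "2*real (m div d) <= real (2*m div d)" by (metis of_nat_le_iff of_nat_mult of_nat_numeral)
   thus "0 <= mangoldt d*(real (2*m div d) - 2*real (m div d))"
    using mangoldt_nonneg[of d] by simp
  qed auto
  finally show ?thesis .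
 qed
 also have "... = ln (fact (2*m)) - 2*ln (fact m)"
 proof -
  have "(\<Sum>d\<in>{1..2*m}. mangoldt d*real (m div d)) = (\<Sum>d\<in>{1..m}. mangoldt d*real (m div d))"
   by (rule sum.mono_neutral_right) auto
  hence "(\<Sum>d\<in>{1..2*m}. mangoldt d*(2*real (m div d))) = 2*(\<Sum>d\<in>{1..m}. mangoldt d*real (m div d))"
   by (simp only: mult.left_commute[of _ 2] sum_distrib_left[symmetric])
  thus ?thesis
   unfolding ln_fact_eq by (simp add: right_diff_distrib sum_subtractf)
 qed
 also have "... = ln (real ((2*m) choose m))"
 proof -
  have "real ((2*m) choose m) = fact (2*m)/(fact m*fact m)"
   using binomial_fact[of m "2*m", where ?'a = real] by (simp add: mult_2)
  thus ?thesis by (simp add: ln_div ln_mult)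
 qed
 also have "... <= ln (2^(2*m))"
 proof -
  have "(2*m) choose m <= 2^(2*m)" by (rule binomial_le_pow2)
  hence "real ((2*m) choose m) <= 2^(2*m)" by (metis of_nat_le_iff of_nat_numeral of_nat_power)
  thus ?thesis by (intro ln_mono) auto
 qed
 also have "... = 2*real m*ln 2" by (simp add: ln_realpow)
 finally show ?thesis .
qed

text \<open>Halving gives psi (2*m) <= 4*m + 2*m*ln 2 <= 6*m. The slack up to 8*m pays for the last
  term of an odd n = 2*m + 1, where \<open>mangoldt n\<close> <= ln n <= n - 1.\<close>

lemma psi_le: "psi n <= 4*real n"
proof (induction n rule: less_induct)
 case (less n)
 have l2: "ln 2 <= (1::real)" using ln_2_less_1 by simp
 show ?case
 proof (cases "n <= 1")
  case True
  hence "n = 0 \<or> n = 1" by auto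
  thus ?thesis by (auto simp: psi_def)
 next
  case False
  define m where "m = n div 2"
  have m: "m < n" "m >= 1" using False by (auto simp: m_def)
  have "psi (2*m) <= 4*real m + 2*real m*ln 2" using psi_double[of m] less[OF m(1)] by simp
  also have "... <= 6*real m" using mult_left_mono[OF l2, of "2*real m"] by simp
  finally have e: "psi (2*m) <= 6*real m" .
  show ?thesis
  proof (cases "even n")
   case True
   hence "n = 2*m" by (simp add: m_def)
   thus ?thesis using e by simp
  next
   case False
   hence n: "n = Suc (2*m)" by (simp add: m_def)
   have "psi n = psi (2*m) + mangoldt n" by (simp add: psi_def n)
   also have "mangoldt n <= ln (real n)" using n by (intro mangoldt_le) auto
   also have "ln (real n) <= real n - 1" using n by (intro ln_le_minus_one) auto
   finally show ?thesis using e n by simp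
  qed
 qed
qed

lemma ln_fact_bounds: "real n*ln (real n) - real n <= ln (fact n)" "ln (fact n) <= real n*ln (real n)"
proof -
 show "ln (fact n) <= real n*ln (real n)"
 proof (cases "n = 0")
  case False
  have "ln (fact n) <= ln (real n^n)"
   using False fact_le_power[of n, where ?'a = real] by (intro ln_mono) auto
  thus ?thesis using False by (simp add: ln_realpow)
 qed simp
 show "real n*ln (real n) - real n <= ln (fact n)"
 proof (cases "n = 0")
  case False
  have "(\<Sum>j\<in>{n}. real n^j /\<^sub>R fact j) <= (\<Sum>j. real n^j /\<^sub>R fact j)"
   by (intro sum_le_suminf summable_exp_generic) auto
  hence "real n^n/fact n <= exp (real n)" by (simp add: exp_def divide_inverse mult.commute)
  hence "ln (real n^n/fact n) <= ln (exp (real n))" using False by (intro ln_mono) auto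
  thus ?thesis using False by (simp add: ln_div ln_realpow)
 qed simp
qed

text \<open>Compare ln (fact n) with n times the sum. Replacing n div k by n/k costs at most psi n
  <= 4*n, the origin of the 4; the 1 is the loss in n*ln n - n <= ln (fact n).\<close>

lemma mertens1:
 assumes "n >= 1"
 shows "(\<Sum>k\<in>{1..n}. mangoldt k/real k) <= ln (real n) + 4"
  and "ln (real n) - 1 <= (\<Sum>k\<in>{1..n}. mangoldt k/real k)"
proof -
 let ?S = "\<Sum>k\<in>{1..n}. mangoldt k/real k"
 have eq: "real n * ?S = (\<Sum>k\<in>{1..n}. mangoldt k*(real n/real k))"
  unfolding sum_distrib_left by (intro sum.cong refl) simp
 have "(\<Sum>k\<in>{1..n}. mangoldt k*(real n/real k)) <= (\<Sum>k\<in>{1..n}. mangoldt k*(real (n div k) + 1))"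
 proof (intro sum_mono mult_left_mono mangoldt_nonneg)
  fix k assume k: "k \<in> {1..n}"
  have "real n = real k*real (n div k) + real (n mod k)"
   by (metis mult_div_mod_eq of_nat_add of_nat_mult)
  moreover have "real (n mod k) <= real k" using k by (intro of_nat_mono) (simp add: less_imp_le)
  ultimately show "real n/real k <= real (n div k) + 1" using k by (simp add: field_simps)
 qed
 also have "... = ln (fact n) + psi n" by (simp add: ln_fact_eq psi_def algebra_simps sum.distrib)
 also have "... <= real n*ln (real n) + 4*real n" using ln_fact_bounds(2)[of n] psi_le[of n] by linarith
 finally have "real n * ?S <= real n*(ln (real n) + 4)" unfolding eq by (simp add: algebra_simps)
 thus "?S <= ln (real n) + 4" using assms by simp
 have "real n*(ln (real n) - 1) <= ln (fact n)" using ln_fact_bounds(1)[of n] by (simp add: algebra_simps)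
 also have "... <= real n * ?S" unfolding eq ln_fact_eq
  by (intro sum_mono mult_left_mono mangoldt_nonneg of_nat_div_le_of_nat)
 finally show "ln (real n) - 1 <= ?S" using assms by simp
qed

text \<open>The constant is 4 + 1 from the two forms of Mertens' estimate, plus 1 for replacing A by
  its integer part.\<close>

lemma sum_mangoldt_interval:
 assumes "1 <= A" "A <= B"
 shows "(\<Sum>k | A < real k & real k <= B. mangoldt k/real k) <= ln (B/A) + 6"
proof -
 define a b where "a = nat (floor A)" and "b = nat (floor B)"
 have a: "1 <= a" "real a <= A" "A < real a + 1"
  using assms real_of_int_floor_add_one_gt[of A] by (auto simp: a_def le_nat_floor of_nat_floor)
 have b: "1 <= b" "real b <= B" "B < real b + 1"
  using assms real_of_int_floor_add_one_gt[of B] by (auto simp: b_def le_nat_floor of_nat_floor)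
 have ab: "a <= b" unfolding a_def b_def using assms by (intro nat_mono floor_mono)
 have "A < real k \<longleftrightarrow> a < k" for k using assms by (simp add: a_def nat_less_iff floor_less_iff)
 moreover have "real k <= B \<longleftrightarrow> k <= b" for k using assms by (simp add: b_def le_nat_iff le_floor_iff)
 ultimately have "{k. A < real k & real k <= B} = {a<..b}" by auto
 hence "(\<Sum>k | A < real k & real k <= B. mangoldt k/real k) = (\<Sum>k\<in>{1..b}. mangoldt k/real k) - (\<Sum>k\<in>{1..a}. mangoldt k/real k)"
 proof -
  have "{1..b} = {1..a} \<union> {a<..b}" using ab a by auto
  thus ?thesis using \<open>_ = {a<..b}\<close> by (simp add: sum.union_disjoint ivl_disj_int)
 qed
 also have "... <= (ln (real b) + 4) - (ln (real a) - 1)"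
  using mertens1(1)[OF b(1)] mertens1(2)[OF a(1)] by linarith
 finally have "(\<Sum>k | A < real k & real k <= B. mangoldt k/real k) <= (ln (real b) + 4) - (ln (real a) - 1)" .
 moreover have "ln (real b) <= ln B" using b by (intro ln_mono) auto
 have "1 <= real a" using a(1) by simp
 hence "A <= 2*real a" using a by linarith
 hence "ln A <= ln (2*real a)" using assms by (intro ln_mono) auto
 hence "ln (real a) >= ln A - 1" using a ln_2_less_1 by (simp add: ln_mult)
 ultimately show ?thesis using assms \<open>ln (real a) >= ln A - 1\<close> \<open>ln (real b) <= ln B\<close> by (simp add: ln_div)
qed

lemma finite_nat_real_le: "finite {k::nat. real k <= B & P k}"
 by (rule finite_subset[of _ "{..nat (floor B)}"]) (auto simp: le_nat_floor)

lemma sum_ln_prime_interval: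
 assumes "1 <= A" "A <= B"
 shows "(\<Sum>p | prime p & A < real p & real p <= B. ln (real p)/real p) <= ln (B/A) + 6"
proof -
 have "(\<Sum>p | prime p & A < real p & real p <= B. ln (real p)/real p)
   = (\<Sum>p | prime p & A < real p & real p <= B. mangoldt p/real p)"
  by (intro sum.cong refl) simp
 also have "... <= (\<Sum>k | A < real k & real k <= B. mangoldt k/real k)"
 proof (intro sum_mono2)
  show "finite {k. A < real k & real k <= B}"
   by (rule finite_subset[OF _ finite_nat_real_le[of B "%_. True"]]) auto
 qed (auto intro!: divide_nonneg_nonneg mangoldt_nonneg)
 finally show ?thesis using sum_mangoldt_interval[OF assms] by simp
qed

text \<open>Dividing by ln A in place of partial summation loses only a constant when the endpoints
  have comparable logarithms, as they do wherever this is applied.\<close>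

lemma sum_inverse_prime_interval:
 assumes "1 < A" "A <= B"
 shows "(\<Sum>p | prime p & A < real p & real p <= B. 1/real p) <= (ln (B/A) + 6)/ln A"
proof -
 have "ln A*(\<Sum>p | prime p & A < real p & real p <= B. 1/real p)
   <= (\<Sum>p | prime p & A < real p & real p <= B. ln (real p)/real p)"
  unfolding sum_distrib_left using assms
  by (intro sum_mono) (auto intro!: divide_right_mono ln_mono)
 also have "... <= ln (B/A) + 6" using assms by (intro sum_ln_prime_interval) auto
 finally show ?thesis using assms by (simp add: field_simps)
qed

definition prime_log_sum :: "nat => real" where
 "prime_log_sum n = (\<Sum>p | prime p & p <= n. ln (real p)/real p)"

lemma prime_log_sum_le: "n >= 1 ==> prime_log_sum n <= ln (real n) + 4"
proof -
 assume n: "n >= 1"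
 have "prime_log_sum n = (\<Sum>p | prime p & p <= n. mangoldt p/real p)"
  unfolding prime_log_sum_def by (intro sum.cong refl) simp
 also have "... <= (\<Sum>k\<in>{1..n}. mangoldt k/real k)"
  by (intro sum_mono2) (auto intro!: divide_nonneg_nonneg mangoldt_nonneg simp: Suc_le_eq prime_gt_0_nat)
 finally show ?thesis using mertens1(1)[OF n] by simp
qed

lemma Collect_prime_le_Suc:
 "{p. prime p & p <= Suc n} = (if prime (Suc n) then insert (Suc n) {p. prime p & p <= n} else {p. prime p & p <= n})"
 by (auto simp: le_Suc_eq)

lemma mertens2_base:
 fixes S P :: real
 assumes "S = 1/2" "P = ln 2/2"
 shows "S - P/ln (real 2) <= ln (ln (real 2)) - ln (ln 2) + 4*(1/ln 2 - 1/ln (real 2))"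
proof -
 have "ln 2/2/ln 2 = (1/2 :: real)" by simp
 hence z: "S - P/ln (real 2) = 0" unfolding assms(1,2) of_nat_numeral by (simp only: diff_self)
 have r: "0 = ln (ln (real 2)) - ln (ln 2) + 4*(1/ln 2 - 1/ln (real 2))"
  unfolding of_nat_numeral diff_self mult_zero_right add_0_right ..
 show ?thesis unfolding z by (rule eq_refl[OF r])
qed

text \<open>Induction in place of partial summation. From n to n + 1 a new prime contributes equally
  to both terms on the left, so only the change of 1/ln n matters. It is weighted by
  \<open>prime_log_sum n\<close> <= ln n + 4, and 1 - l/l' <= ln l' - ln l makes the bound
  telescope.\<close>

lemma mertens2_aux:
 assumes "n >= 2"
 shows "(\<Sum>p | prime p & p <= n. 1/real p) - prime_log_sum n/ln (real n)
   <= ln (ln (real n)) - ln (ln 2) + 4*(1/ln 2 - 1/ln (real n))"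
 using assms
proof (induction n rule: dec_induct)
 case base
 have "p = 2" if "prime p" "p <= 2" for p :: nat
  using prime_ge_2_nat[OF that(1)] that(2) by (rule antisym[rotated])
 hence two: "{p. prime p & p <= (2::nat)} = {2}"
  by (intro equalityI subsetI) (blast, use two_is_prime_nat in blast)
 have "(\<Sum>p | prime p & p <= (2::nat). 1/real p) = 1/2" unfolding two by simp
 moreover have "prime_log_sum 2 = ln 2/2" unfolding prime_log_sum_def two by simp
 ultimately show ?case by (rule mertens2_base)
next
 case (step n)
 let ?l = "ln (real n)" and ?l' = "ln (real (Suc n))"
 have l: "0 < ?l" "?l <= ?l'" using step.hyps by simp_all
 have fin: "finite {p. prime p & p <= n}" by simp
 have new: "(\<Sum>p | prime p & p <= Suc n. 1/real p) - prime_log_sum (Suc n) / ?l'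
   = (\<Sum>p | prime p & p <= n. 1/real p) - prime_log_sum n / ?l'"
 proof (cases "prime (Suc n)")
  case True
  have cancel: "(1/x + s) - (y/x + t)/y = s - t/y" if "y ~= 0" for x y s t :: real
   using that by (simp add: add_divide_distrib)
  have "?l' ~= 0" using l by linarith
  moreover have "(\<Sum>p | prime p & p <= Suc n. 1/real p) = 1/real (Suc n) + (\<Sum>p | prime p & p <= n. 1/real p)"
   using True by (subst Collect_prime_le_Suc) simp
  moreover have "prime_log_sum (Suc n) = ?l'/real (Suc n) + prime_log_sum n"
   using True unfolding prime_log_sum_def by (subst Collect_prime_le_Suc) simp
  ultimately show ?thesis by (simp only: cancel not_False_eq_True)
 next
  case False
  hence "{p. prime p & p <= Suc n} = {p. prime p & p <= n}" by (subst Collect_prime_le_Suc) simp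
  thus ?thesis unfolding prime_log_sum_def by (simp only:)
 qed
 have "prime_log_sum n*(1 / ?l - 1 / ?l') <= (?l + 4)*(1 / ?l - 1 / ?l')"
 proof (rule mult_right_mono)
  show "prime_log_sum n <= ?l + 4" using prime_log_sum_le[of n] step.hyps by simp
  have "1 / ?l' <= 1 / ?l" using l by (intro divide_left_mono mult_pos_pos) linarith+
  thus "0 <= 1 / ?l - 1 / ?l'" by linarith
 qed
 also have "... = (1 - ?l / ?l') + 4*(1 / ?l - 1 / ?l')"
 proof -
  have id: "(x + 4)*(1/x - 1/y) = (1 - x/y) + 4*(1/x - 1/y)" if "x ~= 0" for x y :: real
   unfolding distrib_right[of x 4] right_diff_distrib[of x] using that by simp
  have "?l ~= 0" using l(1) by linarith
  thus ?thesis by (rule id)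
 qed
 also have "1 - ?l / ?l' <= ln ?l' - ln ?l"
 proof -
  have "ln (?l / ?l') <= ?l / ?l' - 1" using l by (intro ln_le_minus_one divide_pos_pos) linarith+
  moreover have "ln (?l / ?l') = ln ?l - ln ?l'" using l by (intro ln_divide_pos) linarith+
  ultimately show ?thesis by linarith
 qed
 finally have diff: "prime_log_sum n / ?l - prime_log_sum n / ?l' <= ln ?l' - ln ?l + 4*(1 / ?l - 1 / ?l')"
  unfolding right_diff_distrib by simp
 have combine: "s - y <= a - c + 4*(w - v)"
  if "x - y <= a - b + 4*(u - v)" "s - x <= b - c + 4*(w - u)" for s x y a b c u v w :: real
  using that by argo
 show ?case unfolding new by (rule combine[OF diff step.IH])
qed

lemma mertens2:
 obtains C where "!!n. n >= 2 ==> (\<Sum>p | prime p & p <= n. 1/real p) <= ln (ln (real n)) + C"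
proof
 fix n :: nat assume n: "n >= 2"
 have l: "0 < ln (real n)" using n by simp
 have "prime_log_sum n/ln (real n) <= (ln (real n) + 4)/ln (real n)"
  using prime_log_sum_le[of n] n l by (intro divide_right_mono) auto
 also have "... = 1 + 4/ln (real n)" using l by (simp add: add_divide_distrib)
 finally show "(\<Sum>p | prime p & p <= n. 1/real p) <= ln (ln (real n)) + (1 + 4/ln 2 - ln (ln 2))"
  using mertens2_aux[OF n] unfolding right_diff_distrib by simp
qed

section \<open>Real characters\<close>

text \<open>A real Dirichlet character as a function on the naturals. The vanishing sum over a
  period says that it is not principal, and is the source of all cancellation.\<close>

locale real_char =
 fixes chi :: "nat => real" and q :: nat
 assumes chi_mult: "chi (m*n) = chi m * chi n" and chi_1: "chi 1 = 1"
  and chi_values: "chi n \<in> {-1, 0, 1}" and chi_period: "chi (n + q) = chi n"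
  and q_pos: "q > 0" and chi_sum: "(\<Sum>n<q. chi n) = 0"
begin

lemma chi_abs_le: "\<bar>chi n\<bar> <= 1" using chi_values[of n] by auto

lemma chi_power: "chi (n^k) = chi n^k"
 by (induction k) (use chi_1 in \<open>auto simp: chi_mult\<close>)

lemma chi_mod: "chi (n mod q) = chi n"
proof -
 have "chi (r + k*q) = chi r" for r k
 proof (induction k)
  case (Suc k)
  have "chi (r + Suc k*q) = chi ((r + k*q) + q)" by (simp add: add_ac)
  thus ?case using Suc chi_period[of "r + k*q"] by simp
 qed simp
 thus ?thesis by (metis mod_div_mult_eq)
qed

lemma chi_sum_lessThan: "\<bar>\<Sum>n<N. chi n\<bar> <= real q"
proof -
 have block: "(\<Sum>n<k*q + r. chi n) = (\<Sum>n<r. chi n)" for k r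
 proof (induction k)
  case (Suc k)
  have "(\<Sum>n<Suc k*q + r. chi n) = (\<Sum>n<q. chi n) + (\<Sum>n\<in>{q..<q + (k*q + r)}. chi n)"
   by (subst sum.atLeastLessThan_concat[of 0, symmetric, simplified atLeast0LessThan]) (auto simp: add_ac)
  also have "(\<Sum>n\<in>{q..<q + (k*q + r)}. chi n) = (\<Sum>n<k*q + r. chi (n + q))"
   using sum.shift_bounds_nat_ivl[of chi 0 q "k*q + r"] by (simp add: atLeast0LessThan add.commute)
  finally show ?case by (simp add: chi_sum chi_period Suc)
 qed simp
 have "(\<Sum>n<N. chi n) = (\<Sum>n<N mod q. chi n)"
  using block[of "N div q" "N mod q"] by simp
 also have "\<bar>...\<bar> <= (\<Sum>n<N mod q. 1)"
  using chi_abs_le by (intro order_trans[OF sum_abs] sum_mono)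
 also have "... <= real q" using q_pos by (simp add: less_imp_le)
 finally show ?thesis .
qed

lemma chi_sum_interval: "\<bar>\<Sum>n\<in>{a..<b}. chi n\<bar> <= 2*real q"
proof (cases "a <= b")
 case True
 have "(\<Sum>n\<in>{a..<b}. chi n) = (\<Sum>n<b. chi n) - (\<Sum>n<a. chi n)"
  using sum_diff_nat_ivl[of 0 a b chi] True by (simp add: atLeast0LessThan)
 thus ?thesis using chi_sum_lessThan[of a] chi_sum_lessThan[of b] by linarith
qed simp

end

section \<open>Non-vanishing at 1 and prime sums of a real character\<close>

lemma abel_bound:
 fixes c f :: "nat => real"
 assumes "!!m. \<bar>\<Sum>n\<in>{a..<m}. c n\<bar> <= K"
  and mono: "!!n. a <= n ==> f (Suc n) <= f n" and nonneg: "!!n. a <= n ==> 0 <= f n"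
 shows "\<bar>\<Sum>n\<in>{a..<b}. c n*f n\<bar> <= K*f a"
proof (cases "a < b")
 case True
 define S where "S = (%m. \<Sum>n\<in>{a..<m}. c n)"
 have K0: "0 <= K" using assms(1)[of a] by simp
 have "(\<Sum>n\<in>{a..<b}. c n*f n) = S b*f b + (\<Sum>n\<in>{a..<b}. S (Suc n)*(f n - f (Suc n)))"
  using True[THEN less_imp_le]
 proof (induction b rule: dec_induct)
  case (step n)
  have "S (Suc n) = S n + c n" using step.hyps by (simp add: S_def)
  thus ?case using step by (simp add: algebra_simps)
 qed (simp add: S_def)
 also have "\<bar>...\<bar> <= K*f b + (\<Sum>n\<in>{a..<b}. K*(f n - f (Suc n)))"
 proof (rule order_trans[OF abs_triangle_ineq add_mono])
  show "\<bar>S b*f b\<bar> <= K*f b"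
   using assms(1)[of b] nonneg[of b] True by (simp add: abs_mult S_def mult_right_mono)
  show "\<bar>\<Sum>n\<in>{a..<b}. S (Suc n)*(f n - f (Suc n))\<bar> <= (\<Sum>n\<in>{a..<b}. K*(f n - f (Suc n)))"
  proof (rule order_trans[OF sum_abs sum_mono])
   fix n assume n: "n \<in> {a..<b}"
   have "\<bar>S (Suc n)\<bar> <= K" unfolding S_def by (rule assms(1))
   thus "\<bar>S (Suc n)*(f n - f (Suc n))\<bar> <= K*(f n - f (Suc n))"
    using mono[of n] n by (simp add: abs_mult mult_right_mono)
  qed
 qed
 also have "(\<Sum>n\<in>{a..<b}. K*(f n - f (Suc n))) = K*(f a - f b)"
  using sum_Suc_diff'[of a b "%n. - f n"] True unfolding sum_distrib_left[symmetric] by simp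
 finally show ?thesis by (simp add: right_diff_distrib)
next
 case False
 thus ?thesis using assms(1)[of a] nonneg[of a] by simp
qed

text \<open>Pair the exponents 2*i and 2*(n - 1 - i); their geometric mean is the middle
  power.\<close>

lemma amgm_geometric:
 fixes s :: real assumes "0 <= s"
 shows "real n * s^(n - 1) <= (\<Sum>i<n. s^(2*i))"
proof -
 have "2 * s^(n - 1) <= s^(2*i) + s^(2*(n - 1 - i))" if "i < n" for i
 proof -
  have "s^(n - 1) = s^i * s^(n - 1 - i)" using that by (simp flip: power_add)
  thus ?thesis
   using sum_squares_bound[of "s^i" "s^(n - 1 - i)"] by (simp only: power_even_eq mult.assoc)
 qed
 hence "(\<Sum>i<n. 2 * s^(n - 1)) <= (\<Sum>i<n. s^(2*i) + s^(2*(n - 1 - i)))" by (intro sum_mono) auto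
 also have "... = 2*(\<Sum>i<n. s^(2*i))"
  using sum.nat_diff_reindex[of "%i. s^(2*i)" n] by (simp add: sum.distrib)
 finally show ?thesis by simp
qed

text \<open>The harmonic weight scaled by 1/(1 - t), minus the Lambert weight. The poles at t = 1
  cancel, and as the difference decreases in n, its sum against chi is bounded uniformly in t by its
  value 1 at n = 1.\<close>

definition lambert :: "real => nat => real" where
 "lambert t n = 1/(real n*(1 - t)) - t^n/(1 - t^n)"

text \<open>Monotonicity is the AM--GM inequality for geometric sums, applied with ratio \<open>t = s^2\<close>.\<close>
lemma lambert_mono:
 assumes s: "0 < s" "s < 1" and n: "n >= 1"
 shows "lambert (s^2) (Suc n) <= lambert (s^2) n" and "0 <= lambert (s^2) n"
proof -
 define t where "t = s^2"
 define g where "g = (%n. \<Sum>i<n. t^i)"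
 have t: "0 < t" "t < 1" using s by (auto simp: t_def power_less_one_iff)
 have g: "1 - t^k = (1 - t)*g k" for k unfolding g_def by (rule one_diff_power_eq)
 have gpos: "0 < g k" if "k >= 1" for k unfolding g_def using t that by (intro sum_pos) (auto simp: lessThan_empty_iff bot_nat_def)
 have ag: "real k * s^(k - 1) <= g k" for k
  using amgm_geometric[of s k] s by (simp add: g_def t_def power_mult)
 have p1: "real n * s^n <= g n"
 proof -
  have "s^n <= s^(n - 1)" using s by (intro power_decreasing) auto
  thus ?thesis using ag[of n] by (meson mult_left_mono of_nat_0_le_iff order_trans)
 qed
 have p2: "real (Suc n) * s^n <= g (Suc n)" using ag[of "Suc n"] by simp
 have "(real n * s^n)*(real (Suc n) * s^n) <= g n*g (Suc n)"
  using p1 p2 s gpos[of n] n by (intro mult_mono) auto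
 hence key: "real n*real (Suc n)*t^n <= g n*g (Suc n)"
 proof -
  have "t^n = s^n * s^n" by (simp add: t_def power2_eq_square power_mult_distrib)
  thus ?thesis using \<open>(real n * s ^ n) * (real (Suc n) * s ^ n) <= g n * g (Suc n)\<close> by (simp only: mult_ac)
 qed
 have L: "lambert t k = (1/(1 - t))*(1/real k - t^k/g k)" if "k >= 1" for k
  unfolding lambert_def g by (simp only: right_diff_distrib times_divide_times_eq mult_1 mult.commute)
 have "t^n/g n - t^Suc n/g (Suc n) = t^n*(g (Suc n) - t*g n)/(g n*g (Suc n))"
  using gpos[of n] gpos[of "Suc n"] n by (simp add: field_simps)
 also have "g (Suc n) - t*g n = 1"
  unfolding g_def sum.lessThan_Suc_shift by (simp add: sum_distrib_left)
 also have "t^n*1/(g n*g (Suc n)) <= 1/(real n*real (Suc n))"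
  using key gpos[of n] gpos[of "Suc n"] n by (simp add: divide_simps mult_ac)
 also have "... = 1/real n - 1/real (Suc n)" using n by (simp add: field_simps)
 finally have "1/real (Suc n) - t^Suc n/g (Suc n) <= 1/real n - t^n/g n" by linarith
 thus "lambert (s^2) (Suc n) <= lambert (s^2) n"
  unfolding t_def[symmetric] using n t by (simp only: L) (simp add: divide_right_mono)
 have "real n*t^n <= g n"
 proof -
  have "t^n = s^n * s^n" by (simp add: t_def power2_eq_square power_mult_distrib)
  also have "... <= s^n" using s by (simp add: mult_left_le power_le_one)
  finally show ?thesis using p1 by (meson mult_left_mono of_nat_0_le_iff order_trans)
 qed
 hence "t^n/g n <= 1/real n" using gpos[of n] n by (simp add: field_simps)
 thus "0 <= lambert (s^2) n" unfolding t_def[symmetric] using n t by (simp add: L)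
qed

context real_char begin

text \<open>The convolution of 1 with chi; for the character of the field it counts the ideals of
  norm n.\<close>

definition div_sum :: "nat => real" where "div_sum n = (\<Sum>d | d dvd n. chi d)"

lemma div_sum_prime_power_mult:
 assumes p: "prime p" "~ p dvd m" and m: "m > 0"
 shows "div_sum (p^k*m) = (\<Sum>i\<le>k. chi p^i)*div_sum m"
proof -
 have cop: "coprime (p^k) m" using p by (simp add: prime_imp_coprime coprime_power_left_iff)
 have "div_sum (p^k*m) = (\<Sum>d\<in>(%(a, b). a*b) ` ({a. a dvd p^k} \<times> {b. b dvd m}). chi d)"
  unfolding div_sum_def
 proof (rule sum.cong)
  show "{d. d dvd p^k*m} = (%(a, b). a*b) ` ({a. a dvd p^k} \<times> {b. b dvd m})"
  proof (intro equalityI subsetI)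
   fix d assume "d \<in> {d. d dvd p^k*m}"
   then obtain a b where "d = a*b" "a dvd p^k" "b dvd m" using division_decomp[of d "p^k" m] by auto
   thus "d \<in> (%(a, b). a*b) ` ({a. a dvd p^k} \<times> {b. b dvd m})" by auto
  qed (auto intro: mult_dvd_mono)
 qed simp
 also have "... = (\<Sum>(a, b)\<in>{a. a dvd p^k} \<times> {b. b dvd m}. chi (a*b))"
 proof (subst sum.reindex)
  show "inj_on (%(a, b). a*b) ({a. a dvd p^k} \<times> {b. b dvd m})"
  proof (rule inj_onI, clarsimp)
   fix a b c d assume h: "a dvd p^k" "b dvd m" "c dvd p^k" "d dvd m" "a*b = c*d"
   have "coprime a d" "coprime c b" using h cop by (meson coprime_divisors)+
   hence "a dvd c" "c dvd a" using h(5)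
    by (metis coprime_dvd_mult_left_iff dvd_triv_left, metis coprime_dvd_mult_left_iff dvd_triv_left)
   hence "a = c" by (rule dvd_antisym)
   moreover have "a ~= 0" using h(1) p(1) by (metis dvd_0_left_iff not_prime_0 power_not_zero)
   ultimately show "a = c & b = d" using h(5) by simp
  qed
 qed (simp add: case_prod_unfold)
 also have "... = (\<Sum>a | a dvd p^k. chi a)*div_sum m"
  by (simp add: div_sum_def sum_product chi_mult sum.cartesian_product)
 also have "{a. a dvd p^k} = (%i. p^i) ` {..k}"
  using divides_primepow_nat[OF p(1)] by (auto simp: le_imp_power_dvd)
 also have "(\<Sum>a\<in>(%i. p^i) ` {..k}. chi a) = (\<Sum>i\<le>k. chi p^i)"
  using prime_gt_1_nat[OF p(1)] by (subst sum.reindex) (auto simp: inj_on_def chi_power)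
 finally show ?thesis .
qed

lemma geometric_chi_nonneg: "0 <= (\<Sum>i\<le>k. chi p^i)" and geometric_chi_even: "1 <= (\<Sum>i\<le>2 * k. chi p^i)"
 and geometric_chi_odd: "chi p = -1 ==> odd k ==> (\<Sum>i\<le>k. chi p^i) = 0"
proof -
 have alt: "(\<Sum>i\<le>k. (-1::real)^i) = (if even k then 1 else 0)" for k
  by (induction k) auto
 have z: "(\<Sum>i\<le>k. (0::real)^i) = 1" for k by (induction k) auto
 have o: "(\<Sum>i\<le>k. (1::real)^i) = real (Suc k)" for k by simp
 have v: "chi p = -1 \<or> chi p = 0 \<or> chi p = 1" using chi_values[of p] by blast
 show "0 <= (\<Sum>i\<le>k. chi p^i)"
  using v alt[of k] z[of k] o[of k] by (elim disjE) (simp_all only:, simp_all)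
 show "1 <= (\<Sum>i\<le>2 * k. chi p^i)"
  using v alt[of "2 * k"] z[of "2 * k"] o[of "2 * k"] by (elim disjE) (simp_all only:, simp_all)
 show "(\<Sum>i\<le>k. chi p^i) = 0" if "chi p = -1" "odd k"
  unfolding that(1) using alt[of k] that(2) by (simp only: if_False)
qed

lemma prime_power_split:
 assumes "n > (1::nat)"
 obtains p k m where "prime p" "k > 0" "n = p^k*m" "~ p dvd m" "m > 0" "m < n"
proof -
 obtain p where p: "prime p" "p dvd n" using assms prime_factor_nat[of n] by auto
 obtain m where m: "n = p^multiplicity p n*m" "~ p dvd m"
  using multiplicity_decompose'[of n p] assms p by (metis not_prime_unit not_less_zero)
 have k: "multiplicity p n > 0" using p assms by (simp add: prime_multiplicity_gt_zero_iff)
 have "m > 0" using m(2) by (auto intro!: Nat.gr0I)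
 moreover have "1 < p^multiplicity p n" using one_less_power[OF prime_gt_1_nat[OF p(1)] k] .
 ultimately have "m < p^multiplicity p n*m"
  using n_less_m_mult_n[of m "p^multiplicity p n"] by (simp only: One_nat_def)
 also have "... = n" by (rule m(1)[symmetric])
 finally have "m < n" .
 thus ?thesis using that p k m \<open>m > 0\<close> by blast
qed

lemma div_sum_nonneg: "n > 0 ==> 0 <= div_sum n"
proof (induction n rule: less_induct)
 case (less n)
 show ?case
 proof (cases "n = 1")
  case True
  thus ?thesis using chi_1 by (simp add: div_sum_def)
 next
  case False
  hence "n > 1" using less.prems by simp
  then obtain p k m where "prime p" "k > 0" "n = p^k*m" "~ p dvd m" "m > 0" "m < n"
   by (rule prime_power_split)
  thus ?thesis using div_sum_prime_power_mult[of p m k] less.IH[of m] geometric_chi_nonneg[where p = p and k = k] by simp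
 qed
qed

lemma div_sum_square: "n > 0 ==> 1 <= div_sum (n^2)"
proof (induction n rule: less_induct)
 case (less n)
 show ?case
 proof (cases "n = 1")
  case True
  thus ?thesis using chi_1 by (simp add: div_sum_def)
 next
  case False
  hence "n > 1" using less.prems by simp
  then obtain p k m where h: "prime p" "k > 0" "n = p^k*m" "~ p dvd m" "m > 0" "m < n"
   by (rule prime_power_split)
  have "n^2 = p^(2 * k)*m^2" by (simp add: h(3) power_mult_distrib power_mult[symmetric] mult.commute)
  moreover have "~ p dvd m\<^sup>2" using h by (simp add: prime_dvd_power_iff)
  ultimately have "div_sum (n^2) = (\<Sum>i\<le>2 * k. chi p^i)*div_sum (m^2)"
   using div_sum_prime_power_mult[of p "m^2" "2 * k"] h by simp
  moreover have "1*1 <= (\<Sum>i\<le>2 * k. chi p^i)*div_sum (m^2)"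
   using geometric_chi_even[where p = p and k = k] less.IH[of m] h by (intro mult_mono) auto
  ultimately show ?thesis by simp
 qed
qed

text \<open>This is how the divisor sum rejects an inert prime with odd exponent: its local factor 1
  - 1 + ... has an even number of terms.\<close>

lemma div_sum_eq_0:
 assumes "prime p" "chi p = -1" "odd (multiplicity p n)" "n > 0"
 shows "div_sum n = 0"
proof -
 obtain m where m: "n = p^multiplicity p n*m" "~ p dvd m"
  using multiplicity_decompose'[of n p] assms by (metis not_prime_unit not_less_zero)
 have "m > 0" using m(2) by (auto intro!: Nat.gr0I)
 have "div_sum (p^multiplicity p n*m) = (\<Sum>i\<le>multiplicity p n. chi p^i)*div_sum m"
  by (rule div_sum_prime_power_mult[OF assms(1) m(2) \<open>m > 0\<close>])
 also have "... = 0" using geometric_chi_odd[OF assms(2,3)] by simp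
 finally show ?thesis by (simp only: m(1)[symmetric])
qed

text \<open>A truncated form of the identity between the power series with coefficients
  \<open>div_sum\<close> and the Lambert series of chi. Nonnegativity of \<open>div_sum\<close>
  allows keeping only the squares; each truncated geometric series has a tail of at most t^N/(1 -
  t).\<close>

lemma div_sum_lambert_lower:
 assumes t: "0 < t" "t < 1" and M: "M^2 <= N"
 shows "(\<Sum>m\<in>{1..M}. t^(m^2)) - real N*t^N/(1 - t) <= (\<Sum>d\<in>{1..N}. chi d*(t^d/(1 - t^d)))"
proof -
 have "(\<Sum>m\<in>{1..M}. t^(m^2)) <= (\<Sum>m\<in>{1..M}. div_sum (m^2)*t^(m^2))"
  using t div_sum_square by (intro sum_mono) (simp add: mult_le_cancel_right1)
 also have "... = (\<Sum>n\<in>(%m. m^2) ` {1..M}. div_sum n*t^n)"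
  by (subst sum.reindex) (auto simp: inj_on_def)
 also have "... <= (\<Sum>n\<in>{1..N}. div_sum n*t^n)"
 proof (rule sum_mono2)
  show "(%m. m^2) ` {1..M} <= {1..N}"
  proof clarify
   fix m assume "m \<in> {1..M}"
   hence "m^2 <= N" "1 <= m^2" by (auto intro: order_trans[OF power_mono M])
   thus "m^2 \<in> {1..N}" by simp
  qed
 qed (use t div_sum_nonneg in auto)
 also have "... = (\<Sum>n\<in>{1..N}. \<Sum>d | d dvd n. chi d*t^(d*(n div d)))"
  unfolding div_sum_def sum_distrib_right by (intro sum.cong refl) auto
 also have "... = (\<Sum>d\<in>{1..N}. \<Sum>e\<in>{1..N div d}. chi d*t^(d*e))"
  by (rule sum_divisors_swap)
 also have "... = (\<Sum>d\<in>{1..N}. chi d*(t^d/(1 - t^d)) - chi d*(t^(d*(N div d + 1))/(1 - t^d)))"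
 proof (intro sum.cong refl)
  fix d assume d: "d \<in> {1..N}"
  have td: "t^d < 1" using t d by (intro power_less_one_iff[THEN iffD2]) auto
  have "(\<Sum>e\<in>{1..k}. (t^d)^e) = t^d/(1 - t^d) - (t^d)^(k + 1)/(1 - t^d)" for k
  proof (induction k)
   case (Suc k)
   have "(t^d)^Suc k = (t^d)^(k + 1)/(1 - t^d) - (t^d)^(Suc k + 1)/(1 - t^d)"
   proof -
    have "y/(1 - x) - x*y/(1 - x) = y" if "x < 1" for x y :: real
    proof -
     have "y/(1 - x) - x*y/(1 - x) = (y*(1 - x))/(1 - x)"
      unfolding diff_divide_distrib[symmetric] right_diff_distrib by (simp only: mult_1_left mult_1_right mult.commute)
     thus ?thesis using that by simp
    qed
    from this[OF td, of "(t^d)^Suc k"] show ?thesis by (simp only: power_Suc add_Suc Suc_eq_plus1[symmetric])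
   qed
   thus ?case using Suc by simp
  qed simp
  thus "(\<Sum>e\<in>{1..N div d}. chi d*t^(d*e)) = chi d*(t^d/(1 - t^d)) - chi d*(t^(d*(N div d + 1))/(1 - t^d))"
   by (simp only: sum_distrib_left[symmetric] power_mult right_diff_distrib)
 qed
 also have "... = (\<Sum>d\<in>{1..N}. chi d*(t^d/(1 - t^d))) - (\<Sum>d\<in>{1..N}. chi d*(t^(d*(N div d + 1))/(1 - t^d)))"
  by (rule sum_subtractf)
 also have "... <= (\<Sum>d\<in>{1..N}. chi d*(t^d/(1 - t^d))) + (\<Sum>d\<in>{1..N}. t^N/(1 - t))"
 proof -
  have "- (\<Sum>d\<in>{1..N}. chi d*(t^(d*(N div d + 1))/(1 - t^d))) <= (\<Sum>d\<in>{1..N}. t^N/(1 - t))"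
   unfolding sum_negf[symmetric]
  proof (intro sum_mono)
   fix d assume d: "d \<in> {1..N}"
   have td: "t^d <= t" using t d power_decreasing[of 1 d t] by simp
   have "N = d*(N div d) + N mod d" by simp
   moreover have "N mod d < d" using d by simp
   ultimately have "N <= d*(N div d + 1)" unfolding distrib_left mult_1_right by linarith
   hence "t^(d*(N div d + 1)) <= t^N" using t by (intro power_decreasing) auto
   hence b: "t^(d*(N div d + 1))/(1 - t^d) <= t^N/(1 - t)" using td t by (intro frac_le) auto
   have "0 <= t^(d*(N div d + 1))/(1 - t^d)" using td t by simp
   hence "\<bar>chi d*(t^(d*(N div d + 1))/(1 - t^d))\<bar> <= 1*(t^(d*(N div d + 1))/(1 - t^d))"
   proof -
    have "\<bar>x*y\<bar> <= 1*y" if "\<bar>x\<bar> <= 1" "0 <= y" for x y :: real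
     using that by (simp add: abs_mult mult_left_le_one_le)
    thus ?thesis using chi_abs_le[of d] \<open>0 <= _\<close> by blast
   qed
   thus "- (chi d*(t^(d*(N div d + 1))/(1 - t^d))) <= t^N/(1 - t)" using b by linarith
  qed
  thus ?thesis by linarith
 qed
 finally show ?thesis by simp
qed

lemma chi_abel:
 assumes "!!n. a <= n ==> f (Suc n) <= f n" "!!n. a <= n ==> 0 <= f n"
 shows "\<bar>\<Sum>n\<in>{a..<b}. chi n*f n\<bar> <= 2*real q*f a"
 using assms by (intro abel_bound[where c = chi and K = "2*real q" and f = f] chi_sum_interval)

lemma chi_harmonic_tail: "a >= 1 ==> \<bar>\<Sum>n\<in>{a..<b}. chi n/real n\<bar> <= 2*real q/real a"
 using chi_abel[of a "%n. 1/real n" b] by (simp add: frac_le)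

lemma chi_harmonic_convergent: "convergent (%N. \<Sum>n\<in>{1..<N}. chi n/real n)"
proof (rule Cauchy_convergent, rule metric_CauchyI)
 fix e :: real assume e: "e > 0"
 obtain a where a: "2*real q/e < real a" using reals_Archimedean2 by blast
 have "0 <= 2*real q/e" using e by simp
 hence a0: "a >= 1" using a by (cases a) simp_all
 have ae: "2*real q/real a < e" using a a0 e by (simp add: field_simps)
 have "dist (\<Sum>n\<in>{1..<m}. chi n/real n) (\<Sum>n\<in>{1..<k}. chi n/real n) < e" if "a <= m" "m <= k" for m k
 proof -
  have "(\<Sum>n\<in>{1..<k}. chi n/real n) - (\<Sum>n\<in>{1..<m}. chi n/real n) = (\<Sum>n\<in>{m..<k}. chi n/real n)"
   using that a0 by (intro sum_diff_nat_ivl) auto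
  hence "dist (\<Sum>n\<in>{1..<m}. chi n/real n) (\<Sum>n\<in>{1..<k}. chi n/real n) = \<bar>\<Sum>n\<in>{m..<k}. chi n/real n\<bar>"
   by (simp add: dist_real_def abs_minus_commute)
  also have "... <= 2*real q/real m" using that a0 by (intro chi_harmonic_tail) auto
  also have "... <= 2*real q/real a" using that a0 by (intro divide_left_mono) auto
  finally show ?thesis using ae by simp
 qed
 thus "\<exists>M. \<forall>m\<ge>M. \<forall>n\<ge>M. dist (\<Sum>n\<in>{1..<m}. chi n/real n) (\<Sum>n\<in>{1..<n}. chi n/real n) < e"
  by (metis dist_commute nle_le)
qed

definition L1 :: real where "L1 = lim (%N. \<Sum>n\<in>{1..<N}. chi n/real n)"

lemma L1_tendsto: "(%N. \<Sum>n\<in>{1..<N}. chi n/real n) \<longlonglongrightarrow> L1"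
 unfolding L1_def using chi_harmonic_convergent convergent_LIMSEQ_iff by blast

lemma L1_error: "\<bar>L1 - (\<Sum>n\<in>{1..<N}. chi n/real n)\<bar> <= 2*real q/real N" if N: "N >= 1"
proof -
 have "(%K. \<bar>(\<Sum>n\<in>{1..<K}. chi n/real n) - (\<Sum>n\<in>{1..<N}. chi n/real n)\<bar>) \<longlonglongrightarrow> \<bar>L1 - (\<Sum>n\<in>{1..<N}. chi n/real n)\<bar>"
  by (intro tendsto_intros L1_tendsto)
 moreover have "eventually (%K. \<bar>(\<Sum>n\<in>{1..<K}. chi n/real n) - (\<Sum>n\<in>{1..<N}. chi n/real n)\<bar> <= 2*real q/real N) sequentially"
  using eventually_ge_at_top[of N]
 proof eventually_elim
  case (elim K)
  thus ?case using chi_harmonic_tail[OF N, of K] sum_diff_nat_ivl[of 1 N K "%n. chi n/real n"] N by simp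
 qed
 ultimately show ?thesis by (rule tendsto_upperbound) simp
qed

text \<open>If L(1, chi) vanished, the partial sums of chi d/d would be O(1/N), so the harmonic part
  would disappear as N grows, in spite of its factor 1/(1 - t). The rest is bounded by summation by
  parts.\<close>

lemma lambert_combination:
 assumes s: "0 < s" "s < 1" and t: "t = s^2" and L: "L1 = 0"
 shows "\<bar>\<Sum>d\<in>{1..N}. chi d*(t^d/(1 - t^d))\<bar> <= 2*real q + 2*real q/(real (Suc N)*(1 - t))"
proof -
 have t01: "0 < t" "t < 1" using s by (auto simp: t power_less_one_iff)
 have iv: "{1..N} = {1..<Suc N}" by auto
 have e1: "(\<Sum>d\<in>{1..N}. chi d*(t^d/(1 - t^d))) = (\<Sum>d\<in>{1..<Suc N}. chi d/real d)/(1 - t) - (\<Sum>d\<in>{1..<Suc N}. chi d*lambert t d)"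
  unfolding iv sum_divide_distrib sum_subtractf[symmetric] lambert_def
  by (intro sum.cong refl) (simp add: algebra_simps)
 have e2: "\<bar>\<Sum>d\<in>{1..<Suc N}. chi d*lambert t d\<bar> <= 2*real q*lambert t 1"
  unfolding t by (intro chi_abel lambert_mono s) auto
 have e3: "lambert t 1 = 1" using t01 by (simp add: lambert_def flip: diff_divide_distrib)
 have e4: "\<bar>(\<Sum>d\<in>{1..<Suc N}. chi d/real d)/(1 - t)\<bar> <= 2*real q/(real (Suc N)*(1 - t))"
 proof -
  have "\<bar>\<Sum>d\<in>{1..<Suc N}. chi d/real d\<bar> <= 2*real q/real (Suc N)" using L1_error[of "Suc N"] L by simp
  hence "\<bar>\<Sum>d\<in>{1..<Suc N}. chi d/real d\<bar>/(1 - t) <= 2*real q/real (Suc N)/(1 - t)"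
   using t01 by (intro divide_right_mono) auto
  thus ?thesis using t01 by (simp add: abs_divide)
 qed
 show ?thesis unfolding e1 using e2[unfolded e3] e4 by linarith
qed

text \<open>Non-vanishing after Monsky: if \<open>L(1, chi)\<close> were zero, the Lambert series of \<open>chi\<close> would stay bounded
 near 1, whereas its coefficients are at least 1 on the squares.\<close>
lemma L1_nonzero: "L1 ~= 0"
proof
 assume L: "L1 = 0"
 \<comment> \<open>As s tends to 1, the sum over squares tends to M, which exceeds the bound
   2*q.\<close>
 define M where "M = 2*q + 1"
 have bound: "(\<Sum>m\<in>{1..M}. (s^2)^(m^2)) <= 2*real q" if s: "0 < s" "s < 1" for s :: real
 proof -
  define t where "t = s^2"
  have t01: "0 < t" "t < 1" using s by (auto simp: t_def power_less_one_iff)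
  have "(%N. 2*real q + 2*real q/(real (Suc N)*(1 - t)) + real N*t^N/(1 - t)) \<longlonglongrightarrow> 2*real q + 0 + 0/(1 - t)"
  proof (intro tendsto_intros)
   show "(%N. 2*real q/(real (Suc N)*(1 - t))) \<longlonglongrightarrow> 0"
    using t01 by real_asymp
   show "(%N. real N*t^N) \<longlonglongrightarrow> 0"
    using t01 by (intro powser_times_n_limit_0) auto
  qed (use t01 in auto)
  moreover have "eventually (%N. (\<Sum>m\<in>{1..M}. t^(m^2)) <= 2*real q + 2*real q/(real (Suc N)*(1 - t)) + real N*t^N/(1 - t)) sequentially"
   using eventually_ge_at_top[of "M^2"]
  proof eventually_elim
   case (elim N)
   show ?case using div_sum_lambert_lower[OF t01 elim] lambert_combination[OF s t_def L, of N] by linarith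
  qed
  ultimately show ?thesis unfolding t_def[symmetric] by (intro tendsto_lowerbound) auto
 qed
 have "((%s. \<Sum>m\<in>{1..M}. (s^2)^(m^2)) \<longlongrightarrow> (\<Sum>m\<in>{1..M}. (1^2)^(m^2))) (at_left (1::real))"
  by (intro tendsto_intros)
 moreover have "eventually (%s::real. (\<Sum>m\<in>{1..M}. (s^2)^(m^2)) <= 2*real q) (at_left 1)"
  by (rule eventually_mono[OF eventually_at_left_real[of 0 1]]) (use bound in simp_all)
 ultimately have "(\<Sum>m\<in>{1..M}. (1^2)^(m^2)) <= 2*real q"
  by (rule tendsto_upperbound) auto
 thus False by (simp add: M_def)
qed

lemma chi_log_sum_bounded: "\<exists>C. \<forall>N. \<bar>\<Sum>n\<in>{1..N}. chi n*ln (real n)/real n\<bar> <= C"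
proof -
 \<comment> \<open>The function ln x / x decreases only from e on, hence the separate treatment of n
   < 3.\<close>
 have dec: "ln (real (Suc n))/real (Suc n) <= ln (real n)/real n" if "3 <= n" for n
 proof -
  have "exp 1 <= real n" using that exp_le by (meson numeral_le_real_of_nat_iff order_trans)
  thus ?thesis using ln_x_over_x_mono[of "real n" "real (Suc n)"] by simp
 qed
 define C0 where "C0 = (\<Sum>n\<in>{1..<3}. \<bar>chi n*ln (real n)/real n\<bar>) + 2*real q*(ln 3/3)"
 have "\<bar>\<Sum>n\<in>{1..N}. chi n*ln (real n)/real n\<bar> <= C0" for N
 proof (cases "N >= 3")
  case True
  have "(\<Sum>n\<in>{1..N}. chi n*ln (real n)/real n) = (\<Sum>n\<in>{1..<3}. chi n*ln (real n)/real n) + (\<Sum>n\<in>{3..<Suc N}. chi n*(ln (real n)/real n))"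
   using True sum.atLeastLessThan_concat[of 1 3 "Suc N" "%n. chi n*ln (real n)/real n"]
   by (simp add: atLeastLessThanSuc_atLeastAtMost)
  moreover have "\<bar>\<Sum>n\<in>{3..<Suc N}. chi n*(ln (real n)/real n)\<bar> <= 2*real q*(ln (real 3)/real 3)"
   by (rule chi_abel) (use dec in auto)
  moreover have "\<bar>\<Sum>n\<in>{1..<3}. chi n*ln (real n)/real n\<bar> <= (\<Sum>n\<in>{1..<3}. \<bar>chi n*ln (real n)/real n\<bar>)"
   by (rule sum_abs)
  ultimately show ?thesis by (simp add: C0_def)
 next
  case False
  have "\<bar>\<Sum>n\<in>{1..N}. chi n*ln (real n)/real n\<bar> <= (\<Sum>n\<in>{1..N}. \<bar>chi n*ln (real n)/real n\<bar>)" by (rule sum_abs)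
  also have "... <= (\<Sum>n\<in>{1..<3}. \<bar>chi n*ln (real n)/real n\<bar>)" using False by (intro sum_mono2) auto
  finally show ?thesis by (simp add: C0_def add_increasing2)
 qed
 thus ?thesis by blast
qed

text \<open>The product of chi and the logarithm is the convolution of the product of chi and the
  von Mangoldt function with chi. The inner sum of chi e/e up to N div d is L(1, chi) up to 2*q*d/N;
  these errors add up to at most 2*q*psi N/N <= 8*q. Division by the nonzero L(1, chi) ends the
  proof.\<close>

lemma chi_mangoldt_bounded: "\<exists>C. \<forall>N. \<bar>\<Sum>n\<in>{1..N}. chi n*mangoldt n/real n\<bar> <= C"
proof -
 obtain C where C: "!!N. \<bar>\<Sum>n\<in>{1..N}. chi n*ln (real n)/real n\<bar> <= C" using chi_log_sum_bounded by blast
 have "\<bar>\<Sum>n\<in>{1..N}. chi n*mangoldt n/real n\<bar> <= (C + 8*real q)/\<bar>L1\<bar>" for N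
 proof (cases "N = 0")
  case False
  have "(\<Sum>n\<in>{1..N}. chi n*ln (real n)/real n) = (\<Sum>n\<in>{1..N}. \<Sum>d | d dvd n. (chi d*mangoldt d/real d)*(chi (n div d)/real (n div d)))"
  proof (intro sum.cong refl)
   fix n assume n: "n \<in> {1..N}"
   have "chi n*ln (real n)/real n = (\<Sum>d | d dvd n. chi n*mangoldt d/real n)"
    using mangoldt_sum[of n, where ?'a = real] n by (simp flip: sum_distrib_left sum_divide_distrib)
   also have "... = (\<Sum>d | d dvd n. (chi d*mangoldt d/real d)*(chi (n div d)/real (n div d)))"
   proof (intro sum.cong refl)
    fix d assume "d \<in> {d. d dvd n}"
    then obtain e where e: "n = d*e" by auto
    thus "chi n*mangoldt d/real n = (chi d*mangoldt d/real d)*(chi (n div d)/real (n div d))"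
     using n by (cases "d = 0") (auto simp: chi_mult)
   qed
   finally show "chi n*ln (real n)/real n = (\<Sum>d | d dvd n. (chi d*mangoldt d/real d)*(chi (n div d)/real (n div d)))" .
  qed
  also have "... = (\<Sum>d\<in>{1..N}. \<Sum>e\<in>{1..N div d}. (chi d*mangoldt d/real d)*(chi e/real e))"
   by (rule sum_divisors_swap)
  also have "... = (\<Sum>d\<in>{1..N}. (chi d*mangoldt d/real d)*(\<Sum>e\<in>{1..<Suc (N div d)}. chi e/real e))"
   by (simp only: sum_distrib_left[symmetric] atLeastLessThanSuc_atLeastAtMost)
  finally have eq: "(\<Sum>n\<in>{1..N}. chi n*ln (real n)/real n) = (\<Sum>d\<in>{1..N}. (chi d*mangoldt d/real d)*(\<Sum>e\<in>{1..<Suc (N div d)}. chi e/real e))" .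
  have "\<bar>L1*(\<Sum>n\<in>{1..N}. chi n*mangoldt n/real n) - (\<Sum>n\<in>{1..N}. chi n*ln (real n)/real n)\<bar>
   = \<bar>\<Sum>d\<in>{1..N}. (chi d*mangoldt d/real d)*(L1 - (\<Sum>e\<in>{1..<Suc (N div d)}. chi e/real e))\<bar>"
   unfolding eq right_diff_distrib sum_subtractf by (simp add: sum_distrib_left mult.commute)
  also have "... <= (\<Sum>d\<in>{1..N}. mangoldt d/real d*(2*real q*real d/real N))"
  proof (rule order_trans[OF sum_abs sum_mono])
   fix d assume d: "d \<in> {1..N}"
   have "N = d*(N div d) + N mod d" "N mod d < d" using d by auto
   hence "N <= d*Suc (N div d)" unfolding mult_Suc_right by linarith
   hence "real N <= real d*real (Suc (N div d))" by (metis of_nat_mono of_nat_mult)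
   hence "2*real q/real (Suc (N div d)) <= 2*real q*real d/real N"
   proof -
    have pos: "0 < real (Suc (N div d))" "0 < real N" using False by simp_all
    have "2*real q*real N <= 2*real q*(real d*real (Suc (N div d)))"
     using \<open>real N <= real d * real (Suc (N div d))\<close> by (intro mult_left_mono) auto
    thus ?thesis unfolding pos_divide_le_eq[OF pos(1)] times_divide_eq_left pos_le_divide_eq[OF pos(2)]
     by (simp only: mult.assoc)
   qed
   hence "\<bar>L1 - (\<Sum>e\<in>{1..<Suc (N div d)}. chi e/real e)\<bar> <= 2*real q*real d/real N"
    using L1_error[of "Suc (N div d)"] by simp
   moreover have "\<bar>chi d*mangoldt d/real d\<bar> <= mangoldt d/real d"
    using mult_right_mono[OF chi_abs_le mangoldt_nonneg, of d d] by (simp add: abs_mult divide_right_mono)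
   ultimately show "\<bar>(chi d*mangoldt d/real d)*(L1 - (\<Sum>e\<in>{1..<Suc (N div d)}. chi e/real e))\<bar>
     <= mangoldt d/real d*(2*real q*real d/real N)"
    unfolding abs_mult[of "chi d*mangoldt d/real d"] by (intro mult_mono) (auto intro: mangoldt_nonneg divide_nonneg_nonneg)
  qed
  also have "... = (\<Sum>d\<in>{1..N}. 2*real q/real N*mangoldt d)"
   by (intro sum.cong refl) simp
  also have "... = 2*real q/real N*psi N" by (simp only: psi_def sum_distrib_left)
  also have "... <= 2*real q/real N*(4*real N)" by (intro mult_left_mono psi_le) auto
  also have "... = 8*real q" using False by simp
  finally have "\<bar>L1\<bar>*\<bar>\<Sum>n\<in>{1..N}. chi n*mangoldt n/real n\<bar> <= C + 8*real q"
   using C[of N] unfolding abs_mult[symmetric] by linarith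
  thus ?thesis using L1_nonzero by (simp add: field_simps)
 qed (use C[of 0] in simp)
 thus ?thesis by blast
qed

end

lemma sum_powers_le: "0 <= x ==> x <= 1/2 ==> (\<Sum>j\<in>{2..N}. x^j) <= 2*(x::real)^2"
proof -
 assume x: "0 <= x" "x <= 1/2"
 have "(\<Sum>j\<in>{2..Suc N}. x^j) <= 2*x^2 - 2*x^(N + 2)" for N
 proof (induction N)
  case (Suc N)
  have "2*x^(Suc N + 2) <= x^(N + 2)"
   using mult_right_mono[of "2*x" 1 "x^(N + 2)"] x by simp
  moreover have "(\<Sum>j\<in>{2..Suc (Suc N)}. x^j) = (\<Sum>j\<in>{2..Suc N}. x^j) + x^(N + 2)" by simp
  ultimately show ?case using Suc by linarith
 qed (simp add: power2_eq_square)
 moreover have "0 <= x^(N + 2)" for N using x by simp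
 ultimately have "(\<Sum>j\<in>{2..Suc N}. x^j) <= 2*x^2" for N by (smt (verit))
 thus ?thesis using x by (cases N) auto
qed

text \<open>The powers of p with exponent at least 2 contribute at most 2*ln p/p^2, a convergent
  sum.\<close>

lemma nonprime_mangoldt_sum_bounded:
 "\<exists>C. \<forall>N. (\<Sum>n\<in>{n\<in>{1..N}. ~ prime n}. mangoldt n/real n) <= C"
proof -
 have sm: "summable (%n. ln (real n)/(real n)^2)"
 proof (rule summable_comparison_test_bigo)
  show "summable (%n. norm (real n powr (- 3/2)))" by (simp add: summable_real_powr_iff)
  show "(%n. ln (real n)/(real n)^2) \<in> O(%n. real n powr (- 3/2))" by real_asymp
 qed
 have "(\<Sum>n\<in>{n\<in>{1..N}. ~ prime n}. mangoldt n/real n) <= 2*(\<Sum>n. ln (real n)/(real n)^2)" for N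
 proof -
  let ?P = "{p\<in>{1..N}. prime p}"
  have "(\<Sum>n\<in>{n\<in>{1..N}. ~ prime n}. mangoldt n/real n) = (\<Sum>n\<in>{n\<in>{1..N}. ~ prime n & primepow n}. mangoldt n/real n)"
   by (rule sum.mono_neutral_right) (auto simp: mangoldt_def)
  also have "... <= (\<Sum>n\<in>(%(p, j). p^j) ` (?P \<times> {2..N}). mangoldt n/real n)"
  proof (rule sum_mono2)
   show "{n\<in>{1..N}. ~ prime n & primepow n} <= (%(p, j). p^j) ` (?P \<times> {2..N})"
   proof clarify
    fix n assume n: "n \<in> {1..N}" "~ prime n" "primepow n"
    then obtain p k where pk: "prime p" "k > 0" "n = p^k" by (auto simp: primepow_def)
    hence "k ~= 1" using n(2) by auto
    hence k2: "2 <= k" using pk(2) by simp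
    have "p^1 <= p^k" using k2 prime_gt_0_nat[OF pk(1)] by (intro power_increasing) auto
    hence pN: "p <= N" using pk(3) n(1) by simp
    have "k < 2^k" by (rule less_exp)
    also have "2^k <= p^k" by (rule power_mono[OF prime_ge_2_nat[OF pk(1)]]) simp
    finally have "k <= N" using pk(3) n(1) by simp
    hence "(p, k) \<in> ?P \<times> {2..N}" using pN k2 pk(1) prime_gt_0_nat[OF pk(1)] by simp
    thus "n \<in> (%(p, j). p^j) ` (?P \<times> {2..N})" unfolding pk(3) by (intro image_eqI[of _ _ "(p, k)"]) simp_all
   qed
  qed (auto intro: divide_nonneg_nonneg mangoldt_nonneg)
  also have "... <= (\<Sum>x\<in>?P \<times> {2..N}. ((%n. mangoldt n/real n) \<circ> (%(p, j). p^j)) x)"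
   by (rule sum_image_le) (auto intro: divide_nonneg_nonneg mangoldt_nonneg)
  also have "... = (\<Sum>p\<in>?P. \<Sum>j\<in>{2..N}. ln (real p)*(1/real p)^j)"
   unfolding sum.cartesian_product by (intro sum.cong refl) (auto simp: power_one_over)
  also have "... <= (\<Sum>p\<in>?P. 2*(ln (real p)/(real p)^2))"
  proof (rule sum_mono)
   fix p assume p: "p \<in> ?P"
   hence p2: "2 <= real p" using prime_ge_2_nat[of p] by simp
   have "(\<Sum>j\<in>{2..N}. (1/real p)^j) <= 2*(1/real p)^2" using p2 by (intro sum_powers_le) (auto simp: field_simps)
   hence "ln (real p)*(\<Sum>j\<in>{2..N}. (1/real p)^j) <= ln (real p)*(2*(1/real p)^2)"
    using p2 by (intro mult_left_mono) auto
   thus "(\<Sum>j\<in>{2..N}. ln (real p)*(1/real p)^j) <= 2*(ln (real p)/(real p)^2)"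
    unfolding sum_distrib_left by (simp add: power_one_over mult.commute)
  qed
  also have "... = 2*(\<Sum>p\<in>?P. ln (real p)/(real p)^2)" by (rule sum_distrib_left[symmetric])
  also have "(\<Sum>p\<in>?P. ln (real p)/(real p)^2) <= (\<Sum>n. ln (real n)/(real n)^2)"
  proof (rule sum_le_suminf[OF sm])
   show "0 <= ln (real n)/(real n)^2" for n by (cases "n = 0") auto
  qed simp
  finally show ?thesis by simp
 qed
 thus ?thesis by blast
qed

context real_char begin

text \<open>Uniformity in b matters: beyond a large a the sum over any interval is small, which
  later reduces a sum of chi over products of large primes to its first term. Prime powers are
  removed from the von Mangoldt sum, and summation by parts against 1/ln n does the rest.\<close>

lemma chi_prime_sum: "\<exists>C\<ge>0. \<forall>a b. a >= 2 --> \<bar>\<Sum>p\<in>{p\<in>{a<..b}. prime p}. chi p/real p\<bar> <= C/ln (real a)"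
proof -
 obtain C1 where C1: "!!N. \<bar>\<Sum>n\<in>{1..N}. chi n*mangoldt n/real n\<bar> <= C1" using chi_mangoldt_bounded by blast
 obtain C2 where C2: "!!N. (\<Sum>n\<in>{n\<in>{1..N}. ~ prime n}. mangoldt n/real n) <= C2" using nonprime_mangoldt_sum_bounded by blast
 define c where "c = (%n. if prime n then chi n*ln (real n)/real n else 0)"
 have S: "\<bar>\<Sum>n\<in>{1..N}. c n\<bar> <= C1 + C2" for N
 proof -
  have "(\<Sum>n\<in>{1..N}. chi n*mangoldt n/real n) = (\<Sum>n\<in>{1..N}. c n + (if prime n then 0 else chi n*mangoldt n/real n))"
   by (intro sum.cong refl) (auto simp: c_def)
  also have "... = (\<Sum>n\<in>{1..N}. c n) + (\<Sum>n\<in>{1..N}. if prime n then 0 else chi n*mangoldt n/real n)"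
   by (rule sum.distrib)
  finally have e: "(\<Sum>n\<in>{1..N}. chi n*mangoldt n/real n) = (\<Sum>n\<in>{1..N}. c n) + (\<Sum>n\<in>{1..N}. if prime n then 0 else chi n*mangoldt n/real n)" .
  have "\<bar>\<Sum>n\<in>{1..N}. if prime n then 0 else chi n*mangoldt n/real n\<bar> <= (\<Sum>n\<in>{1..N}. if ~ prime n then mangoldt n/real n else 0)"
  proof (rule order_trans[OF sum_abs sum_mono])
   fix n
   have "\<bar>chi n*mangoldt n/real n\<bar> <= 1*mangoldt n/real n"
    using mult_right_mono[OF chi_abs_le mangoldt_nonneg, of n n] by (simp add: abs_mult divide_right_mono)
   thus "\<bar>if prime n then 0 else chi n*mangoldt n/real n\<bar> <= (if ~ prime n then mangoldt n/real n else 0)" by simp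
  qed
  also have "... = (\<Sum>n\<in>{n\<in>{1..N}. ~ prime n}. mangoldt n/real n)"
   by (rule sum.inter_filter[symmetric]) simp
  finally show ?thesis using C1[of N] C2[of N] e by linarith
 qed
 define C where "C = 2*(C1 + C2)"
 have C0: "0 <= C" using S[of 0] by (simp add: C_def)
 have "\<bar>\<Sum>p\<in>{p\<in>{a<..b}. prime p}. chi p/real p\<bar> <= C/ln (real a)" if a: "a >= 2" for a b
 proof -
  have la: "0 < ln (real a)" using a by simp
  have part: "\<bar>\<Sum>n\<in>{Suc a..<m}. c n\<bar> <= C" for m
  proof (cases "Suc a <= m")
   case True
   have "(\<Sum>n\<in>{Suc a..<m}. c n) = (\<Sum>n\<in>{1..<m}. c n) - (\<Sum>n\<in>{1..<Suc a}. c n)"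
    using sum_diff_nat_ivl[of 1 "Suc a" m c] True by simp
   moreover have "{1..<m} = {1..m - 1}" "{1..<Suc a} = {1..a}" using True by auto
   ultimately have e: "(\<Sum>n\<in>{Suc a..<m}. c n) = (\<Sum>n\<in>{1..m - 1}. c n) - (\<Sum>n\<in>{1..a}. c n)" by (simp only:)
   show ?thesis unfolding e C_def
   proof -
    have "\<bar>x - y\<bar> <= 2*K" if "\<bar>x\<bar> <= K" "\<bar>y\<bar> <= K" for x y K :: real
     using that by linarith
    thus "\<bar>(\<Sum>n\<in>{1..m - 1}. c n) - (\<Sum>n\<in>{1..a}. c n)\<bar> <= 2*(C1 + C2)" using S by blast
   qed
  qed (simp add: C0)
  have "(\<Sum>p\<in>{p\<in>{a<..b}. prime p}. chi p/real p) = (\<Sum>n\<in>{a<..b}. if prime n then chi n/real n else 0)"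
   by (rule sum.inter_filter) simp
  also have "... = (\<Sum>n\<in>{Suc a..<Suc b}. c n*(1/ln (real n)))"
  proof (rule sum.cong)
   fix n assume "n \<in> {Suc a..<Suc b}"
   hence "ln (real n) ~= 0" using a by (simp add: ln_eq_zero_iff)
   thus "(if prime n then chi n/real n else 0) = c n*(1/ln (real n))" by (simp add: c_def)
  qed auto
  also have "\<bar>...\<bar> <= C*(1/ln (real (Suc a)))"
  proof (rule abel_bound[OF part])
   fix n assume "Suc a <= n"
   hence "0 < ln (real n)" "ln (real n) <= ln (real (Suc n))" using a by simp_all
   thus "1/ln (real (Suc n)) <= 1/ln (real n)" "0 <= 1/ln (real n)" by (auto intro: frac_le)
  qed
  also have "... <= C*(1/ln (real a))"
   using la C0 a by (intro mult_left_mono frac_le) auto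
  finally show ?thesis by simp
 qed
 thus ?thesis using C0 by blast
qed

end

section \<open>Points on conics modulo primes\<close>

definition quad :: "int => int => int => int" where "quad D u v = u^2 + D * v^2"

lemma quad_mult: "quad D (a*u - D*b * v) (b*u + a * v) = quad D a b*quad D u v"
 by (simp add: quad_def power2_eq_square algebra_simps)

lemma quad_cong: "[u = u'] (mod n) ==> [v = v'] (mod n) ==> [quad D u v = quad D u' v'] (mod n)"
 unfolding quad_def by (intro cong_add cong_mult cong_pow cong_refl)

lemma dvd_quad_mod: "n dvd quad D (u mod n) (v mod n) - c \<longleftrightarrow> n dvd quad D u v - c"
proof -
 have "[quad D (u mod n) (v mod n) = quad D u v] (mod n)" by (intro quad_cong) (simp_all add: cong_def)
 thus ?thesis unfolding cong_iff_dvd_diff[symmetric] by (simp add: cong_def)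
qed

lemma dvd_plus_left: "(n::int) dvd x ==> n dvd y ==> z = x * s + y*t ==> n dvd z"
 by simp

lemma small_multiple_eq_0: "(n::int) dvd x ==> \<bar>x\<bar> < n ==> x = 0"
 using zdvd_not_zless[of "\<bar>x\<bar>" n] by (cases "x = 0") simp_all

lemma residue_eq:
 assumes "s \<in> {0..<n}" "t \<in> {0..<n}" "(n::int) dvd s - t" shows "s = t"
proof -
 have "\<bar>s - t\<bar> < n" using assms(1,2) by (simp add: abs_less_iff)
 thus ?thesis using small_multiple_eq_0[OF assms(3)] by simp
qed

lemma finite_residue_filter: "finite {u\<in>{0..<int n}. P u}"
 by (rule finite_subset[of _ "{0..<int n}"]) auto

lemma card_quadratic_roots:
 fixes a b c :: int
 assumes p: "prime p" and nz: "~ (int p dvd a & int p dvd b & int p dvd c)"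
 shows "card {x\<in>{0..<int p}. int p dvd a*x^2 + b*x + c} <= 2"
proof (rule ccontr)
 let ?A = "{x\<in>{0..<int p}. int p dvd a*x^2 + b*x + c}"
 have pp: "prime (int p)" using p by simp
 assume "~ card ?A <= 2"
 hence "3 <= card ?A" by simp
 then obtain T where T: "T <= ?A" "card T = 3" "finite T" by (rule obtain_subset_with_card_n)
 then obtain x y z where xyz: "T = {x, y, z}" "x ~= y" "x ~= z" "y ~= z" by (auto simp: card_3_iff)
 have ndvd: "~ int p dvd s - t" if "s \<in> ?A" "t \<in> ?A" "s ~= t" for s t
  using residue_eq[of s "int p" t] that by auto
 have step: "int p dvd a*(s + t) + b" if "s \<in> ?A" "t \<in> ?A" "s ~= t" for s t
 proof -
  have "int p dvd (a * s^2 + b * s + c) - (a*t^2 + b*t + c)" using that by (intro dvd_diff) auto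
  also have "... = (s - t)*(a*(s + t) + b)" by (simp add: power2_eq_square algebra_simps)
  finally show ?thesis using prime_dvd_mult_iff[OF pp] ndvd[OF that] by blast
 qed
 have mem: "x \<in> ?A" "y \<in> ?A" "z \<in> ?A" using T xyz by auto
 have "int p dvd (a*(x + y) + b) - (a*(x + z) + b)"
  using step[OF mem(1,2) xyz(2)] step[OF mem(1,3) xyz(3)] by (rule dvd_diff)
 also have "... = a*(y - z)" by (simp add: algebra_simps)
 finally have a: "int p dvd a" using prime_dvd_mult_iff[OF pp] ndvd[OF mem(2,3) xyz(4)] by blast
 have "int p dvd a*(x + y)" using a by simp
 hence b: "int p dvd b" using step[OF mem(1,2) xyz(2)] by (simp add: dvd_add_right_iff)
 have "int p dvd a*x^2 + b*x" using a b by simp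
 hence "int p dvd c" using mem(1) by (simp add: dvd_add_right_iff)
 thus False using nz a b by blast
qed

definition conic_pts :: "int => int => nat => (int \<times> int) set" where
 "conic_pts D c n = {(u, v). u \<in> {0..<int n} & v \<in> {0..<int n} & int n dvd quad D u v - c}"

lemma finite_conic_pts [simp]: "finite (conic_pts D c n)"
 by (rule finite_subset[of _ "{0..<int n} \<times> {0..<int n}"]) (auto simp: conic_pts_def)

lemma conic_mod: "n > 0 ==> int n dvd quad D u v - c ==> (u mod int n, v mod int n) \<in> conic_pts D c n"
 by (simp add: conic_pts_def dvd_quad_mod)

locale conic_prime =
 fixes D :: int and p :: nat
 assumes p: "prime p" and p2: "p > 2" and pD: "~ int p dvd D"
begin

lemma pp: "prime (int p)" using p by simp
lemma p0: "p > 0" using p2 by simp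
lemma dvd_mult_cases: "int p dvd a*b ==> int p dvd a \<or> int p dvd b"
 using prime_dvd_mult_iff[OF pp] by blast
lemma not_dvd_2: "~ int p dvd 2" using p2 zdvd_not_zless[of 2 "int p"] by auto

text \<open>Multiplication by a + b*sqrt(-D) is invertible modulo p when its norm is; the two
  combinations used are the coordinates of the product with the conjugate.\<close>

lemma linear_injective:
 assumes "int p dvd a*x - D*b*y" "int p dvd b*x + a*y" "~ int p dvd quad D a b"
 shows "int p dvd x & int p dvd y"
proof -
 have "int p dvd quad D a b*x" "int p dvd quad D a b*y"
  by (rule dvd_plus_left[OF assms(1,2), of _ a "D*b"], simp add: quad_def power2_eq_square algebra_simps)
    (rule dvd_plus_left[OF assms(1,2), of _ "- b" a], simp add: quad_def power2_eq_square algebra_simps)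
 thus ?thesis using dvd_mult_cases assms(3) by blast
qed

text \<open>Pigeonhole: the squares and the values r - D*b^2, with arguments from 0 to (p - 1)/2,
  each fill more than half of the residues.\<close>

lemma quad_universal: "\<exists>a b. int p dvd quad D a b - r"
proof -
 define m where "m = (int p - 1) div 2"
 have m: "0 <= m" "2*m < int p" "int p <= 2*m + 2" using p2 by (auto simp: m_def)
 have m1: "2*(m + 1) > int p"
 proof -
  have "odd p" using p p2 prime_odd_nat by blast
  thus ?thesis using m by presburger
 qed
 have inj: "int p dvd s*(a^2 - b^2) ==> a = b" if "a \<in> {0..m}" "b \<in> {0..m}" "~ int p dvd s" for a b s
 proof -
  assume "int p dvd s*(a^2 - b^2)"
  hence "int p dvd a\<^sup>2 - b^2" using dvd_mult_cases that(3) by blast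
  hence "int p dvd (a - b)*(a + b)" by (simp add: power2_eq_square algebra_simps)
  hence "int p dvd a - b \<or> int p dvd a + b" by (rule dvd_mult_cases)
  moreover have "\<bar>a - b\<bar> < int p" "\<bar>a + b\<bar> < int p" using that m by auto
  ultimately have "a - b = 0 \<or> a + b = 0" using small_multiple_eq_0 by blast
  thus "a = b" using that by auto
 qed
 let ?f = "%a. a^2 mod int p" and ?g = "%b. (r - D*b^2) mod int p"
 have f: "inj_on ?f {0..m}"
 proof (rule inj_onI)
  fix a b assume ab: "a \<in> {0..m}" "b \<in> {0..m}" "?f a = ?f b"
  hence "int p dvd 1*(a^2 - b^2)" by (simp add: mod_eq_dvd_iff)
  thus "a = b" using inj[OF ab(1,2), of 1] p2 by auto
 qed
 have g: "inj_on ?g {0..m}"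
 proof (rule inj_onI)
  fix a b assume ab: "a \<in> {0..m}" "b \<in> {0..m}" "?g a = ?g b"
  hence "int p dvd (r - D*a^2) - (r - D*b^2)" by (simp only: mod_eq_dvd_iff)
  also have "... = (- D)*(a^2 - b^2)" by (simp add: algebra_simps)
  finally show "a = b" using inj[OF ab(1,2), of "- D"] pD by simp
 qed
 have "?f ` {0..m} \<inter> ?g ` {0..m} ~= {}"
 proof
  assume dis: "?f ` {0..m} \<inter> ?g ` {0..m} = {}"
  have "card (?f ` {0..m} \<union> ?g ` {0..m}) = card {0..m} + card {0..m}"
   using card_image[OF f] card_image[OF g] dis by (subst card_Un_disjoint) auto
  moreover have "card (?f ` {0..m} \<union> ?g ` {0..m}) <= card {0..<int p}"
   using p0 by (intro card_mono) auto
  ultimately show False using m1 m by simp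
 qed
 then obtain a b where "a^2 mod int p = (r - D*b^2) mod int p" by auto
 hence "int p dvd a\<^sup>2 - (r - D*b^2)" by (simp only: mod_eq_dvd_iff)
 thus ?thesis by (auto simp: quad_def algebra_simps)
qed

text \<open>Multiplication by an element of norm c/c', which exists by
  \<open>quad_universal\<close>, maps one conic injectively into the other; by symmetry all nonzero
  c have equally many points.\<close>

lemma card_conic_le:
 assumes c: "~ int p dvd c" and c': "~ int p dvd c'"
 shows "card (conic_pts D c' p) <= card (conic_pts D c p)"
proof -
 obtain i where i: "[c'*i = 1] (mod int p)"
  using cong_solve_coprime_int[of c' "int p"] prime_imp_coprime[OF pp c'] by (auto simp: coprime_commute)
 obtain a b where ab: "int p dvd quad D a b - c*i" using quad_universal by blast
 have rc: "[quad D a b * c' = c] (mod int p)"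
 proof -
  have "[quad D a b * c' = c*i * c'] (mod int p)" using ab by (intro cong_mult cong_refl) (simp add: cong_iff_dvd_diff)
  also have "c*i * c' = c*(c'*i)" by simp
  also have "[c*(c'*i) = c*1] (mod int p)" by (intro cong_mult cong_refl i)
  finally show ?thesis by simp
 qed
 have nq: "~ int p dvd quad D a b"
  using rc c by (metis cong_dvd_iff dvd_mult2)
 let ?T = "%(u, v). ((a*u - D*b * v) mod int p, (b*u + a * v) mod int p)"
 have "inj_on ?T (conic_pts D c' p)"
 proof (rule inj_onI, clarify)
  fix u v u' v'
  assume h: "(u, v) \<in> conic_pts D c' p" "(u', v') \<in> conic_pts D c' p"
   and e: "(a*u - D*b * v) mod int p = (a*u' - D*b * v') mod int p"
       "(b*u + a * v) mod int p = (b*u' + a * v') mod int p"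
  have "int p dvd a*(u - u') - D*b*(v - v')" "int p dvd b*(u - u') + a*(v - v')"
   using e by (simp_all add: mod_eq_dvd_iff algebra_simps)
  hence "int p dvd u - u'" "int p dvd v - v'" using linear_injective nq by blast+
  thus "u = u' & v = v'"
   using residue_eq[of u "int p" u'] residue_eq[of v "int p" v'] h by (auto simp: conic_pts_def)
 qed
 moreover have "?T ` conic_pts D c' p <= conic_pts D c p"
 proof clarify
  fix u v assume h: "(u, v) \<in> conic_pts D c' p"
  have "[quad D a b*quad D u v = quad D a b * c'] (mod int p)"
   using h by (intro cong_mult cong_refl) (simp add: conic_pts_def cong_iff_dvd_diff)
  hence "[quad D (a*u - D*b * v) (b*u + a * v) = c] (mod int p)"
   unfolding quad_mult using rc by (rule cong_trans)
  thus "((a*u - D*b * v) mod int p, (b*u + a * v) mod int p) \<in> conic_pts D c p"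
   by (intro conic_mod p0) (simp add: cong_iff_dvd_diff)
 qed
 ultimately show ?thesis by (intro card_inj_on_le[of ?T]) auto
qed

text \<open>For each nonzero v there are at most two u, and for v = 0 only u = 0. A nontrivial zero
  would make -D a square modulo p.\<close>

lemma card_conic_0: "1 <= card (conic_pts D 0 p)" "card (conic_pts D 0 p) <= 2*p - 1"
 and card_conic_0_inert: "(!!s. ~ int p dvd s\<^sup>2 + D) ==> card (conic_pts D 0 p) = 1"
proof -
 have z: "(0, 0) \<in> conic_pts D 0 p" using p0 by (simp add: conic_pts_def quad_def)
 thus "1 <= card (conic_pts D 0 p)" using card_gt_0_iff[of "conic_pts D 0 p"] by (simp add: Suc_le_eq) blast
 have v0: "u = 0" if "(u, 0) \<in> conic_pts D 0 p" for u
 proof -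
  have "int p dvd u*u" using that by (simp add: conic_pts_def quad_def power2_eq_square)
  hence "int p dvd u" using dvd_mult_cases by blast
  thus ?thesis using that residue_eq[of u "int p" 0] by (auto simp: conic_pts_def)
 qed
 have "conic_pts D 0 p <= {(0, 0)} \<union> (%(v, u). (u, v)) ` (SIGMA v:{1..<int p}. {u\<in>{0..<int p}. int p dvd 1*u^2 + 0*u + D * v^2})"
 proof clarify
  fix u v assume uv: "(u, v) \<in> conic_pts D 0 p" and n: "(u, v) \<notin> (%(v, u). (u, v)) ` (SIGMA v:{1..<int p}. {u\<in>{0..<int p}. int p dvd 1*u^2 + 0*u + D * v^2})"
  have "v = 0"
  proof (rule ccontr)
   assume "v ~= 0"
   hence "(v, u) \<in> (SIGMA v:{1..<int p}. {u\<in>{0..<int p}. int p dvd 1*u^2 + 0*u + D * v^2})"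
    using uv by (auto simp: conic_pts_def quad_def)
   thus False using n by (metis (no_types, lifting) case_prod_conv image_eqI)
  qed
  thus "u = 0 & v = 0" using v0 uv by auto
 qed
 hence "card (conic_pts D 0 p) <= card ({(0, 0)} \<union> (%(v, u). (u, v)) ` (SIGMA v:{1..<int p}. {u\<in>{0..<int p}. int p dvd 1*u^2 + 0*u + D * v^2}))"
  by (intro card_mono finite_UnI finite_imageI finite_SigmaI finite_residue_filter) auto
 also have "... <= 1 + card (SIGMA v:{1..<int p}. {u\<in>{0..<int p}. int p dvd 1*u^2 + 0*u + D * v^2})"
  by (intro order_trans[OF card_Un_le] add_mono card_image_le finite_SigmaI finite_residue_filter) auto
 also have "card (SIGMA v:{1..<int p}. {u\<in>{0..<int p}. int p dvd 1*u^2 + 0*u + D * v^2}) <= (\<Sum>v\<in>{1..<int p}. 2)"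
 proof -
  have "card (SIGMA v:{1..<int p}. {u\<in>{0..<int p}. int p dvd 1*u^2 + 0*u + D * v^2})
    = (\<Sum>v\<in>{1..<int p}. card {u\<in>{0..<int p}. int p dvd 1*u^2 + 0*u + D * v^2})"
   by (rule card_SigmaI, simp, rule ballI, rule finite_residue_filter)
  also have "... <= (\<Sum>v\<in>{1..<int p}. 2)"
   using p2 by (intro sum_mono card_quadratic_roots p) auto
  finally show ?thesis .
 qed
 also have "1 + (\<Sum>v\<in>{1..<int p}. 2) = 2*p - 1" using p2 by (simp add: nat_diff_distrib)
 finally show "card (conic_pts D 0 p) <= 2*p - 1" by simp
 assume inert: "!!s. ~ int p dvd s\<^sup>2 + D"
 have "conic_pts D 0 p <= {(0, 0)}"
 proof (rule subsetI)
  fix w assume "w \<in> conic_pts D 0 p"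
  then obtain u v where w: "w = (u, v)" and uv: "(u, v) \<in> conic_pts D 0 p" by (cases w) simp
  have "v = 0"
  proof (rule ccontr)
   assume "v ~= 0"
   hence "~ int p dvd v" using uv residue_eq[of v "int p" 0] by (auto simp: conic_pts_def)
   then obtain i where i: "[v * i = 1] (mod int p)"
    using cong_solve_coprime_int[of v "int p"] prime_imp_coprime[OF pp] by (auto simp: coprime_commute)
   have "int p dvd (u^2 + D * v^2)*i^2" using uv by (simp add: conic_pts_def quad_def)
   also have "(u^2 + D * v^2)*i^2 = (u*i)^2 + D*(v * i)^2" by (simp add: power_mult_distrib algebra_simps)
   finally have "[(u*i)^2 + D*(v * i)^2 = 0] (mod int p)" by (simp add: cong_0_iff)
   moreover have "[(u*i)^2 + D*(v * i)^2 = (u*i)^2 + D*1^2] (mod int p)"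
    by (intro cong_add cong_mult cong_pow cong_refl i)
   ultimately have "int p dvd (u*i)\<^sup>2 + D" by (simp add: cong_dvd_iff cong_0_iff)
   thus False using inert by blast
  qed
  thus "w \<in> {(0, 0)}" using uv v0 w by auto
 qed
 hence "conic_pts D 0 p = {(0, 0)}" using z by auto
 thus "card (conic_pts D 0 p) = 1" by simp
qed

lemma card_conic_total: "~ int p dvd c ==> p*p = card (conic_pts D 0 p) + (p - 1) * card (conic_pts D c p)"
proof -
 assume c: "~ int p dvd c"
 have "{0..<int p} \<times> {0..<int p} = (\<Union>r\<in>{0..<int p}. conic_pts D r p)"
 proof (intro equalityI subsetI)
  fix x assume "x \<in> {0..<int p} \<times> {0..<int p}"
  then obtain u v where x: "x = (u, v)" "u \<in> {0..<int p}" "v \<in> {0..<int p}" by auto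
  have "x \<in> conic_pts D (quad D u v mod int p) p" using x by (auto simp: conic_pts_def)
  moreover have "quad D u v mod int p \<in> {0..<int p}" using p0 by auto
  ultimately show "x \<in> (\<Union>r\<in>{0..<int p}. conic_pts D r p)" by blast
 qed (auto simp: conic_pts_def)
 moreover have "conic_pts D r p \<inter> conic_pts D s p = {}" if "r \<in> {0..<int p}" "s \<in> {0..<int p}" "r ~= s" for r s
 proof (rule ccontr)
  assume "conic_pts D r p \<inter> conic_pts D s p ~= {}"
  then obtain u v where "int p dvd quad D u v - r" "int p dvd quad D u v - s" by (auto simp: conic_pts_def)
  hence "int p dvd (quad D u v - s) - (quad D u v - r)" using dvd_diff by blast
  hence "int p dvd r - s" by simp
  thus False using that residue_eq by blast
 qed
 ultimately have "card ({0..<int p} \<times> {0..<int p}) = (\<Sum>r\<in>{0..<int p}. card (conic_pts D r p))"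
  by (simp only:) (rule card_UN_disjoint, auto)
 also have "... = card (conic_pts D 0 p) + (\<Sum>r\<in>{0..<int p} - {0}. card (conic_pts D r p))"
  using p0 by (intro sum.remove) auto
 also have "(\<Sum>r\<in>{0..<int p} - {0}. card (conic_pts D r p)) = (\<Sum>r\<in>{0..<int p} - {0}. card (conic_pts D c p))"
 proof (intro sum.cong refl antisym card_conic_le)
  show "~ int p dvd r" if "r \<in> {0..<int p} - {0}" for r
   using that residue_eq[of r "int p" 0] by auto
  thus "~ int p dvd r" if "r \<in> {0..<int p} - {0}" for r using that by blast
 qed (use c in auto)
 also have "... = (p - 1) * card (conic_pts D c p)"
  using p0 by (simp add: card_Diff_singleton)
 finally show ?thesis by (simp add: card_cartesian_product)
qed

text \<open>The p - 1 equinumerous conics with nonzero c, together with the 1 to 2*p - 1 zeros of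
  the form, fill the p^2 pairs.\<close>

lemma card_conic_bounds:
 assumes "~ int p dvd c" shows "p - 1 <= card (conic_pts D c p)" "card (conic_pts D c p) <= p + 1"
proof -
 let ?r = "card (conic_pts D c p)" and ?n = "card (conic_pts D 0 p)"
 note t = card_conic_total[OF assms] and n = card_conic_0
 obtain k where k: "p = Suc k" "k > 0" using p2 by (cases p) auto
 have "p*p = k * k + 2 * k + 1" "k*(p + 1) = k * k + 2 * k" "p - 1 = k" using k(1) by simp_all
 hence t': "k * k + 2 * k + 1 = ?n + k * ?r" using t by simp
 have "k * ?r <= k*(p + 1)" using t' n(1) \<open>k * (p + 1) = _\<close> by linarith
 thus "?r <= p + 1" by (rule iffD1[OF nat_mult_le_cancel1[OF k(2)]])
 have "k * k <= k * ?r" using t' n(2) k(1) by linarith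
 hence "k <= ?r" by (rule iffD1[OF nat_mult_le_cancel1[OF k(2)]])
 thus "p - 1 <= ?r" using k by simp
qed

text \<open>Subtracting the two equations puts the common points of the conic and its translate on a
  line, and a line meets the conic in at most two points. If x is a unit, u is eliminated, otherwise
  v; a quadratic congruence remains.\<close>

lemma card_chord:
 assumes c: "~ int p dvd c" and z: "~ (int p dvd x & int p dvd y)"
 shows "card {(u, v) \<in> conic_pts D c p. int p dvd quad D (u + x) (v + y) - c} <= 2"
proof -
 let ?A = "{(u, v) \<in> conic_pts D c p. int p dvd quad D (u + x) (v + y) - c}" and ?N = "quad D x y"
 have fin: "finite ?A" by (rule finite_subset[OF _ finite_conic_pts[of D c p]]) auto
 have base1: "int p dvd quad D u v - c" if "(u, v) \<in> ?A" for u v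
  using that by (simp add: conic_pts_def)
 have base2: "int p dvd 2*(x*u + D*y * v) + ?N" if "(u, v) \<in> ?A" for u v
 proof -
  have q: "int p dvd quad D (u + x) (v + y) - c" using that by simp
  have "int p dvd (quad D (u + x) (v + y) - c) - (quad D u v - c)" by (rule dvd_diff[OF q base1[OF that]])
  also have "... = 2*(x*u + D*y * v) + ?N" by (simp add: quad_def power2_eq_square algebra_simps)
  finally show ?thesis .
 qed
 have p4: "~ int p dvd 4" using not_dvd_2 dvd_mult_cases[of 2 2] by auto
 show ?thesis
 proof (cases "int p dvd x")
  case False
  let ?R = "{v\<in>{0..<int p}. int p dvd (4*D * ?N) * v^2 + (4*D*y * ?N) * v + (?N\<^sup>2 - 4*x^2 * c)}"
  have "inj_on snd ?A"
  proof (rule inj_onI, clarsimp)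
   fix u u' v assume h: "(u, v) \<in> conic_pts D c p" "(u', v) \<in> conic_pts D c p"
    "int p dvd quad D (u + x) (v + y) - c" "int p dvd quad D (u' + x) (v + y) - c"
   have "int p dvd (2*(x*u + D*y * v) + ?N) - (2*(x*u' + D*y * v) + ?N)"
    using h by (intro dvd_diff base2) auto
   also have "... = 2*(x*(u - u'))" by (simp add: algebra_simps)
   finally have "int p dvd u - u'" using dvd_mult_cases not_dvd_2 False by blast
   thus "u = u'" using h residue_eq[of u "int p" u'] by (auto simp: conic_pts_def)
  qed
  hence "card ?A = card (snd ` ?A)" by (rule card_image[symmetric])
  also have "... <= card ?R"
  proof (rule card_mono[OF finite_residue_filter], rule subsetI)
   fix w assume "w \<in> snd ` ?A"
   then obtain z where z: "w = snd z" "z \<in> ?A" by (rule imageE)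
   obtain u v where "z = (u, v)" by (cases z)
   hence w: "w = snd (u, v)" and uv: "(u, v) \<in> ?A" using z by simp_all
   hence h: "(u, v) \<in> conic_pts D c p" by simp
   have "int p dvd (4*D * ?N) * v^2 + (4*D*y * ?N) * v + (?N\<^sup>2 - 4*x^2 * c)"
    by (rule dvd_plus_left[OF base2[OF uv] base1[OF uv], of _ "?N + 2*D*y * v - 2*x*u" "4*x^2"])
      (simp add: quad_def power2_eq_square algebra_simps)
   moreover have "v \<in> {0..<int p}" using h by (simp add: conic_pts_def)
   ultimately show "w \<in> ?R" by (simp add: w)
  qed
  also have "card ?R <= 2"
  proof (rule card_quadratic_roots[OF p], rule notI, elim conjE)
   \<comment> \<open>If the leading and constant coefficients both vanish modulo p, so does
     \<open>quad D x y\<close>, and then also 4*x^2*c, which is a unit.\<close>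
   assume h: "int p dvd 4*D * ?N" "int p dvd ?N\<^sup>2 - 4*x^2 * c"
   have "int p dvd ?N" using h(1) dvd_mult_cases p4 pD by blast
   hence "int p dvd ?N\<^sup>2" by (simp add: power2_eq_square)
   hence "int p dvd 4*x^2 * c" using h(2) dvd_diff[of "int p" "?N\<^sup>2" "?N\<^sup>2 - 4*x^2 * c"] by simp
   hence "int p dvd 4*(x*x) * c" by (simp add: power2_eq_square)
   thus False using dvd_mult_cases p4 False c by blast
  qed
  finally show ?thesis .
 next
  case True
  hence y: "~ int p dvd y" using z by blast
  let ?R = "{u\<in>{0..<int p}. int p dvd (4 * ?N)*u^2 + (4*x * ?N)*u + (?N\<^sup>2 - 4*D*y^2 * c)}"
  have "inj_on fst ?A"
  proof (rule inj_onI, clarsimp)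
   fix u v v' assume h: "(u, v) \<in> conic_pts D c p" "(u, v') \<in> conic_pts D c p"
    "int p dvd quad D (u + x) (v + y) - c" "int p dvd quad D (u + x) (v' + y) - c"
   have "int p dvd (2*(x*u + D*y * v) + ?N) - (2*(x*u + D*y * v') + ?N)"
    using h by (intro dvd_diff base2) auto
   also have "... = 2*(D*(y*(v - v')))" by (simp add: algebra_simps)
   finally have "int p dvd v - v'" using dvd_mult_cases not_dvd_2 pD y by blast
   thus "v = v'" using h residue_eq[of v "int p" v'] by (auto simp: conic_pts_def)
  qed
  hence "card ?A = card (fst ` ?A)" by (rule card_image[symmetric])
  also have "... <= card ?R"
  proof (rule card_mono[OF finite_residue_filter], rule subsetI)
   fix w assume "w \<in> fst ` ?A"
   then obtain z where z: "w = fst z" "z \<in> ?A" by (rule imageE)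
   obtain u v where "z = (u, v)" by (cases z)
   hence w: "w = fst (u, v)" and uv: "(u, v) \<in> ?A" using z by simp_all
   hence h: "(u, v) \<in> conic_pts D c p" by simp
   have "int p dvd (4 * ?N)*u^2 + (4*x * ?N)*u + (?N\<^sup>2 - 4*D*y^2 * c)"
    by (rule dvd_plus_left[OF base2[OF uv] base1[OF uv], of _ "?N + 2*x*u - 2*D*y * v" "4*D*y^2"])
      (simp add: quad_def power2_eq_square algebra_simps)
   moreover have "u \<in> {0..<int p}" using h by (simp add: conic_pts_def)
   ultimately show "w \<in> ?R" by (simp add: w)
  qed
  also have "card ?R <= 2"
  proof (rule card_quadratic_roots[OF p], rule notI, elim conjE)
   assume h: "int p dvd 4 * ?N" "int p dvd ?N\<^sup>2 - 4*D*y^2 * c"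
   have "int p dvd ?N" using h(1) dvd_mult_cases p4 by blast
   hence "int p dvd ?N\<^sup>2" by (simp add: power2_eq_square)
   hence "int p dvd 4*D*y^2 * c" using h(2) dvd_diff[of "int p" "?N\<^sup>2" "?N\<^sup>2 - 4*D*y^2 * c"] by simp
   hence "int p dvd 4*D*(y*y) * c" by (simp add: power2_eq_square)
   thus False using dvd_mult_cases p4 pD y c by blast
  qed
  finally show ?thesis .
 qed
qed

lemma card_chord_0: "~ int p dvd c ==> card {(u, v) \<in> conic_pts D c p. int p dvd quad D (u + 0) (v + 0) - c} = card (conic_pts D c p)"
 by (intro arg_cong[of _ _ card]) (auto simp: conic_pts_def)

definition ind :: "int => int => int => real" where
 "ind c u v = of_bool (int p dvd quad D u v - c)"

lemma per_ind: "per p (ind c)"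
 by (simp add: per_def ind_def dvd_quad_mod)

lemma hat_ind_0: "hat p (ind c) 0 0 = of_nat (card (conic_pts D c p))"
proof -
 have "hat p (ind c) 0 0 = (\<Sum>(u, v)\<in>{0..<int p} \<times> {0..<int p}. of_bool (int p dvd quad D u v - c))"
  unfolding hat_def ind_def sum.cartesian_product by (intro sum.cong refl) auto
 also have "... = (\<Sum>x\<in>{x\<in>{0..<int p} \<times> {0..<int p}. case x of (u, v) => int p dvd quad D u v - c}. 1)"
  by (subst sum.inter_filter) (auto intro!: sum.cong simp: of_bool_def split: prod.splits)
 also have "{x\<in>{0..<int p} \<times> {0..<int p}. case x of (u, v) => int p dvd quad D u v - c} = conic_pts D c p"
  by (auto simp: conic_pts_def)
 finally show ?thesis by simp
qed

lemma autocorr_ind: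
 "autocorr p (ind c) x y = real (card {(u, v) \<in> conic_pts D c p. int p dvd quad D (u + x) (v + y) - c})"
proof -
 have "autocorr p (ind c) x y = (\<Sum>(u, v)\<in>{0..<int p} \<times> {0..<int p}. of_bool (int p dvd quad D u v - c & int p dvd quad D (u + x) (v + y) - c))"
  unfolding autocorr_def sum.cartesian_product by (intro sum.cong refl) (auto simp: ind_def)
 also have "... = (\<Sum>z\<in>{z\<in>{0..<int p} \<times> {0..<int p}. case z of (u, v) => int p dvd quad D u v - c & int p dvd quad D (u + x) (v + y) - c}. 1)"
  by (subst sum.inter_filter) (auto intro!: sum.cong simp: of_bool_def split: prod.splits)
 also have "{z\<in>{0..<int p} \<times> {0..<int p}. case z of (u, v) => int p dvd quad D u v - c & int p dvd quad D (u + x) (v + y) - c}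
   = {(u, v) \<in> conic_pts D c p. int p dvd quad D (u + x) (v + y) - c}"
  by (auto simp: conic_pts_def)
 finally show ?thesis by simp
qed

text \<open>By Parseval the fourth moment is p^2 times the second moment of the chord counts. These
  equal r at the origin, are at most 2 elsewhere and have sum r^2, so the second moment is at most
  r^2 + 2*r^2; finally r <= p + 1.\<close>

lemma fourth_moment:
 assumes c: "~ int p dvd c"
 shows "(\<Sum>(f, g)\<in>{0..<int p} \<times> {0..<int p}. norm (hat p (ind c) f g)^4) <= 3*(real p)^2*(real (p + 1))^2"
proof -
 let ?X = "{0..<int p} \<times> {0..<int p}"
 define r where "r = real (card (conic_pts D c p))"
 define R where "R = (%(x, y). autocorr p (ind c) x y)"
 have R0: "R (0, 0) = r" by (simp add: R_def autocorr_ind r_def card_chord_0[OF c, simplified])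
 have Rnn: "0 <= R z" for z by (simp add: R_def autocorr_ind split: prod.splits)
 have R2: "R z <= 2" if "z \<in> ?X - {(0, 0)}" for z
 proof -
  obtain x y where z: "z = (x, y)" by (cases z)
  have "~ (int p dvd x & int p dvd y)"
  proof
   assume "int p dvd x & int p dvd y"
   hence "x = 0" "y = 0" using residue_eq[of x "int p" 0] residue_eq[of y "int p" 0] that z by auto
   thus False using that z by simp
  qed
  hence "card {(u, v) \<in> conic_pts D c p. int p dvd quad D (u + x) (v + y) - c} <= 2" by (rule card_chord[OF c])
  thus ?thesis by (simp add: R_def autocorr_ind z)
 qed
 have tot: "(\<Sum>z\<in>?X. R z) = r^2"
 proof -
  have "complex_of_real (\<Sum>z\<in>?X. R z) = hat p (autocorr p (ind c)) 0 0"
   by (simp add: hat_def R_def sum.cartesian_product case_prod_unfold)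
  also have "... = of_real (r^2)"
   unfolding hat_autocorr[OF p0 per_ind] hat_ind_0 by (simp add: r_def power2_eq_square)
  finally show ?thesis by (simp only: of_real_eq_iff)
 qed
 have X0: "(0, 0) \<in> ?X" "finite ?X" using p0 by auto
 have "(\<Sum>z\<in>?X. (R z)^2) = (R (0, 0))^2 + (\<Sum>z\<in>?X - {(0, 0)}. (R z)^2)"
  by (rule sum.remove[OF X0(2,1)])
 also have "(\<Sum>z\<in>?X - {(0, 0)}. (R z)^2) <= (\<Sum>z\<in>?X - {(0, 0)}. 2 * R z)"
 proof (rule sum_mono)
  fix z assume "z \<in> ?X - {(0, 0)}"
  hence "R z * R z <= 2 * R z" by (intro mult_right_mono R2 Rnn)
  thus "(R z)^2 <= 2 * R z" by (simp add: power2_eq_square)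
 qed
 also have "... = 2*(\<Sum>z\<in>?X - {(0, 0)}. R z)" by (rule sum_distrib_left[symmetric])
 also have "(\<Sum>z\<in>?X - {(0, 0)}. R z) <= (\<Sum>z\<in>?X. R z)" by (rule sum_mono2) (use X0 Rnn in auto)
 finally have S: "(\<Sum>z\<in>?X. (R z)^2) <= 3*r^2" unfolding R0 tot by simp
 have "(\<Sum>(f, g)\<in>?X. norm (hat p (ind c) f g)^4) = (\<Sum>(f, g)\<in>?X. (norm (hat p (autocorr p (ind c)) f g))^2)"
  unfolding hat_autocorr[OF p0 per_ind]
  by (intro sum.cong refl) (simp add: norm_mult power_mult_distrib split: prod.splits)
 also have "... = (real p)^2*(\<Sum>z\<in>?X. (R z)^2)"
  unfolding sum.cartesian_product[symmetric] hat_parseval[OF p0 per_autocorr[OF per_ind]]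
  by (simp add: R_def sum.cartesian_product case_prod_unfold)
 also have "... <= (real p)^2*(3*r^2)" by (intro mult_left_mono S) auto
 also have "... <= (real p)^2*(3*(real (p + 1))^2)"
  using card_conic_bounds(2)[OF c] unfolding r_def by (intro mult_left_mono power_mono) auto
 finally show ?thesis by (simp add: mult_ac)
qed

text \<open>Multiplication by an element of norm one permutes the pairs and preserves the conic, so
  the transform is invariant under the adjoint action on frequencies.\<close>

lemma hat_ind_rotate:
 assumes ab: "int p dvd quad D a b - 1"
 shows "hat p (ind c) (f*a + g*b) (g*a - D*f*b) = hat p (ind c) f g"
proof -
 let ?X = "{0..<int p} \<times> {0..<int p}"
 let ?T = "%(u, v). ((a*u - D*b * v) mod int p, (b*u + a * v) mod int p)"
 have nq: "~ int p dvd quad D a b"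
 proof
  assume "int p dvd quad D a b"
  hence "int p dvd quad D a b - (quad D a b - 1)" using ab by (rule dvd_diff)
  thus False using p2 by auto
 qed
 have "inj_on ?T ?X"
 proof (rule inj_onI, clarify)
  fix u v u' v'
  assume h: "u \<in> {0..<int p}" "v \<in> {0..<int p}" "u' \<in> {0..<int p}" "v' \<in> {0..<int p}"
   and e: "(a*u - D*b * v) mod int p = (a*u' - D*b * v') mod int p"
       "(b*u + a * v) mod int p = (b*u' + a * v') mod int p"
  have "int p dvd a*(u - u') - D*b*(v - v')" "int p dvd b*(u - u') + a*(v - v')"
   using e by (simp_all add: mod_eq_dvd_iff algebra_simps)
  hence "int p dvd u - u'" "int p dvd v - v'" using linear_injective nq by blast+
  thus "u = u' & v = v'"
   using residue_eq[of u "int p" u'] residue_eq[of v "int p" v'] h by auto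
 qed
 moreover have "?T ` ?X <= ?X" using p0 by auto
 ultimately have bij: "bij_betw ?T ?X ?X" by (intro bij_betw_imageI endo_inj_surj) auto
 have "hat p (ind c) f g = (\<Sum>z\<in>?X. (%(u, v). of_real (ind c u v)*ex p (f*u + g * v)) z)"
  by (simp add: hat_def sum.cartesian_product)
 also have "... = (\<Sum>z\<in>?X. (%(u, v). of_real (ind c u v)*ex p (f*u + g * v)) (?T z))"
  by (rule sum.reindex_bij_betw[OF bij, symmetric])
 also have "... = (\<Sum>z\<in>?X. (%(u, v). of_real (ind c u v)*ex p ((f*a + g*b)*u + (g*a - D*f*b) * v)) z)"
 proof (rule sum.cong[OF refl], clarify)
  fix u v
  have "[quad D a b*quad D u v = 1*quad D u v] (mod int p)"
   using ab by (intro cong_mult cong_refl) (simp add: cong_iff_dvd_diff)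
  hence "[quad D (a*u - D*b * v) (b*u + a * v) = quad D u v] (mod int p)"
   unfolding quad_mult by simp
  hence "ind c (a*u - D*b * v) (b*u + a * v) = ind c u v"
   unfolding ind_def cong_iff_dvd_diff[symmetric] by (simp add: cong_def)
  hence 1: "ind c ((a*u - D*b * v) mod int p) ((b*u + a * v) mod int p) = ind c u v"
   by (simp add: perD[OF per_ind])
  have "[f*((a*u - D*b * v) mod int p) + g*((b*u + a * v) mod int p)
    = f*(a*u - D*b * v) + g*(b*u + a * v)] (mod int p)"
   by (intro cong_add cong_mult cong_refl) (auto simp: cong_def)
  also have "f*(a*u - D*b * v) + g*(b*u + a * v) = (f*a + g*b)*u + (g*a - D*f*b) * v"
   by (simp add: algebra_simps)
  finally show "of_real (ind c ((a*u - D*b * v) mod int p) ((b*u + a * v) mod int p)) *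
    ex p (f*((a*u - D*b * v) mod int p) + g*((b*u + a * v) mod int p)) =
   of_real (ind c u v)*ex p ((f*a + g*b)*u + (g*a - D*f*b) * v)"
   using ex_cong[OF p0] 1 by simp
 qed
 also have "... = hat p (ind c) (f*a + g*b) (g*a - D*f*b)"
  by (simp add: hat_def sum.cartesian_product)
 finally show ?thesis by simp
qed

text \<open>The norm-one group acts freely on nonzero frequencies. If the dual form Q is a unit at
  (f, g), this is linear algebra; on the isotropic lines, where Q vanishes, the norm equations of
  the two group elements supply the missing relation.\<close>

lemma orbit_injective:
 assumes fg: "~ (int p dvd f & int p dvd g)"
  and 1: "int p dvd quad D a b - 1" "int p dvd quad D a' b' - 1"
  and e: "int p dvd f*(a - a') + g*(b - b')" "int p dvd g*(a - a') - D*f*(b - b')"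
 shows "int p dvd a - a' & int p dvd b - b'"
proof -
 define x y Q where "x = a - a'" and "y = b - b'" and "Q = g^2 + D*f^2"
 note e = e[folded x_def y_def]
 have "int p dvd Q*x" "int p dvd Q*y"
  by (rule dvd_plus_left[OF e, of _ "D*f" g], simp add: Q_def power2_eq_square algebra_simps)
    (rule dvd_plus_left[OF e, of _ g "- f"], simp add: Q_def power2_eq_square algebra_simps)
 then consider "int p dvd x & int p dvd y" | "int p dvd Q" using dvd_mult_cases by blast
 thus ?thesis
 proof cases
  case 2
  have f: "~ int p dvd f"
  proof
   assume "int p dvd f"
   hence "int p dvd Q - D*f^2" using 2 by (intro dvd_diff) (auto simp: power2_eq_square)
   hence "int p dvd g*g" by (simp add: Q_def power2_eq_square)
   hence "int p dvd g" using dvd_mult_cases by blast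
   thus False using fg \<open>int p dvd f\<close> by blast
  qed
  have "int p dvd (quad D a b - 1) - (quad D a' b' - 1)" using 1 by (rule dvd_diff)
  also have "... = (a + a')*x + D*(b + b')*y" by (simp add: x_def y_def quad_def power2_eq_square algebra_simps)
  finally have d: "int p dvd (a + a')*x + D*(b + b')*y" .
  have "int p dvd y*(D*f*(b + b') - g*(a + a'))"
   by (rule dvd_plus_left[OF d e(1), of _ f "- (a + a')"]) (simp add: algebra_simps)
  then consider "int p dvd y" | "int p dvd D*f*(b + b') - g*(a + a')" using dvd_mult_cases by blast
  thus ?thesis
  proof cases
   case 1
   hence "int p dvd (f*x + g*y) - g*y" using e(1) by (intro dvd_diff) auto
   hence "int p dvd x" using dvd_mult_cases f by auto
   thus ?thesis using 1 by (simp add: x_def y_def)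
  next
   case w: 2
   have "int p dvd 2*(D*f*b - g*a)"
    by (rule dvd_plus_left[OF w e(2), of _ 1 "- 1"]) (simp add: x_def y_def algebra_simps)
   hence w: "int p dvd D*f*b - g*a" using dvd_mult_cases not_dvd_2 by blast
   have "int p dvd D*f^2*quad D a b"
    by (rule dvd_plus_left[OF w 2, of _ "D*f*b + g*a" "a^2"])
      (simp add: Q_def quad_def power2_eq_square algebra_simps)
   hence "int p dvd D*f^2*quad D a b - D*f^2*(quad D a b - 1)"
    using 1(1) by (intro dvd_diff) auto
   hence "int p dvd D*(f*f)" by (simp add: power2_eq_square algebra_simps)
   thus ?thesis using dvd_mult_cases pD f by blast
  qed
 qed (simp add: x_def y_def)
qed

text \<open>The transform is constant on the orbit of (f, g) under the norm-one group, and the orbit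
  has at least p - 1 elements, so one value takes at most that share of the fourth moment.\<close>

lemma hat_ind_bound4:
 assumes c: "~ int p dvd c" and fg: "~ (int p dvd f & int p dvd g)"
 shows "real (p - 1)*norm (hat p (ind c) f g)^4 <= 3*(real p)^2*(real (p + 1))^2"
proof -
 let ?X = "{0..<int p} \<times> {0..<int p}" and ?G = "conic_pts D 1 p"
 let ?T = "%(a, b). ((f*a + g*b) mod int p, (g*a - D*f*b) mod int p)"
 have hm: "hat p (ind c) (x mod int p) (y mod int p) = hat p (ind c) x y" for x y
 proof -
  have "ex p (x mod int p*u + y mod int p * v) = ex p (x*u + y * v)" for u v
   by (rule ex_cong[OF p0], intro cong_add cong_mult cong_refl) (auto simp: cong_def)
  thus ?thesis by (simp add: hat_def)
 qed
 have "~ int p dvd 1" using p2 by auto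
 hence "p - 1 <= card ?G" by (rule card_conic_bounds(1))
 hence "real (p - 1)*norm (hat p (ind c) f g)^4 <= real (card ?G)*norm (hat p (ind c) f g)^4"
  by (intro mult_right_mono) auto
 also have "... = (\<Sum>z\<in>?G. norm (hat p (ind c) f g)^4)" by simp
 also have "... = (\<Sum>z\<in>?G. (%(f, g). norm (hat p (ind c) f g)^4) (?T z))"
 proof (rule sum.cong[OF refl])
  fix z assume z: "z \<in> ?G"
  obtain a b where ab: "z = (a, b)" by (cases z)
  have "hat p (ind c) (f*a + g*b) (g*a - D*f*b) = hat p (ind c) f g"
   using z by (intro hat_ind_rotate) (simp add: ab conic_pts_def)
  thus "norm (hat p (ind c) f g)^4 = (%(f, g). norm (hat p (ind c) f g)^4) (?T z)"
   by (simp add: ab hm)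
 qed
 also have "... = (\<Sum>z\<in>?T ` ?G. (%(f, g). norm (hat p (ind c) f g)^4) z)"
 proof (rule sum.reindex[symmetric, unfolded o_def], rule inj_onI, clarify)
  fix a b a' b' assume h: "(a, b) \<in> ?G" "(a', b') \<in> ?G"
   and e: "(f*a + g*b) mod int p = (f*a' + g*b') mod int p"
    "(g*a - D*f*b) mod int p = (g*a' - D*f*b') mod int p"
  have "int p dvd f*(a - a') + g*(b - b')" "int p dvd g*(a - a') - D*f*(b - b')"
   using e by (simp_all add: mod_eq_dvd_iff algebra_simps)
  hence "int p dvd a - a' & int p dvd b - b'"
   using orbit_injective[OF fg, of a b a' b'] h by (simp add: conic_pts_def)
  thus "a = a' & b = b'" using residue_eq[of a "int p" a'] residue_eq[of b "int p" b'] h by (auto simp: conic_pts_def)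
 qed
 also have "... <= (\<Sum>z\<in>?X. (%(f, g). norm (hat p (ind c) f g)^4) z)"
  using p0 by (intro sum_mono2) (auto split: prod.splits)
 also have "... <= 3*(real p)^2*(real (p + 1))^2" using fourth_moment[OF c] by simp
 finally show ?thesis .
qed

definition dens :: "int => real" where "dens c = real (card (conic_pts D c p))/(real p)^2"

text \<open>The indicator minus its mean: the transform vanishes at the zero frequency, so that in
  products over primes only the empty product has a main term.\<close>

definition bal :: "int => int => int => real" where "bal c u v = ind c u v - dens c"

lemma per_bal: "per p (bal c)"
 using per_ind[of c] by (simp add: per_def bal_def)

lemma hat_bal: "hat p (bal c) f g = (if int p dvd f & int p dvd g then 0 else hat p (ind c) f g)"
proof -
 have e: "(\<Sum>u\<in>{0..<int p}. ex p (f*u)) = (if int p dvd f then of_nat p else 0)" for f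
  using ex_orthogonality[OF p0, of f] by (simp add: mult.commute)
 have pr: "(\<Sum>u\<in>{0..<int p}. \<Sum>v\<in>{0..<int p}. ex p (f*u + g * v)) = (\<Sum>u\<in>{0..<int p}. ex p (f*u))*(\<Sum>v\<in>{0..<int p}. ex p (g * v))"
  by (simp only: ex_add sum_product)
 have "hat p (bal c) f g = hat p (ind c) f g - of_real (dens c)*(\<Sum>u\<in>{0..<int p}. \<Sum>v\<in>{0..<int p}. ex p (f*u + g * v))"
  by (simp add: hat_def bal_def left_diff_distrib sum_subtractf sum_distrib_left)
 note this[unfolded pr]
 moreover have "hat p (ind c) f g = of_real (dens c)*(of_nat p * of_nat p)" if "int p dvd f" "int p dvd g"
 proof -
  have "ex p (f*u + g * v) = 1" for u v using that ex_eq_1_iff[OF p0] by simp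
  hence "hat p (ind c) f g = hat p (ind c) 0 0" by (simp add: hat_def)
  thus ?thesis using p0 by (simp add: hat_ind_0 dens_def power2_eq_square)
 qed
 ultimately show ?thesis by (auto simp: e)
qed

text \<open>The constant 2 is chosen because its fourth power absorbs 3*(p + 1)^2/(p*(p - 1)) <= 16
  for p >= 3.\<close>

lemma hat_bal_bound:
 assumes c: "~ int p dvd c"
 shows "norm (hat p (bal c) f g) <= 2*real p powr (3/4)"
proof (cases "int p dvd f & int p dvd g")
 case False
 define t where "t = norm (hat p (bal c) f g)"
 have t: "real (p - 1)*t^4 <= 3*(real p)^2*(real (p + 1))^2"
  using hat_ind_bound4[OF c False] False by (simp add: t_def hat_bal)
 define P where "P = real p"
 have P: "P >= 3" "real (p - 1) = P - 1" "real (p + 1) = P + 1" using p2 by (auto simp: P_def)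
 have "3*(P + 1)^2 <= 16*P*(P - 1)"
 proof -
  have "0 <= (P - 3)*(13*P + 17)" using P by simp
  thus ?thesis by (simp add: power2_eq_square algebra_simps)
 qed
 hence "P^2*(3*(P + 1)^2) <= P^2*(16*P*(P - 1))" by (intro mult_left_mono) auto
 hence "(P - 1)*t^4 <= (P - 1)*(16*P^3)"
  using t unfolding P P_def[symmetric] by (simp add: power2_eq_square power3_eq_cube mult_ac)
 hence "t^4 <= 16*P^3" using P by simp
 also have "... = (2*P powr (3/4))^4"
 proof -
  have "(P powr (3/4))^4 = P powr (real 4*(3/4))" using P by (subst powr_power) auto
  also have "... = P^3" using P powr_realpow[of P 3] by simp
  finally show ?thesis by (simp add: power_mult_distrib)
 qed
 finally have "t <= 2*P powr (3/4)" by (intro power_le_imp_le_base[of t 3 "2*P powr (3/4)"]) (simp_all add: numeral_eq_Suc)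
 thus ?thesis by (simp add: t_def P_def)
qed (simp add: hat_bal)

lemma dens_bounds: "~ int p dvd c ==> \<bar>dens c - 1/real p\<bar> <= 1/(real p)^2"
proof -
 assume c: "~ int p dvd c"
 have "\<bar>real (card (conic_pts D c p)) - real p\<bar> <= 1" using card_conic_bounds[OF c] p2 by linarith
 hence "\<bar>real (card (conic_pts D c p)) - real p\<bar>/(real p)^2 <= 1/(real p)^2" by (intro divide_right_mono) auto
 moreover have "dens c - 1/real p = (real (card (conic_pts D c p)) - real p)/(real p)^2"
  using p0 by (simp add: dens_def field_simps power2_eq_square)
 ultimately show ?thesis by (simp add: abs_divide)
qed

end

section \<open>Equidistribution of values of the form\<close>

text \<open>The same density as \<open>dens\<close>, but for any modulus; prime powers will occur
  too.\<close>

definition cdens :: "int => int => nat => real" where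
 "cdens D c n = real (card (conic_pts D c n))/(real n)^2"

definition wmean :: "nat => (int => int => real) => real" where
 "wmean N F = (\<Sum>u\<in>{0..<int N}. \<Sum>v\<in>{0..<int N}. F u v)/(real N)^2"

lemma hat_0_0: "N > 0 ==> hat N F 0 0 = of_real ((real N)^2*wmean N F)"
 by (simp add: hat_def wmean_def)

lemma wmean_mult:
 assumes co: "coprime N M" and pos: "N > 0" "M > 0" and F: "per N F" and G: "per M G"
 shows "wmean (N*M) (%u v. F u v * G u v) = wmean N F*wmean M G"
proof -
 have "N*M > 0" using pos by simp
 have "complex_of_real ((real (N*M))^2*wmean (N*M) (%u v. F u v * G u v))
   = of_real (((real N)^2*wmean N F)*((real M)^2*wmean M G))"
  using hat_mult[OF co pos F G, of 0 0 0 0]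
  unfolding hat_0_0[OF pos(1)] hat_0_0[OF pos(2)] mult_zero_right add_0_right hat_0_0[OF \<open>N * M > 0\<close>] of_real_mult[symmetric] .
 hence "(real (N*M))^2*wmean (N*M) (%u v. F u v * G u v) = ((real N)^2*wmean N F)*((real M)^2*wmean M G)"
  by (simp only: of_real_eq_iff)
 hence "(real N)^2*(real M)^2*wmean (N*M) (%u v. F u v * G u v) = (real N)^2*(real M)^2*(wmean N F*wmean M G)"
  by (simp only: of_nat_mult power_mult_distrib mult_ac)
 thus ?thesis using pos by simp
qed

lemma wmean_prod:
 fixes F :: "nat => int => int => real"
 assumes "finite K" "!!p. p \<in> K ==> prime p" "!!p. p \<in> K ==> per p (F p)"
 shows "per (\<Prod>K) (%u v. \<Prod>p\<in>K. F p u v) & wmean (\<Prod>K) (%u v. \<Prod>p\<in>K. F p u v) = (\<Prod>p\<in>K. wmean p (F p))"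
 using assms
proof (induction K rule: finite_induct)
 case empty
 thus ?case by (simp add: per_def wmean_def)
next
 case (insert p K)
 note IH = insert.IH[OF insert.prems(1)[OF insertI2] insert.prems(2)[OF insertI2]]
 have p: "prime p" "per p (F p)" using insert.prems(1,2)[OF insertI1] by blast+
 have pos: "p > 0" "\<Prod>K > 0" using insert.prems(1) by (auto intro!: prod_pos simp: prime_gt_0_nat)
 have co: "coprime p (\<Prod>K)"
  using insert.hyps insert.prems(1) by (intro prod_coprime_right primes_coprime) auto
 have eq: "(%u v. \<Prod>p\<in>insert p K. F p u v) = (%u v. F p u v * (\<Prod>p\<in>K. F p u v))"
  using insert.hyps by (intro ext) (rule prod.insert)
 have e1: "(\<Prod>p\<in>insert p K. wmean p (F p)) = wmean p (F p)*(\<Prod>p\<in>K. wmean p (F p))"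
  using insert.hyps by (rule prod.insert)
 have e2: "\<Prod>(insert p K) = p*\<Prod>K" using insert.hyps by (rule prod.insert)
 show ?case unfolding eq e1 e2
  using per_times_coprime[OF p(2) conjunct1[OF IH]] wmean_mult[OF co pos p(2) conjunct1[OF IH]] conjunct2[OF IH] by simp
qed

lemma wmean_nonneg: "(!!u v. 0 <= F u v) ==> 0 <= wmean N F"
 by (simp add: wmean_def sum_nonneg)

lemma wmean_mono: "(!!u v. F u v <= G u v) ==> wmean N F <= wmean N G"
 unfolding wmean_def by (intro divide_right_mono sum_mono) auto

lemma wmean_le_1: "N > 0 ==> (!!u v. F u v <= 1) ==> wmean N F <= 1"
 using wmean_mono[of F "%u v. 1" N] by (simp add: wmean_def power2_eq_square)

lemma wmean_linear: "wmean N (%u v. a*F u v + b*G u v) = a*wmean N F + b*wmean N G"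
 by (simp add: wmean_def sum.distrib sum_distrib_left add_divide_distrib)

lemma wmean_conic: "wmean n (%u v. of_bool (int n dvd quad D u v - c)) = cdens D c n"
proof -
 have "(\<Sum>u\<in>{0..<int n}. \<Sum>v\<in>{0..<int n}. of_bool (int n dvd quad D u v - c))
   = (\<Sum>z\<in>{0..<int n} \<times> {0..<int n}. of_bool (case z of (u, v) => int n dvd quad D u v - c))"
  unfolding sum.cartesian_product by (intro sum.cong refl) auto
 also have "... = (\<Sum>z\<in>{z\<in>{0..<int n} \<times> {0..<int n}. case z of (u, v) => int n dvd quad D u v - c}. (1::real))"
  by (subst sum.inter_filter) (auto intro!: sum.cong simp: of_bool_def split: prod.splits)
 also have "{z\<in>{0..<int n} \<times> {0..<int n}. case z of (u, v) => int n dvd quad D u v - c} = conic_pts D c n"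
  by (auto simp: conic_pts_def)
 finally show ?thesis by (simp add: wmean_def cdens_def)
qed

lemma per_conic: "per n (%u v. of_bool (int n dvd quad D u v - c))"
 by (simp add: per_def dvd_quad_mod)

lemma prod_primes_dvd_iff:
 assumes "finite K" "!!p. p \<in> K ==> prime p"
 shows "int (\<Prod>K) dvd m \<longleftrightarrow> (\<forall>p\<in>K. int p dvd m)"
 using assms
proof (induction K rule: finite_induct)
 case (insert p K)
 have co: "coprime (int p) (int (\<Prod>K))"
  unfolding coprime_int_iff using insert.hyps insert.prems by (intro prod_coprime_right primes_coprime) auto
 have "int (\<Prod>(insert p K)) = int p*int (\<Prod>K)" using insert.hyps by simp
 hence "int (\<Prod>(insert p K)) dvd m \<longleftrightarrow> int p dvd m & int (\<Prod>K) dvd m"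
  using divides_mult[OF _ _ co] by (metis dvd_mult_left dvd_mult_right)
 thus ?case using insert by simp
qed simp

lemma powr_three_quarters_prod:
 "finite S ==> (\<Prod>p\<in>S. 2*real p powr (3/4)) = 2^card S*real (\<Prod>S) powr (3/4)"
 by (induction S rule: finite_induct) (auto simp: powr_mult)

text \<open>Each indicator modulo p is its mean plus a centred function. In the expansion over
  subsets S of K only S = {} has a nonzero mean and gives the main term. For the others, with s the
  product of S and k that of K, the period is only Q*s, the transform is at most Q^2*2^card
  S*s^(3/4), and the means outside S contribute at most 2^card (K - S)*s/k. The 2^card K subsets
  with constants 2^card K make 4^card K.\<close>

lemma equidistribution:
 assumes K: "finite K" "!!p. p \<in> K ==> prime p & p > 2 & ~ int p dvd D & ~ int p dvd c"
  and Q: "Q > 0" "coprime Q (\<Prod>K)" and w: "per Q w" "!!u v. \<bar>w u v\<bar> <= 1"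
 shows "\<bar>box_sum L (%u v. w u v * of_bool (int (\<Prod>K) dvd quad D u v - c)) - wmean Q w*(\<Prod>p\<in>K. cdens D c p)*real L^4\<bar>
   <= 4^card K*(real Q)^2*((real L)^2*real (\<Prod>K) powr (3/4) + 2*real L^3*real (\<Prod>K) powr (- 1/4))"
proof -
 have cp: "conic_prime D p" if "p \<in> K" for p using K(2)[OF that] by unfold_locales auto
 define k where "k = real (\<Prod>K)"
 define b where "b = (%p. conic_prime.bal D p c)"
 define m where "m = (%p. cdens D c p)"
 have dens: "conic_prime.dens D p c = m p" if "p \<in> K" for p
  by (simp add: conic_prime.dens_def[OF cp[OF that]] m_def cdens_def)
 have ind: "of_bool (int p dvd quad D u v - c) = b p u v + m p" if "p \<in> K" for p u v
  by (simp add: b_def conic_prime.bal_def[OF cp[OF that]] conic_prime.ind_def[OF cp[OF that]] dens[OF that])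
 have m2: "0 <= m p" "m p <= 2/real p" if "p \<in> K" for p
 proof -
  show "0 <= m p" by (simp add: m_def cdens_def)
  have p: "prime p" "p > 2" using K(2)[OF that] by auto
  have "m p <= 1/real p + 1/(real p)^2"
   using conic_prime.dens_bounds[OF cp[OF that], of c] K(2)[OF that] dens[OF that] by (simp add: abs_le_iff)
  also have "1/(real p)^2 <= 1/real p" using p by (simp add: frac_le power2_eq_square)
  finally show "m p <= 2/real p" by simp
 qed
 have posK: "\<Prod>S > 0" if "S <= K" for S using that K(2) by (intro prod_pos) (auto simp: prime_gt_0_nat)
 have real1: "1 <= real n" if "n > 0" for n :: nat using that by simp
 have k1: "k >= 1" unfolding k_def by (rule real1[OF posK[OF subset_refl]])
 have expand: "w u v * of_bool (int (\<Prod>K) dvd quad D u v - c)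
   = (\<Sum>S\<in>Pow K. (\<Prod>p\<in>K - S. m p)*(w u v * (\<Prod>p\<in>S. b p u v)))" for u v
 proof -
  have "of_bool (int (\<Prod>K) dvd quad D u v - c) = (\<Prod>p\<in>K. of_bool (int p dvd quad D u v - c) :: real)"
   using prod_primes_dvd_iff[of K "quad D u v - c"] K by (simp add: of_bool_def prod_zero_iff)
  also have "... = (\<Prod>p\<in>K. b p u v + m p)" by (intro prod.cong refl ind)
  also have "... = (\<Sum>S\<in>Pow K. (\<Prod>p\<in>S. b p u v)*(\<Prod>p\<in>K - S. m p))" by (rule prod_add[OF K(1)])
  finally show ?thesis by (simp add: sum_distrib_left mult_ac)
 qed
 define E where "E = (real Q)^2*((real L)^2 * k powr (3/4) + 2*real L^3 * k powr (- 1/4))"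
 define T where "T = (%S. box_sum L (%u v. w u v * (\<Prod>p\<in>S. b p u v)))"
 define main where "main = (%S::nat set. if S = {} then wmean Q w*real L^4 else 0)"
 have est: "\<bar>(\<Prod>p\<in>K - S. m p)*(T S - main S)\<bar> <= 2^card K*E" if S: "S <= K" for S
 proof -
  define s where "s = real (\<Prod>S)"
  have finS: "finite S" using S K(1) finite_subset by blast
  have s1: "s >= 1" unfolding s_def by (rule real1[OF posK[OF S]])
  have coS: "coprime Q (\<Prod>S)"
  proof -
   have "\<Prod>S dvd \<Prod>K" using S K(1) by (rule prod_dvd_prod_subset[rotated])
   thus ?thesis using Q(2) by (meson coprime_divisors dvd_refl)
  qed
  have hp: "per (\<Prod>S) (%u v. \<Prod>p\<in>S. b p u v)"
   "!!f g. norm (hat (\<Prod>S) (%u v. \<Prod>p\<in>S. b p u v) f g) <= (\<Prod>p\<in>S. 2*real p powr (3/4))"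
   "hat (\<Prod>S) (%u v. \<Prod>p\<in>S. b p u v) 0 0 = (\<Prod>p\<in>S. hat p (b p) 0 0)"
   using hat_prod[OF finS, of b "%p. 2*real p powr (3/4)"] S K(2) cp
    conic_prime.per_bal[of D _ c] conic_prime.hat_bal_bound[of D _ c] unfolding b_def by (blast, blast, blast)
  have N0: "Q*\<Prod>S > 0" using Q posK[OF S] by simp
  have hb: "norm (hat (Q*\<Prod>S) (%u v. w u v * (\<Prod>p\<in>S. b p u v)) f g) <= (real Q)^2*(\<Prod>p\<in>S. 2*real p powr (3/4))" for f g
   by (rule hat_mult_bound[OF coS Q(1) posK[OF S] w(1) hp(1) hat_trivial_bound[OF w(2)] hp(2)])
  have h0: "hat (Q*\<Prod>S) (%u v. w u v * (\<Prod>p\<in>S. b p u v)) 0 0 = of_real ((real (Q*\<Prod>S))^2*(main S/real L^4))" if L: "L > 0"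
  proof -
   have "hat (Q*\<Prod>S) (%u v. w u v * (\<Prod>p\<in>S. b p u v)) 0 0 = hat Q w 0 0*(\<Prod>p\<in>S. hat p (b p) 0 0)"
    using hat_mult[OF coS Q(1) posK[OF S] w(1) hp(1), of 0 0 0 0] hp(3) by simp
   also have "... = of_real ((real (Q*\<Prod>S))^2*(main S/real L^4))"
   proof (cases "S = {}")
    case True
    thus ?thesis using L Q by (simp add: main_def hat_0_0)
   next
    case False
    then obtain p where p: "p \<in> S" by blast
    hence "hat p (b p) 0 0 = 0" using conic_prime.hat_bal[of D p c 0 0] cp S by (auto simp: b_def)
    hence "(\<Prod>p\<in>S. hat p (b p) 0 0) = 0" using p finS by (intro prod_zero) auto
    thus ?thesis using False by (simp add: main_def)
   qed
   finally show ?thesis .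
  qed
  have TS: "\<bar>T S - main S\<bar> <= (real Q)^2*(2^card S * s powr (3/4))*((real L)^2 + 2*real L^3/(real Q * s))"
  proof (cases "L = 0")
   case True
   thus ?thesis by (simp add: T_def main_def box_sum_def)
  next
   case False
   hence L: "L > 0" by simp
   have "hat (Q*\<Prod>S) (%u v. w u v * (\<Prod>p\<in>S. b p u v)) 0 0/(of_nat (Q*\<Prod>S))^2 * of_nat L^4 = complex_of_real (main S)"
   proof -
    have "complex_of_real ((real n)^2*(x/real L^4))/(of_nat n)^2 * of_nat L^4 = of_real x" if "n > 0" for n x
     using that L by simp
    from this[OF N0] show ?thesis unfolding h0[OF L] .
   qed
   hence "norm (complex_of_real (T S - main S)) <= (real Q)^2*(\<Prod>p\<in>S. 2*real p powr (3/4))*((real L)^2 + 2*real L^3/real (Q*\<Prod>S))"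
    using box_sum_estimate[OF N0 per_times_coprime[OF w(1) hp(1)] hb, of L] by (simp add: T_def)
   thus ?thesis unfolding norm_of_real powr_three_quarters_prod[OF finS] s_def of_nat_mult .
  qed
  have pm: "(\<Prod>p\<in>K - S. m p) <= 2^card (K - S)*(s / k)"
  proof -
   have "(\<Prod>p\<in>K - S. m p) <= (\<Prod>p\<in>K - S. 2/real p)" using m2 by (intro prod_mono) auto
   also have "... = 2^card (K - S)/real (\<Prod>(K - S))" by (simp add: prod_dividef)
   also have "k = s*real (\<Prod>(K - S))"
    unfolding k_def s_def using prod.subset_diff[OF S K(1), of "%x. x"] by (simp add: mult.commute)
   hence "1/real (\<Prod>(K - S)) = s / k" using s1 k1 by (simp add: field_simps)
   hence "2^card (K - S)/real (\<Prod>(K - S)) = 2^card (K - S)*(s / k)" by (metis mult.right_neutral times_divide_eq_right)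
   finally show ?thesis .
  qed
  have pm0: "0 <= (\<Prod>p\<in>K - S. m p)" using m2 by (intro prod_nonneg) auto
  have sk: "s <= k"
  proof -
   have "\<Prod>S dvd \<Prod>K" using S K(1) by (rule prod_dvd_prod_subset[rotated])
   hence "\<Prod>S <= \<Prod>K" using posK[of K] by (intro dvd_imp_le) auto
   thus ?thesis unfolding s_def k_def by (rule of_nat_mono)
  qed
  have "\<bar>(\<Prod>p\<in>K - S. m p)*(T S - main S)\<bar> = (\<Prod>p\<in>K - S. m p)*\<bar>T S - main S\<bar>"
   using pm0 by (simp add: abs_mult)
  also have "... <= (2^card (K - S)*(s / k))*((real Q)^2*(2^card S * s powr (3/4))*((real L)^2 + 2*real L^3/(real Q * s)))"
   using pm TS pm0 s1 k1 by (intro mult_mono) auto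
  also have "... = (2^card (K - S)*2^card S)*((real Q)^2*((real L)^2*(s / k * s powr (3/4)) + 2*real L^3*(s powr (3/4)/(k*real Q))))"
  proof -
   have "x*(y / k)*(z*(u*t)*(a + 2 * c/(q*y))) = (x*u)*(z*(a*(y / k*t) + 2 * c*(t/(k*q))))"
    if "y ~= 0" "q ~= 0" "k ~= 0" for x y z u t a c q :: real
    using that by (simp add: field_simps)
   thus ?thesis using s1 k1 Q(1) by simp
  qed
  also have "2^card (K - S)*2^card S = (2::real)^card K"
   using S K(1) finS by (simp add: power_add[symmetric] card_Diff_subset card_mono)
  also have "(real Q)^2*((real L)^2*(s / k * s powr (3/4)) + 2*real L^3*(s powr (3/4)/(k*real Q))) <= E"
   unfolding E_def
  proof (intro mult_left_mono add_mono)
   have "s / k * s powr (3/4) <= 1 * k powr (3/4)" using s1 k1 sk by (intro mult_mono powr_mono2) (auto simp: field_simps)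
   thus "s / k * s powr (3/4) <= k powr (3/4)" by simp
   have "s powr (3/4)/(k*real Q) <= k powr (3/4)/(k*1)"
    using s1 k1 sk Q(1) by (intro frac_le powr_mono2 mult_left_mono mult_pos_pos) auto
   also have "... = k powr (3/4) * k powr (- 1)" using k1 by (simp add: powr_minus field_simps)
   also have "... = k powr (- 1/4)" unfolding powr_add[symmetric] by simp
   finally show "s powr (3/4)/(k*real Q) <= k powr (- 1/4)" .
  qed auto
  finally show ?thesis by simp
 qed
 have box: "box_sum L (%u v. w u v * of_bool (int (\<Prod>K) dvd quad D u v - c)) = (\<Sum>S\<in>Pow K. (\<Prod>p\<in>K - S. m p)*T S)"
  unfolding expand box_sum_sum box_sum_mult T_def ..
 have mainsum: "(\<Sum>S\<in>Pow K. (\<Prod>p\<in>K - S. m p)*main S) = wmean Q w*(\<Prod>p\<in>K. m p)*real L^4"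
 proof -
  have "(\<Sum>S\<in>Pow K. (\<Prod>p\<in>K - S. m p)*main S) = (\<Sum>S\<in>{{}}. (\<Prod>p\<in>K - S. m p)*main S)"
   using K(1) by (intro sum.mono_neutral_right) (auto simp: main_def)
  thus ?thesis by (simp add: main_def)
 qed
 have "\<bar>(\<Sum>S\<in>Pow K. (\<Prod>p\<in>K - S. m p)*T S) - (\<Sum>S\<in>Pow K. (\<Prod>p\<in>K - S. m p)*main S)\<bar>
   = \<bar>\<Sum>S\<in>Pow K. (\<Prod>p\<in>K - S. m p)*(T S - main S)\<bar>"
  by (simp add: sum_subtractf right_diff_distrib)
 also have "... <= (\<Sum>S\<in>Pow K. 2^card K*E)"
  using est by (intro order_trans[OF sum_abs sum_mono]) auto
 also have "... = 4^card K*E" using K(1) by (simp add: card_Pow power_mult_distrib[symmetric])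
 finally have "\<bar>box_sum L (%u v. w u v * of_bool (int (\<Prod>K) dvd quad D u v - c)) - wmean Q w*(\<Prod>p\<in>K. m p)*real L^4\<bar> <= 4^card K*E"
  unfolding box mainsum .
 thus ?thesis unfolding E_def k_def m_def by (simp only: mult.assoc)
qed

lemma prime_factors_prod_primes:
 fixes E :: "nat set"
 assumes "finite E" "!!p. p \<in> E ==> prime p"
 shows "prime_factors (\<Prod>E) = E"
 using assms
proof (induction E rule: finite_induct)
 case (insert p E)
 have "p ~= 0" "\<Prod>E ~= 0" using insert by (auto dest: prime_gt_0_nat)
 hence "prime_factors (p*\<Prod>E) = prime_factors p \<union> prime_factors (\<Prod>E)" by (rule prime_factors_product)
 thus ?case using insert by (simp add: prime_prime_factors)
qed simp

section \<open>Divisors and the hyperbola method\<close>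

lemma rough_smooth_split:
 fixes m :: nat and y :: real
 assumes "m > 0"
 shows "\<exists>s r. m = s*r & s > 0 & r > 0 & (\<forall>p. prime p --> p dvd s --> real p <= y) & (\<forall>p. prime p --> p dvd r --> y < real p)"
 using assms
proof (induction m rule: prime_divisors_induct)
 case (unit x)
 thus ?case by (intro exI[of _ 1]) (auto simp: prime_nat_iff)
next
 case (factor p x)
 then obtain s r where sr: "x = s*r" "s > 0" "r > 0" "!!p. prime p ==> p dvd s ==> real p <= y" "!!p. prime p ==> p dvd r ==> y < real p"
  by (auto simp: mult_eq_0_iff)
 have pp: "prime l ==> l dvd p*t ==> l = p \<or> l dvd t" for l t
  using factor.hyps by (auto simp: prime_dvd_mult_iff dest: primes_dvd_imp_eq)
 have p0: "p > 0" using factor.hyps by (simp add: prime_gt_0_nat)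
 show ?case
 proof (cases "real p <= y")
  case True
  have "prime l ==> l dvd p * s ==> real l <= y" for l using pp[of l s] sr(4) True by auto
  thus ?thesis
   by (intro exI[of _ "p * s"] exI[of _ r]) (use sr p0 in \<open>simp add: mult_ac\<close>)
 next
  case False
  have "prime l ==> l dvd p*r ==> y < real l" for l using pp[of l r] sr(5) False by auto
  thus ?thesis
   by (intro exI[of _ s] exI[of _ "p*r"]) (use sr p0 in \<open>simp add: mult_ac\<close>)
 qed
qed simp

text \<open>The witness j is the number of prime factors counted with multiplicity: each exceeds y,
  and each at most doubles the number of divisors.\<close>

lemma rough_divisors:
 fixes r :: nat and y :: real
 assumes "r > 0" "y > 1" "!!p. prime p ==> p dvd r ==> y < real p"
 shows "\<exists>j. y^j <= real r & card {k. k dvd r} <= 2^j & card (prime_factors r) <= j"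
 using assms(1,3)
proof (induction r rule: prime_divisors_induct)
 case (unit x)
 hence "x = 1" by simp
 thus ?case by (intro exI[of _ 0]) simp
next
 case (factor p x)
 have x0: "x > 0" using factor.prems by simp
 have p: "prime p" by (rule factor.hyps)
 obtain j where j: "y^j <= real x" "card {k. k dvd x} <= 2^j" "card (prime_factors x) <= j"
  using factor.IH[OF x0] factor.prems(2) by (auto intro: dvd_mult)
 have yp: "y <= real p" using factor.prems(2)[OF p] by simp
 have 1: "y^Suc j <= real (p*x)" using mult_mono[OF yp j(1)] assms(2) by simp
 have sub: "{k. k dvd p*x} <= {k. k dvd x} \<union> (%k. p * k) ` {k. k dvd x}"
 proof
  fix k assume "k \<in> {k. k dvd p*x}"
  hence k: "k dvd p*x" by simp
  show "k \<in> {k. k dvd x} \<union> (%k. p * k) ` {k. k dvd x}"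
  proof (cases "p dvd k")
   case True
   then obtain l where l: "k = p*l" by (auto elim: dvdE)
   hence "l dvd x" using k prime_gt_0_nat[OF p] by simp
   thus ?thesis using l by blast
  next
   case False
   hence "coprime p k" using p by (rule prime_imp_coprime[rotated])
   hence "k dvd x" using k by (simp add: coprime_commute coprime_dvd_mult_right_iff)
   thus ?thesis by blast
  qed
 qed
 have fin: "finite {k. k dvd x}" using x0 by simp
 have "card {k. k dvd p*x} <= card ({k. k dvd x} \<union> (%k. p * k) ` {k. k dvd x})" using fin by (intro card_mono sub) simp
 also have "... <= card {k. k dvd x} + card ((%k. p * k) ` {k. k dvd x})" by (rule card_Un_le)
 also have "card ((%k. p * k) ` {k. k dvd x}) <= card {k. k dvd x}" by (rule card_image_le[OF fin])
 finally have 2: "card {k. k dvd p*x} <= 2^Suc j" using j(2) by simp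
 have "prime_factors (p*x) = insert p (prime_factors x)"
  using p x0 prime_gt_0_nat[OF p] by (auto simp: prime_factors_product prime_prime_factors)
 hence 3: "card (prime_factors (p*x)) <= Suc j" using j(3) by (simp add: card_insert_if)
 show ?case using 1 2 3 by blast
qed simp

lemma rough_divisors_le:
 fixes r :: nat and y :: real
 assumes "r > 0" "y > 1" "!!p. prime p ==> p dvd r ==> y < real p" and le: "real r <= y^J"
 shows "card {k. k dvd r} <= 2^J" "card (prime_factors r) <= J"
proof -
 obtain j where j: "y^j <= real r" "card {k. k dvd r} <= 2^j" "card (prime_factors r) <= j"
  using rough_divisors[OF assms(1-3)] by blast
 have "j <= J" using power_le_imp_le_exp[OF assms(2)] j(1) le by (meson order_trans)
 thus "card (prime_factors r) <= J" using j(3) by simp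
 have "(2::nat)^j <= 2^J" using \<open>j <= J\<close> by (intro power_increasing) auto
 thus "card {k. k dvd r} <= 2^J" by (rule order_trans[OF j(2)])
qed

lemma sum_inverse_squares_le:
 assumes "a >= 1"
 shows "(\<Sum>n\<in>{a<..b}. 1/(real n)^2) <= 1/real a"
proof -
 have "a <= b ==> (\<Sum>n\<in>{a<..b}. 1/(real n)^2) <= 1/real a - 1/real b"
 proof (induction b rule: dec_induct)
  case (step n)
  have n: "real n >= 1" using step.hyps assms by simp
  have "1/(real (Suc n))^2 <= 1/(real n*real (Suc n))"
   using n by (intro divide_left_mono) (auto simp: power2_eq_square mult_mono)
  also have "... = 1/real n - 1/real (Suc n)" using n by (simp add: field_simps)
  finally have "1/(real (Suc n))^2 <= 1/real n - 1/real (Suc n)" .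
  moreover have "{a<..Suc n} = insert (Suc n) {a<..n}" using step.hyps by auto
  ultimately show ?case using step.IH by simp
 qed simp
 moreover have "0 <= 1/real b" by simp
 ultimately show ?thesis by (cases "a <= b") (auto intro: order_trans)
qed

lemma finite_real_le_set: "finite {n::nat. P n & real n <= B}"
 by (rule finite_subset[of _ "{..nat (floor B)}"]) (auto simp: le_nat_floor)

lemma sum_inverse_squares_real_le:
 fixes y :: real
 assumes y: "y >= 1" and A: "finite A" "!!p. p \<in> A ==> y < real p"
 shows "(\<Sum>p\<in>A. 1/(real p)^2) <= 2/y"
proof -
 define a where "a = nat (floor y)"
 have a1: "real a = of_int (floor y)" using y by (simp add: a_def)
 have "(floor y) >= 1" using y by simp
 hence a2: "real_of_int (floor y) >= 1" by simp
 have a: "a >= 1" "real a >= y/2" using a1 a2 floor_correct[of y] by linarith+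
 have sub: "A <= {a<..Max A}"
 proof
  fix p assume p: "p \<in> A"
  have "a < p" using A(2)[OF p] y unfolding a_def by linarith
  thus "p \<in> {a<..Max A}" using p A(1) by simp
 qed
 have "(\<Sum>p\<in>A. 1/(real p)^2) <= (\<Sum>p\<in>{a<..Max A}. 1/(real p)^2)" by (rule sum_mono2[OF _ sub]) auto
 also have "... <= 1/real a" by (rule sum_inverse_squares_le[OF a(1)])
 also have "... <= 1/(y/2)" using a y by (intro divide_left_mono) auto
 finally show ?thesis by simp
qed

text \<open>The first exponent with p^E > z. A prime power dividing a smooth number is then either
  at most z, or forces p^E to divide it, which is a rare event.\<close>

lemma next_prime_power:
 fixes z :: real
 assumes "z >= 1"
 shows "\<exists>E. \<forall>p::nat. p >= 2 --> z < real p^E p & real p^E p <= z*real p & E p >= 1"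
proof -
 have "\<forall>p::nat. \<exists>e. p >= 2 --> z < real p^e & real p^e <= z*real p & e >= 1"
 proof (intro allI)
  fix p :: nat
  show "\<exists>e. p >= 2 --> z < real p^e & real p^e <= z*real p & e >= 1"
  proof (cases "p >= 2")
   case True
   have z1: "1 <= nat (floor z)" using assms by linarith
   obtain n where n: "p^n <= nat (floor z)" "nat (floor z) < p^(n + 1)"
    using ex_power_ivl1[OF True z1] by blast
   have "real (p^n) <= z" using n(1) assms by (meson of_nat_floor of_nat_le_iff order_trans zero_le_one le_nat_floor of_nat_mono)
   hence "real p^n*real p <= z*real p" by (intro mult_right_mono) simp_all
   hence "real p^(n + 1) <= z*real p" by (simp add: mult.commute)
   moreover have "z < real (p^(n + 1))" using n(2) assms by linarith
   ultimately show ?thesis by (intro exI[of _ "n + 1"]) simp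
  qed simp
 qed
 thus ?thesis by (rule choice)
qed

text \<open>Split at sqrt z. Below, at most sqrt z primes contribute 1/z each; above, the exponent
  is at least 2, as p <= z < p^E, and reciprocal squares sum to 2 / sqrt z.\<close>

lemma sum_next_prime_power:
 fixes z :: real
 assumes z: "z >= 1" and E: "!!p. p >= 2 ==> z < real p^E p"
 shows "(\<Sum>p | prime p & real p <= z. 1/real p^E p) <= 3 / sqrt z"
proof -
 let ?S = "{p. prime p & real p <= z}"
 have fin: "finite ?S" by (rule finite_real_le_set)
 have sz: "sqrt z >= 1" using z by simp
 define A where "A = {p\<in>?S. real p <= sqrt z}"
 define B where "B = {p\<in>?S. sqrt z < real p}"
 have AB: "?S = A \<union> B" "A \<inter> B = {}" "finite A" "finite B"
  unfolding A_def B_def by (auto intro: finite_subset[OF _ fin])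
 have "(\<Sum>p\<in>A. 1/real p^E p) <= (\<Sum>p\<in>A. 1/z)"
  using E z by (intro sum_mono divide_left_mono) (auto simp: A_def prime_ge_2_nat less_imp_le intro!: mult_pos_pos zero_less_power prime_gt_0_nat)
 also have "... = real (card A)/z" by simp
 finally have s1: "(\<Sum>p\<in>A. 1/real p^E p) <= real (card A)/z" .
 have "card A <= card {1..nat \<lfloor>sqrt z\<rfloor>}"
  by (intro card_mono) (auto simp: A_def le_nat_floor Suc_le_eq prime_gt_0_nat)
 hence "real (card A) <= real (nat \<lfloor>sqrt z\<rfloor>)" by simp
 also have "... <= sqrt z" using sz by (intro of_nat_floor) simp
 finally have "real (card A) <= sqrt z" .
 hence "real (card A)/z <= sqrt z/z" using z by (intro divide_right_mono) auto
 note order_trans[OF s1 this]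
 also have "sqrt z/z = 1 / sqrt z" using z by (simp add: real_div_sqrt field_simps)
 finally have 1: "(\<Sum>p\<in>A. 1/real p^E p) <= 1 / sqrt z" .
 have "(\<Sum>p\<in>B. 1/real p^E p) <= (\<Sum>p\<in>B. 1/(real p)^2)"
 proof (rule sum_mono)
  fix p assume p: "p \<in> B"
  hence p2: "p >= 2" "real p <= z" by (auto simp: B_def prime_ge_2_nat)
  have "real p < real p^E p" using E[OF p2(1)] p2(2) by linarith
  hence "real p^1 < real p^E p" by (simp only: power_one_right)
  hence "1 < E p" using p2 by (intro power_less_imp_less_exp[of "real p"]) auto
  hence "(real p)^2 <= real p^E p" using p2 by (intro power_increasing) auto
  thus "1/real p^E p <= 1/(real p)^2" using p2 by (intro divide_left_mono) auto
 qed
 also have "... <= 2 / sqrt z" by (rule sum_inverse_squares_real_le[OF sz AB(4)]) (auto simp: B_def)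
 finally have 2: "(\<Sum>p\<in>B. 1/real p^E p) <= 2 / sqrt z" .
 have "(\<Sum>p\<in>?S. 1/real p^E p) = (\<Sum>p\<in>A. 1/real p^E p) + (\<Sum>p\<in>B. 1/real p^E p)"
  unfolding AB(1) by (rule sum.union_disjoint[OF AB(3,4,2)])
 also have "... <= 1 / sqrt z + 2 / sqrt z" by (intro add_mono 1 2)
 finally show ?thesis by (simp add: add_divide_distrib[symmetric])
qed

context real_char begin

text \<open>As chi r = 1 and chi is real, chi (r div k) = chi k, so the divisors beyond K reflect
  onto those with k*K < r. These are written as all k <= K minus the range r/K <= k <= K: the full
  sum, which has the main term, occurs twice, while the range near K will be short and is only
  bounded from above.\<close>

lemma hyperbola:
 assumes r: "r > 0" "chi r = 1" and K: "r <= K^2"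
 shows "div_sum r = 2*(\<Sum>k | k dvd r & k <= K. chi k) - (\<Sum>k | k dvd r & k <= K & r <= k*K. chi k)"
proof -
 have fin: "finite {k. k dvd r & P k}" for P using r by simp
 have "div_sum r = (\<Sum>k | k dvd r & k <= K. chi k) + (\<Sum>k | k dvd r & K < k. chi k)"
  unfolding div_sum_def by (subst sum.union_disjoint[symmetric]) (auto simp: fin intro!: sum.cong)
 also have "(\<Sum>k | k dvd r & K < k. chi k) = (\<Sum>k | k dvd r & k*K < r. chi k)"
 proof (rule sum.reindex_bij_witness[of _ "%k. r div k" "%k. r div k"])
  fix k assume "k \<in> {k. k dvd r & K < k}"
  then obtain l where l: "r = k*l" "K < k" by (auto elim: dvdE)
  have "k > 0" "l > 0" using l r(1) by auto
  show "r div (r div k) = k" using \<open>k > 0\<close> \<open>l > 0\<close> by (simp add: l)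
  show "r div k \<in> {k. k dvd r & k*K < r}" using \<open>k > 0\<close> \<open>l > 0\<close> l(2) by (simp add: l(1) mult.commute)
  have "chi k * chi l = 1" using r(2) by (simp add: l(1) chi_mult)
  hence "chi l = chi k" using chi_values[of k] chi_values[of l] by auto
  thus "chi (r div k) = chi k" using \<open>k > 0\<close> by (simp add: l(1))
 next
  fix k assume "k \<in> {k. k dvd r & k*K < r}"
  then obtain l where l: "r = k*l" "k*K < r" by (auto elim: dvdE)
  have "k > 0" "l > 0" using l r(1) by auto
  show "r div (r div k) = k" using \<open>k > 0\<close> \<open>l > 0\<close> by (simp add: l)
  show "r div k \<in> {k. k dvd r & K < k}" using \<open>k > 0\<close> l(2) by (simp add: l(1))
 qed
 also have "... = (\<Sum>k | k dvd r & k <= K. chi k) - (\<Sum>k | k dvd r & k <= K & r <= k*K. chi k)"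
 proof -
  have "k <= K" if "k*K < r" for k
  proof (rule ccontr)
   assume "~ k <= K"
   hence "K*K <= k*K" by (intro mult_right_mono) auto
   thus False using that K unfolding power2_eq_square by linarith
  qed
  hence "{k. k dvd r & k <= K} = {k. k dvd r & k*K < r} \<union> {k. k dvd r & k <= K & r <= k*K}" by auto
  hence "(\<Sum>k | k dvd r & k <= K. chi k) = (\<Sum>k | k dvd r & k*K < r. chi k) + (\<Sum>k | k dvd r & k <= K & r <= k*K. chi k)"
   by (simp only:) (rule sum.union_disjoint, auto simp: fin)
  thus ?thesis by simp
 qed
 finally show ?thesis by simp
qed

lemma chi_eq_1_if_primes:
 assumes "s > 0" "!!p. prime p ==> p dvd s ==> chi p = 1"
 shows "chi s = 1"
 using assms
proof (induction s rule: prime_divisors_induct)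
 case (unit x)
 thus ?case using chi_1 by simp
next
 case (factor p x)
 thus ?case by (simp add: chi_mult)
qed simp

end

section \<open>Multiplicity of representations\<close>

text \<open>Primitive representations of \<open>n = n0 * n1\<close> by \<open>u\<^sup>2 + D * v^2\<close> are classified by the set of primes of \<open>n1\<close>
 at which the ratio \<open>u / v\<close> agrees with that of a fixed representation; each class is small because the
 cross product \<open>u * v' - u' * v\<close> is divisible by \<open>n1\<close> and bounded by \<open>n\<close>.\<close>

lemma square_eq_imp:
 fixes a b :: int
 assumes "a^2 = b^2" shows "a = b \<or> a = - b"
 using assms by (simp add: power2_eq_iff)

text \<open>Brahmagupta's identity for the product of one element with the conjugate of the
  other.\<close>

lemma quad_cross: "(u*u' + D * v * v')^2 + D*(u * v' - u' * v)^2 = quad D u v * quad D u' v'"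
 by (simp add: quad_def power2_eq_square algebra_simps)

text \<open>The quotient of the cross product by n1 takes one of 2*n0 + 1 values. By
  \<open>quad_cross\<close> the other coordinate of the product with the conjugate is then fixed up
  to sign, and both coordinates determine the second representation.\<close>

lemma card_fibre_representations:
 fixes D n n0 n1 :: int
 assumes D: "D > 0" and n: "n = n0*n1" "n0 > 0" "n1 > 0"
  and A: "!!u v. (u, v) \<in> A ==> quad D u v = n"
  and cross: "!!u v u' v'. (u, v) \<in> A ==> (u', v') \<in> A ==> n1 dvd u * v' - u' * v"
 shows "finite A & card A <= nat (2*(2*n0 + 1))"
proof (cases "A = {}")
 case False
 then obtain u v where uv: "(u, v) \<in> A" by auto
 let ?f = "%(u', v'). ((u * v' - u' * v) div n1, u*u' + D * v * v' >= 0)"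
 have n_pos: "n > 0" using n by simp
 have range: "?f ` A <= {- n0..n0} \<times> UNIV"
 proof (rule image_subsetI)
  fix x assume "x \<in> A"
  then obtain u' v' where h: "(u', v') \<in> A" and x: "x = (u', v')" by (cases x) auto
  obtain k where k: "u * v' - u' * v = n1 * k" using cross[OF uv h] by (auto elim: dvdE)
  have "(u*u' + D * v * v')^2 + D*(u * v' - u' * v)^2 = n^2"
   unfolding quad_cross A[OF uv] A[OF h] by (simp add: power2_eq_square)
  hence "D*(n1 * k)^2 <= n^2" unfolding k using zero_le_power2[of "u*u' + D * v * v'"] by linarith
  moreover have "1*(n1 * k)^2 <= D*(n1 * k)^2" using D by (intro mult_right_mono) auto
  ultimately have "(n1 * k)^2 <= (n1*n0)^2" by (simp add: n(1) mult.commute)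
  hence "\<bar>n1 * k\<bar> <= \<bar>n1*n0\<bar>" by (simp add: abs_le_square_iff)
  hence "n1*\<bar>k\<bar> <= n1*n0" using n by (simp add: abs_mult)
  hence "\<bar>k\<bar> <= n0" using n(3) by simp
  thus "?f x \<in> {- n0..n0} \<times> UNIV" using n(3) by (auto simp: x k abs_le_iff)
 qed
 have inj: "inj_on ?f A"
 proof (rule inj_onI)
  fix x x' assume xx: "x \<in> A" "x' \<in> A" "?f x = ?f x'"
  obtain a b a' b' where x: "x = (a, b)" "x' = (a', b')" by (cases x, cases x') auto
  have h: "(a, b) \<in> A" "(a', b') \<in> A" using xx x by simp_all
  have e: "(u*b - a * v) div n1 = (u*b' - a' * v) div n1" "(u*a + D * v * b >= 0) = (u*a' + D * v * b' >= 0)"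
   using xx(3) by (simp_all add: x)
  have c: "u*b - a * v = u*b' - a' * v"
   using cross[OF uv h(1)] cross[OF uv h(2)] e(1) by (metis dvd_mult_div_cancel)
  have "(u*a + D * v * b)^2 + D*(u*b - a * v)^2 = (u*a' + D * v * b')^2 + D*(u*b' - a' * v)^2"
   unfolding quad_cross A[OF h(1)] A[OF h(2)] ..
  hence "(u*a + D * v * b)^2 = (u*a' + D * v * b')^2" unfolding c by simp
  hence "u*a + D * v * b = u*a' + D * v * b' \<or> u*a + D * v * b = - (u*a' + D * v * b')" by (rule square_eq_imp)
  hence r: "u*a + D * v * b = u*a' + D * v * b'" using e(2) by linarith
  have "n*a = u*(u*a + D * v * b) - D * v * (u*b - a * v)"
   unfolding A[OF uv, symmetric] by (simp add: quad_def power2_eq_square algebra_simps)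
  also have "... = n*a'" unfolding c r A[OF uv, symmetric] by (simp add: quad_def power2_eq_square algebra_simps)
  finally have a: "a = a'" using n_pos by simp
  have "n*b = v * (u*a + D * v * b) + u*(u*b - a * v)"
   unfolding A[OF uv, symmetric] by (simp add: quad_def power2_eq_square algebra_simps)
  also have "... = n*b'" unfolding c r A[OF uv, symmetric] by (simp add: quad_def power2_eq_square algebra_simps)
  finally have "b = b'" using n_pos by simp
  thus "x = x'" using a x by simp
 qed
 have fin: "finite ({- n0..n0} \<times> (UNIV :: bool set))" by simp
 have "card A = card (?f ` A)" using inj by (simp add: card_image)
 also have "... <= card ({- n0..n0} \<times> (UNIV :: bool set))" by (rule card_mono[OF fin range])
 also have "... = nat (2*n0 + 1)*2" using n(2) by (simp add: card_cartesian_product)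
 also have "... = nat (2*(2*n0 + 1))" using n(2) by (simp add: nat_mult_distrib)
 finally show ?thesis using inj_on_finite[OF inj range fin] by simp
qed simp

lemma prime_power_dvd_one_factor:
 fixes a b :: int
 assumes p: "prime p" and d: "int p^k dvd a*b" and n: "~ (int p dvd a & int p dvd b)"
 shows "int p^k dvd a \<or> int p^k dvd b"
proof (cases "int p dvd a")
 case True
 hence "coprime (int p^k) b" using n p by (simp add: prime_imp_coprime coprime_power_left_iff)
 thus ?thesis using d by (simp add: coprime_dvd_mult_left_iff)
next
 case False
 hence "coprime (int p^k) a" using p by (simp add: prime_imp_coprime coprime_power_left_iff)
 thus ?thesis using d by (simp add: coprime_dvd_mult_right_iff)
qed

lemma dvd_if_prime_powers_dvd:
 fixes n :: nat and x :: int
 assumes "n > 0" "!!p. p \<in> prime_factors n ==> int p^multiplicity p n dvd x"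
 shows "int n dvd x"
proof -
 have "(\<Prod>p\<in>S. int p^multiplicity p n) dvd x" if "finite S" "S <= prime_factors n" for S
  using that
 proof (induction S rule: finite_induct)
  case (insert p S)
  have "coprime (int p^multiplicity p n) (\<Prod>p\<in>S. int p^multiplicity p n)"
  proof (rule prod_coprime_right)
   fix r assume r: "r \<in> S"
   have "prime p" "prime r" "p ~= r" using insert r by auto
   hence "coprime p r" by (rule primes_coprime)
   hence "coprime (int p) (int r)" by simp
   thus "coprime (int p^multiplicity p n) (int r^multiplicity r n)"
    by (simp add: coprime_power_left_iff coprime_power_right_iff)
  qed
  moreover have "int p^multiplicity p n dvd x" "(\<Prod>p\<in>S. int p^multiplicity p n) dvd x"
   using insert assms(2) by auto
  ultimately show ?case using insert.hyps by (simp add: divides_mult)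
 qed simp
 from this[of "prime_factors n"] have "(\<Prod>p\<in>prime_factors n. int p^multiplicity p n) dvd x" by simp
 moreover have "(\<Prod>p\<in>prime_factors n. int p^multiplicity p n) = int n"
 proof -
  have "(\<Prod>p\<in>prime_factors n. int p^multiplicity p n) = int (\<Prod>p\<in>prime_factors n. p^multiplicity p n)" by simp
  also have "... = int n" by (rule arg_cong[OF prime_factorization_nat[OF assms(1), symmetric]])
  finally show ?thesis .
 qed
 ultimately show ?thesis by simp
qed

lemma card_primitive_representations:
 fixes D n n0 :: int and n1 :: nat
 assumes D: "D > 0" and n: "n = n0*int n1" "n0 > 0" "n1 > 0"
  and co: "!!p. p \<in> prime_factors n1 ==> p > 2 & ~ int p dvd D"
  and A: "!!u v. (u, v) \<in> A ==> quad D u v = n & (\<forall>p\<in>prime_factors n1. ~ (int p dvd u & int p dvd v))"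
 shows "finite A & card A <= 2^card (prime_factors n1)*nat (2*(2*n0 + 1))"
proof (cases "A = {}")
 case False
 then obtain u v where uv: "(u, v) \<in> A" by auto
 \<comment> \<open>The primes at which the ratio of (a, b) agrees with that of the fixed (u, v), to
   the full power of p in n1; at the others it is the opposite ratio.\<close>
 define J where "J = (%(a, b). {p\<in>prime_factors n1. int p^multiplicity p n1 dvd u*b - a * v})"
 have pf: "prime p" "prime (int p)" "int p dvd int n1" if "p \<in> prime_factors n1" for p using that by auto
 have nv: "~ int p dvd b" "~ int p dvd a" if ab: "(a, b) \<in> A" and p: "p \<in> prime_factors n1" for a b p
 proof -
  have dn: "int p dvd a*a + D*(b*b)"
   using A[OF ab] pf(3)[OF p] n(1) by (simp add: quad_def power2_eq_square)
  show "~ int p dvd b"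
  proof
   assume b: "int p dvd b"
   hence "int p dvd a*a" using dn by (simp add: dvd_add_left_iff)
   hence "int p dvd a" using pf(2)[OF p] by (simp add: prime_dvd_mult_iff)
   thus False using A[OF ab] b p by blast
  qed
  show "~ int p dvd a"
  proof
   assume a: "int p dvd a"
   hence "int p dvd D*(b*b)" using dn by (simp add: dvd_add_right_iff)
   hence "int p dvd b" using pf(2)[OF p] co[OF p] by (simp add: prime_dvd_mult_iff)
   thus False using A[OF ab] a p by blast
  qed
 qed
 have pow: "int p^multiplicity p n1 dvd n" for p
 proof -
  have "int (p^multiplicity p n1) dvd int n1" by (simp only: of_nat_dvd_iff multiplicity_dvd)
  thus ?thesis by (simp add: n(1))
 qed
 \<comment> \<open>The full power of p divides the product of u*b - a*v and u*b + a*v; since p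
   divides at most one of the factors, that factor takes all of it.\<close>
 have opp: "int p^multiplicity p n1 dvd u*b + a * v"
  if ab: "(a, b) \<in> A" and p: "p \<in> prime_factors n1" and nd: "~ int p^multiplicity p n1 dvd u*b - a * v" for a b p
 proof -
  have e: "(u*b - a * v)*(u*b + a * v) = quad D u v * b^2 - quad D a b * v^2"
   by (simp add: quad_def power2_eq_square algebra_simps)
  have "int p^multiplicity p n1 dvd n*b^2 - n * v^2" by (intro dvd_diff dvd_mult2 pow)
  hence "int p^multiplicity p n1 dvd (u*b - a * v)*(u*b + a * v)"
   unfolding e using A[OF ab] A[OF uv] by simp
  moreover have "~ (int p dvd u*b - a * v & int p dvd u*b + a * v)"
  proof (rule notI, elim conjE)
   assume "int p dvd u*b - a * v" "int p dvd u*b + a * v"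
   hence "int p dvd (u*b - a * v) + (u*b + a * v)" by (rule dvd_add)
   hence "int p dvd 2*(u*b)" by (simp add: mult.commute)
   moreover have "~ int p dvd 2" using co[OF p] zdvd_not_zless[of 2 "int p"] by auto
   ultimately show False using nv(1)[OF ab p] nv(2)[OF uv p] pf(2)[OF p] by (simp add: prime_dvd_mult_iff)
  qed
  ultimately show ?thesis using prime_power_dvd_one_factor[OF pf(1)[OF p]] nd by blast
 qed
 have fib: "finite {x\<in>A. J x = S} & card {x\<in>A. J x = S} <= nat (2*(2*n0 + 1))" for S
 proof (rule card_fibre_representations[OF D n(1,2)])
  show "int n1 > 0" using n(3) by simp
  fix a b assume "(a, b) \<in> {x\<in>A. J x = S}"
  thus "quad D a b = n" using A by blast
 next
  fix a b a' b' assume h: "(a, b) \<in> {x\<in>A. J x = S}" "(a', b') \<in> {x\<in>A. J x = S}"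
  show "int n1 dvd a*b' - a'*b"
  proof (rule dvd_if_prime_powers_dvd[OF n(3)])
   fix p assume p: "p \<in> prime_factors n1"
   let ?q = "int p^multiplicity p n1"
   have same: "?q dvd u*b - a * v \<longleftrightarrow> ?q dvd u*b' - a' * v"
   proof -
    have "p \<in> J (a, b) \<longleftrightarrow> p \<in> J (a', b')" using h by simp
    thus ?thesis using p by (simp add: J_def)
   qed
   \<comment> \<open>With equal or with opposite ratios alike, combining the two relations with
     coefficients b and b' eliminates u and leaves v times the cross product; v is prime to
     p.\<close>
   have "?q dvd v * (a*b' - a'*b)"
   proof (cases "?q dvd u*b - a * v")
    case True
    hence t: "?q dvd u*b - a * v" "?q dvd u*b' - a' * v" using same by blast+
    have "?q dvd b*(u*b' - a' * v) - b'*(u*b - a * v)" by (rule dvd_diff[OF dvd_mult[OF t(2)] dvd_mult[OF t(1)]])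
    also have "... = v * (a*b' - a'*b)" by (simp add: algebra_simps)
    finally show ?thesis .
   next
    case False
    have m: "(a, b) \<in> A" "(a', b') \<in> A" using h by simp_all
    have t: "?q dvd u*b + a * v" by (rule opp[OF m(1) p False])
    have t': "?q dvd u*b' + a' * v" by (rule opp[OF m(2) p]) (use False same in blast)
    have "?q dvd b'*(u*b + a * v) - b*(u*b' + a' * v)" by (rule dvd_diff[OF dvd_mult[OF t] dvd_mult[OF t']])
    also have "... = v * (a*b' - a'*b)" by (simp add: algebra_simps)
    finally show ?thesis .
   qed
   moreover have "coprime ?q v" using nv(1)[OF uv p] pf[OF p] by (simp add: prime_imp_coprime coprime_power_left_iff)
   ultimately show "?q dvd a*b' - a'*b" by (simp add: coprime_dvd_mult_right_iff)
  qed
 qed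
 have union: "A = (\<Union>S\<in>Pow (prime_factors n1). {x\<in>A. J x = S})"
 proof -
  have "J x \<in> Pow (prime_factors n1)" for x unfolding J_def by (cases x) simp
  thus ?thesis by blast
 qed
 have finP: "finite (Pow (prime_factors n1))" by simp
 have "finite (\<Union>S\<in>Pow (prime_factors n1). {x\<in>A. J x = S})" using fib by (intro finite_UN_I finP) blast
 hence finA: "finite A" using union by simp
 have "card A = card (\<Union>S\<in>Pow (prime_factors n1). {x\<in>A. J x = S})" using union by simp
 also have "... <= (\<Sum>S\<in>Pow (prime_factors n1). card {x\<in>A. J x = S})" by (rule card_UN_le[OF finP])
 also have "... <= (\<Sum>S\<in>Pow (prime_factors n1). nat (2*(2*n0 + 1)))" using fib by (intro sum_mono) blast
 also have "... = 2^card (prime_factors n1)*nat (2*(2*n0 + 1))" by (simp add: card_Pow)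
 finally show ?thesis using finA by blast
qed simp

text \<open>A crude bound in place of lifting solutions. At each point some coordinate is a unit
  modulo p, and for a fixed other coordinate its square is determined, which leaves at most two
  values. Each of the two cases has at most 2*p^k points.\<close>

lemma card_conic_prime_power:
 fixes D c :: int
 assumes p: "prime p" "p > 2" "~ int p dvd D" "~ int p dvd c"
 shows "card (conic_pts D c (p^k)) <= 4*p^k"
proof -
 let ?n = "p^k" and ?N = "int (p^k)"
 have pp: "prime (int p)" using p(1) by simp
 have n0: "?n > 0" using p(1) by (simp add: prime_gt_0_nat)
 have two: "~ int p dvd 2" using p(2) zdvd_not_zless[of 2 "int p"] by auto
 have pair: "x = y \<or> x = (- y) mod ?N"
  if xy: "x \<in> {0..<?N}" "y \<in> {0..<?N}" "~ int p dvd y" "?N dvd x\<^sup>2 - y^2" for x y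
 proof -
  have "int p^k dvd (x - y)*(x + y)" using xy(4) by (simp add: power2_eq_square algebra_simps)
  moreover have "~ (int p dvd x - y & int p dvd x + y)"
  proof (rule notI, elim conjE)
   assume a: "int p dvd x - y" and b: "int p dvd x + y"
   have "int p dvd (x + y) - (x - y)" by (rule dvd_diff[OF b a])
   hence "int p dvd 2*y" by simp
   thus False using two xy(3) pp by (simp add: prime_dvd_mult_iff)
  qed
  ultimately have "?N dvd x - y \<or> ?N dvd x - (- y)" using prime_power_dvd_one_factor[OF p(1)] by simp
  thus ?thesis
  proof
   assume "?N dvd x - y" thus ?thesis using residue_eq xy by blast
  next
   assume "?N dvd x - (- y)"
   hence "x mod ?N = (- y) mod ?N" by (simp only: mod_eq_dvd_iff)
   thus ?thesis using xy(1) by simp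
  qed
 qed
 have fib: "card X <= 2" if X: "X <= {0..<?N}" "!!x y. x \<in> X ==> y \<in> X ==> ~ int p dvd y & ?N dvd x\<^sup>2 - y^2" for X
 proof (cases "X = {}")
  case False
  then obtain y where y: "y \<in> X" by blast
  have "X <= {y, (- y) mod ?N}" using pair X y by blast
  hence "card X <= card {y, (- y) mod ?N}" by (intro card_mono) auto
  also have "... <= 2" by (simp add: card_insert_if)
  finally show ?thesis .
 qed simp
 let ?A = "SIGMA v:{0..<?N}. {u\<in>{0..<?N}. ~ int p dvd u & ?N dvd quad D u v - c}"
 let ?B = "SIGMA u:{0..<?N}. {v\<in>{0..<?N}. ~ int p dvd v & ?N dvd quad D u v - c}"
 show ?thesis
 proof (cases "k = 0")
  case True
  have "conic_pts D c (p^k) <= {(0, 0)}" using True by (auto simp: conic_pts_def)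
  hence "card (conic_pts D c (p^k)) <= card {(0::int, 0::int)}" by (intro card_mono) auto
  thus ?thesis using True by simp
 next
  case False
  hence pN: "int p dvd ?N" by simp
  have sub: "conic_pts D c (p^k) <= (%(v, u). (u, v)) ` ?A \<union> ?B"
  proof (rule subsetI)
   fix x assume "x \<in> conic_pts D c (p^k)"
   then obtain u v where x: "x = (u, v)" and uv: "u \<in> {0..<?N}" "v \<in> {0..<?N}" "?N dvd quad D u v - c"
    by (auto simp: conic_pts_def)
   show "x \<in> (%(v, u). (u, v)) ` ?A \<union> ?B"
   proof (cases "int p dvd u")
    case True
    have "~ int p dvd v"
    proof
     assume "int p dvd v"
     hence "int p dvd quad D u v" using True by (simp add: quad_def power2_eq_square)
     moreover have "int p dvd quad D u v - c" using uv(3) pN dvd_trans by blast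
     ultimately have "int p dvd quad D u v - (quad D u v - c)" by (rule dvd_diff)
     thus False using p(4) by simp
    qed
    thus ?thesis using uv x by simp
   next
    case False
    hence "(v, u) \<in> ?A" using uv by simp
    hence "x \<in> (%(v, u). (u, v)) ` ?A" unfolding x by (intro image_eqI[of _ _ "(v, u)"]) simp_all
    thus ?thesis by blast
   qed
  qed
  have fA: "finite ?A" and fB: "finite ?B" by (rule finite_SigmaI, simp, rule finite_residue_filter)+
  have "card ?A = (\<Sum>v\<in>{0..<?N}. card {u\<in>{0..<?N}. ~ int p dvd u & ?N dvd quad D u v - c})"
   by (rule card_SigmaI, simp, rule ballI, rule finite_residue_filter)
  also have "... <= (\<Sum>v\<in>{0..<?N}. 2)"
  proof (rule sum_mono, rule fib)
   fix v x y assume h: "x \<in> {u\<in>{0..<?N}. ~ int p dvd u & ?N dvd quad D u v - c}" "y \<in> {u\<in>{0..<?N}. ~ int p dvd u & ?N dvd quad D u v - c}"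
   hence a: "?N dvd quad D x v - c" "?N dvd quad D y v - c" by simp_all
   have "?N dvd (quad D x v - c) - (quad D y v - c)" by (rule dvd_diff[OF a])
   thus "~ int p dvd y & ?N dvd x\<^sup>2 - y^2" using h by (simp add: quad_def)
  qed auto
  also have "... = 2 * ?n" by (simp add: nat_power_eq)
  finally have cA: "card ?A <= 2 * ?n" .
  have "card ?B = (\<Sum>u\<in>{0..<?N}. card {v\<in>{0..<?N}. ~ int p dvd v & ?N dvd quad D u v - c})"
   by (rule card_SigmaI, simp, rule ballI, rule finite_residue_filter)
  also have "... <= (\<Sum>u\<in>{0..<?N}. 2)"
  proof (rule sum_mono, rule fib)
   fix u x y assume h: "x \<in> {v\<in>{0..<?N}. ~ int p dvd v & ?N dvd quad D u v - c}" "y \<in> {v\<in>{0..<?N}. ~ int p dvd v & ?N dvd quad D u v - c}"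
   hence a: "?N dvd quad D u x - c" "?N dvd quad D u y - c" by simp_all
   have "?N dvd (quad D u x - c) - (quad D u y - c)" by (rule dvd_diff[OF a])
   also have "... = D*(x^2 - y^2)" by (simp add: quad_def algebra_simps)
   finally have "int p^k dvd D*(x^2 - y^2)" by simp
   moreover have "coprime (int p^k) D" using p(3) pp by (simp add: prime_imp_coprime coprime_power_left_iff)
   ultimately have "?N dvd x\<^sup>2 - y^2" by (simp add: coprime_dvd_mult_right_iff)
   thus "~ int p dvd y & ?N dvd x\<^sup>2 - y^2" using h by simp
  qed auto
  also have "... = 2 * ?n" by (simp add: nat_power_eq)
  finally have cB: "card ?B <= 2 * ?n" .
  have "card (conic_pts D c (p^k)) <= card ((%(v, u). (u, v)) ` ?A \<union> ?B)"
   using fA fB by (intro card_mono sub) simp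
  also have "... <= card ((%(v, u). (u, v)) ` ?A) + card ?B" by (rule card_Un_le)
  also have "card ((%(v, u). (u, v)) ` ?A) <= card ?A" using fA by (rule card_image_le)
  finally show ?thesis using cA cB by simp
 qed
qed

section \<open>The ring of integers\<close>

text \<open>Coordinates are doubled so that one description serves all residues of D modulo 4: the
  ring consists of the elements with \<open>4 dvd norm4 D X Y\<close>, and \<open>norm4\<close> is
  four times the norm.\<close>

definition half_lattice :: "int => int => int => complex" where
 "half_lattice D X Y = Complex (of_int X/2) (of_int Y/2 * sqrt (of_int D))"

definition norm4 :: "int => int => int => int" where "norm4 D X Y = X^2 + D*Y^2"

lemma half_lattice_add: "half_lattice D X Y + half_lattice D X' Y' = half_lattice D (X + X') (Y + Y')"
 by (simp add: half_lattice_def complex_eq_iff add_divide_distrib algebra_simps)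

lemma field_norm_half_lattice: "D >= 0 ==> field_norm (half_lattice D X Y) = of_int (norm4 D X Y)/4"
 by (simp add: field_norm_def half_lattice_def norm4_def power2_eq_square field_simps)

lemma square_mod_4: "(x::int)^2 mod 4 = (if even x then 0 else 1)"
proof -
 have "x mod 4 = 0 \<or> x mod 4 = 1 \<or> x mod 4 = 2 \<or> x mod 4 = 3" by presburger
 moreover have "x^2 mod 4 = (x mod 4)^2 mod 4" by (simp add: power_mod)
 moreover have "even x \<longleftrightarrow> even (x mod 4)" by presburger
 ultimately show ?thesis by auto
qed

lemma norm4_dvd_iff:
 assumes "~ 4 dvd D"
 shows "4 dvd norm4 D X Y \<longleftrightarrow> (even X \<longleftrightarrow> even Y) & (D mod 4 ~= 3 --> even X)"
proof -
 define r where "r = D mod 4"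
 have main: "norm4 D X Y mod 4 = (X^2 mod 4 + (D mod 4)*(Y^2 mod 4)) mod 4"
 proof -
  have "[X^2 + D*Y^2 = X^2 mod 4 + (D mod 4)*(Y^2 mod 4)] (mod 4)"
   by (intro cong_add cong_mult) (simp_all add: cong_def)
  thus ?thesis by (simp only: norm4_def cong_def)
 qed
 have "r = 1 \<or> r = 2 \<or> r = 3" using assms unfolding r_def by presburger
 thus ?thesis unfolding dvd_eq_mod_eq_0 main square_mod_4 r_def[symmetric]
  by (elim disjE) (simp_all split: if_split)
qed

text \<open>The parity conditions make both coordinates of the product even, and multiplicativity of
  \<open>norm4\<close> then returns the divisibility by 4.\<close>

lemma half_lattice_mult:
 assumes "~ 4 dvd D" "D >= 0" "4 dvd norm4 D X Y" "4 dvd norm4 D X' Y'"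
 obtains X'' Y'' where "half_lattice D X Y*half_lattice D X' Y' = half_lattice D X'' Y''"
  "4 dvd norm4 D X'' Y''" "norm4 D X'' Y'' = norm4 D X Y*norm4 D X' Y' div 4"
proof -
 have par: "(even X \<longleftrightarrow> even Y) & (D mod 4 ~= 3 --> even X)" "(even X' \<longleftrightarrow> even Y') & (D mod 4 ~= 3 --> even X')"
  using assms norm4_dvd_iff by blast+
 have Dodd: "D mod 4 = 3 ==> odd D" by presburger
 have e: "even (X*X' - D*Y*Y')" "even (X*Y' + X'*Y)"
  using par Dodd by (cases "D mod 4 = 3"; cases "even X"; cases "even X'"; auto)+
 obtain A where A: "X*X' - D*Y*Y' = 2*A" using e(1) by (rule evenE)
 obtain B where B: "X*Y' + X'*Y = 2*B" using e(2) by (rule evenE)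
 note AB = A B
 have "norm4 D (X*X' - D*Y*Y') (X*Y' + X'*Y) = norm4 D X Y*norm4 D X' Y'"
  by (simp add: norm4_def power2_eq_square algebra_simps)
 hence n: "4*norm4 D A B = norm4 D X Y*norm4 D X' Y'" unfolding AB by (simp add: norm4_def power2_eq_square algebra_simps)
 obtain k l where kl: "norm4 D X Y = 4 * k" "norm4 D X' Y' = 4*l" using assms(3,4) by (auto elim!: dvdE)
 have "norm4 D A B = 4*(k*l)" using n kl by simp
 hence d: "4 dvd norm4 D A B" by simp
 have "half_lattice D X Y*half_lattice D X' Y' = half_lattice D A B"
 proof -
  have s: "sqrt (of_int D) * sqrt (of_int D) = of_int D" using assms(2) by simp
  have "of_int X * of_int X' - of_int D * of_int Y * of_int Y' = 2*(of_int A :: real)"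
     "of_int X * of_int Y' + of_int X' * of_int Y = 2*(of_int B :: real)"
   using arg_cong[OF AB(1), of real_of_int] arg_cong[OF AB(2), of real_of_int] by simp_all
  hence a: "of_int A = (of_int X * of_int X' - of_int D * of_int Y * of_int Y')/(2::real)"
   and b: "of_int B = (of_int X * of_int Y' + of_int X' * of_int Y)/(2::real)" by simp_all
  have "(of_int Y/2 * sqrt (of_int D))*(of_int Y'/2 * sqrt (of_int D)) = of_int Y * of_int Y'*(sqrt (of_int D) * sqrt (of_int D))/(4::real)"
   by simp
  thus ?thesis unfolding half_lattice_def complex_eq_iff a b using assms(2) by (simp add: s field_simps)
 qed
 moreover have "norm4 D A B = norm4 D X Y*norm4 D X' Y' div 4" using n by simp
 ultimately show ?thesis using that d by blast
qed

locale imag_quad =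
 fixes d D :: int
 assumes d_neg: "d < 0" and sqf: "squarefree d" and D_def: "D = - d"
begin

lemma D_pos: "D > 0" using d_neg D_def by simp

lemma square_dvd_D: "(x::int)^2 dvd D ==> x = 1 \<or> x = -1"
 using sqf unfolding squarefree_def D_def by (auto simp: zdvd1_eq)

lemma not_4_dvd: "~ 4 dvd D"
 using square_dvd_D[of 2] by auto

lemma half_lattice_in_ring:
 assumes "4 dvd norm4 D X Y" shows "half_lattice D X Y \<in> ring_of_integers d"
proof -
 obtain N where N: "norm4 D X Y = 4*N" using assms by (auto elim: dvdE)
 let ?z = "half_lattice D X Y"
 have "?z \<in> imag_quad_field d"
  unfolding imag_quad_field_def
 proof (rule CollectI, intro exI conjI TrueI)
  show "?z = of_real (of_rat (of_int X/2)) + of_real (of_rat (of_int Y/2))*\<i> * of_real (sqrt (of_int (- d)))"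
   by (simp add: half_lattice_def complex_eq_iff D_def of_rat_divide)
 qed
 moreover have "algebraic_int ?z"
 proof (rule algebraic_int.intros)
  let ?p = "[:of_int N, - of_int X, 1:] :: complex poly"
  show "lead_coeff ?p = 1" by simp
  show "\<forall>i. Polynomial.coeff ?p i \<in> \<int>"
   by (simp add: coeff_pCons split: nat.split)
  have "real_of_int X*real_of_int X + real_of_int D*(real_of_int Y*real_of_int Y) = 4*real_of_int N"
   using arg_cong[OF N, of real_of_int] by (simp add: norm4_def power2_eq_square)
  moreover have "sqrt (real_of_int D) * sqrt (real_of_int D) = real_of_int D" using D_pos by simp
  moreover have "(of_int Y/2 * sqrt (of_int D))*(of_int Y/2 * sqrt (of_int D)) = of_int Y * of_int Y*(sqrt (of_int D) * sqrt (of_int D))/(4::real)"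
   by simp
  ultimately show "poly ?p ?z = 0" by (simp add: half_lattice_def complex_eq_iff field_simps)
 qed
 ultimately show ?thesis by (simp add: ring_of_integers_def)
qed

lemma rational_square_int:
 fixes r :: rat assumes "of_int D*r^2 \<in> \<int>" shows "r \<in> \<int>"
proof -
 obtain s t where q: "quotient_of r = (s, t)" by (cases "quotient_of r")
 have st: "r = of_int s / of_int t" "t > 0" "coprime s t"
  using quotient_of_div[OF q] quotient_of_denom_pos[OF q] quotient_of_coprime[OF q] by auto
 obtain k where k: "of_int D*r^2 = of_int k" using assms by (auto elim: Ints_cases)
 have "(of_int (D * s^2) :: rat) = of_int (k*t^2)" using k st by (simp add: power_divide field_simps)
 hence "D * s^2 = k*t^2" by (simp only: of_int_eq_iff)
 hence "t^2 dvd D * s^2" by simp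
 moreover have "coprime (t^2) (s^2)" using st(3) by (simp add: coprime_commute)
 ultimately have "t^2 dvd D" by (simp add: coprime_dvd_mult_left_iff)
 hence "t = 1" using square_dvd_D[of t] st(2) by auto
 thus ?thesis using st(1) by simp
qed

text \<open>The primitive integral quadratic polynomial of a non-real element divides every monic integral
 polynomial vanishing there, hence is itself monic by comparing contents.\<close>
lemma quadratic_alg_int:
 fixes z :: complex and a b c :: int
 assumes alg: "algebraic_int z" and im: "Im z ~= 0" and c: "c > 0"
  and root: "of_int c*z^2 + of_int a*z + of_int b = 0"
 shows "c dvd a & c dvd b"
proof -
 obtain P where P: "poly (map_poly of_int P) z = 0" "lead_coeff P = 1"
  using alg unfolding algebraic_int_altdef_ipoly by blast
 define F0 where "F0 = [:b, a, c:]"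
 define F where "F = primitive_part F0"
 have F0: "F0 ~= 0" "content F0 ~= 0" using c by (simp_all add: F0_def)
 have smF: "Polynomial.smult (content F0) F = F0" by (simp add: F_def)
 have cF: "content F = 1" unfolding F_def using F0 by (intro content_primitive_part) auto
 have degF: "Polynomial.degree F = 2"
 proof -
  have "Polynomial.degree F0 = Polynomial.degree F" using smF F0(2) by (metis degree_smult_eq)
  thus ?thesis using c by (simp add: F0_def)
 qed
 have F00: "poly (map_poly of_int F0) z = 0"
  using root by (simp add: F0_def map_poly_pCons algebra_simps power2_eq_square)
 have mapsm: "map_poly of_int (Polynomial.smult x A) = Polynomial.smult (of_int x) (map_poly of_int A :: complex poly)" for x A
  by (intro poly_eqI) (simp add: coeff_map_poly)
 have "map_poly of_int F0 = (map_poly of_int (Polynomial.smult (content F0) F) :: complex poly)"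
  by (simp only: smF)
 hence "map_poly of_int F0 = Polynomial.smult (of_int (content F0)) (map_poly of_int F :: complex poly)"
  by (simp only: mapsm)
 hence Fz: "poly (map_poly of_int F) z = 0" using F00 F0(2) by simp
 have Fn: "F ~= 0" using degF by auto
 \<comment> \<open>Pseudo-division stays over the integers; the remainder is at most linear and
   vanishes at the non-real z, so it will be zero.\<close>
 obtain e q where e: "e ~= 0" "Polynomial.smult e P = F*q + pseudo_mod P F" using pseudo_mod(1)[OF Fn] by blast
 define R where "R = pseudo_mod P F"
 have mapadd: "map_poly of_int (A + B) = map_poly of_int A + (map_poly of_int B :: complex poly)" for A B
  by (intro poly_eqI) (simp add: coeff_map_poly)
 have mapmult: "map_poly of_int (A*B) = map_poly of_int A*(map_poly of_int B :: complex poly)" for A B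
  by (intro poly_eqI) (simp add: coeff_map_poly coeff_mult)
 have "poly (map_poly of_int (Polynomial.smult e P)) z = 0" using P(1) by (simp add: mapsm)
 hence Rz: "poly (map_poly of_int R) z = 0" using Fz unfolding e(2) R_def by (simp add: mapadd mapmult)
 have "R = 0"
 proof (rule ccontr)
  assume "R ~= 0"
  hence "Polynomial.degree R < 2" using pseudo_mod(2)[OF Fn, of P] degF by (auto simp: R_def)
  hence R: "R = [:Polynomial.coeff R 0, Polynomial.coeff R 1:]"
   by (intro poly_eqI) (auto simp: coeff_pCons coeff_eq_0 split: nat.split)
  have "poly (map_poly of_int [:Polynomial.coeff R 0, Polynomial.coeff R 1:]) z = (of_int (Polynomial.coeff R 0) + of_int (Polynomial.coeff R 1)*z :: complex)"
   by (simp add: map_poly_pCons)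
  hence eq: "of_int (Polynomial.coeff R 0) + of_int (Polynomial.coeff R 1)*z = (0::complex)" using Rz R by simp
  hence "Im (of_int (Polynomial.coeff R 0) + of_int (Polynomial.coeff R 1)*z) = 0" by simp
  hence "Polynomial.coeff R 1 = 0" using im by simp
  hence "Polynomial.coeff R 0 = 0" using eq by simp
  hence "R = 0" using R \<open>Polynomial.coeff R 1 = 0\<close> by simp
  thus False using \<open>R ~= 0\<close> by blast
 qed
 hence eP: "Polynomial.smult e P = F*q" using e(2) R_def by simp
 have "content P dvd lead_coeff P" by (rule content_dvd_coeff)
 hence "content P dvd 1" unfolding P(2) .
 hence "normalize (content P) = 1" by (rule is_unit_normalize)
 hence cP: "content P = 1" by (simp only: normalize_content)
 \<comment> \<open>Gauss's lemma: F and P have content 1, so the multiplier e divides q and can be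
   cancelled.\<close>
 have "content (Polynomial.smult e P) = content (F*q)" by (simp only: eP)
 hence cq: "content q = \<bar>e\<bar>" by (simp add: content_mult cF cP)
 hence "e dvd content q" by simp
 hence "[:e:] dvd q" by (simp add: const_poly_dvd_iff_dvd_content)
 then obtain q' where q': "q = Polynomial.smult e q'" by (auto elim!: dvdE)
 have "Polynomial.smult e P = Polynomial.smult e (F*q')" using eP q' by simp
 hence "Polynomial.smult e (P - F*q') = 0" by (simp add: smult_diff_right)
 hence "P = F*q'" using e(1) by (simp add: smult_eq_0_iff)
 hence "1 = lead_coeff F*lead_coeff q'" using P(2) by (simp add: lead_coeff_mult)
 hence "lead_coeff F dvd 1" by (metis dvd_triv_left)
 hence u: "lead_coeff F = 1 \<or> lead_coeff F = -1" by (auto simp: abs_if split: if_splits)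
 have "c = content F0*lead_coeff F"
 proof -
  have "Polynomial.coeff F0 2 = content F0*Polynomial.coeff F 2" using arg_cong[OF smF, of "%p. Polynomial.coeff p 2"] by simp
  thus ?thesis using degF by (simp add: F0_def numeral_2_eq_2)
 qed
 hence "c dvd content F0" using u by auto
 moreover have "content F0 dvd Polynomial.coeff F0 0" "content F0 dvd Polynomial.coeff F0 1" by (rule content_dvd_coeff)+
 ultimately show ?thesis by (auto simp: F0_def intro: dvd_trans)
qed

text \<open>Clearing the denominators of trace and norm gives an integral quadratic equation, and
  \<open>quadratic_alg_int\<close> makes both integers. Then D*(2*q)^2 is an integer, and
  squarefreeness of D passes this on to 2*q.\<close>

lemma ring_cases:
 assumes "z \<in> ring_of_integers d"
 obtains X Y where "z = half_lattice D X Y" "4 dvd norm4 D X Y"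
proof -
 have alg: "algebraic_int z" using assms by (simp add: ring_of_integers_def)
 obtain p q where z: "z = of_real (of_rat p) + of_real (of_rat q)*\<i> * of_real (sqrt (of_int D))"
  using assms by (auto simp: ring_of_integers_def imag_quad_field_def D_def)
 show ?thesis
 proof (cases "q = 0")
  case True
  hence z': "z = of_real (real_of_rat p)" using z by simp
  hence "algebraic_int (real_of_rat p)" using alg by simp
  hence "real_of_rat p \<in> \<int>" by (rule rational_algebraic_int_is_int) simp
  then obtain n where "real_of_rat p = of_int n" by (auto elim: Ints_cases)
  hence n: "z = of_int n" using z' by simp
  show ?thesis
   by (rule that[of "2*n" 0]) (simp_all add: n half_lattice_def complex_eq_iff norm4_def power2_eq_square)
 next
  case False
  obtain a b where ab: "quotient_of (- 2*p) = (a, b)" by (cases "quotient_of (- 2*p)")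
  obtain a' b' where ab': "quotient_of (p^2 + of_int D*q^2) = (a', b')" by (cases "quotient_of (p^2 + of_int D*q^2)")
  have b0: "b > 0" "b' > 0" using quotient_of_denom_pos ab ab' by blast+
  have tr: "- 2*p = of_int a / of_int b" and nm: "p^2 + of_int D*q^2 = of_int a' / of_int b'"
   using quotient_of_div[OF ab] quotient_of_div[OF ab'] by auto
  have im: "Im z ~= 0" using False D_pos by (simp add: z)
  have tr': "- 2*real_of_rat p = of_int a / of_int b"
   using arg_cong[OF tr, of real_of_rat] by (simp add: of_rat_mult of_rat_divide of_rat_minus)
  have nm': "(real_of_rat p)^2 + of_int D*(real_of_rat q)^2 = of_int a' / of_int b'"
   using arg_cong[OF nm, of real_of_rat] by (simp add: of_rat_mult of_rat_divide of_rat_add of_rat_power)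
  have s: "sqrt (real_of_int D) * sqrt (real_of_int D) = real_of_int D" using D_pos by simp
  have q2: "(x * sqrt (real_of_int D))*(x * sqrt (real_of_int D)) = real_of_int D*x^2" for x
   using s by (simp add: power2_eq_square)
  have "z^2 + of_real (- 2 * of_rat p)*z + of_real ((of_rat p)^2 + of_int D*(of_rat q)^2) = 0"
   unfolding z complex_eq_iff power2_eq_square[of "_ + _"] using D_pos by (simp add: q2 power2_eq_square algebra_simps)
  hence eq0: "z^2 + of_real (of_int a / of_int b)*z + of_real (of_int a' / of_int b') = 0"
   unfolding tr' nm' .
  have "of_int (b*b')*(z^2 + of_real (of_int a / of_int b)*z + of_real (of_int a' / of_int b'))
    = of_int (b*b')*z^2 + of_int (a*b')*z + of_int (a'*b)"
   using b0 by (simp add: field_simps)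
  hence root: "of_int (b*b')*z^2 + of_int (a*b')*z + of_int (a'*b) = (0::complex)" unfolding eq0 by simp
  have "b*b' dvd a*b' & b*b' dvd a'*b"
   by (rule quadratic_alg_int[OF alg im _ root]) (use b0 in simp)
  hence "b dvd a" "b' dvd a'" using b0 by (auto simp: mult.commute)
  then obtain X N where X: "a = b*X" and N: "a' = b'*N" by (auto elim!: dvdE)
  have p: "2*p = of_int (- X)" using tr X b0 by (simp add: field_simps)
  have n: "p^2 + of_int D*q^2 = of_int N" using nm N b0 by simp
  have "of_int D*(2*q)^2 = 4*(p^2 + of_int D*q^2) - (2*p)^2" by (simp add: power2_eq_square algebra_simps)
  also have "... = of_int (4*N - (- X)^2)" unfolding n p by simp
  finally have h: "of_int D*(2*q)^2 = of_int (4*N - (- X)^2)" .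
  hence "of_int D*(2*q)^2 \<in> \<int>" by (simp only: Ints_of_int)
  hence "2*q \<in> \<int>" by (rule rational_square_int)
  then obtain Y where Y: "2*q = of_int Y" by (auto elim: Ints_cases)
  have "(of_int (D*Y^2) :: rat) = of_int (4*N - (- X)^2)" using h unfolding Y by simp
  hence "D*Y^2 = 4*N - (- X)^2" by (simp only: of_int_eq_iff)
  hence d4: "4 dvd norm4 D (- X) Y" by (simp add: norm4_def)
  have "2*real_of_rat p = of_int (- X)" "2*real_of_rat q = of_int Y"
   using arg_cong[OF p, of real_of_rat] arg_cong[OF Y, of real_of_rat] by (simp_all add: of_rat_mult of_rat_minus)
  hence pq: "real_of_rat p = of_int (- X)/2" "real_of_rat q = of_int Y/2" by simp_all
  have "z = half_lattice D (- X) Y" unfolding z half_lattice_def complex_eq_iff by (simp add: pq)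
  thus ?thesis using that d4 by blast
 qed
qed

definition is_norm :: "int => bool" where "is_norm n \<longleftrightarrow> (\<exists>X Y. norm4 D X Y = 4*n)"

lemma bK_eq_1: "n > 0 ==> is_norm n ==> bK d n = 1"
proof -
 assume n: "n > 0" "is_norm n"
 then obtain X Y where XY: "norm4 D X Y = 4*n" by (auto simp: is_norm_def)
 have "field_norm (half_lattice D X Y) = of_int n" using D_pos XY by (simp add: field_norm_half_lattice)
 moreover have "half_lattice D X Y \<in> ring_of_integers d" using XY by (intro half_lattice_in_ring) simp
 ultimately show ?thesis using n by (auto simp: bK_def)
qed

lemma is_norm_mult: "is_norm m ==> is_norm n ==> is_norm (m*n)"
proof -
 assume "is_norm m" "is_norm n"
 then obtain X Y X' Y' where h: "norm4 D X Y = 4*m" "norm4 D X' Y' = 4*n" by (auto simp: is_norm_def)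
 obtain X'' Y'' where "norm4 D X'' Y'' = norm4 D X Y*norm4 D X' Y' div 4"
  using half_lattice_mult[OF not_4_dvd _, of X Y X' Y'] h D_pos by (metis dvd_triv_left less_imp_le)
 thus ?thesis unfolding h is_norm_def by (intro exI[of _ X''] exI[of _ Y'']) simp
qed

lemma is_norm_quad: "is_norm (u^2 + D * v^2)"
 unfolding is_norm_def norm4_def by (rule exI[of _ "2*u"], rule exI[of _ "2 * v"]) (simp add: power2_eq_square algebra_simps)

lemma is_norm_square: "is_norm (n^2)"
 using is_norm_quad[of n 0] by simp

end

section \<open>Class number one: norms of primes and possible discriminants\<close>

context imag_quad begin

abbreviation "OK == ring_of_integers d"

lemma half_lattice_inj: "half_lattice D X Y = half_lattice D X' Y' ==> X = X' & Y = Y'"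
 using D_pos by (auto simp: half_lattice_def complex_eq_iff)

lemma half_lattice_cnj: "cnj (half_lattice D X Y) = half_lattice D X (- Y)"
 by (simp add: half_lattice_def complex_eq_iff)

lemma half_lattice_norm: "half_lattice D X Y * cnj (half_lattice D X Y) = of_int (norm4 D X Y)/4"
proof -
 have "(of_int Y/2 * sqrt (of_int D))*(of_int Y/2 * sqrt (of_int D)) = of_int Y * of_int Y*(sqrt (of_int D) * sqrt (of_int D))/(4::real)"
  by simp
 thus ?thesis using D_pos by (simp add: half_lattice_def complex_eq_iff norm4_def power2_eq_square field_simps)
qed

lemma OK_cnj: "z \<in> OK ==> cnj z \<in> OK"
 by (elim ring_cases) (auto simp: half_lattice_cnj norm4_def intro!: half_lattice_in_ring)

lemma OK_add: assumes "z \<in> OK" "w \<in> OK" shows "z + w \<in> OK"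
proof -
 obtain X Y where 1: "z = half_lattice D X Y" "4 dvd norm4 D X Y" using ring_cases[OF assms(1)] by blast
 obtain X' Y' where 2: "w = half_lattice D X' Y'" "4 dvd norm4 D X' Y'" using ring_cases[OF assms(2)] by blast
 have "4 dvd norm4 D (X + X') (Y + Y')" using 1(2) 2(2) unfolding norm4_dvd_iff[OF not_4_dvd] by auto
 thus ?thesis unfolding 1(1) 2(1) half_lattice_add by (rule half_lattice_in_ring)
qed

lemma OK_mult: assumes "z \<in> OK" "w \<in> OK" shows "z*w \<in> OK"
proof -
 obtain X Y where 1: "z = half_lattice D X Y" "4 dvd norm4 D X Y" using ring_cases[OF assms(1)] by blast
 obtain X' Y' where 2: "w = half_lattice D X' Y'" "4 dvd norm4 D X' Y'" using ring_cases[OF assms(2)] by blast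
 have D0: "D >= 0" using D_pos by simp
 obtain X'' Y'' where "half_lattice D X Y*half_lattice D X' Y' = half_lattice D X'' Y''" "4 dvd norm4 D X'' Y''"
  using half_lattice_mult[OF not_4_dvd D0 1(2) 2(2)] by blast
 thus ?thesis unfolding 1(1) 2(1) using half_lattice_in_ring by simp
qed

lemma OK_of_int: "of_int n \<in> OK"
proof -
 have "of_int n = half_lattice D (2*n) 0" by (simp add: half_lattice_def complex_eq_iff)
 thus ?thesis by (simp add: half_lattice_in_ring norm4_def power2_eq_square)
qed

lemma OK_norm:
 assumes "z \<in> OK" obtains n where "z * cnj z = of_int n" "n >= 0" "is_norm n"
proof -
 obtain X Y where 1: "z = half_lattice D X Y" "4 dvd norm4 D X Y" using ring_cases[OF assms] by blast
 obtain n where n: "norm4 D X Y = 4*n" using 1(2) by (auto elim: dvdE)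
 have "norm4 D X Y >= 0" using D_pos by (simp add: norm4_def)
 thus ?thesis using that[of n] n by (simp add: 1(1) half_lattice_norm) (auto simp: is_norm_def)
qed

text \<open>The ideal generated by p and beta has a generator a, whose norm divides p^2. Norm 1
  would make the conjugate of beta a multiple of p, because p divides the norm of beta; norm p^2
  would make a an associate of p and hence beta a multiple of p. Both are excluded, so the norm is
  p.\<close>

lemma prime_divides_norm_is_norm:
 assumes cl: "class_number_one d" and p: "prime (p::nat)" and b: "\<beta> \<in> OK" "\<beta> * cnj \<beta> = of_int (int p*N)"
  and nb: "!!t. t \<in> OK ==> \<beta> ~= of_nat p*t" "!!t. t \<in> OK ==> cnj \<beta> ~= of_nat p*t"
 shows "is_norm (int p)"
proof -
 define I where "I = {of_nat p*r + \<beta> * s | r s. r \<in> OK & s \<in> OK}"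
 have pO: "of_nat p \<in> OK" using OK_of_int[of "int p"] by simp
 have O0: "0 \<in> OK" and O1: "1 \<in> OK" using OK_of_int[of 0] OK_of_int[of 1] by simp_all
 have "is_ideal OK I"
  unfolding is_ideal_def
 proof (intro conjI ballI subsetI)
  show "x \<in> OK" if "x \<in> I" for x using that unfolding I_def by (auto intro!: OK_add OK_mult pO b(1))
  show "0 \<in> I" unfolding I_def using O0 by force
  show "x + y \<in> I" if xy: "x \<in> I" "y \<in> I" for x y
  proof -
   obtain r s r' s' where h: "x = of_nat p*r + \<beta> * s" "y = of_nat p*r' + \<beta> * s'" "r \<in> OK" "s \<in> OK" "r' \<in> OK" "s' \<in> OK"
    using xy unfolding I_def by blast
   have "x + y = of_nat p*(r + r') + \<beta>*(s + s')" by (simp add: h algebra_simps)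
   thus ?thesis unfolding I_def using OK_add h by blast
  qed
  show "c*x \<in> I" if cx: "c \<in> OK" "x \<in> I" for c x
  proof -
   obtain r s where h: "x = of_nat p*r + \<beta> * s" "r \<in> OK" "s \<in> OK" using cx unfolding I_def by blast
   have "c*x = of_nat p*(c*r) + \<beta>*(c * s)" by (simp add: h algebra_simps)
   thus ?thesis unfolding I_def using OK_mult h cx by blast
  qed
 qed
 then obtain a where a: "a \<in> OK" "I = {a*r | r. r \<in> OK}"
  using cl unfolding class_number_one_def is_principal_ideal_def by blast
 have "of_nat p*1 + \<beta>*0 \<in> I" unfolding I_def using O0 O1 by blast
 then obtain r1 where r1: "of_nat p = a*r1" "r1 \<in> OK" using a(2) by auto
 have "of_nat p*0 + \<beta>*1 \<in> I" unfolding I_def using O0 O1 by blast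
 then obtain r2 where r2: "\<beta> = a*r2" "r2 \<in> OK" using a(2) by auto
 have aI: "a \<in> I" using a(2) O1 by force
 then obtain r s where rs: "a = of_nat p*r + \<beta> * s" "r \<in> OK" "s \<in> OK" unfolding I_def by blast
 obtain na where na: "a * cnj a = of_int na" "na >= 0" "is_norm na" using OK_norm[OF a(1)] by blast
 obtain nr where nr: "r1 * cnj r1 = of_int nr" "nr >= 0" using OK_norm[OF r1(2)] by blast
 have "(of_int (na*nr) :: complex) = (a*r1) * cnj (a*r1)" by (simp add: na(1)[symmetric] nr(1)[symmetric] mult_ac)
 also have "... = of_int (int p^2)" unfolding r1(1)[symmetric] by (simp add: power2_eq_square)
 finally have pp: "na*nr = int p^2" by (simp only: of_int_eq_iff)
 have "na dvd int p^2" using pp by (metis dvd_triv_left)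
 then obtain i where i: "i <= 2" "na = int p^i"
  using divides_primepow[of "int p" na 2] p na(2) by (auto)
 consider "i = 0" | "i = 1" | "i = 2" using i(1) by linarith
 thus ?thesis
 proof cases
  case 1
  hence "a * cnj a = 1" using na(1) i(2) by simp
  have "1 \<in> I"
  proof -
   have "cnj a*a \<in> I" using \<open>is_ideal OK I\<close> OK_cnj[OF a(1)] aI unfolding is_ideal_def by blast
   thus ?thesis using \<open>a * cnj a = 1\<close> by (simp add: mult.commute)
  qed
  then obtain r s where h: "1 = of_nat p*r + \<beta> * s" "r \<in> OK" "s \<in> OK" unfolding I_def by blast
  have "cnj \<beta> = cnj \<beta>*(of_nat p*r + \<beta> * s)" using h(1) by simp
  also have "... = of_nat p*(cnj \<beta>*r) + (\<beta> * cnj \<beta>) * s" by (simp add: algebra_simps)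
  also have "... = of_nat p*(cnj \<beta>*r + of_int N * s)" unfolding b(2) by (simp add: algebra_simps)
  finally have "cnj \<beta> = of_nat p*(cnj \<beta>*r + of_int N * s)" .
  moreover have "cnj \<beta>*r + of_int N * s \<in> OK" by (intro OK_add OK_mult OK_cnj OK_of_int b(1) h)
  ultimately show ?thesis using nb(2) by blast
 next
  case 2
  thus ?thesis using na(3) i(2) by simp
 next
  case 3
  have "na > 0" using i(2) prime_gt_0_nat[OF p] by simp
  hence "nr = 1" using pp i(2) 3 by simp
  hence u: "r1 * cnj r1 = 1" using nr(1) by simp
  have "a = of_nat p * cnj r1" unfolding r1(1) using u by (simp add: mult.assoc)
  hence "\<beta> = of_nat p*(cnj r1*r2)" using r2(1) by (simp add: mult.assoc)
  moreover have "cnj r1*r2 \<in> OK" by (intro OK_mult OK_cnj r1 r2)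
  ultimately show ?thesis using nb(1) by blast
 qed
qed

lemma of_nat_mult_half_lattice: "of_nat p*half_lattice D X Y = half_lattice D (int p*X) (int p*Y)"
 by (simp add: half_lattice_def complex_eq_iff)

text \<open>Applied with beta = s + sqrt(-D); ramified p, with s = 0, are included.\<close>

lemma split_prime_is_norm:
 assumes cl: "class_number_one d" and p: "prime p" "p > 2" and s: "int p dvd s\<^sup>2 + D"
 shows "is_norm (int p)"
proof -
 obtain N where N: "s^2 + D = int p*N" using s by (auto elim: dvdE)
 have n: "norm4 D (2 * s) 2 = 4*(int p*N)" "norm4 D (2 * s) (-2) = 4*(int p*N)"
  unfolding N[symmetric] by (simp_all add: norm4_def power2_eq_square algebra_simps)
 have nd: "~ int p dvd 2" using p(2) zdvd_not_zless[of 2 "int p"] by auto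
 show ?thesis
 proof (rule prime_divides_norm_is_norm[OF cl p(1), of "half_lattice D (2 * s) 2" N])
  show "half_lattice D (2 * s) 2 \<in> OK" using n by (intro half_lattice_in_ring) simp
  show "half_lattice D (2 * s) 2 * cnj (half_lattice D (2 * s) 2) = of_int (int p*N)"
   unfolding half_lattice_norm n by simp
  fix t assume "t \<in> OK"
  then obtain X Y where t: "t = half_lattice D X Y" by (auto elim: ring_cases)
  show "half_lattice D (2 * s) 2 ~= of_nat p*t"
  proof
   assume "half_lattice D (2 * s) 2 = of_nat p*t"
   hence "2 = int p*Y" unfolding t of_nat_mult_half_lattice using half_lattice_inj by blast
   thus False using nd by (metis dvd_triv_left)
  qed
  show "cnj (half_lattice D (2 * s) 2) ~= of_nat p*t"
  proof
   assume "cnj (half_lattice D (2 * s) 2) = of_nat p*t"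
   hence "- 2 = int p*Y" unfolding t of_nat_mult_half_lattice half_lattice_cnj using half_lattice_inj by blast
   hence "2 = int p*(- Y)" by simp
   thus False using nd by (metis dvd_triv_left)
  qed
 qed
qed

text \<open>Ramified primes decide. An odd prime p dividing D is a norm, and with D = p*e the
  equation p*W^2 + e*Y^2 = 4 leaves only e = 1. If this prime D were 1 modulo 4, then 2 would be a
  norm too, which x^2 + D*y^2 = 2 forbids for D >= 5. Without odd prime factors, D is 1 or
  2.\<close>

lemma discriminant_cases:
 assumes cl: "class_number_one d"
 shows "D = 1 \<or> D = 2 \<or> D > 0 & prime D & D mod 4 = 3"
proof (cases "\<exists>p::nat. prime p & p > 2 & int p dvd D")
 case True
 then obtain p :: nat where p: "prime p" "p > 2" "int p dvd D" by blast
 obtain e where e: "D = int p*e" using p(3) by (auto elim: dvdE)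
 have e0: "e > 0" using D_pos p(2) by (simp add: e zero_less_mult_iff)
 have "is_norm (int p)" by (rule split_prime_is_norm[OF cl p(1,2), of 0]) (use p(3) in simp)
 then obtain X Y where XY: "X^2 + D*Y^2 = 4*int p" by (auto simp: is_norm_def norm4_def)
 have "X^2 = int p*(4 - e*Y^2)" using XY by (simp add: e algebra_simps)
 hence "int p dvd X\<^sup>2" by simp
 hence "int p dvd X" using p(1) by (meson prime_dvd_power prime_nat_int_transfer)
 then obtain W where W: "X = int p*W" by (auto elim: dvdE)
 have "int p*(int p*W^2 + e*Y^2) = int p*4" using XY by (simp add: W e power2_eq_square algebra_simps)
 hence q: "int p*W^2 + e*Y^2 = 4" using p(2) by simp
 have pW: "int p*W^2 >= 0" by simp
 have "Y ~= 0"
 proof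
  assume "Y = 0"
  hence "int p dvd 4" using q by (metis dvd_triv_left mult_zero_right power_zero_numeral add_0_right)
  hence "int p dvd 2^2" by simp
  hence "int p dvd 2" using p(1) by (meson prime_dvd_power prime_nat_int_transfer)
  thus False using p(2) zdvd_not_zless[of 2 "int p"] by auto
 qed
 hence "Y^2 >= 1" using zero_less_power2[of Y] by linarith
 hence "e*Y^2 >= e" using e0 mult_left_mono[of 1 "Y^2" e] by simp
 hence e4: "e <= 4" using q pW by linarith
 have W0: "e*Y^2 = 4" if "W = 0" using q that by simp
 have W1: "int p + e*Y^2 <= 4" if "W ~= 0"
 proof -
  have "W^2 >= 1" using that zero_less_power2[of W] by linarith
  hence "int p*W^2 >= int p" using mult_left_mono[of 1 "W^2" "int p"] by simp
  thus ?thesis using q by linarith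
 qed
 have ne4: "e ~= 4"
 proof
  assume "e = 4"
  hence "4 dvd D" by (simp add: e)
  thus False using not_4_dvd by blast
 qed
 have "e = 1"
 proof (cases "W = 0")
  case True
  have "Y^2 dvd 4" using W0[OF True] by (metis dvd_triv_right)
  have "\<bar>Y\<bar> <= 2"
  proof (rule ccontr)
   assume "~ \<bar>Y\<bar> <= 2"
   hence "3*3 <= \<bar>Y\<bar>*\<bar>Y\<bar>" by (intro mult_mono) auto
   hence "9 <= Y^2" by (simp add: power2_eq_square)
   hence "e*9 <= e*Y^2" using e0 by (intro mult_left_mono) auto
   thus False using W0[OF True] e0 by linarith
  qed
  hence "Y = -2 \<or> Y = -1 \<or> Y = 0 \<or> Y = 1 \<or> Y = 2" by linarith
  thus ?thesis using W0[OF True] ne4 by auto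
 next
  case False
  thus ?thesis using W1[OF False] \<open>e * Y^2 >= e\<close> p(2) e0 by linarith
 qed
 hence Dp: "D = int p" using e by simp
 hence prD: "prime D" using p(1) by simp
 have "odd D" using Dp p prime_odd_nat by auto
 moreover have "D mod 4 ~= 1"
 proof
  assume D1: "D mod 4 = 1"
  have D5: "D >= 5" using D1 Dp p(2) by presburger
  obtain k where k: "1 + D = 2 * k" using \<open>odd D\<close> by (metis evenE even_plus_one_iff add.commute)
  \<comment> \<open>The element 1 + sqrt(-D) has even norm but is not divisible by 2, since for D =
    1 modulo 4 the ring has no half-integral elements.\<close>
  have "is_norm (int 2)"
  proof (rule prime_divides_norm_is_norm[OF cl, of 2 "half_lattice D 2 2" k])
   have n: "norm4 D 2 2 = 4*(2 * k)" unfolding k[symmetric] by (simp add: norm4_def)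
   show "half_lattice D 2 2 \<in> OK" using n by (intro half_lattice_in_ring) simp
   show "half_lattice D 2 2 * cnj (half_lattice D 2 2) = of_int (int 2 * k)" unfolding half_lattice_norm n by simp
   fix t assume "t \<in> OK"
   then obtain X Y where t: "t = half_lattice D X Y" "4 dvd norm4 D X Y" by (auto elim: ring_cases)
   have X: "X ~= 1" using t(2) D1 unfolding norm4_dvd_iff[OF not_4_dvd] by auto
   show "half_lattice D 2 2 ~= of_nat 2*t"
   proof
    assume "half_lattice D 2 2 = of_nat 2*t"
    hence "2 = int 2*X" unfolding t(1) of_nat_mult_half_lattice using half_lattice_inj by blast
    thus False using X by simp
   qed
   show "cnj (half_lattice D 2 2) ~= of_nat 2*t"
   proof
    assume "cnj (half_lattice D 2 2) = of_nat 2*t"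
    hence "2 = int 2*X" unfolding t(1) of_nat_mult_half_lattice half_lattice_cnj using half_lattice_inj by blast
    thus False using X by simp
   qed
  qed simp
  then obtain X Y where XY: "norm4 D X Y = 4*2" by (auto simp: is_norm_def)
  have "4 dvd norm4 D X Y" unfolding XY by simp
  hence "even X" "even Y" using D1 unfolding norm4_dvd_iff[OF not_4_dvd] by auto
  then obtain x y where xy: "X = 2*x" "Y = 2*y" by (auto elim!: evenE)
  have "4*(x^2 + D*y^2) = 4*2" using XY by (simp add: xy norm4_def power2_eq_square algebra_simps)
  hence q: "x^2 + D*y^2 = 2" by simp
  have "y = 0"
  proof (rule ccontr)
   assume "y ~= 0"
   hence "y^2 >= 1" using zero_less_power2[of y] by linarith
   hence "D*y^2 >= D" using D5 mult_left_mono[of 1 "y^2" D] by simp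
   thus False using q D5 zero_le_power2[of x] by linarith
  qed
  hence x2: "x^2 = 2" using q by simp
  have "\<bar>x\<bar> <= 1"
  proof (rule ccontr)
   assume "~ \<bar>x\<bar> <= 1"
   hence "2*2 <= \<bar>x\<bar>*\<bar>x\<bar>" by (intro mult_mono) auto
   thus False using x2 by (simp add: power2_eq_square)
  qed
  hence "x = -1 \<or> x = 0 \<or> x = 1" by linarith
  thus False using x2 by auto
 qed
 ultimately have "D mod 4 = 3" by presburger
 thus ?thesis using prD D_pos by blast
next
 case False
 show ?thesis
 proof (cases "D = 1")
  case D1: False
  have "even D"
  proof (rule ccontr)
   assume o: "odd D"
   have "nat D ~= 1" using D1 D_pos by linarith
   then obtain p where p: "prime p" "p dvd nat D" using prime_factor_nat by blast
   have pd: "int p dvd D" using p(2) D_pos by (simp add: int_dvd_int_iff[symmetric] del: int_dvd_int_iff)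
   have "p ~= 2" using pd o by auto
   hence "p > 2" using prime_ge_2_nat[OF p(1)] by simp
   thus False using False p(1) pd by blast
  qed
  then obtain e where e: "D = 2*e" by (elim evenE)
  have eo: "odd e" using not_4_dvd e by (auto elim!: evenE)
  have "e = 1"
  proof (rule ccontr)
   assume "e ~= 1"
   have "nat e ~= 1" using \<open>e ~= 1\<close> D_pos e by linarith
   then obtain p where p: "prime p" "p dvd nat e" using prime_factor_nat by blast
   have pd: "int p dvd e" using p(2) D_pos e by (simp add: int_dvd_int_iff[symmetric] del: int_dvd_int_iff)
   have "p ~= 2" using pd eo by auto
   hence "p > 2" using prime_ge_2_nat[OF p(1)] by simp
   thus False using False p(1) pd e by auto
  qed
  thus ?thesis using e by simp
 qed simp
qed

text \<open>Norms are multiplicative; split primes are norms, and an inert prime enters only through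
  its square.\<close>

lemma norm_if_inert_even:
 assumes cl: "class_number_one d" and m: "m > (0::nat)"
  and l: "!!l. prime l ==> l dvd m ==> l > 2 & ((\<exists>s. int l dvd s\<^sup>2 + D) \<or> even (multiplicity l m))"
 shows "is_norm (int m)"
proof -
 have one: "is_norm 1" using is_norm_square[of 1] by simp
 have "is_norm (\<Prod>p\<in>S. int p^multiplicity p m)" if "finite S" "S <= prime_factors m" for S
  using that
 proof (induction S rule: finite_induct)
  case (insert p S)
  have p: "prime p" "p dvd m" using insert.prems by auto
  have pw: "is_norm (int p^k)" if "is_norm (int p)" for k
   by (induction k) (auto simp: one intro: is_norm_mult that)
  have "is_norm (int p^multiplicity p m)"
  proof (cases "even (multiplicity p m)")
   case True
   then obtain k where "multiplicity p m = 2 * k" by (elim evenE)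
   hence "int p^multiplicity p m = (int p^k)^2" by (simp add: power_mult mult.commute)
   thus ?thesis using is_norm_square by simp
  next
   case False
   thus ?thesis using l[OF p] split_prime_is_norm[OF cl p(1)] pw by blast
  qed
  thus ?case using insert by (simp add: is_norm_mult)
 qed (simp add: one)
 from this[of "prime_factors m"] have "is_norm (\<Prod>p\<in>prime_factors m. int p^multiplicity p m)" by simp
 also have "(\<Prod>p\<in>prime_factors m. int p^multiplicity p m) = int (\<Prod>p\<in>prime_factors m. p^multiplicity p m)" by simp
 also have "... = int m" by (rule arg_cong[OF prime_factorization_nat[OF m, symmetric]])
 finally show ?thesis .
qed

end

section \<open>The sieve combined with equidistribution on the box\<close>

lemma box_sum_mono: "(!!u v. F u v <= G u v) ==> box_sum L F <= (box_sum L G :: real)"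
 unfolding box_sum_def by (intro sum_mono)

text \<open>The interval from t to t^2 gives 1 + 6/ln t, and ln t >= 2/3 for t >= 2, so the bound is
  3*(1 + 9) = 30, the value of G. For t < 2 the block contains no prime from 8 on.\<close>

lemma prime_block_sum_le:
 fixes P :: "nat set"
 assumes P: "finite P" "!!p. p \<in> P ==> prime p & 8 <= p" and t: "1 <= t"
 shows "(\<Sum>p\<in>{p\<in>P. t < real p & real p <= t^2}. 3/real p) <= 30"
proof (cases "t < 2")
 case True
 have "{p\<in>P. t < real p & real p <= t^2} = {}"
 proof (rule ccontr)
  assume "{p\<in>P. t < real p & real p <= t^2} ~= {}"
  then obtain p where p: "p \<in> P" "real p <= t^2" by auto
  have "t*t < 2*2" using True t by (intro mult_strict_mono) auto
  hence "real p < 4" using p(2) by (simp add: power2_eq_square)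
  thus False using P(2)[OF p(1)] by simp
 qed
 thus ?thesis by (simp only: sum.empty)
next
 case False
 hence t2: "t >= 2" by simp
 have l2: "ln (2::real) >= 2/3" by (rule ln2_ge_two_thirds)
 have lt: "ln t >= 2/3" proof -
  have "ln 2 <= ln t" using t2 by simp
  thus ?thesis using l2 by linarith
 qed
 have fin: "finite {p. prime p & t < real p & real p <= t^2}"
  by (rule finite_subset[OF _ finite_nat_real_le[of "t^2" "%_. True"]]) auto
 have "(\<Sum>p\<in>{p\<in>P. t < real p & real p <= t^2}. 3/real p) = 3*(\<Sum>p\<in>{p\<in>P. t < real p & real p <= t^2}. 1/real p)"
  by (simp add: sum_distrib_left)
 also have "(\<Sum>p\<in>{p\<in>P. t < real p & real p <= t^2}. 1/real p) <= (\<Sum>p | prime p & t < real p & real p <= t^2. 1/real p)"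
  by (rule sum_mono2[OF fin]) (use P in auto)
 also have "... <= (ln (t^2/t) + 6)/ln t"
  using t2 by (intro sum_inverse_prime_interval) (auto simp: power2_eq_square)
 also have "... = 1 + 6/ln t" using t2 lt by (simp add: power2_eq_square add_divide_distrib)
 also have "6/ln t <= 6/(2/3)" using lt by (intro divide_left_mono) auto
 finally show ?thesis by simp
qed

text \<open>Distinct sets of primes have distinct products, so at most Y sets matter.\<close>

lemma support_sum_le:
 fixes P :: "nat set" and c :: "nat set => real"
 assumes P: "finite P" "!!p. p \<in> P ==> prime p" and Y: "0 <= Y" and X: "0 <= X"
  and t: "!!E. E <= P ==> real (\<Prod>E) <= Y ==> t E <= X" and z: "!!E. E <= P ==> ~ real (\<Prod>E) <= Y ==> t E <= 0"
 shows "(\<Sum>E\<in>Pow P. t E) <= Y*X"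
proof -
 let ?S = "{E\<in>Pow P. real (\<Prod>E) <= Y}"
 have pf: "prime_factors (\<Prod>E) = E" if "E <= P" for E
  using that P finite_subset[OF that P(1)] by (intro prime_factors_prod_primes) auto
 have inj: "inj_on (%E. \<Prod>E) ?S" using pf by (auto intro!: inj_onI) (metis subsetD)+
 have fin: "finite (Pow P)" using P(1) by simp
 have "card ?S = card ((%E. \<Prod>E) ` ?S)" using inj by (simp add: card_image)
 also have "... <= card {1..nat (floor Y)}"
 proof (intro card_mono subsetI)
  fix k assume "k \<in> (%E. \<Prod>E) ` ?S"
  then obtain E where E: "k = \<Prod>E" "E <= P" "real (\<Prod>E) <= Y" by blast
  have "\<Prod>E > 0" using E(2) P(2) by (intro prod_pos) (auto simp: prime_gt_0_nat)
  thus "k \<in> {1..nat (floor Y)}" using E(1,3) Y by (simp only: atLeastAtMost_iff E(1)) (auto simp: le_nat_floor simp del: of_nat_prod)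
 qed simp
 finally have "real (card ?S) <= real (nat (floor Y))" by simp
 also have "... <= Y" using Y by (rule of_nat_floor)
 finally have cS: "real (card ?S) <= Y" .
 have "(\<Sum>E\<in>Pow P. t E) <= (\<Sum>E\<in>Pow P. if real (\<Prod>E) <= Y then X else 0)"
  using t z by (intro sum_mono) (simp del: of_nat_prod)
 also have "... = (\<Sum>E\<in>?S. X)" using fin by (subst sum.inter_filter[symmetric]) auto
 also have "... = real (card ?S)*X" by simp
 also have "... <= Y*X" using cS X by (rule mult_right_mono)
 finally show ?thesis .
qed

text \<open>The sieve weights turn the product over P into a combination of products over sets E
  whose total modulus is at most Y. Each is handled by \<open>equidistribution\<close> with Q times
  the product of E in the role of the trivially bounded modulus, which costs that product squared;
  with at most Y sets this makes Y^3. The moduli in K keep the full Fourier saving.\<close>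

lemma sieved_box_sum:
 fixes e :: "nat => int => int => real" and y :: real and L b :: nat
 assumes P: "finite P" "!!p. p \<in> P ==> prime p & 8 <= p & real p <= y" and y: "1 < y"
  and e: "!!p. p \<in> P ==> per p (e p)" "!!p u v. p \<in> P ==> 0 <= e p u v & e p u v <= 1"
   "!!p. p \<in> P ==> 1 - wmean p (e p) <= 3/real p"
  and K: "finite K" "!!p. p \<in> K ==> prime p & p > 2 & ~ int p dvd D & ~ int p dvd c" "K \<inter> P = {}"
  and Q: "Q > 0" "coprime Q (\<Prod>K)" "!!p. p \<in> P ==> ~ p dvd Q" and w: "per Q w" "!!u v. 0 <= w u v & w u v <= 1"
 defines "X == wmean Q w*(\<Prod>p\<in>K. cdens D c p)*(\<Prod>p\<in>P. wmean p (e p))*real L^4"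
  and "Y == y powr (4*real b + 6)"
 shows "\<bar>box_sum L (%u v. w u v * (\<Prod>p\<in>P. e p u v) * of_bool (int (\<Prod>K) dvd quad D u v - c)) - X\<bar>
  <= sieve_error 30 b*X + Y^3*(4^card K*(real Q)^2*((real L)^2*real (\<Prod>K) powr (3/4) + 2*real L^3*real (\<Prod>K) powr (- 1/4)))"
proof -
 define R where "R = 4^card K*(real Q)^2*((real L)^2*real (\<Prod>K) powr (3/4) + 2*real L^3*real (\<Prod>K) powr (- 1/4))"
 define ik where "ik = (%u v. of_bool (int (\<Prod>K) dvd quad D u v - c) :: real)"
 define f where "f = (%u v p. 1 - e p u v)"
 define g where "g = (%p. 1 - wmean p (e p))"
 define X0 where "X0 = wmean Q w*(\<Prod>p\<in>K. cdens D c p)*real L^4"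
 have P8: "8 <= p & real p <= y" if "p \<in> P" for p using P(2)[OF that] by blast
 have Pp: "prime p" if "p \<in> P" for p using P(2)[OF that] by blast
 have R0: "0 <= R" unfolding R_def by (intro mult_nonneg_nonneg add_nonneg_nonneg) auto
 have X00: "0 <= X0" unfolding X0_def using w(2) by (intro mult_nonneg_nonneg wmean_nonneg prod_nonneg) (auto simp: cdens_def)
 have Y1: "1 <= Y" unfolding Y_def using y by (intro ge_one_powr_ge_zero) auto
 have G: "(\<Sum>p\<in>{p\<in>P. t < real p & real p <= t^2}. 3/real p) <= 30" if "1 <= t" for t
  by (rule prime_block_sum_le[OF P(1) _ that]) (use P(2) in blast)
 have ex: "\<exists>lp lm. (\<forall>E\<subseteq>P. \<bar>lp E\<bar> <= 1 & \<bar>lm E\<bar> <= 1 &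
    (lp E ~= 0 \<or> lm E ~= 0 --> real (\<Prod>E) <= y powr (4*real b + 6))) &
   (\<forall>f. (\<forall>p\<in>P. 0 <= f p & f p <= 1) -->
    set_poly P lm f <= (\<Prod>p\<in>P. 1 - f p) & (\<Prod>p\<in>P. 1 - f p) <= set_poly P lp f &
    ((\<forall>p\<in>P. f p <= 3/real p) -->
     set_poly P lp f <= (\<Prod>p\<in>P. 1 - f p)*(1 + sieve_error 30 b) &
     (\<Prod>p\<in>P. 1 - f p)*(1 - sieve_error 30 b) <= set_poly P lm f))"
  by (rule fundamental_lemma[OF P(1) P8 y _ G]) simp_all
 then obtain lp lm where l0: "\<forall>E\<subseteq>P. \<bar>lp E\<bar> <= 1 & \<bar>lm E\<bar> <= 1 & (lp E ~= 0 \<or> lm E ~= 0 --> real (\<Prod>E) <= y powr (4*real b + 6))"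
  and f0: "\<forall>f. (\<forall>p\<in>P. 0 <= f p & f p <= 1) -->
    set_poly P lm f <= (\<Prod>p\<in>P. 1 - f p) & (\<Prod>p\<in>P. 1 - f p) <= set_poly P lp f &
    ((\<forall>p\<in>P. f p <= 3/real p) -->
     set_poly P lp f <= (\<Prod>p\<in>P. 1 - f p)*(1 + sieve_error 30 b) &
     (\<Prod>p\<in>P. 1 - f p)*(1 - sieve_error 30 b) <= set_poly P lm f)"
  by (elim exE conjE) (rule that)
 have l: "\<bar>lp E\<bar> <= 1 & \<bar>lm E\<bar> <= 1 & (lp E ~= 0 \<or> lm E ~= 0 --> real (\<Prod>E) <= Y)" if "E <= P" for E
  using l0 that unfolding Y_def by blast
 have f1: "set_poly P lm f <= (\<Prod>p\<in>P. 1 - f p) & (\<Prod>p\<in>P. 1 - f p) <= set_poly P lp f" if "\<forall>p\<in>P. 0 <= f p & f p <= 1" for f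
  using f0 that by blast
 have f2: "set_poly P lp f <= (\<Prod>p\<in>P. 1 - f p)*(1 + sieve_error 30 b) &
     (\<Prod>p\<in>P. 1 - f p)*(1 - sieve_error 30 b) <= set_poly P lm f"
  if "\<forall>p\<in>P. 0 <= f p & f p <= 1" "\<forall>p\<in>P. f p <= 3/real p" for f
  using f0 that by blast
 have p0: "p > 0" if "p \<in> P" for p using Pp[OF that] by (rule prime_gt_0_nat)
 have g01: "\<forall>p\<in>P. 0 <= g p & g p <= 1"
  unfolding g_def using e(2) wmean_nonneg wmean_le_1 p0 by (auto simp: algebra_simps)
 have fm: "wmean p (%u v. f u v p) = g p" if "p \<in> P" for p
 proof -
  have "wmean p (%u v. 1*1 + (- 1)*e p u v) = 1*wmean p (%u v. 1) + (- 1)*wmean p (e p)" by (rule wmean_linear)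
  moreover have "wmean p (%u v. 1) = 1" using p0[OF that] by (simp add: wmean_def power2_eq_square)
  ultimately show ?thesis by (simp add: f_def g_def)
 qed
 have main: "\<bar>box_sum L (%u v. w u v * set_poly P l (f u v)*ik u v) - X0 * set_poly P l g\<bar> <= Y^3 * R"
  if l: "!!E. E <= P ==> \<bar>l E\<bar> <= 1 & (l E ~= 0 --> real (\<Prod>E) <= Y)" for l
 proof -
  define wE where "wE = (%E u v. w u v * (\<Prod>p\<in>E. f u v p))"
  have bs: "box_sum L (%u v. w u v * set_poly P l (f u v)*ik u v) = (\<Sum>E\<in>Pow P. l E*box_sum L (%u v. wE E u v * ik u v))"
   unfolding box_sum_mult[symmetric] box_sum_sum[symmetric]
   by (intro arg_cong[of _ _ "box_sum L"] ext) (simp add: set_poly_def wE_def sum_distrib_left sum_distrib_right mult_ac)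
  have est: "\<bar>box_sum L (%u v. wE E u v * ik u v) - X0*prod g E\<bar> <= (real (\<Prod>E))^2 * R" if E: "E <= P" for E
  proof -
   have fE: "finite E" using E P(1) finite_subset by blast
   have pE: "p \<in> E ==> prime p" for p using E Pp by blast
   have fp: "per p (%u v. f u v p)" if "p \<in> E" for p
   proof -
    have "per p (e p)" using e(1) E that by blast
    thus ?thesis by (simp add: per_def f_def)
   qed
   note wp = wmean_prod[OF fE pE fp]
   have coE: "coprime Q (\<Prod>E)"
   proof (rule prod_coprime_right)
    fix p assume "p \<in> E"
    hence "prime p" "~ p dvd Q" using pE Q(3) E by auto
    thus "coprime Q p" using prime_imp_coprime coprime_commute by blast
   qed
   have coEK: "coprime (\<Prod>E) (\<Prod>K)"
    using K(2,3) E pE by (intro prod_coprime_left prod_coprime_right primes_coprime) auto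
   have E0: "\<Prod>E > 0" using pE by (intro prod_pos) (auto simp: prime_gt_0_nat)
   have pw: "per (Q*\<Prod>E) (wE E)"
    unfolding wE_def by (rule per_times_coprime[OF w(1)]) (use wp in simp)
   have mw: "wmean (Q*\<Prod>E) (wE E) = wmean Q w*prod g E"
   proof -
    have "wmean (Q*\<Prod>E) (wE E) = wmean Q w*wmean (\<Prod>E) (%u v. \<Prod>p\<in>E. f u v p)"
     unfolding wE_def by (rule wmean_mult[OF coE Q(1) E0 w(1)]) (use wp in simp)
    also have "wmean (\<Prod>E) (%u v. \<Prod>p\<in>E. f u v p) = (\<Prod>p\<in>E. wmean p (%u v. f u v p))" using wp by simp
    also have "... = prod g E" by (rule prod.cong) (use fm E in auto)
    finally show ?thesis .
   qed
   have w1: "\<bar>wE E u v\<bar> <= 1" for u v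
   proof -
    have "0 <= f u v p & f u v p <= 1" if "p \<in> E" for p using e(2)[of p u v] E that by (auto simp: f_def)
    hence "0 <= (\<Prod>p\<in>E. f u v p)" "(\<Prod>p\<in>E. f u v p) <= 1" by (auto intro: prod_nonneg prod_le_1)
    hence "0 <= wE E u v" "wE E u v <= 1" unfolding wE_def using w(2)[of u v] by (auto intro: mult_le_one)
    thus ?thesis by simp
   qed
   have "\<bar>box_sum L (%u v. wE E u v * ik u v) - wmean (Q*\<Prod>E) (wE E)*(\<Prod>p\<in>K. cdens D c p)*real L^4\<bar>
    <= 4^card K*(real (Q*\<Prod>E))^2*((real L)^2*real (\<Prod>K) powr (3/4) + 2*real L^3*real (\<Prod>K) powr (- 1/4))"
    unfolding ik_def by (rule equidistribution[OF K(1,2) _ _ pw w1]) (use Q E0 coEK in \<open>simp_all add: coprime_mult_left_iff\<close>)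
   thus ?thesis unfolding mw R_def X0_def by (simp add: power_mult_distrib mult_ac del: of_nat_prod)
  qed
  have "\<bar>box_sum L (%u v. w u v * set_poly P l (f u v)*ik u v) - X0 * set_poly P l g\<bar>
    = \<bar>\<Sum>E\<in>Pow P. l E*(box_sum L (%u v. wE E u v * ik u v) - X0*prod g E)\<bar>"
   unfolding bs unfolding set_poly_def sum_distrib_left sum_subtractf[symmetric] by (simp add: right_diff_distrib mult.left_commute)
  also have "... <= (\<Sum>E\<in>Pow P. \<bar>l E\<bar>*\<bar>box_sum L (%u v. wE E u v * ik u v) - X0*prod g E\<bar>)"
   unfolding abs_mult[symmetric] by (rule sum_abs)
  also have "... <= Y*(Y^2 * R)"
  proof (rule support_sum_le[OF P(1) Pp])
   show "0 <= Y" "0 <= Y^2 * R" using Y1 R0 by simp_all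
   fix E assume E: "E <= P"
   {
    assume le: "real (\<Prod>E) <= Y"
    have "\<bar>l E\<bar>*\<bar>box_sum L (%u v. wE E u v * ik u v) - X0*prod g E\<bar> <= 1*((real (\<Prod>E))^2 * R)"
     using l[OF E] est[OF E] by (intro mult_mono) auto
    also have "... <= Y^2 * R" using le R0 by (simp add: mult_right_mono power_mono del: of_nat_prod)
    finally show "\<bar>l E\<bar>*\<bar>box_sum L (%u v. wE E u v * ik u v) - X0*prod g E\<bar> <= Y^2 * R" .
   next
    assume "~ real (\<Prod>E) <= Y"
    hence "l E = 0" using l[OF E] by blast
    thus "\<bar>l E\<bar>*\<bar>box_sum L (%u v. wE E u v * ik u v) - X0*prod g E\<bar> <= 0" by simp
   }
  qed
  finally show ?thesis by (simp add: power3_eq_cube power2_eq_square mult_ac)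
 qed
 let ?S = "box_sum L (%u v. w u v * (\<Prod>p\<in>P. e p u v)*ik u v)"
 have ff: "\<forall>p\<in>P. 0 <= f u v p & f u v p <= 1" for u v using e(2) by (auto simp: f_def)
 have ef: "(\<Prod>p\<in>P. e p u v) = (\<Prod>p\<in>P. 1 - f u v p)" for u v by (simp add: f_def)
 have ik0: "0 <= ik u v" for u v by (simp add: ik_def)
 have up: "?S <= box_sum L (%u v. w u v * set_poly P lp (f u v)*ik u v)"
  unfolding ef using f1[OF ff] w(2) ik0 by (intro box_sum_mono mult_right_mono mult_left_mono) auto
 have lo: "box_sum L (%u v. w u v * set_poly P lm (f u v)*ik u v) <= ?S"
  unfolding ef using f1[OF ff] w(2) ik0 by (intro box_sum_mono mult_right_mono mult_left_mono) auto
 have g3: "\<forall>p\<in>P. g p <= 3/real p" using e(3) by (simp add: g_def)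
 have X: "X = X0*(\<Prod>p\<in>P. 1 - g p)" by (simp add: X_def X0_def g_def mult_ac)
 have "X0 * set_poly P lp g <= X0*((\<Prod>p\<in>P. 1 - g p)*(1 + sieve_error 30 b))"
  using f2[OF g01 g3] X00 by (intro mult_left_mono) auto
 hence "X0 * set_poly P lp g <= X + sieve_error 30 b*X" by (simp add: X algebra_simps)
 moreover have "\<bar>box_sum L (%u v. w u v * set_poly P lp (f u v)*ik u v) - X0 * set_poly P lp g\<bar> <= Y^3 * R"
  by (rule main) (use l in blast)
 moreover have "X0*((\<Prod>p\<in>P. 1 - g p)*(1 - sieve_error 30 b)) <= X0 * set_poly P lm g"
  using f2[OF g01 g3] X00 by (intro mult_left_mono) auto
 hence "X - sieve_error 30 b*X <= X0 * set_poly P lm g" by (simp add: X algebra_simps)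
 moreover have "\<bar>box_sum L (%u v. w u v * set_poly P lm (f u v)*ik u v) - X0 * set_poly P lm g\<bar> <= Y^3 * R"
  by (rule main) (use l in blast)
 ultimately have "\<bar>?S - X\<bar> <= sieve_error 30 b*X + Y^3 * R" using up lo by (simp only: abs_le_iff) linarith
 thus ?thesis unfolding ik_def R_def .
qed

section \<open>The character that governs splitting\<close>

lemma Legendre_values: "Legendre a p \<in> {-1, 0, 1}" by (simp add: Legendre_def)

lemma Legendre_cong: "[a = b] (mod p) ==> Legendre a p = Legendre b p"
proof -
 assume h: "[a = b] (mod p)"
 have "[y^2 = a] (mod p) \<longleftrightarrow> [y^2 = b] (mod p)" for y using h by (simp add: cong_def)
 moreover have "[a = 0] (mod p) \<longleftrightarrow> [b = 0] (mod p)" using h by (simp add: cong_def)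
 ultimately show ?thesis by (simp add: Legendre_def QuadRes_def)
qed

lemma unit_cong_eq:
 fixes a b :: int
 assumes "a \<in> {-1, 0, 1}" "b \<in> {-1, 0, 1}" "[a = b] (mod int p)" "p > 2"
 shows "a = b"
proof -
 have d: "int p dvd a - b" using assms(3) by (simp add: cong_iff_dvd_diff)
 show ?thesis
 proof (rule ccontr)
  assume "a ~= b"
  hence "\<bar>int p\<bar> <= \<bar>a - b\<bar>" using dvd_imp_le_int[OF _ d] by simp
  thus False using assms(1,2,4) by auto
 qed
qed

lemma Legendre_mult:
 assumes p: "prime p" "p > 2"
 shows "Legendre (a*b) (int p) = Legendre a (int p)*Legendre b (int p)"
proof (rule unit_cong_eq[OF _ _ _ p(2)])
 show "Legendre (a*b) (int p) \<in> {-1, 0, 1}" by (rule Legendre_values)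
 show "Legendre a (int p)*Legendre b (int p) \<in> {-1, 0, 1}" using Legendre_values[of a "int p"] Legendre_values[of b "int p"] by auto
 have "[Legendre (a*b) (int p) = (a*b)^((p - 1) div 2)] (mod int p)" by (rule euler_criterion[OF p])
 moreover have "[Legendre a (int p)*Legendre b (int p) = a^((p - 1) div 2)*b^((p - 1) div 2)] (mod int p)"
  by (intro cong_mult euler_criterion p)
 ultimately show "[Legendre (a*b) (int p) = Legendre a (int p)*Legendre b (int p)] (mod int p)"
  unfolding power_mult_distrib by (meson cong_sym cong_trans)
qed

lemma Legendre_minus_1:
 assumes p: "prime p" "p > 2"
 shows "Legendre (-1) (int p) = (-1)^((p - 1) div 2)"
proof (rule unit_cong_eq[OF Legendre_values _ euler_criterion[OF p] p(2)])
 show "(-1::int)^((p - 1) div 2) \<in> {-1, 0, 1}" by (cases "even ((p - 1) div 2)") auto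
qed

text \<open>Gauss's lemma with multiplier 2: for h = (p - 1) div 2, the doubles exceeding h belong
  to the x from h div 2 + 1 to h.\<close>

lemma Legendre_2:
 assumes p: "prime p" "p > 2"
 shows "Legendre 2 (int p) = (-1)^((p - 1) div 2 - (p - 1) div 2 div 2)"
proof -
 have nd: "~ int p dvd 2" using p(2) zdvd_not_zless[of 2 "int p"] by auto
 interpret GAUSS p 2 by unfold_locales (use p nd in \<open>auto simp: cong_0_iff\<close>)
 define h where "h = (p - 1) div 2"
 have odd: "odd p" using p prime_odd_nat by auto
 have ph: "int p = 2*int h + 1" using odd p(2) unfolding h_def by (auto elim!: oddE)
 have "C = (%x. 2*x) ` {0<..int h}"
  unfolding C_def B_def A_def image_image using ph by (intro image_cong) (auto simp: mult.commute)
 hence "E = (%x. 2*x) ` {int (h div 2)<..int h}" unfolding E_def using ph by (auto simp: image_iff zdiv_int)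
 hence "card E = card {int (h div 2)<..int h}" by (simp add: card_image inj_on_def)
 also have "... = h - h div 2" by simp
 finally show ?thesis using gauss_lemma by (simp add: h_def)
qed

lemma Legendre_eq_1_iff:
 assumes "~ l dvd a"
 shows "Legendre a l = 1 & (\<exists>s. l dvd s\<^sup>2 - a) \<or> Legendre a l = -1 & (\<forall>s. ~ l dvd s\<^sup>2 - a)"
 using assms by (auto simp: Legendre_def QuadRes_def cong_iff_dvd_diff)

text \<open>The character of discriminant -4.\<close>

definition chi4 :: "nat => real" where
 "chi4 n = (if n mod 4 = 1 then 1 else if n mod 4 = 3 then -1 else 0)"

text \<open>The character of discriminant -8, which belongs to D = 2; hence the value 1 at 3 modulo
  8.\<close>

definition chi8 :: "nat => real" where
 "chi8 n = (if n mod 8 = 1 \<or> n mod 8 = 3 then 1 else if n mod 8 = 5 \<or> n mod 8 = 7 then -1 else 0)"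

lemma real_char_chi4: "real_char chi4 4"
proof
 fix m n :: nat
 have "chi4 (m*n) = chi4 ((m mod 4)*(n mod 4))" by (simp add: chi4_def mod_mult_eq)
 moreover have "m mod 4 = 0 \<or> m mod 4 = 1 \<or> m mod 4 = 2 \<or> m mod 4 = 3" "n mod 4 = 0 \<or> n mod 4 = 1 \<or> n mod 4 = 2 \<or> n mod 4 = 3" by presburger+
 ultimately show "chi4 (m*n) = chi4 m * chi4 n" by (elim disjE) (simp_all add: chi4_def)
 show "chi4 n \<in> {-1, 0, 1}" by (simp add: chi4_def)
 show "chi4 (n + 4) = chi4 n" by (simp add: chi4_def)
 show "chi4 1 = 1" by (simp add: chi4_def)
 show "(\<Sum>n<4. chi4 n) = 0" by (simp add: chi4_def lessThan_nat_numeral lessThan_Suc)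
qed simp

lemma real_char_chi8: "real_char chi8 8"
proof
 fix m n :: nat
 have "chi8 (m*n) = chi8 ((m mod 8)*(n mod 8))" by (simp add: chi8_def mod_mult_eq)
 moreover have c: "k mod 8 = 0 \<or> k mod 8 = 1 \<or> k mod 8 = 2 \<or> k mod 8 = 3 \<or> k mod 8 = 4 \<or> k mod 8 = 5 \<or> k mod 8 = 6 \<or> k mod 8 = 7" for k :: nat by presburger
 ultimately show "chi8 (m*n) = chi8 m * chi8 n" using c[of m] c[of n] by (elim disjE) (simp_all add: chi8_def)
 show "chi8 n \<in> {-1, 0, 1}" by (simp add: chi8_def)
 show "chi8 (n + 8) = chi8 n" by (simp add: chi8_def)
 show "chi8 1 = 1" by (simp add: chi8_def)
 show "(\<Sum>n<8. chi8 n) = 0" by (simp add: chi8_def lessThan_nat_numeral lessThan_Suc)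
qed simp

text \<open>P = 3 modulo 4 makes -1 a non-residue, so the reflection of n to P - n changes the sign
  and the sum over a period vanishes.\<close>

lemma real_char_Legendre:
 fixes P :: nat
 assumes P: "prime P" "P mod 4 = 3"
 shows "real_char (%n. of_int (Legendre (int n) (int P))) P"
proof
 have P2: "P > 2" using prime_ge_2_nat[OF P(1)] P(2) by (cases "P = 2") auto
 fix m n :: nat
 show "real_of_int (Legendre (int (m*n)) (int P)) = of_int (Legendre (int m) (int P)) * of_int (Legendre (int n) (int P))"
  by (simp add: Legendre_mult[OF P(1) P2])
 show "real_of_int (Legendre (int n) (int P)) \<in> {-1, 0, 1}" using Legendre_values[of "int n" "int P"] by auto
 show "real_of_int (Legendre (int (n + P)) (int P)) = of_int (Legendre (int n) (int P))"
  using Legendre_cong[of "int (n + P)" "int n" "int P"] by (simp add: cong_def)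
 have "~ int P dvd 1" using P2 by (auto simp: zdvd1_eq)
 moreover have "QuadRes (int P) 1" unfolding QuadRes_def by (rule exI[of _ 1]) simp
 ultimately show "real_of_int (Legendre (int 1) (int P)) = 1"
  unfolding Legendre_def by (auto simp: cong_0_iff)
 show "P > 0" using P2 by simp
 have "odd ((P - 1) div 2)" using P(2) by presburger
 hence m1: "Legendre (-1) (int P) = -1" using Legendre_minus_1[OF P(1) P2] by simp
 define f where "f = (%n. Legendre (int n) (int P))"
 have refl: "f (P - n) = - f n" if "n \<in> {1..<P}" for n
 proof -
  have "[int (P - n) = (-1)*int n] (mod int P)" using that by (simp add: cong_iff_dvd_diff of_nat_diff)
  hence "f (P - n) = Legendre ((-1)*int n) (int P)" unfolding f_def by (rule Legendre_cong)
  also have "... = - f n" unfolding f_def Legendre_mult[OF P(1) P2] m1 by simp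
  finally show ?thesis .
 qed
 have "sum f {1..<P} = (\<Sum>n\<in>{1..<P}. f (P - n))"
  by (rule sum.reindex_bij_witness[of _ "%n. P - n" "%n. P - n"]) auto
 also have "... = - sum f {1..<P}" using refl by (simp add: sum_negf)
 finally have s: "sum f {1..<P} = 0" by simp
 have "f 0 = 0" by (simp add: f_def Legendre_def)
 moreover have "{..<P} = insert 0 {1..<P}" using P2 by auto
 ultimately have "sum f {..<P} = 0" using s by simp
 hence "real_of_int (sum f {..<P}) = 0" by simp
 thus "(\<Sum>n<P. real_of_int (Legendre (int n) (int P))) = 0" by (simp add: f_def)
qed

text \<open>The Legendre symbol of -D modulo l has to become periodic in l. The supplementary laws
  do this for D = 1 and D = 2; for a prime D = 3 modulo 4 the symbol of -1 cancels the sign in the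
  reciprocity law, leaving the symbol of l modulo D.\<close>

lemma splitting_character:
 fixes D :: int
 assumes D: "D = 1 \<or> D = 2 \<or> D > 0 & prime D & D mod 4 = 3"
 shows "\<exists>chi q. real_char chi q & (\<forall>l::nat. prime l --> l > 2 --> ~ int l dvd D -->
  chi l = 1 & (\<exists>s. int l dvd s\<^sup>2 + D) \<or> chi l = -1 & (\<forall>s. ~ int l dvd s\<^sup>2 + D))"
proof -
 have key: "\<exists>chi q. real_char chi q & (\<forall>l::nat. prime l --> l > 2 --> ~ int l dvd D -->
  chi l = 1 & (\<exists>s. int l dvd s\<^sup>2 + D) \<or> chi l = -1 & (\<forall>s. ~ int l dvd s\<^sup>2 + D))"
  if "real_char chi q" "!!l. prime l ==> l > 2 ==> ~ int l dvd D ==> chi l = of_int (Legendre (- D) (int l))" for chi q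
 proof (rule exI[of _ chi], rule exI[of _ q], intro conjI allI impI)
  show "real_char chi q" by (rule that(1))
  fix l :: nat assume l: "prime l" "l > 2" "~ int l dvd D"
  have "~ int l dvd - D" using l(3) by simp
  from Legendre_eq_1_iff[OF this]
  show "chi l = 1 & (\<exists>s. int l dvd s\<^sup>2 + D) \<or> chi l = -1 & (\<forall>s. ~ int l dvd s\<^sup>2 + D)"
   unfolding that(2)[OF l] by auto
 qed
 have neg1: "(-1::real)^k = (if even k then 1 else -1)" for k by simp
 consider "D = 1" | "D = 2" | "D > 0" "prime D" "D mod 4 = 3" using D by blast
 thus ?thesis
 proof cases
  case 1
  show ?thesis
  proof (rule key[OF real_char_chi4])
   fix l :: nat assume l: "prime l" "l > 2"
   have "odd l" using l prime_odd_nat by auto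
   hence "l mod 4 = 1 & even ((l - 1) div 2) \<or> l mod 4 = 3 & odd ((l - 1) div 2)" by presburger
   thus "chi4 l = of_int (Legendre (- D) (int l))" unfolding 1 Legendre_minus_1[OF l] by (auto simp: chi4_def)
  qed
 next
  case 2
  show ?thesis
  proof (rule key[OF real_char_chi8])
   fix l :: nat assume l: "prime l" "l > 2"
   define h where "h = (l - 1) div 2"
   have "odd l" using l prime_odd_nat by auto
   hence c: "(l mod 8 = 1 \<or> l mod 8 = 3) & even (h div 2) \<or> (l mod 8 = 5 \<or> l mod 8 = 7) & odd (h div 2)"
    unfolding h_def by presburger
   have e: "even (h + (h - h div 2)) \<longleftrightarrow> even (h div 2)" by presburger
   have "Legendre (- D) (int l) = Legendre (-1) (int l)*Legendre 2 (int l)"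
    using Legendre_mult[OF l, of "-1" 2] by (simp add: 2)
   also have "... = (-1)^(h + (h - h div 2))" unfolding Legendre_minus_1[OF l] Legendre_2[OF l] h_def by (rule power_add[symmetric])
   also have "... = (if even (h div 2) then 1 else -1)" using e by (simp add: minus_one_power_iff)
   finally show "chi8 l = of_int (Legendre (- D) (int l))" using c by (auto simp: chi8_def)
  qed
 next
  case 3
  obtain P where P1: "D = int P" using 3(1) zero_le_imp_eq_int[of D] by auto
  have "prime (int P)" using 3(2) unfolding P1 .
  hence Pp: "prime P" by simp
  have "int (P mod 4) = 3" using 3(3) unfolding P1 by (simp add: zmod_int)
  hence "P mod 4 = 3" by linarith
  note P = P1 Pp this
  have P2: "P > 2" using prime_ge_2_nat[OF P(2)] P(3) by (cases "P = 2") auto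
  show ?thesis
  proof (rule key[OF real_char_Legendre[OF P(2,3)]])
   fix l :: nat assume l: "prime l" "l > 2" "~ int l dvd D"
   have ne: "P ~= l" using l(3) P(1) by auto
   have o: "odd ((P - 1) div 2)" using P(3) by presburger
   have "Legendre (int P) (int l)*Legendre (int l) (int P) = (-1)^((P - 1) div 2*((l - 1) div 2))"
    by (rule Quadratic_Reciprocity[OF P(2) P2 l(1,2) ne])
   also have "... = (-1)^((l - 1) div 2)" using o by (simp add: minus_one_power_iff)
   finally have qr: "Legendre (int P) (int l)*Legendre (int l) (int P) = (-1)^((l - 1) div 2)" .
   have "Legendre (- D) (int l) = Legendre (-1) (int l)*Legendre (int P) (int l)"
    using Legendre_mult[OF l(1,2), of "-1" "int P"] by (simp add: P(1))
   also have "... = (-1)^((l - 1) div 2)*Legendre (int P) (int l)" unfolding Legendre_minus_1[OF l(1,2)] ..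
   also have "... = Legendre (int l) (int P)*(Legendre (int P) (int l)*Legendre (int P) (int l))"
    unfolding qr[symmetric] by simp
   also have "Legendre (int P) (int l)*Legendre (int P) (int l) = 1"
   proof -
    have "(-1::int)^((l - 1) div 2) ~= 0" by simp
    hence "Legendre (int P) (int l) ~= 0" unfolding qr[symmetric] by auto
    thus ?thesis using Legendre_values[of "int P" "int l"] by auto
   qed
   finally show "real_of_int (Legendre (int l) (int P)) = of_int (Legendre (- D) (int l))" by simp
  qed
 qed
qed

section \<open>Weights and local densities\<close>

lemma sum_of_bool: "finite A ==> (\<Sum>x\<in>A. of_bool (P x)) = real (card {x\<in>A. P x})"
proof -
 assume A: "finite A"
 have "(\<Sum>x\<in>{x\<in>A. P x}. 1::real) = (\<Sum>x\<in>A. if P x then 1 else 0)" by (rule sum.inter_filter[OF A])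
 thus ?thesis by (simp add: of_bool_def)
qed

lemma box_sum_product:
 fixes f g :: "int => real"
 shows "box_sum L (%u v. f u*g v)
  = (\<Sum>i<L. \<Sum>i'<L. f (int L + int i + int i'))*(\<Sum>j<L. \<Sum>j'<L. g (int L + int j + int j'))"
 unfolding box_sum_def sum_distrib_left[symmetric] sum_distrib_right[symmetric] ..

lemma residue_count:
 assumes "n > 0"
 shows "(\<Sum>i<L. \<Sum>i'<L. of_bool (int n dvd int L + int i + int i' - a)) <= real L*(real L/real n + 1)"
proof -
 have "(\<Sum>i'<L. of_bool (int n dvd int L + int i + int i' - a)) <= real L/real n + 1" for i
 proof -
  have "(\<Sum>i'<L. of_bool (int n dvd int i' - (a - int L - int i))) <= real L/real n + 1"
   using card_residue_le[OF assms, of L "a - int L - int i"] by (simp only: sum_of_bool[OF finite_lessThan])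
  moreover have "int i' - (a - int L - int i) = int L + int i + int i' - a" for i' by simp
  ultimately show ?thesis by simp
 qed
 hence "(\<Sum>i<L. \<Sum>i'<L. of_bool (int n dvd int L + int i + int i' - a)) <= (\<Sum>i<L. real L/real n + 1)"
  by (intro sum_mono)
 thus ?thesis by simp
qed

lemma box_sum_residues_le:
 fixes n L :: nat
 assumes n: "n > 0" and S: "finite S" and F: "!!u v. F u v ==> (u mod int n, v mod int n) \<in> S"
 shows "box_sum L (%u v. of_bool (F u v)) <= real (card S)*(real L*(real L/real n + 1))^2"
proof -
 have pt: "of_bool (F u v) <= (\<Sum>s\<in>S. of_bool (int n dvd u - fst s) * of_bool (int n dvd v - snd s) :: real)" for u v
 proof (cases "F u v")
  case True
  let ?s = "(u mod int n, v mod int n)"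
  have "of_bool (int n dvd u - fst ?s) * of_bool (int n dvd v - snd ?s) = (1::real)" by (simp add: mod_eq_dvd_iff[symmetric])
  hence "1 = (\<Sum>s\<in>{?s}. of_bool (int n dvd u - fst s) * of_bool (int n dvd v - snd s) :: real)" by simp
  also have "... <= (\<Sum>s\<in>S. of_bool (int n dvd u - fst s) * of_bool (int n dvd v - snd s))"
   using S F[OF True] by (intro sum_mono2) auto
  finally show ?thesis using True by simp
 qed (simp add: sum_nonneg)
 have "box_sum L (%u v. of_bool (F u v)) <= (box_sum L (%u v. \<Sum>s\<in>S. of_bool (int n dvd u - fst s) * of_bool (int n dvd v - snd s)) :: real)"
  by (intro box_sum_mono pt)
 also have "... = (\<Sum>s\<in>S. box_sum L (%u v. of_bool (int n dvd u - fst s) * of_bool (int n dvd v - snd s)))" by (rule box_sum_sum)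
 also have "... <= (\<Sum>s\<in>S. (real L*(real L/real n + 1))^2)"
  unfolding box_sum_product power2_eq_square using n
  by (intro sum_mono mult_mono residue_count sum_nonneg mult_nonneg_nonneg add_nonneg_nonneg) auto
 finally show ?thesis by simp
qed

lemma residue_density_bound:
 fixes n L :: nat and C :: real
 assumes "n > 0" "C >= 1" "real n <= C*real L"
 shows "(real L*(real L/real n + 1))^2 <= 4*C^2*real L^4/(real n)^2"
proof -
 have "real n*1 <= C*real L" using assms(3) by simp
 hence "1 <= C*real L/real n" using assms(1) by (simp add: field_simps)
 moreover have "real L/real n <= C*real L/real n" using assms by (intro divide_right_mono) (simp_all add: mult_le_cancel_right1)
 ultimately have "real L/real n + 1 <= 2*C*real L/real n" by simp
 hence "(real L*(real L/real n + 1))^2 <= (real L*(2*C*real L/real n))^2"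
  by (intro power_mono mult_left_mono) auto
 also have "... = 4*C^2*real L^4/(real n)^2" by (simp add: power2_eq_square power4_eq_xxxx field_simps)
 finally show ?thesis .
qed

text \<open>For moduli up to a multiple of L, counting residue classes directly loses only a
  constant. This serves for the rare events, squares of large primes and high prime powers, whose
  moduli have a small reciprocal sum.\<close>

lemma box_sum_prime_power_le:
 fixes L p k :: nat and C :: real
 assumes p: "prime p" "p > 2" "~ int p dvd D" "~ int p dvd c" and C: "C >= 1" "real (p^k) <= C*real L"
 shows "box_sum L (%u v. of_bool (int (p^k) dvd quad D u v - c)) <= 16*C^2*real L^4/real (p^k)"
proof -
 let ?n = "p^k"
 have n0: "?n > 0" using p(1) by (simp add: prime_gt_0_nat)
 have "box_sum L (%u v. of_bool (int ?n dvd quad D u v - c)) <= real (card (conic_pts D c ?n))*(real L*(real L/real ?n + 1))^2"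
  by (rule box_sum_residues_le[OF n0 finite_conic_pts]) (rule conic_mod[OF n0])
 also have "... <= (4*real ?n)*(4*C^2*real L^4/(real ?n)^2)"
 proof (rule mult_mono[OF _ residue_density_bound[OF n0 C]])
  have "real (card (conic_pts D c ?n)) <= real (4 * ?n)" using card_conic_prime_power[OF p, of k] by (simp only: of_nat_le_iff)
  thus "real (card (conic_pts D c ?n)) <= 4*real ?n" by simp
 qed auto
 also have "... = 16*C^2*real L^4/real ?n"
 proof -
  have "4*x*(4*C^2*real L^4/x^2) = 16*C^2*real L^4/x" if "x > 0" for x :: real
   using that by (simp add: power2_eq_square)
  moreover have "real ?n > 0" using n0 by (simp only: of_nat_0_less_iff)
  ultimately show ?thesis by blast
 qed
 finally show ?thesis .
qed

lemma box_sum_common_divisor_le: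
 fixes L p :: nat
 assumes "p > 0" "real p <= 3*real L"
 shows "box_sum L (%u v. of_bool (int p dvd u & int p dvd v)) <= 36*real L^4/(real p)^2"
proof -
 have "box_sum L (%u v. of_bool (int p dvd u & int p dvd v)) <= real (card {(0::int, 0::int)})*(real L*(real L/real p + 1))^2"
  by (rule box_sum_residues_le[OF assms(1)]) auto
 also have "... <= 4*3^2*real L^4/(real p)^2" using residue_density_bound[OF assms(1) _ assms(2)] by simp
 finally show ?thesis by simp
qed

lemma wmean_residue:
 assumes "n > 0"
 shows "wmean n (%u v. of_bool (int n dvd u - a & int n dvd v - b)) = 1/(real n)^2"
proof -
 have eq: "int n dvd u - a \<longleftrightarrow> u = a mod int n" if "u \<in> {0..<int n}" for u a
  using that by (simp add: mod_eq_dvd_iff[symmetric])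
 have r: "a mod int n \<in> {0..<int n}" for a using assms by simp
 have "(\<Sum>u\<in>{0..<int n}. \<Sum>v\<in>{0..<int n}. of_bool (int n dvd u - a & int n dvd v - b) :: real)
   = (\<Sum>u\<in>{0..<int n}. \<Sum>v\<in>{0..<int n}. (if u = a mod int n then (if v = b mod int n then 1 else 0) else 0))"
  using eq by (intro sum.cong refl) (auto simp: of_bool_def)
 also have "... = (\<Sum>u\<in>{0..<int n}. (if u = a mod int n then 1 else 0))"
  using r[of b] by (intro sum.cong refl) (auto simp: sum.delta')
 also have "... = 1" using r[of a] by (simp add: sum.delta')
 finally show ?thesis by (simp add: wmean_def)
qed

lemma per_residue: "per n (%u v. of_bool (int n dvd u - a & int n dvd v - b) :: real)"
 by (simp add: per_def mod_eq_dvd_iff[symmetric])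

text \<open>\<open>n0\<close> is the value of the form at (u0, 1), and u0 will be chosen so that
  \<open>m0\<close> is a norm. The modulus is n0*m0 times N = 420*q*D*h*n0*m0, so that after
  division by n0 and by m0 the cofactors are still 1 modulo N. The factor 420 = 4*3*5*7 contains all
  primes below 8, as the sieve requires, and q controls chi.\<close>

locale shifted_form = real_char chi q for chi :: "nat => real" and q :: nat +
 fixes D h u0 n0 m0 :: int and M :: nat
 assumes D_pos: "D > 0" and h_pos: "h > 0" and n0: "n0 = u0^2 + D" and m0: "m0 = n0 + h"
  and M: "int M = n0*m0*(420*int q*D*h*n0*m0)"
  and splitting: "!!l. prime l ==> ~ l dvd M ==> chi l = 1 \<or> chi l = -1 & (\<forall>s. ~ int l dvd s\<^sup>2 + D)"
begin

lemma n0_pos: "n0 > 0" using n0 D_pos by (simp add: add_nonneg_pos)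
lemma m0_pos: "m0 > 0" using m0 n0_pos h_pos by simp
lemma M_pos: "M > 0"
proof -
 have "int M > 0" unfolding M using n0_pos m0_pos q_pos D_pos h_pos by simp
 thus ?thesis by simp
qed

lemma dvd_M: "int n dvd 420 ==> n dvd M" "int n dvd int q ==> n dvd M" "int n dvd D ==> n dvd M" "int n dvd h ==> n dvd M"
 "int n dvd n0 ==> n dvd M" "int n dvd m0 ==> n dvd M"
proof -
 have *: "n dvd M" if "int n dvd x" "int M = x*y" for x y
 proof -
  have "int n dvd int M" unfolding that(2) using that(1) by (rule dvd_mult2)
  thus ?thesis by simp
 qed
 show "int n dvd 420 ==> n dvd M" by (rule *[of _ "n0*m0*(int q*D*h*n0*m0)"], assumption, simp only: M mult_ac)
 show "int n dvd int q ==> n dvd M" by (rule *[of _ "n0*m0*(420*D*h*n0*m0)"], assumption, simp only: M mult_ac)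
 show "int n dvd D ==> n dvd M" by (rule *[of _ "n0*m0*(420*int q*h*n0*m0)"], assumption, simp only: M mult_ac)
 show "int n dvd h ==> n dvd M" by (rule *[of _ "n0*m0*(420*int q*D*n0*m0)"], assumption, simp only: M mult_ac)
 show "int n dvd n0 ==> n dvd M" by (rule *[of _ "m0*(420*int q*D*h*n0*m0)"], assumption, simp only: M mult_ac)
 show "int n dvd m0 ==> n dvd M" by (rule *[of _ "n0*(420*int q*D*h*n0*m0)"], assumption, simp only: M mult_ac)
qed

lemma prime_not_dvd_M:
 assumes "prime p" "~ p dvd M"
 shows "8 <= p" "p > 2" "~ int p dvd D" "~ int p dvd h" "~ int p dvd - h"
proof -
 show "8 <= p"
 proof (rule ccontr)
  assume "~ 8 <= p"
  moreover have "p > 0" using assms(1) by (rule prime_gt_0_nat)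
  ultimately have "p = 1 \<or> p = 2 \<or> p = 3 \<or> p = 4 \<or> p = 5 \<or> p = 6 \<or> p = 7" by linarith
  hence "int p dvd 420" by (elim disjE) simp_all
  thus False using dvd_M(1) assms(2) by blast
 qed
 thus "p > 2" by simp
 show "~ int p dvd D" "~ int p dvd h" using dvd_M assms(2) by blast+
 thus "~ int p dvd - h" by simp
qed

lemma cong_1_coprime:
 fixes x :: int
 assumes x: "[x = 1] (mod (420*int q*D*h*n0*m0))"
 shows "coprime x (int M)"
proof -
 let ?N = "420*int q*D*h*n0*m0"
 have "coprime x ?N" using x by (metis cong_imp_coprime cong_sym coprime_1_left)
 hence "coprime x n0" "coprime x m0" by simp_all
 thus ?thesis unfolding M using \<open>coprime x ?N\<close> by simp
qed

definition in_class :: "int => int => bool" where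
 "in_class u v \<longleftrightarrow> int M dvd u - u0 & int M dvd v - 1"

text \<open>Both cofactors are 1 modulo 420*q*D*h*n0*m0: this makes them prime to M and gives chi
  the value 1 at the second one.\<close>

lemma class_factorization:
 assumes "in_class u v"
 obtains n1 m1 :: nat where "quad D u v = n0*int n1" "quad D u v + h = m0*int m1" "n1 > 0" "m1 > 0"
  "coprime n1 M" "coprime m1 M" "chi m1 = 1"
proof -
 let ?N = "420*int q*D*h*n0*m0"
 have cq: "[quad D u v = n0] (mod int M)"
 proof -
  have "[quad D u v = quad D u0 1] (mod int M)" using assms unfolding in_class_def by (intro quad_cong) (simp_all add: cong_iff_dvd_diff)
  thus ?thesis by (simp add: quad_def n0)
 qed
 obtain k where k: "quad D u v - n0 = int M * k" using cq by (auto simp: cong_iff_dvd_diff elim: dvdE)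
 define x where "x = 1 + m0 * ?N * k"
 define y where "y = 1 + n0 * ?N * k"
 have x: "quad D u v = n0*x" using k unfolding M x_def by (simp add: algebra_simps)
 have y: "quad D u v + h = m0*y" using k unfolding M y_def m0 by (simp add: algebra_simps)
 have qp: "quad D u v >= 0" using D_pos by (simp add: quad_def)
 have cx: "[x = 1] (mod ?N)" and cy: "[y = 1] (mod ?N)" unfolding x_def y_def by (simp_all add: cong_iff_dvd_diff)
 have "x ~= 0"
 proof
  assume "x = 0"
  hence "?N dvd 1" using cx by (simp add: cong_iff_dvd_diff)
  hence "420 dvd (1::int)" by (meson dvd_mult_left)
  thus False by simp
 qed
 hence xp: "x > 0" using qp n0_pos x by (simp add: zero_le_mult_iff)
 have "m0*y > 0" using y qp h_pos by linarith
 hence yp: "y > 0" using m0_pos by (simp add: zero_less_mult_iff)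
 have co: "coprime x (int M)" "coprime y (int M)" using cong_1_coprime cx cy by blast+
 have chiy: "chi (nat y) = 1"
 proof -
  have "int q dvd ?N" by simp
  hence "[y = 1] (mod int q)" using cy by (meson cong_dvd_modulus)
  hence "[int (nat y) = int 1] (mod int q)" using yp by simp
  hence "[nat y = 1] (mod q)" by (simp only: cong_int_iff)
  hence "nat y mod q = 1 mod q" by (simp add: cong_def)
  hence "chi (nat y) = chi 1" by (metis chi_mod)
  thus ?thesis using chi_1 by simp
 qed
 show ?thesis
 proof (rule that[of "nat x" "nat y"])
  show "quad D u v = n0*int (nat x)" "quad D u v + h = m0*int (nat y)" using x y xp yp by simp_all
  show "nat x > 0" "nat y > 0" using xp yp by simp_all
  show "coprime (nat x) M" "coprime (nat y) M" using co xp yp by (simp_all add: coprime_int_iff[symmetric] del: coprime_int_iff)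
 qed (rule chiy)
qed

definition w0 :: "int => int => real" where "w0 u v = of_bool (in_class u v)"

lemma w0: "per M w0" "wmean M w0 = 1/(real M)^2" "0 <= w0 u v & w0 u v <= 1"
proof -
 have w: "w0 = (%u v. of_bool (int M dvd u - u0 & int M dvd v - 1))" by (intro ext) (simp add: w0_def in_class_def)
 show "per M w0" unfolding w by (rule per_residue)
 show "wmean M w0 = 1/(real M)^2" unfolding w by (rule wmean_residue[OF M_pos])
 show "0 <= w0 u v & w0 u v <= 1" by (simp add: w0_def)
qed

text \<open>The factor 1/2 at the primes dividing the value of the form compensates for the number of its
 representations; the remaining factors remove inert primes, and all primes above z, from the shifted value.\<close>
definition e :: "real => nat => int => int => real" where
 "e z p u v = of_bool (~ (int p dvd u & int p dvd v))*(if int p dvd quad D u v - 0 then 1/2 else 1)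
   * of_bool (~ (int p dvd quad D u v - (- h) & (chi p = -1 \<or> z < real p)))"

lemma e_range: "0 <= e z p u v & e z p u v <= 1" by (simp add: e_def)

lemma per_e: "per p (e z p)"
 unfolding per_def e_def dvd_quad_mod by (simp add: dvd_mod_iff)

text \<open>For split p the form vanishes with density about 2/p, which the weight halves; for inert
  p it vanishes only at the origin, while the shifted value is excluded with density about 1/p. Up
  to z both cases cost 1/p, so the sieve has dimension 1. Above z both costs can occur together, and
  3/p covers them.\<close>

lemma e_density:
 assumes p: "prime p" "~ p dvd M"
 shows "0 <= 1 - wmean p (e z p)" "1 - wmean p (e z p) <= 3/real p"
  "real p <= z ==> 1 - wmean p (e z p) <= 1/real p + 2/(real p)^2"
proof -
 note pm = prime_not_dvd_M[OF p] and spl = splitting[OF p]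
 interpret conic_prime D p by unfold_locales (use p pm in auto)
 have p0: "p > 0" and rp: "real p >= 8" using pm(1) by simp_all
 show "0 <= 1 - wmean p (e z p)" using wmean_le_1[OF p0, of "e z p"] e_range by simp
 define k where "k = (of_bool (chi p = -1 \<or> z < real p) :: real)"
 define i0 where "i0 = (%u v. of_bool (int p dvd quad D u v - 0) :: real)"
 define i1 where "i1 = (%u v. of_bool (int p dvd u - 0 & int p dvd v - 0) :: real)"
 define ih where "ih = (%u v. of_bool (int p dvd quad D u v - (- h)) :: real)"
 \<comment> \<open>When p divides both coordinates the whole weight 1 is lost; the halves of
   \<open>i0\<close> and \<open>i1\<close> together pay for it.\<close>
 have pt: "1 - e z p u v <= 1/2*i0 u v + 1/2*i1 u v + k*ih u v" for u v
 proof (cases "int p dvd u & int p dvd v")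
  case True
  hence "int p dvd quad D u v" by (simp add: quad_def power2_eq_square)
  thus ?thesis using True by (simp add: e_def i0_def i1_def ih_def k_def)
 next
  case False
  thus ?thesis by (cases "int p dvd quad D u v"; cases "int p dvd quad D u v + h") (auto simp: e_def i0_def i1_def ih_def k_def)
 qed
 have w1: "wmean p (%u v. 1) = 1" using p0 by (simp add: wmean_def power2_eq_square)
 have "1 - wmean p (e z p) = wmean p (%u v. 1*1 + (- 1)*e z p u v)" unfolding wmean_linear w1 by simp
 also have "... <= wmean p (%u v. 1*(1/2*i0 u v + 1/2*i1 u v) + k*ih u v)" using pt by (intro wmean_mono) simp
 also have "... = 1/2 * cdens D 0 p + 1/2*(1/(real p)^2) + k * cdens D (- h) p"
  unfolding wmean_linear unfolding i0_def i1_def ih_def wmean_conic wmean_residue[OF p0] by simp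
 finally have g: "1 - wmean p (e z p) <= 1/2 * cdens D 0 p + 1/2*(1/(real p)^2) + k * cdens D (- h) p" .
 have c0: "cdens D 0 p <= (2*real p - 1)/(real p)^2"
 proof -
  have "real (card (conic_pts D 0 p)) <= 2*real p - 1" using card_conic_0(2) p0 by linarith
  thus ?thesis unfolding cdens_def by (intro divide_right_mono) auto
 qed
 have c0i: "cdens D 0 p <= 1/(real p)^2" if "chi p = -1"
 proof -
  have "\<forall>s. ~ int p dvd s\<^sup>2 + D" using spl that by auto
  hence "card (conic_pts D 0 p) = 1" using card_conic_0_inert by blast
  thus ?thesis by (simp add: cdens_def)
 qed
 have ch: "cdens D (- h) p <= (real p + 1)/(real p)^2" "0 <= cdens D (- h) p"
 proof -
  have "real (card (conic_pts D (- h) p)) <= real p + 1" using card_conic_bounds(2)[OF pm(5)] by linarith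
  thus "cdens D (- h) p <= (real p + 1)/(real p)^2" unfolding cdens_def by (intro divide_right_mono) auto
  show "0 <= cdens D (- h) p" by (simp add: cdens_def)
 qed
 have ip: "1/(real p)^2 <= (1/8)*(1/real p)" using rp by (simp add: power2_eq_square field_simps)
 have s1: "(2*real p - 1)/(real p)^2 = 2/real p - 1/(real p)^2" "(real p + 1)/(real p)^2 = 1/real p + 1/(real p)^2"
  "2/(real p)^2 = 2*(1/(real p)^2)" "2/real p = 2*(1/real p)" "3/real p = 3*(1/real p)"
  using rp by (simp_all add: power2_eq_square field_simps)
 have q0: "0 <= 1/(real p)^2" by simp
 have kch: "k * cdens D (- h) p <= 1/real p + 1/(real p)^2" using ch unfolding s1 k_def by (auto simp: of_bool_def)
 show "1 - wmean p (e z p) <= 3/real p" using g c0 kch ip q0 unfolding s1 by linarith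
 assume pz: "real p <= z"
 show "1 - wmean p (e z p) <= 1/real p + 2/(real p)^2"
 proof (cases "chi p = -1")
  case True
  thus ?thesis using g c0i kch q0 unfolding s1 by linarith
 next
  case False
  hence "k * cdens D (- h) p = 0" using pz by (simp add: k_def)
  thus ?thesis using g c0 q0 unfolding s1 by linarith
 qed
qed

definition P :: "real => nat set" where "P y = {p. prime p & ~ p dvd M & real p <= y}"

lemma finite_P: "finite (P y)" unfolding P_def by (rule finite_subset[OF _ finite_real_le_set[of "%_. True" y]]) auto

definition V :: "real => real => real" where "V z y = (\<Prod>p\<in>P y. wmean p (e z p))"

lemma exp_lower: "0 <= x ==> x <= 1/2 ==> exp (- x - 2*x^2) <= 1 - (x::real)"
 using ln_one_minus_pos_lower_bound[of x] by (subst ln_ge_iff[symmetric]) auto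

text \<open>Up to z the local means multiply to a constant times 1/ln z by Mertens' estimate; the
  primes from z to z^A contribute a factor bounded in terms of A alone.\<close>

lemma V_lower:
 assumes "A >= 1"
 shows "\<exists>c>0. \<forall>z\<ge>3. c/ln z <= V z (z powr A)"
proof -
 obtain C where C: "!!n. n >= 2 ==> (\<Sum>p | prime p & p <= n. 1/real p) <= ln (ln (real n)) + C"
  using mertens2 by blast
 define c where "c = exp (- (C + 36 + 3*(A + 5) + 40))"
 have "c/ln z <= V z (z powr A)" if z: "z >= 3" for z
 proof -
  define y where "y = z powr A"
  have yz: "z <= y" unfolding y_def using z assms powr_mono[of 1 A z] by simp
  define g where "g = (%p. 1 - wmean p (e z p))"
  define P1 where "P1 = {p\<in>P y. real p <= z}"
  define P2 where "P2 = {p\<in>P y. z < real p}"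
  have PP: "P y = P1 \<union> P2" "P1 \<inter> P2 = {}" "finite P1" "finite P2" using finite_P[of y] by (auto simp: P1_def P2_def)
  have pr: "prime p" "~ p dvd M" if "p \<in> P y" for p using that by (auto simp: P_def)
  have g0: "0 <= g p" "g p <= 3/real p" if "p \<in> P y" for p using e_density[OF pr[OF that]] by (auto simp: g_def)
  have gsq: "2*(g p)^2 <= 18*(1/(real p)^2)" if "p \<in> P y" for p
   using power_mono[OF g0(2)[OF that] g0(1)[OF that], of 2] by (simp add: power_divide)
  have p8: "8 <= real p" if "p \<in> P y" for p using prime_not_dvd_M(1)[OF pr[OF that]] by simp
  have sq: "(\<Sum>p\<in>S. 1/(real p)^2) <= 2" if "S <= P y" for S
   using sum_inverse_squares_real_le[of 1 S] finite_subset[OF that finite_P] p8 that by force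
  have e1: "exp (- g p - 2*(g p)^2) <= wmean p (e z p)" if "p \<in> P y" for p
  proof -
   have "3/real p <= 1/2" using p8[OF that] by (simp add: field_simps)
   hence "exp (- g p - 2*(g p)^2) <= 1 - g p" using g0[OF that] by (intro exp_lower) auto
   thus ?thesis by (simp add: g_def)
  qed
  have z3: "ln z >= 1"
  proof -
   have "exp 1 <= z" using exp_le z by linarith
   thus ?thesis using z by (subst ln_ge_iff) auto
  qed
  have S1: "(\<Sum>p\<in>P1. g p + 2*(g p)^2) <= ln (ln z) + C + 40"
  proof -
   have "(\<Sum>p\<in>P1. g p + 2*(g p)^2) <= (\<Sum>p\<in>P1. 1/real p + 20*(1/(real p)^2))"
   proof (rule sum_mono)
    fix p assume p: "p \<in> P1"
    hence pP: "p \<in> P y" and pz: "real p <= z" by (auto simp: P1_def)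
    have "g p <= 1/real p + 2*(1/(real p)^2)" using e_density(3)[OF pr[OF pP] pz] by (simp add: g_def)
    thus "g p + 2*(g p)^2 <= 1/real p + 20*(1/(real p)^2)" using gsq[OF pP] by linarith
   qed
   also have "... = (\<Sum>p\<in>P1. 1/real p) + 20*(\<Sum>p\<in>P1. 1/(real p)^2)" by (simp add: sum.distrib sum_distrib_left)
   also have "(\<Sum>p\<in>P1. 1/(real p)^2) <= 2" by (rule sq) (auto simp: P1_def)
   also have "(\<Sum>p\<in>P1. 1/real p) <= (\<Sum>p | prime p & p <= nat (floor z). 1/real p)"
    using pr by (intro sum_mono2) (auto simp: P1_def le_nat_floor)
   also have "... <= ln (ln (real (nat (floor z)))) + C" using z by (intro C) linarith
   also have "ln (ln (real (nat (floor z)))) <= ln (ln z)"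
   proof -
    have n2: "2 <= nat (floor z)" using z by linarith
    hence "real (nat (floor z)) >= 2" by linarith
    moreover have "real (nat (floor z)) <= z" using z by (intro of_nat_floor) simp
    ultimately show ?thesis by (intro ln_mono) auto
   qed
   finally show ?thesis by simp
  qed
  have S2: "(\<Sum>p\<in>P2. g p + 2*(g p)^2) <= 3*(A + 5) + 36"
  proof -
   have fin: "finite {p. prime p & z < real p & real p <= y}"
    by (rule finite_subset[OF _ finite_real_le_set[of "%_. True" y]]) auto
   have "(\<Sum>p\<in>P2. g p + 2*(g p)^2) <= (\<Sum>p\<in>P2. 3*(1/real p) + 18*(1/(real p)^2))"
   proof (rule sum_mono)
    fix p assume p: "p \<in> P2"
    hence pP: "p \<in> P y" by (auto simp: P2_def)
    show "g p + 2*(g p)^2 <= 3*(1/real p) + 18*(1/(real p)^2)" using gsq[OF pP] g0(2)[OF pP] by simp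
   qed
   also have "... = 3*(\<Sum>p\<in>P2. 1/real p) + 18*(\<Sum>p\<in>P2. 1/(real p)^2)" by (simp add: sum.distrib sum_distrib_left)
   also have "(\<Sum>p\<in>P2. 1/(real p)^2) <= 2" by (rule sq) (auto simp: P2_def)
   also have "(\<Sum>p\<in>P2. 1/real p) <= (\<Sum>p | prime p & z < real p & real p <= y. 1/real p)"
    by (rule sum_mono2[OF fin]) (auto simp: P2_def P_def)
   also have "... <= (ln (y/z) + 6)/ln z" using z yz by (intro sum_inverse_prime_interval) auto
   also have "... = A - 1 + 6/ln z" using z z3 by (simp add: y_def ln_div ln_powr field_simps)
   also have "6/ln z <= 6/1" using z3 by (intro divide_left_mono) auto
   finally show ?thesis by simp
  qed
  have "exp (- (\<Sum>p\<in>P y. g p + 2*(g p)^2)) = (\<Prod>p\<in>P y. exp (- g p - 2*(g p)^2))"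
   by (simp add: exp_sum[OF finite_P, symmetric] sum_negf[symmetric] algebra_simps)
  also have "... <= V z y" unfolding V_def using e1 by (intro prod_mono) auto
  finally have V: "exp (- (\<Sum>p\<in>P y. g p + 2*(g p)^2)) <= V z y" .
  have "(\<Sum>p\<in>P y. g p + 2*(g p)^2) = (\<Sum>p\<in>P1. g p + 2*(g p)^2) + (\<Sum>p\<in>P2. g p + 2*(g p)^2)"
   unfolding PP(1) by (rule sum.union_disjoint[OF PP(3,4,2)])
  hence "- (C + 36 + 3*(A + 5) + 40) - ln (ln z) <= - (\<Sum>p\<in>P y. g p + 2*(g p)^2)" using S1 S2 by linarith
  hence "exp (- (C + 36 + 3*(A + 5) + 40) - ln (ln z)) <= V z y" using V by (meson exp_le_cancel_iff order_trans)
  moreover have "exp (- (C + 36 + 3*(A + 5) + 40) - ln (ln z)) = c/ln z" unfolding c_def exp_diff using z3 by simp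
  ultimately show ?thesis by (simp add: y_def)
 qed
 moreover have "c > 0" by (simp add: c_def)
 ultimately show ?thesis by blast
qed

end

section \<open>A pointwise lower bound for the indicator of good cofactors\<close>

lemma prod_prime_factors_or_square_dvd:
 fixes k :: nat
 assumes "k > 0" "\<Prod>(prime_factors k) ~= k"
 shows "\<exists>p. prime p & p\<^sup>2 dvd k"
proof (rule ccontr)
 assume no: "\<nexists>p. prime p & p\<^sup>2 dvd k"
 have "multiplicity p k = 1" if p: "p \<in> prime_factors k" for p
 proof -
  have "prime p" "p dvd k" using p by auto
  have "multiplicity p k >= 1" using p by (simp add: prime_factors_multiplicity)
  moreover have "~ multiplicity p k >= 2"
  proof
   assume "multiplicity p k >= 2"
   hence "p^2 dvd k" by (rule multiplicity_dvd')
   thus False using no \<open>prime p\<close> by blast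
  qed
  ultimately show ?thesis by simp
 qed
 hence "(\<Prod>p\<in>prime_factors k. p^multiplicity p k) = (\<Prod>p\<in>prime_factors k. p)" by (intro prod.cong) simp_all
 hence "k = \<Prod>(prime_factors k)" using prime_factorization_nat[OF assms(1)] by (rule trans[rotated])
 thus False using assms(2) by simp
qed

lemma sum_le_sum_superset:
 fixes f :: "'a => real"
 assumes "finite B" "finite A" "!!x. 0 <= f x" "!!x. x \<in> A ==> f x ~= 0 ==> x \<in> B"
 shows "sum f A <= sum f B"
proof -
 have "sum f A = sum f {x\<in>A. f x ~= 0}" using assms(2) by (intro sum.mono_neutral_right) auto
 also have "... <= sum f B" using assms by (intro sum_mono2) auto
 finally show ?thesis .
qed

text \<open>A Markov-type bound for the event t < s. As ln s is the sum of the von Mangoldt function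
  over the divisors of s, either some prime power in that sum exceeds z, which forces
  \<open>p^E p\<close> to divide m1, or those up to z alone carry more than ln t.\<close>

lemma smooth_part_bound:
 fixes s m1 :: nat and z t :: real
 assumes s: "s > 0" "s dvd m1" "!!p. prime p ==> p dvd s ==> real p <= z" and m1: "m1 > 0"
  and E: "!!p. p >= 2 ==> real p^E p <= z*real p & E p >= 1"
  and t: "1 < t" "t < real s"
 shows "1 <= (\<Sum>q | q >= 2 & real q <= z & q dvd m1. mangoldt q)/ln t + real (card {p. prime p & real p <= z & p^E p dvd m1})"
proof -
 let ?S = "{q. q >= 2 & real q <= z & q dvd m1}" and ?B = "{p. prime p & real p <= z & p^E p dvd m1}"
 have finS: "finite ?S" by (rule finite_subset[OF _ finite_real_le_set[of "%_. True" z]]) auto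
 have finB: "finite ?B" by (rule finite_subset[OF _ finite_real_le_set[of "%_. True" z]]) auto
 have nn: "0 <= (\<Sum>q\<in>?S. mangoldt q)/ln t" using t by (intro divide_nonneg_pos sum_nonneg mangoldt_nonneg) auto
 show ?thesis
 proof (cases "?B = {}")
  case False
  hence "card ?B >= 1" using finB by (simp add: Suc_le_eq card_gt_0_iff)
  hence "real (card ?B) >= 1" by simp
  thus ?thesis using nn by linarith
 next
  case True
  have "ln t < ln (real s)" using t by simp
  also have "... = (\<Sum>d | d dvd s. mangoldt d)" using mangoldt_sum[of s, where ?'a = real] s(1) by simp
  also have "... <= (\<Sum>q\<in>?S. mangoldt q)"
  proof (rule sum_le_sum_superset)
   show "finite ?S" by (rule finS)
   show "finite {d. d dvd s}" using s(1) by simp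
   show "0 <= (mangoldt q :: real)" for q by (rule mangoldt_nonneg)
   fix d assume d: "d \<in> {d. d dvd s}" "mangoldt d ~= (0::real)"
   hence "primepow d" by (simp add: mangoldt_def split: if_splits)
   then obtain p a where pa: "prime p" "a > 0" "d = p^a" by (auto simp: primepow_def)
   have ps: "p dvd s" using d(1) pa(2,3) by (meson dvd_power dvd_trans mem_Collect_eq)
   have pz: "real p <= z" using s(3) pa(1) ps by blast
   have p2: "p >= 2" using pa(1) by (rule prime_ge_2_nat)
   have dm: "d dvd m1" using d(1) s(2) dvd_trans by blast
   have "real d <= z"
   proof (rule ccontr)
    assume "~ real d <= z"
    hence zd: "z < real p^a" by (simp add: pa(3))
    obtain e where e: "E p = Suc e" using E[OF p2] by (cases "E p") auto
    have "real p^e*real p <= z*real p" using E[OF p2] by (simp add: e mult.commute)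
    hence "real p^e <= z" using p2 by simp
    hence "real p^e < real p^a" using zd by linarith
    hence "e < a" using p2 by (intro power_less_imp_less_exp[of "real p"]) auto
    hence "p^E p dvd d" unfolding pa(3) e by (intro le_imp_power_dvd) simp
    hence "p \<in> ?B" using pa(1) pz dm dvd_trans by blast
    thus False using True by blast
   qed
   moreover have "d >= 2"
   proof -
    have "p^1 <= p^a" using pa(2) p2 by (intro power_increasing) auto
    thus ?thesis using p2 pa(3) by simp
   qed
   ultimately show "d \<in> ?S" using dm by simp
  qed
  finally have "1 <= (\<Sum>q\<in>?S. mangoldt q)/ln t" using t by (simp add: field_simps)
  thus ?thesis by (simp only: True)
 qed
qed

context real_char begin

text \<open>Write m1 = s*r with r its y-rough part. The sum of chi over the divisors of r lies
  between 0 and 2^J and vanishes if an inert prime has odd exponent, so it is at most 2^J times the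
  indicator. \<open>hyperbola\<close> opens it. Divisors that are not squarefree are charged to
  squares of primes above y, three times, as T enters twice and A once. If s > t, the last error
  term alone outweighs the main sum.\<close>

lemma pointwise_lower_bound:
 fixes y z t :: real and m1 Kc J :: nat
 assumes m1: "m1 > 0" "chi m1 = 1" "m1 <= Kc^2" "real m1 <= y^J" and y: "1 < y" and t: "1 < t"
  and primes: "!!p. prime p ==> p dvd m1 ==> real p <= z & chi p = 1 \<or> y < real p" 
  and E: "!!p. p >= 2 ==> real p^E p <= z*real p & E p >= 1"
 defines "KK == {K. K <= {p. prime p & y < real p & p <= Kc} & \<Prod>K <= Kc}"
 shows "2*(\<Sum>K\<in>{K\<in>KK. \<Prod>K dvd m1}. chi (\<Prod>K)) - real (card {K\<in>KK. \<Prod>K dvd m1 & real m1 <= t*real (\<Prod>K)*real Kc})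
  - 2^J*(3*real (card {r. prime r & y < real r & r\<^sup>2 <= Kc & r\<^sup>2 dvd m1}))
  - 2*2^J*((\<Sum>q | q >= 2 & real q <= z & q dvd m1. mangoldt q)/ln t + real (card {p. prime p & real p <= z & p^E p dvd m1}))
  <= 2^J * of_bool (\<forall>p. prime p --> chi p = -1 --> even (multiplicity p m1))"
proof -
 let ?Sm = "(\<Sum>q | q >= 2 & real q <= z & q dvd m1. mangoldt q)/ln t + real (card {p. prime p & real p <= z & p^E p dvd m1})"
 define Bd where "Bd = {r. prime r & y < real r & r\<^sup>2 <= Kc & r\<^sup>2 dvd m1}"
 define c where "c = real (card Bd)"
 obtain s r where sr: "m1 = s*r" "s > 0" "r > 0" "!!p. prime p ==> p dvd s ==> real p <= y" "!!p. prime p ==> p dvd r ==> y < real p"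
  using rough_smooth_split[OF m1(1), of y] by blast
 have sz: "real p <= z & chi p = 1" if "prime p" "p dvd s" for p
 proof -
  have "p dvd m1" using that(2) sr(1) by simp
  thus ?thesis using primes[OF that(1)] sr(4)[OF that] by auto
 qed
 have chis: "chi s = 1" by (rule chi_eq_1_if_primes[OF sr(2)], rule conjunct2[OF sz])
 have chir: "chi r = 1" using m1(2) chis by (simp add: sr(1) chi_mult)
 have rm: "r <= m1" using sr by simp
 have rK: "r <= Kc^2" using rm m1(3) by simp
 have ry: "real r <= y^J" 
 proof -
  have "real r <= real m1" using rm by simp
  thus ?thesis using m1(4) by linarith
 qed
 have dr: "card {k. k dvd r} <= 2^J" by (rule rough_divisors_le(1)[OF sr(3) y sr(5) ry])
 have fr: "finite {k. k dvd r & Q k}" for Q using sr(3) by simp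
 have card_le: "real (card {k. k dvd r & Q k}) <= 2^J" for Q
 proof -
  have "card {k. k dvd r & Q k} <= card {k. k dvd r}" using sr(3) by (intro card_mono) auto
  hence "card {k. k dvd r & Q k} <= 2^J" using dr by (rule order_trans)
  hence "real (card {k. k dvd r & Q k}) <= real (2^J)" by (simp only: of_nat_le_iff)
  thus ?thesis by simp
 qed
 have Sm0: "0 <= ?Sm" using t by (intro add_nonneg_nonneg divide_nonneg_pos sum_nonneg mangoldt_nonneg) auto
 have finBd: "finite Bd" unfolding Bd_def by (rule finite_subset[of _ "{r. r dvd m1}"]) (use m1(1) in \<open>auto intro: dvd_trans[OF dvd_power[of 2]]\<close>)
 let ?sq = "%k. \<Prod>(prime_factors k) = k"
 \<comment> \<open>One divisor that is not squarefree already produces a prime in \<open>Bd\<close>;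
   all 2^J possible divisors are charged to it.\<close>
 have bad: "real (card {k. k dvd r & k <= Kc & ~ ?sq k}) <= 2^J * c"
 proof (cases "{k. k dvd r & k <= Kc & ~ ?sq k} = {}")
  case True
  thus ?thesis by (simp only: True) (simp add: c_def)
 next
  case False
  then obtain k where k: "k dvd r" "k <= Kc" "~ ?sq k" by blast
  have k0: "k > 0" using k(1) sr(3) by (auto intro: Nat.gr0I)
  obtain p where p: "prime p" "p^2 dvd k" using prod_prime_factors_or_square_dvd[OF k0 k(3)] by blast
  have pr: "p^2 dvd r" using p(2) k(1) by (rule dvd_trans)
  have "p dvd r" using pr by (meson dvd_trans dvd_power zero_less_numeral)
  hence "y < real p" using sr(5) p(1) by blast
  moreover have "p^2 <= Kc" using dvd_imp_le[OF p(2) k0] k(2) by simp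
  moreover have "p^2 dvd m1" unfolding sr(1) using pr by (rule dvd_mult)
  ultimately have "p \<in> Bd" using p(1) by (simp add: Bd_def)
  hence "card Bd >= 1" using finBd by (metis One_nat_def Suc_le_eq card_gt_0_iff empty_iff)
  hence "1 <= c" by (simp add: c_def)
  hence "2^J*1 <= 2^J * c" by (intro mult_left_mono) auto
  thus ?thesis using card_le[of "%k. k <= Kc & ~ ?sq k"] by linarith
 qed
 have KKp: "finite K" "!!p. p \<in> K ==> prime p & y < real p" if "K \<in> KK" for K
 proof -
  have "K <= {..Kc}" using that by (auto simp: KK_def)
  thus "finite K" using finite_subset by blast
  show "!!p. p \<in> K ==> prime p & y < real p" using that by (auto simp: KK_def)
 qed
 have pfK: "prime_factors (\<Prod>K) = K" if "K \<in> KK" for K using KKp[OF that] by (intro prime_factors_prod_primes) auto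
 have Kdvd: "\<Prod>K dvd m1 \<longleftrightarrow> \<Prod>K dvd r" if K: "K \<in> KK" for K
 proof -
  have "coprime (\<Prod>K) s"
  proof (rule prod_coprime_left)
   fix p assume p: "p \<in> K"
   have "~ p dvd s" using KKp(2)[OF K p] sr(4)[of p] by auto
   thus "coprime p s" using KKp(2)[OF K p] by (simp add: prime_imp_coprime)
  qed
  thus ?thesis by (simp add: sr(1) coprime_dvd_mult_right_iff)
 qed
 \<comment> \<open>Sets of primes above y correspond to squarefree divisors of r, since the smooth
   part is prime to them.\<close>
 have bij: "bij_betw (%K. \<Prod>K) {K\<in>KK. \<Prod>K dvd m1} {k. k dvd r & k <= Kc & ?sq k}"
 proof (rule bij_betw_byWitness[where f' = prime_factors])
  show "\<forall>K\<in>{K\<in>KK. \<Prod>K dvd m1}. prime_factors (\<Prod>K) = K" using pfK by blast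
  show "\<forall>k\<in>{k. k dvd r & k <= Kc & ?sq k}. \<Prod>(prime_factors k) = k" by blast
  show "(%K. \<Prod>K) ` {K\<in>KK. \<Prod>K dvd m1} <= {k. k dvd r & k <= Kc & ?sq k}"
  proof (rule image_subsetI)
   fix K assume "K \<in> {K\<in>KK. \<Prod>K dvd m1}"
   hence K: "K \<in> KK" "\<Prod>K dvd m1" by blast+
   have "\<Prod>K <= Kc" using K(1) unfolding KK_def by blast
   thus "\<Prod>K \<in> {k. k dvd r & k <= Kc & ?sq k}" using Kdvd[OF K(1)] K(2) pfK[OF K(1)] by simp
  qed
  show "prime_factors ` {k. k dvd r & k <= Kc & ?sq k} <= {K\<in>KK. \<Prod>K dvd m1}"
  proof (rule image_subsetI)
   fix k assume k: "k \<in> {k. k dvd r & k <= Kc & ?sq k}"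
   hence k': "k dvd r" "k <= Kc" "\<Prod>(prime_factors k) = k" by blast+
   have k0: "k > 0" using k'(1) sr(3) by (auto intro: Nat.gr0I)
   have "prime_factors k <= {p. prime p & y < real p & p <= Kc}"
   proof
    fix p assume "p \<in> prime_factors k"
    hence p: "prime p" "p dvd k" by auto
    have "p <= Kc" using dvd_imp_le[OF p(2) k0] k'(2) by simp
    thus "p \<in> {p. prime p & y < real p & p <= Kc}" using sr(5)[OF p(1) dvd_trans[OF p(2) k'(1)]] p(1) by blast
   qed
   hence "prime_factors k \<in> KK" unfolding KK_def using k'(2,3) by (simp only: mem_Collect_eq)
   moreover have "\<Prod>(prime_factors k) dvd m1" 
   proof -
    have "\<Prod>(prime_factors k) dvd r" unfolding k'(3) by (rule k'(1))
    thus ?thesis using Kdvd[OF calculation] by blast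
   qed
   ultimately show "prime_factors k \<in> {K\<in>KK. \<Prod>K dvd m1}" by blast
  qed
 qed
 define Ts where "Ts = (\<Sum>K\<in>{K\<in>KK. \<Prod>K dvd m1}. chi (\<Prod>K))"
 have Ts: "Ts = (\<Sum>k | k dvd r & k <= Kc & ?sq k. chi k)" unfolding Ts_def by (rule sum.reindex_bij_betw[OF bij])
 have abs_chi: "\<bar>\<Sum>k | k dvd r & Q k. chi k\<bar> <= real (card {k. k dvd r & Q k})" for Q
 proof -
  have "\<bar>\<Sum>k | k dvd r & Q k. chi k\<bar> <= (\<Sum>k | k dvd r & Q k. \<bar>chi k\<bar>)" by (rule sum_abs)
  also have "... <= (\<Sum>k | k dvd r & Q k. 1)" by (intro sum_mono chi_abs_le)
  finally show ?thesis by simp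
 qed
 have TsJ: "Ts <= 2^J" using abs_chi[of "%k. k <= Kc & ?sq k"] card_le[of "%k. k <= Kc & ?sq k"] unfolding Ts by linarith
 define Am where "Am = real (card {K\<in>KK. \<Prod>K dvd m1 & real m1 <= t*real (\<Prod>K)*real Kc})"
 have g0: "0 <= div_sum r" using sr(3) by (rule div_sum_nonneg)
 have gJ: "div_sum r <= 2^J"
 proof -
  have "\<bar>\<Sum>k | k dvd r. chi k\<bar> <= real (card {k. k dvd r})" using abs_chi[of "%_. True"] by (simp only: simp_thms)
  moreover have "real (card {k. k dvd r}) <= 2^J" using card_le[of "%_. True"] by (simp only: simp_thms)
  ultimately show ?thesis unfolding div_sum_def by linarith
 qed
 have good: "div_sum r <= 2^J * of_bool (\<forall>p. prime p --> chi p = -1 --> even (multiplicity p m1))"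
 proof (cases "div_sum r = 0")
  case False
  have "even (multiplicity p m1)" if p: "prime p" "chi p = -1" for p
  proof -
   have "~ p dvd s" using sz[OF p(1)] p(2) by auto
   hence "multiplicity p s = 0" by (rule not_dvd_imp_multiplicity_0)
   hence "multiplicity p m1 = multiplicity p r"
    using p(1) sr(2,3) by (simp add: sr(1) prime_elem_multiplicity_mult_distrib)
   thus ?thesis using div_sum_eq_0[OF p _ sr(3)] False by auto
  qed
  hence "of_bool (\<forall>p. prime p --> chi p = -1 --> even (multiplicity p m1)) = (1::real)" by simp
  thus ?thesis using gJ by simp
 qed simp
 have c0: "0 <= 2^J * c" by (simp add: c_def)
 have Am0: "0 <= Am" by (simp add: Am_def)
 have "2*Ts - Am - 2^J*(3 * c) - 2*2^J * ?Sm <= div_sum r"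
 proof (cases "t < real s")
  case True
  have "1 <= ?Sm" by (rule smooth_part_bound[OF sr(2) _ _ m1(1) E t True]) (use sz sr(1) in auto)
  hence "2*2^J*1 <= 2*2^J * ?Sm" by (intro mult_left_mono) auto
  thus ?thesis using TsJ Am0 c0 g0 by linarith
 next
  case False
  define T where "T = (\<Sum>k | k dvd r & k <= Kc. chi k)"
  define A where "A = (\<Sum>k | k dvd r & k <= Kc & r <= k*Kc. chi k)"
  have g: "div_sum r = 2*T - A" unfolding T_def A_def by (rule hyperbola[OF sr(3) chir rK])
  have "T = Ts + (\<Sum>k | k dvd r & k <= Kc & ~ ?sq k. chi k)"
   unfolding T_def Ts by (subst sum.union_disjoint[symmetric]) (auto simp: fr intro!: sum.cong)
  hence T: "Ts - 2^J * c <= T" using abs_chi[of "%k. k <= Kc & ~ ?sq k"] bad by linarith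
  have "A <= real (card {k. k dvd r & k <= Kc & r <= k*Kc})"
   unfolding A_def using abs_chi[of "%k. k <= Kc & r <= k*Kc"] by linarith
  also have "card {k. k dvd r & k <= Kc & r <= k*Kc} <= card ((%K. \<Prod>K) ` {K\<in>KK. \<Prod>K dvd m1 & real m1 <= t*real (\<Prod>K)*real Kc} \<union> {k. k dvd r & k <= Kc & ~ ?sq k})"
  proof (rule card_mono)
   have "finite {K\<in>KK. \<Prod>K dvd m1}" by (simp only: bij_betw_finite[OF bij] fr)
   hence "finite {K\<in>KK. \<Prod>K dvd m1 & real m1 <= t*real (\<Prod>K)*real Kc}" by (rule rev_finite_subset) blast
   thus "finite ((%K. \<Prod>K) ` {K\<in>KK. \<Prod>K dvd m1 & real m1 <= t*real (\<Prod>K)*real Kc} \<union> {k. k dvd r & k <= Kc & ~ ?sq k})"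
    by (intro finite_UnI finite_imageI fr)
   show "{k. k dvd r & k <= Kc & r <= k*Kc} <= (%K. \<Prod>K) ` {K\<in>KK. \<Prod>K dvd m1 & real m1 <= t*real (\<Prod>K)*real Kc} \<union> {k. k dvd r & k <= Kc & ~ ?sq k}"
   proof
    fix k assume "k \<in> {k. k dvd r & k <= Kc & r <= k*Kc}"
    hence k: "k dvd r" "k <= Kc" "r <= k*Kc" by blast+
    show "k \<in> (%K. \<Prod>K) ` {K\<in>KK. \<Prod>K dvd m1 & real m1 <= t*real (\<Prod>K)*real Kc} \<union> {k. k dvd r & k <= Kc & ~ ?sq k}"
    proof (cases "?sq k")
     case True
     hence "k \<in> (%K. \<Prod>K) ` {K\<in>KK. \<Prod>K dvd m1}" using bij k unfolding bij_betw_def by blast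
     then obtain K where K: "K \<in> KK" "\<Prod>K dvd m1" "k = \<Prod>K" by blast
     \<comment> \<open>With s <= t the condition r <= k*Kc becomes m1 <= t*k*Kc, free of the
       factorization of m1.\<close>
     have "real m1 = real s*real r" by (simp add: sr(1))
     also have "... <= t*real (k*Kc)" using False k(3) t by (intro mult_mono) (auto simp del: of_nat_mult)
     finally have "real m1 <= t*real (\<Prod>K)*real Kc" by (simp add: K(3) mult.assoc del: of_nat_prod)
     thus ?thesis using K by blast
    qed (use k in blast)
   qed
  qed
  also have "... <= card ((%K. \<Prod>K) ` {K\<in>KK. \<Prod>K dvd m1 & real m1 <= t*real (\<Prod>K)*real Kc}) + card {k. k dvd r & k <= Kc & ~ ?sq k}"
   by (rule card_Un_le)
  also have "card ((%K. \<Prod>K) ` {K\<in>KK. \<Prod>K dvd m1 & real m1 <= t*real (\<Prod>K)*real Kc}) <= card {K\<in>KK. \<Prod>K dvd m1 & real m1 <= t*real (\<Prod>K)*real Kc}"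
  proof (rule card_image_le)
   have "finite {K\<in>KK. \<Prod>K dvd m1}" by (simp only: bij_betw_finite[OF bij] fr)
   thus "finite {K\<in>KK. \<Prod>K dvd m1 & real m1 <= t*real (\<Prod>K)*real Kc}" by (rule rev_finite_subset) blast
  qed
  finally have "A <= Am + real (card {k. k dvd r & k <= Kc & ~ ?sq k})" unfolding Am_def by simp
  hence A: "A <= Am + 2^J * c" using bad by linarith
  have "0 <= 2*2^J * ?Sm" using Sm0 by (intro mult_nonneg_nonneg) auto
  thus ?thesis using g T A by linarith
 qed
 thus ?thesis using good unfolding Ts_def Am_def c_def Bd_def by linarith
qed

end

definition KR :: "real => nat => nat set" where "KR y Kc = {p. prime p & y < real p & p <= Kc}"

text \<open>The squarefree integers up to Kc with all prime factors above y, represented by their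
  sets of primes.\<close>

definition KK :: "real => nat => nat set set" where "KK y Kc = {K. K <= KR y Kc & \<Prod>K <= Kc}"

abbreviation "RR y Kc == {r::nat. prime r & y < real r & r\<^sup>2 <= Kc}"

section \<open>Sums over products of large primes\<close>

abbreviation "KL a y Kc == {K\<in>KK y Kc. a <= real (\<Prod>K)}"

lemma finite_KR: "finite (KR y Kc)" unfolding KR_def by (rule finite_subset[of _ "{..Kc}"]) auto

lemma KK_D:
 assumes "K \<in> KK y Kc" shows "finite K" "!!p. p \<in> K ==> prime p & y < real p" "\<Prod>K <= Kc" "\<Prod>K > 0" "K <= KR y Kc"
proof -
 show sub: "K <= KR y Kc" using assms by (simp add: KK_def)
 thus "finite K" using finite_KR finite_subset by blast
 show pr: "!!p. p \<in> K ==> prime p & y < real p" using sub by (auto simp: KR_def)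
 show "\<Prod>K <= Kc" using assms by (simp add: KK_def)
 show "\<Prod>K > 0" using pr by (intro prod_pos) (auto simp: prime_gt_0_nat)
qed

lemma KK_subset: "KK y Kc <= Pow (KR y Kc)" by (auto simp: KK_def)

lemma finite_KK: "finite (KK y Kc)" by (rule finite_subset[OF KK_subset]) (simp add: finite_KR)

lemma card_KK: "card (KK y Kc) <= Kc"
proof -
 have "inj_on (%K. \<Prod>K) (KK y Kc)"
 proof (rule inj_onI)
  fix K K' assume h: "K \<in> KK y Kc" "K' \<in> KK y Kc" "\<Prod>K = \<Prod>K'"
  have pf: "prime_factors (\<Prod>K) = K" "prime_factors (\<Prod>K') = K'"
   using KK_D[OF h(1)] KK_D[OF h(2)] by (auto intro!: prime_factors_prod_primes)
  show "K = K'" by (rule trans[OF pf(1)[symmetric] trans[OF arg_cong[OF h(3), of prime_factors] pf(2)]])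
 qed
 hence "card (KK y Kc) = card ((%K. \<Prod>K) ` KK y Kc)" by (simp add: card_image)
 also have "... <= card {1..Kc}" using KK_D(3,4) by (intro card_mono) (auto simp: Suc_le_eq)
 finally show ?thesis by simp
qed

lemma KK_card_le:
 assumes "K \<in> KK y Kc" "y > 1" "real Kc <= y^J" shows "card K <= J"
proof -
 note K = KK_D[OF assms(1)]
 have "y^card K = (\<Prod>p\<in>K. y)" by simp
 also have "... <= (\<Prod>p\<in>K. real p)" using K(2) assms(2) by (intro prod_mono) (auto intro: less_imp_le)
 also have "... = real (\<Prod>K)" by simp
 also have "... <= y^J" using K(3) assms(3) by (simp del: of_nat_prod)
 finally show ?thesis using power_le_imp_le_exp[OF assms(2)] by blast
qed

lemma sum_prod_KK_le:
 fixes f :: "nat => real"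
 assumes "!!p. p \<in> KR y Kc ==> 0 <= f p"
 shows "(\<Sum>K\<in>KK y Kc. \<Prod>p\<in>K. f p) <= exp (\<Sum>p\<in>KR y Kc. f p)"
proof -
 have "(\<Sum>K\<in>KK y Kc. \<Prod>p\<in>K. f p) <= (\<Sum>K\<in>Pow (KR y Kc). \<Prod>p\<in>K. f p)"
  using assms finite_KR KK_subset by (intro sum_mono2) (auto intro!: prod_nonneg)
 also have "... = (\<Prod>p\<in>KR y Kc. f p + 1)" by (subst prod_add[OF finite_KR]) simp
 also have "... <= exp (\<Sum>p\<in>KR y Kc. f p)"
  using prod_one_plus_le_exp[of "KR y Kc" f] assms finite_KR by (simp add: add.commute)
 finally show ?thesis .
qed

text \<open>Every nonempty set arises once by adjoining its largest prime to the rest. The inner sum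
  then runs over the primes of one interval, where the cancellation of chi or the shortness of the
  interval can be used.\<close>

lemma sum_KK_largest_prime:
 fixes f :: "nat => real" and F :: "nat => real"
 shows "(\<Sum>K\<in>KK y Kc - {{}}. F (\<Prod>K)*(\<Prod>p\<in>K. f p))
  = (\<Sum>K\<in>KK y Kc. (\<Prod>p\<in>K. f p)*(\<Sum>p | p \<in> KR y Kc & (\<forall>l\<in>K. l < p) & p*\<Prod>K <= Kc. F (p*\<Prod>K)*f p))"
proof -
 define S where "S = (%K. {p. p \<in> KR y Kc & (\<forall>l\<in>K. l < p) & p*\<Prod>K <= Kc})"
 have finS: "finite (S K)" for K unfolding S_def by (rule finite_subset[OF _ finite_KR]) auto
 have ins: "finite K" "p \<notin> K" if "K \<in> KK y Kc" "p \<in> S K" for K p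
  using KK_D(1)[OF that(1)] that(2) by (auto simp: S_def)
 have "(\<Sum>K\<in>KK y Kc. (\<Prod>p\<in>K. f p)*(\<Sum>p\<in>S K. F (p*\<Prod>K)*f p))
   = (\<Sum>(K, p)\<in>Sigma (KK y Kc) S. (\<Prod>p\<in>K. f p)*(F (p*\<Prod>K)*f p))"
  unfolding sum_distrib_left by (subst sum.Sigma) (auto simp: finite_KK finS)
 also have "... = (\<Sum>K\<in>KK y Kc - {{}}. F (\<Prod>K)*(\<Prod>p\<in>K. f p))"
 proof (rule sum.reindex_bij_witness[of _ "%K. (K - {Max K}, Max K)" "%(K, p). insert p K"])
  fix x assume "x \<in> Sigma (KK y Kc) S"
  then obtain K p where x: "x = (K, p)" "K \<in> KK y Kc" "p \<in> S K" by auto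
  note i = ins[OF x(2,3)]
  have mx: "Max (insert p K) = p" using i x(3) by (intro Max_eqI) (auto simp: S_def less_imp_le)
  show "(case x of (K, p) => insert p K) \<in> KK y Kc - {{}}"
   using x i by (auto simp: KK_def S_def)
  show "((case x of (K, p) => insert p K) - {Max (case x of (K, p) => insert p K)}, Max (case x of (K, p) => insert p K)) = x"
   using i by (simp add: x(1) mx)
  show "F (\<Prod>(case x of (K, p) => insert p K))*(\<Prod>p\<in>(case x of (K, p) => insert p K). f p)
    = (case x of (K, p) => (\<Prod>p\<in>K. f p)*(F (p*\<Prod>K)*f p))" using i by (simp add: x(1))
 next
  fix K assume K: "K \<in> KK y Kc - {{}}"
  hence KK: "K \<in> KK y Kc" "K ~= {}" by auto
  note d = KK_D[OF KK(1)]
  have m: "Max K \<in> K" using d(1) KK(2) by simp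
  have pr: "Max K*\<Prod>(K - {Max K}) = \<Prod>K" using d(1) m by (simp add: prod.remove)
  have "\<Prod>(K - {Max K}) <= \<Prod>K"
  proof -
   have "Max K >= 1" using d(2)[OF m] prime_gt_0_nat by (simp add: Suc_le_eq)
   hence "1*\<Prod>(K - {Max K}) <= Max K*\<Prod>(K - {Max K})" by (intro mult_right_mono) auto
   thus ?thesis by (simp add: pr)
  qed
  hence 1: "K - {Max K} \<in> KK y Kc" using d(3,5) unfolding KK_def by auto
  have 2: "Max K \<in> S (K - {Max K})"
   unfolding S_def mem_Collect_eq pr using m d(1,3,5) by (auto simp: less_le)
  show "(K - {Max K}, Max K) \<in> Sigma (KK y Kc) S" using 1 2 by blast
  show "(case (K - {Max K}, Max K) of (K, p) => insert p K) = K" using m by auto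
 qed
 finally show ?thesis by (simp only: S_def)
qed

text \<open>Here \<open>L1\<close> is an exponent with Kc <= y^L1; it is unrelated to the value L(1,
  chi) of the same name in \<open>real_char\<close>.\<close>

locale conic_density =
 fixes D c :: int and y :: real and Kc :: nat and L1 :: real
 assumes y: "y >= exp 1" and good: "!!p. prime p ==> y < real p ==> p > 2 & ~ int p dvd D & ~ int p dvd c"
  and Kc: "real Kc >= y" "ln (real Kc) <= L1*ln y"
begin

lemma y1: "y > 1" "ln y >= 1"
proof -
 have "exp (1::real) > 1" by simp
 thus "y > 1" using y by linarith
 thus "ln y >= 1" using y by (simp add: ln_ge_iff)
qed

lemma cdens_bounds:
 assumes "prime p" "y < real p"
 shows "\<bar>cdens D c p - 1/real p\<bar> <= 1/(real p)^2" "0 <= cdens D c p" "cdens D c p <= 2*(1/real p)"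
proof -
 interpret cp: conic_prime D p by unfold_locales (use assms good in auto)
 have "cp.dens c = cdens D c p" by (simp add: cp.dens_def cdens_def)
 thus 1: "\<bar>cdens D c p - 1/real p\<bar> <= 1/(real p)^2" using cp.dens_bounds[of c] good[OF assms] by simp
 show "0 <= cdens D c p" by (simp add: cdens_def)
 have "1/(real p)^2 <= 1/real p" using assms(1) prime_gt_0_nat[OF assms(1)] by (intro divide_left_mono) (auto simp: power2_eq_square)
 thus "cdens D c p <= 2*(1/real p)" using 1 by linarith
qed

lemma KRD: "p \<in> KR y Kc ==> prime p & y < real p" by (simp add: KR_def)

lemma sum_inverse_KR: "(\<Sum>p\<in>KR y Kc. 1/real p) <= L1 + 6"
proof -
 have "KR y Kc = {p. prime p & y < real p & real p <= real Kc}" by (auto simp: KR_def)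
 hence "(\<Sum>p\<in>KR y Kc. 1/real p) <= (ln (real Kc/y) + 6)/ln y"
  using sum_inverse_prime_interval[OF y1(1) Kc(1)] by simp
 also have "... <= (L1*ln y + 6*ln y)/ln y" using y1 Kc by (intro divide_right_mono) (auto simp: ln_div)
 also have "... = L1 + 6" using y1 by (simp add: field_simps)
 finally show ?thesis .
qed

lemma sum_squares_sub: "S <= KR y Kc ==> (\<Sum>p\<in>S. 1/(real p)^2) <= 2/y"
 using y1 KRD by (intro sum_inverse_squares_real_le finite_subset[OF _ finite_KR]) auto

lemma sum_cdens_KR: "(\<Sum>p\<in>KR y Kc. cdens D c p) <= L1 + 8"
proof -
 have "(\<Sum>p\<in>KR y Kc. cdens D c p) <= (\<Sum>p\<in>KR y Kc. 1/real p + 1/(real p)^2)"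
  using cdens_bounds(1) KRD by (intro sum_mono) (auto simp: abs_le_iff algebra_simps)
 also have "... = (\<Sum>p\<in>KR y Kc. 1/real p) + (\<Sum>p\<in>KR y Kc. 1/(real p)^2)" by (rule sum.distrib)
 also have "... <= L1 + 6 + 2/y" by (intro add_mono sum_inverse_KR sum_squares_sub) simp
 also have "2/y <= 2" using y1 by (simp add: field_simps)
 finally show ?thesis by simp
qed

definition rho :: "nat set => real" where "rho K = (\<Prod>p\<in>K. cdens D c p)"

lemma rho_nonneg: "0 <= rho K" by (simp add: rho_def cdens_def prod_nonneg)

lemma sum_rho: "(\<Sum>K\<in>KK y Kc. rho K) <= exp (L1 + 8)"
 unfolding rho_def using sum_prod_KK_le[of y Kc "cdens D c"] sum_cdens_KR cdens_bounds(2) KRD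
 by (meson exp_le_cancel_iff order_trans)

lemma sum_inverse_KK: "(\<Sum>K\<in>KK y Kc. 1/real (\<Prod>K)) <= exp (L1 + 8)"
proof -
 have "(\<Sum>K\<in>KK y Kc. 1/real (\<Prod>K)) = (\<Sum>K\<in>KK y Kc. \<Prod>p\<in>K. 1/real p)" by (simp add: prod_dividef)
 also have "... <= exp (\<Sum>p\<in>KR y Kc. 1/real p)" by (rule sum_prod_KK_le) simp
 also have "... <= exp (L1 + 8)" using sum_inverse_KR by simp
 finally show ?thesis .
qed

text \<open>Once the smaller primes are fixed, the largest lies in an interval whose endpoints have
  ratio at most 2*Kc/a. The sum is therefore small when ln (Kc/a) and 1 are small against ln
  y.\<close>

lemma sum_rho_large:
 assumes a: "1 < a" "a <= 2*real Kc"
 shows "(\<Sum>K | K \<in> KK y Kc & a <= real (\<Prod>K). rho K) <= 2*((ln (2*real Kc/a) + 6)/ln y)*exp (L1 + 8)"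
proof -
 define F where "F = (%k::nat. of_bool (a <= real k) :: real)"
 define T where "T = 2*((ln (2*real Kc/a) + 6)/ln y)"
 have T0: "0 <= T" unfolding T_def using a y1 by (intro mult_nonneg_nonneg divide_nonneg_nonneg add_nonneg_nonneg ln_ge_zero) (auto simp: field_simps)
 have "(\<Sum>K | K \<in> KK y Kc & a <= real (\<Prod>K). rho K) = (\<Sum>K\<in>{K\<in>KK y Kc - {{}}. a <= real (\<Prod>K)}. rho K)"
  using a(1) by (intro sum.cong) auto
 also have "... = (\<Sum>K\<in>KK y Kc - {{}}. if a <= real (\<Prod>K) then rho K else 0)"
  by (rule sum.inter_filter) (simp add: finite_KK)
 also have "... = (\<Sum>K\<in>KK y Kc - {{}}. F (\<Prod>K)*(\<Prod>p\<in>K. cdens D c p))"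
  by (intro sum.cong refl) (simp add: F_def rho_def of_bool_def del: of_nat_prod)
 also have "... = (\<Sum>K\<in>KK y Kc. rho K*(\<Sum>p | p \<in> KR y Kc & (\<forall>l\<in>K. l < p) & p*\<Prod>K <= Kc. F (p*\<Prod>K) * cdens D c p))"
  unfolding sum_KK_largest_prime rho_def ..
 also have "... <= (\<Sum>K\<in>KK y Kc. rho K*T)"
 proof (intro sum_mono mult_left_mono rho_nonneg)
  fix K assume K: "K \<in> KK y Kc"
  define k where "k = real (\<Prod>K)"
  have k: "k > 0" using KK_D(4)[OF K] by (simp add: k_def del: of_nat_prod)
  \<comment> \<open>The factor 2 makes a/(2*k) < p strict, as the half-open interval of primes
    requires.\<close>
  define A where "A = max y (a/(2 * k))"
  define B where "B = real Kc / k"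
  define S where "S = {p. p \<in> KR y Kc & (\<forall>l\<in>K. l < p) & p*\<Prod>K <= Kc}"
  have finS: "finite S" unfolding S_def by (rule finite_subset[OF _ finite_KR]) auto
  have sub: "p \<in> {p. prime p & A < real p & real p <= B}" if "p \<in> S" "F (p*\<Prod>K) ~= 0" for p
  proof -
   have 1: "prime p" "y < real p" "p*\<Prod>K <= Kc" using that(1) by (auto simp: S_def KR_def)
   have "real (p*\<Prod>K) <= real Kc" using 1(3) by (simp only: of_nat_le_iff)
   hence "real p * k <= real Kc" by (simp add: k_def)
   hence "real p <= B" using k by (simp add: B_def field_simps)
   have "a <= real (p*\<Prod>K)" using that(2) by (simp add: F_def del: of_nat_mult)
   hence "a <= real p * k" by (simp add: k_def)
   moreover have "0 < real p * k" using k prime_gt_0_nat[OF 1(1)] by simp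
   ultimately have "a < 2*(real p * k)" by linarith
   hence "a/(2 * k) < real p" using k by (simp add: field_simps)
   thus ?thesis using 1 \<open>real p <= B\<close> by (simp add: A_def)
  qed
  have finT: "finite {p. prime p & A < real p & real p <= B}"
   by (rule finite_subset[OF _ finite_real_le_set[of "%_. True" B]]) auto
  have "(\<Sum>p\<in>S. F (p*\<Prod>K) * cdens D c p) = (\<Sum>p\<in>{p\<in>S. F (p*\<Prod>K) ~= 0}. F (p*\<Prod>K) * cdens D c p)"
   using finS by (intro sum.mono_neutral_right) auto
  also have "... <= (\<Sum>p\<in>{p\<in>S. F (p*\<Prod>K) ~= 0}. 2*(1/real p))"
  proof (rule sum_mono)
   fix p assume p: "p \<in> {p\<in>S. F (p*\<Prod>K) ~= 0}"
   hence "prime p" "y < real p" by (auto simp: S_def KR_def)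
   hence "cdens D c p <= 2*(1/real p)" by (rule cdens_bounds(3))
   moreover have "F (p*\<Prod>K) = 1" using p by (simp add: F_def of_bool_def split: if_splits)
   ultimately show "F (p*\<Prod>K) * cdens D c p <= 2*(1/real p)" by simp
  qed
  also have "... <= (\<Sum>p\<in>{p. prime p & A < real p & real p <= B}. 2*(1/real p))"
   using sub by (intro sum_mono2[OF finT]) auto
  also have "... = 2*(\<Sum>p\<in>{p. prime p & A < real p & real p <= B}. 1/real p)" by (rule sum_distrib_left[symmetric])
  also have "... <= T"
  proof (cases "A <= B")
   case True
   have A1: "1 < A" "y <= A" "a/(2 * k) <= A" using y1 by (auto simp: A_def)
   have AB: "B/A <= 2*real Kc/a"
   proof -
    have "B/A <= B/(a/(2 * k))" using A1 a k by (intro divide_left_mono) (auto simp: B_def)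
    also have "... = 2*real Kc/a" using k a by (simp add: B_def field_simps)
    finally show ?thesis .
   qed
   have "(\<Sum>p\<in>{p. prime p & A < real p & real p <= B}. 1/real p) <= (ln (B/A) + 6)/ln A"
    by (rule sum_inverse_prime_interval[OF A1(1) True])
   also have "... <= (ln (2*real Kc/a) + 6)/ln A"
    using AB A1 True by (intro divide_right_mono add_right_mono ln_mono) auto
   also have "... <= (ln (2*real Kc/a) + 6)/ln y"
   proof (rule divide_left_mono)
    show "ln y <= ln A" using A1 y1 by simp
    show "0 <= ln (2*real Kc/a) + 6" using a by (intro add_nonneg_nonneg ln_ge_zero) (auto simp: field_simps)
    show "0 < ln A*ln y" using A1 y1 by simp
   qed
   finally show ?thesis unfolding T_def by (intro mult_left_mono) auto
  next
   case False
   hence "{p. prime p & A < real p & real p <= B} = {}" by auto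
   thus ?thesis using T0 by (simp only: sum.empty mult_zero_right)
  qed
  finally show "(\<Sum>p | p \<in> KR y Kc & (\<forall>l\<in>K. l < p) & p*\<Prod>K <= Kc. F (p*\<Prod>K) * cdens D c p) <= T"
   by (simp only: S_def)
 qed
 also have "... = T*(\<Sum>K\<in>KK y Kc. rho K)" by (simp add: sum_distrib_left mult.commute)
 also have "... <= T*exp (L1 + 8)" by (intro mult_left_mono sum_rho T0)
 finally show ?thesis by (simp only: T_def)
qed

text \<open>The empty set contributes 1. In all other terms the largest prime runs over an interval
  beginning at the integer part of y or later, where the sum of chi p/p is O(1/ln y) by hypothesis,
  and replacing the conic density by 1/p costs at most 2/y.\<close>

lemma sum_chi_rho:
 fixes chi :: "nat => real" and C :: real
 assumes chi: "!!m n. chi (m*n) = chi m * chi n" "chi 1 = 1" "!!n. \<bar>chi n\<bar> <= 1" and C0: "C >= 0"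
  and C: "!!a b. a >= 2 ==> \<bar>\<Sum>p\<in>{p\<in>{a<..b}. prime p}. chi p/real p\<bar> <= C/ln (real a)"
 shows "\<bar>(\<Sum>K\<in>KK y Kc. chi (\<Prod>K)*rho K) - 1\<bar> <= (C/ln (real (nat (floor y))) + 2/y)*exp (L1 + 8)"
proof -
 define f where "f = (%p. chi p * cdens D c p)"
 define T where "T = C/ln (real (nat (floor y))) + 2/y"
 have "exp (1::real) >= 2" using exp_ge_add_one_self[of 1] by simp
 hence y2: "y >= 2" using y by linarith
 define Y where "Y = nat (floor y)"
 have Y2: "Y >= 2" unfolding Y_def using y2 by linarith
 have yY: "y < real p \<longleftrightarrow> Y < p" for p :: nat unfolding Y_def using y1 by linarith
 have T0: "0 <= T" unfolding T_def Y_def[symmetric] using C0 Y2 y1 by (intro add_nonneg_nonneg divide_nonneg_nonneg ln_ge_zero) auto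
 have ch: "chi (\<Prod>K) = (\<Prod>p\<in>K. chi p)" if "finite K" for K
  using that by (induction K rule: finite_induct) (use chi in simp_all)
 have e: "chi (\<Prod>K)*rho K = (\<Prod>p\<in>K. f p)" if "K \<in> KK y Kc" for K
  using ch[OF KK_D(1)[OF that]] by (simp add: rho_def f_def prod.distrib)
 have empty: "{} \<in> KK y Kc" using Kc y1 by (simp add: KK_def)
 have "(\<Sum>K\<in>KK y Kc. chi (\<Prod>K)*rho K) = (\<Sum>K\<in>KK y Kc. \<Prod>p\<in>K. f p)" by (intro sum.cong refl e)
 also have "... = 1 + (\<Sum>K\<in>KK y Kc - {{}}. 1*(\<Prod>p\<in>K. f p))"
  using sum.remove[OF finite_KK empty, of "%K. \<Prod>p\<in>K. f p"] by simp
 also have "(\<Sum>K\<in>KK y Kc - {{}}. 1*(\<Prod>p\<in>K. f p)) = (\<Sum>K\<in>KK y Kc. (\<Prod>p\<in>K. f p)*(\<Sum>p | p \<in> KR y Kc & (\<forall>l\<in>K. l < p) & p*\<Prod>K <= Kc. 1*f p))"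
  by (rule sum_KK_largest_prime[of "%_. 1" f y Kc])
 finally have main: "(\<Sum>K\<in>KK y Kc. chi (\<Prod>K)*rho K) - 1 = (\<Sum>K\<in>KK y Kc. (\<Prod>p\<in>K. f p)*(\<Sum>p | p \<in> KR y Kc & (\<forall>l\<in>K. l < p) & p*\<Prod>K <= Kc. 1*f p))"
  by (simp only: add_diff_cancel_left')
 have inner: "\<bar>\<Sum>p | p \<in> KR y Kc & (\<forall>l\<in>K. l < p) & p*\<Prod>K <= Kc. 1*f p\<bar> <= T" if K: "K \<in> KK y Kc" for K
 proof -
  define S where "S = {p. p \<in> KR y Kc & (\<forall>l\<in>K. l < p) & p*\<Prod>K <= Kc}"
  define a where "a = Max (insert Y K)"
  define b where "b = Kc div \<Prod>K"
  note d = KK_D[OF K]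
  have aY: "Y <= a" using d(1) by (simp add: a_def)
  have S: "S = {p\<in>{a<..b}. prime p}"
  proof -
   have "p*\<Prod>K <= Kc \<longleftrightarrow> p <= b" for p unfolding b_def using d(4) by (simp add: less_eq_div_iff_mult_less_eq)
   moreover have "p <= b ==> p <= Kc" for p unfolding b_def using div_le_dividend order_trans by blast
   moreover have "a < p \<longleftrightarrow> Y < p & (\<forall>l\<in>K. l < p)" for p unfolding a_def using d(1) by (subst Max_less_iff) auto
   ultimately show ?thesis unfolding S_def KR_def yY by auto
  qed
  have sub: "S <= KR y Kc" by (auto simp: S_def)
  have "(\<Sum>p\<in>S. 1*f p) = (\<Sum>p\<in>S. chi p/real p) + (\<Sum>p\<in>S. chi p*(cdens D c p - 1/real p))"
   by (simp add: f_def sum.distrib[symmetric] algebra_simps)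
  moreover have "\<bar>\<Sum>p\<in>S. chi p/real p\<bar> <= C/ln (real Y)"
  proof -
   have "\<bar>\<Sum>p\<in>S. chi p/real p\<bar> <= C/ln (real a)" unfolding S using C[of a b] aY Y2 by simp
   also have "... <= C/ln (real Y)" using aY Y2 C0 by (intro divide_left_mono) auto
   finally show ?thesis .
  qed
  moreover have "\<bar>\<Sum>p\<in>S. chi p*(cdens D c p - 1/real p)\<bar> <= 2/y"
  proof -
   have "\<bar>\<Sum>p\<in>S. chi p*(cdens D c p - 1/real p)\<bar> <= (\<Sum>p\<in>S. \<bar>chi p*(cdens D c p - 1/real p)\<bar>)" by (rule sum_abs)
   also have "... <= (\<Sum>p\<in>S. 1/(real p)^2)"
   proof (rule sum_mono)
    fix p assume "p \<in> S"
    hence "prime p" "y < real p" using sub KRD by auto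
    hence "\<bar>cdens D c p - 1/real p\<bar> <= 1/(real p)^2" by (rule cdens_bounds(1))
    hence "\<bar>chi p\<bar>*\<bar>cdens D c p - 1/real p\<bar> <= 1*(1/(real p)^2)" by (intro mult_mono chi(3)) auto
    thus "\<bar>chi p*(cdens D c p - 1/real p)\<bar> <= 1/(real p)^2" by (simp add: abs_mult)
   qed
   also have "... <= 2/y" by (rule sum_squares_sub[OF sub])
   finally show ?thesis .
  qed
  ultimately have "\<bar>\<Sum>p\<in>S. 1*f p\<bar> <= T" unfolding T_def Y_def[symmetric] by linarith
  thus ?thesis by (simp only: S_def)
 qed
 have fr: "\<bar>\<Prod>p\<in>K. f p\<bar> <= rho K" for K
  unfolding abs_prod rho_def
 proof (rule prod_mono)
  fix p
  have "\<bar>chi p\<bar>*\<bar>cdens D c p\<bar> <= 1 * cdens D c p" by (intro mult_mono chi(3)) (simp_all add: cdens_def)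
  thus "0 <= \<bar>f p\<bar> & \<bar>f p\<bar> <= cdens D c p" by (simp add: f_def abs_mult)
 qed
 have "\<bar>(\<Sum>K\<in>KK y Kc. chi (\<Prod>K)*rho K) - 1\<bar> <= (\<Sum>K\<in>KK y Kc. \<bar>(\<Prod>p\<in>K. f p)*(\<Sum>p | p \<in> KR y Kc & (\<forall>l\<in>K. l < p) & p*\<Prod>K <= Kc. 1*f p)\<bar>)"
  unfolding main by (rule sum_abs)
 also have "... <= (\<Sum>K\<in>KK y Kc. rho K*T)"
  unfolding abs_mult using fr inner rho_nonneg by (intro sum_mono mult_mono) auto
 also have "... = T*(\<Sum>K\<in>KK y Kc. rho K)" by (simp add: sum_distrib_left mult.commute)
 also have "... <= T*exp (L1 + 8)" by (intro mult_left_mono sum_rho T0)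
 finally show ?thesis by (simp only: T_def)
qed

end

section \<open>Averaging the pointwise bound over the box\<close>

lemma box_sum_mono_range:
 fixes F G :: "int => int => real"
 assumes "!!u v. int L <= u ==> u < 3*int L ==> int L <= v ==> v < 3*int L ==> F u v <= G u v"
 shows "box_sum L F <= box_sum L G"
 unfolding box_sum_def by (intro sum_mono assms) auto

lemma sum_chi_of_bool: "finite A ==> (\<Sum>x\<in>{x\<in>A. P x}. f x) = (\<Sum>x\<in>A. f x * of_bool (P x) :: real)"
proof -
 assume "finite A"
 hence "(\<Sum>x\<in>{x\<in>A. P x}. f x) = (\<Sum>x\<in>A. if P x then f x else 0)" by (rule sum.inter_filter)
 also have "... = (\<Sum>x\<in>A. f x * of_bool (P x))" by (intro sum.cong refl) simp
 finally show ?thesis .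
qed

context shifted_form begin

text \<open>Written with - (- h) to match the conics with parameter c = -h.\<close>

definition mm :: "int => int => int" where "mm u v = quad D u v - (- h)"

definition W :: "real => real => int => int => real" where "W z y u v = (\<Prod>p\<in>P y. e z p u v)"

definition good :: "int => int => bool" where
 "good u v \<longleftrightarrow> (\<exists>m1::nat. quad D u v + h = m0*int m1 & m1 > 0 & coprime m1 M &
   (\<forall>p. prime p --> chi p = -1 --> even (multiplicity p m1)))"

abbreviation "QQ z == {n. primepow n & coprime n M & real n <= z}"

lemma W_range: "0 <= W z y u v" "W z y u v <= 1"
 unfolding W_def using e_range by (auto intro!: prod_nonneg prod_le_1)

lemma W_nonzero:
 assumes "W z y u v ~= 0" "prime p" "~ p dvd M" "int p dvd mm u v" "real p <= y"
 shows "real p <= z & chi p = 1"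
proof -
 have "p \<in> P y" using assms by (simp add: P_def)
 hence "e z p u v ~= 0" using assms(1) finite_P by (auto simp: W_def)
 hence "~ (chi p = -1 \<or> z < real p)" using assms(4) by (auto simp: e_def mm_def)
 thus ?thesis using splitting[OF assms(2,3)] by auto
qed

text \<open>\<open>pointwise_lower_bound\<close> is restated with divisibility of the shifted value
  in place of its cofactor m1; for moduli prime to M the two agree. On the box the shifted value is
  at least L^2, so m1 <= t*k*Kc turns into a <= k, a condition on k alone.\<close>

lemma class_pointwise:
 fixes a t y z :: real and u v :: int and L Kc J :: nat
 assumes cl: "in_class u v" and W: "W z y u v ~= 0" and L: "L > 0" "int L <= u" "int L <= v"
  and y: "real M <= y" "1 < y" and t: "1 < t" and mK: "mm u v <= (int Kc)^2" and mJ: "real_of_int (mm u v) <= y^J"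
  and E: "!!p. p >= 2 ==> real p^E p <= z*real p & E p >= 1"
  and a: "a*(of_int m0*t*real Kc) <= (real L)^2"
 shows "2*(\<Sum>K\<in>KK y Kc. chi (\<Prod>K) * of_bool (int (\<Prod>K) dvd mm u v))
  - (\<Sum>K\<in>(KL a y Kc). of_bool (int (\<Prod>K) dvd mm u v))
  - 2^J*(3*(\<Sum>r\<in>RR y Kc. of_bool (int (r^2) dvd mm u v)))
  - 2*2^J*((\<Sum>n\<in>QQ z. mangoldt n * of_bool (int n dvd mm u v))/ln t
    + (\<Sum>p\<in>P z. of_bool (int (p^E p) dvd mm u v)))
  <= 2^J * of_bool (good u v)"
proof -
 obtain m1 where m1: "quad D u v + h = m0*int m1" "m1 > 0" "coprime m1 M" "chi m1 = 1"
  using class_factorization[OF cl] by metis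
 have mm: "mm u v = m0*int m1" using m1(1) by (simp add: mm_def)
 have m1mm: "int m1 <= mm u v" unfolding mm using m0_pos mult_right_mono[of 1 m0 "int m1"] by simp
 have imp: "int n dvd mm u v" if "n dvd m1" for n unfolding mm using that by simp
 have iff: "int n dvd mm u v \<longleftrightarrow> n dvd m1" if "coprime n M" for n
 proof -
  have "coprime (int n) (int M)" using that by simp
  hence "coprime (int n) m0" unfolding M by simp
  thus ?thesis unfolding mm by (simp add: coprime_dvd_mult_right_iff)
 qed
 have co: "coprime n M" if "n dvd m1" for n using m1(3) that by (meson coprime_divisors dvd_refl)
 have big: "coprime p M" if "prime p" "y < real p" for p
 proof -
  have "M < p" using that y by simp
  hence "~ p dvd M" using M_pos by (auto dest: dvd_imp_le)
  thus ?thesis using that(1) by (rule prime_imp_coprime[rotated])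
 qed
 have K2: "m1 <= Kc^2"
 proof -
  have "int m1 <= (int Kc)^2" by (rule order_trans[OF m1mm mK])
  hence "int m1 <= int (Kc^2)" by (simp only: of_nat_power)
  thus ?thesis by (simp only: of_nat_le_iff)
 qed
 have yJ: "real m1 <= y^J"
 proof -
  have "real_of_int (int m1) <= real_of_int (mm u v)" using m1mm by (simp only: of_int_le_iff)
  thus ?thesis using mJ by simp
 qed
 have pr: "real p <= z & chi p = 1 \<or> y < real p" if "prime p" "p dvd m1" for p
 proof (cases "real p <= y")
  case True
  have "~ p dvd M" using co[OF that(2)] that(1) by (metis coprime_common_divisor_nat dvd_refl not_prime_1)
  thus ?thesis using W_nonzero[OF W that(1) _ imp[OF that(2)] True] by blast
 qed simp
 have KKeq: "{K. K <= {p. prime p & y < real p & p <= Kc} & \<Prod>K <= Kc} = KK y Kc" by (simp add: KK_def KR_def)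
 note pw = pointwise_lower_bound[OF m1(2,4) K2 yJ y(2) t pr E, unfolded KKeq]
 have coK: "coprime (\<Prod>K) M" if "K \<in> KK y Kc" for K
  using KK_D(2)[OF that] big by (intro prod_coprime_left) auto
 have T: "(\<Sum>K\<in>{K\<in>KK y Kc. \<Prod>K dvd m1}. chi (\<Prod>K)) = (\<Sum>K\<in>KK y Kc. chi (\<Prod>K) * of_bool (int (\<Prod>K) dvd mm u v))"
  unfolding sum_chi_of_bool[OF finite_KK] using iff coK by (intro sum.cong refl) (simp del: of_nat_prod)
 have Am: "real (card {K\<in>KK y Kc. \<Prod>K dvd m1 & real m1 <= t*real (\<Prod>K)*real Kc})
   <= (\<Sum>K\<in>(KL a y Kc). of_bool (int (\<Prod>K) dvd mm u v))"
 proof -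
  have sub: "{K\<in>KK y Kc. \<Prod>K dvd m1 & real m1 <= t*real (\<Prod>K)*real Kc} <= {K\<in>(KL a y Kc). int (\<Prod>K) dvd mm u v}"
  proof
   fix K assume "K \<in> {K\<in>KK y Kc. \<Prod>K dvd m1 & real m1 <= t*real (\<Prod>K)*real Kc}"
   hence K: "K \<in> KK y Kc" "\<Prod>K dvd m1" "real m1 <= t*real (\<Prod>K)*real Kc" by blast+
   have Lsq: "(int L)^2 <= mm u v"
   proof -
    have "(int L)^2 <= u^2" using L by (intro power_mono) auto
    moreover have "0 <= D * v^2" using D_pos by simp
    ultimately show ?thesis unfolding mm_def quad_def using h_pos by linarith
   qed
   have "(real L)^2 = real_of_int ((int L)^2)" by simp
   also have "... <= real_of_int (mm u v)" using Lsq by (simp only: of_int_le_iff)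
   also have "... = of_int m0*real m1" unfolding mm by simp
   also have "... <= of_int m0*(t*real (\<Prod>K)*real Kc)" using K(3) m0_pos by (intro mult_left_mono) auto
   finally have "a*(of_int m0*t*real Kc) <= real (\<Prod>K)*(of_int m0*t*real Kc)" using a by (simp add: mult_ac del: of_nat_prod)
   moreover have "Kc > 0" using K2 m1(2) by (cases Kc) auto
   ultimately have "a <= real (\<Prod>K)" using m0_pos t by (simp add: mult_le_cancel_right del: of_nat_prod)
   thus "K \<in> {K\<in>(KL a y Kc). int (\<Prod>K) dvd mm u v}" using K(1) imp[OF K(2)] by blast
  qed
  have "real (card {K\<in>KK y Kc. \<Prod>K dvd m1 & real m1 <= t*real (\<Prod>K)*real Kc}) <= real (card {K\<in>(KL a y Kc). int (\<Prod>K) dvd mm u v})"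
   using finite_KK by (simp only: of_nat_le_iff) (intro card_mono[OF _ sub], simp)
  thus ?thesis using finite_KK by (subst sum_of_bool) auto
 qed
 have R: "real (card {r. prime r & y < real r & r\<^sup>2 <= Kc & r\<^sup>2 dvd m1})
  <= (\<Sum>r\<in>RR y Kc. of_bool (int (r^2) dvd mm u v))"
 proof -
  have fin: "finite (RR y Kc)"
   by (rule finite_subset[of _ "{..Kc}"]) (auto simp: power2_eq_square intro: order_trans[OF le_square])
  have "card {r. prime r & y < real r & r\<^sup>2 <= Kc & r\<^sup>2 dvd m1} <= card {r\<in>(RR y Kc). int (r^2) dvd mm u v}"
  proof (rule card_mono)
   show "finite {r\<in>(RR y Kc). int (r^2) dvd mm u v}"
    by (rule finite_subset[OF _ fin]) (rule Collect_restrict)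
   show "{r. prime r & y < real r & r\<^sup>2 <= Kc & r\<^sup>2 dvd m1} <= {r\<in>(RR y Kc). int (r^2) dvd mm u v}"
   proof
    fix r assume r: "r \<in> {r. prime r & y < real r & r\<^sup>2 <= Kc & r\<^sup>2 dvd m1}"
    hence "r^2 dvd m1" by blast
    hence "int (r^2) dvd mm u v" by (rule imp)
    thus "r \<in> {r\<in>(RR y Kc). int (r^2) dvd mm u v}" using r by blast
   qed
  qed
  thus ?thesis by (simp only: sum_of_bool[OF fin] of_nat_le_iff)
 qed
 have lt: "0 < ln t" using t by simp
 have Q: "(\<Sum>q | q >= 2 & real q <= z & q dvd m1. (mangoldt q :: real))
   <= (\<Sum>n\<in>QQ z. mangoldt n * of_bool (int n dvd mm u v))"
 proof -
  let ?f = "%n. mangoldt n * of_bool (int n dvd mm u v) :: real"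
  have fin: "finite {q. q >= 2 & real q <= z & q dvd m1}" "finite (QQ z)"
   by (rule finite_subset[OF _ finite_real_le_set[of "%_. True" z]], auto)+
  have "(\<Sum>q | q >= 2 & real q <= z & q dvd m1. (mangoldt q :: real)) = sum ?f {q. q >= 2 & real q <= z & q dvd m1}"
   using imp by (intro sum.cong) auto
  also have "... <= sum ?f (QQ z)"
  proof (rule sum_le_sum_superset[OF fin(2,1)])
   show "0 <= ?f n" for n by (simp add: mangoldt_nonneg)
   fix n assume n: "n \<in> {q. q >= 2 & real q <= z & q dvd m1}" "?f n ~= 0"
   hence "primepow n" by (auto simp: mangoldt_def split: if_splits)
   thus "n \<in> (QQ z)" using n(1) co by blast
  qed
  finally show ?thesis .
 qed
 have B: "real (card {p. prime p & real p <= z & p^E p dvd m1}) <= (\<Sum>p\<in>P z. of_bool (int (p^E p) dvd mm u v))"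
 proof -
  have "{p. prime p & real p <= z & p^E p dvd m1} <= {p\<in>P z. int (p^E p) dvd mm u v}"
  proof
   fix p assume "p \<in> {p. prime p & real p <= z & p^E p dvd m1}"
   hence p: "prime p" "real p <= z" "p^E p dvd m1" by blast+
   have "E p > 0" using E[OF prime_ge_2_nat[OF p(1)]] by simp
   hence "p dvd m1" using p(3) by (meson dvd_power dvd_trans)
   hence "~ p dvd M" using co p(1) by (metis coprime_common_divisor_nat dvd_refl not_prime_1)
   thus "p \<in> {p\<in>P z. int (p^E p) dvd mm u v}" using p imp[OF p(3)] by (simp add: P_def)
  qed
  hence "card {p. prime p & real p <= z & p^E p dvd m1} <= card {p\<in>P z. int (p^E p) dvd mm u v}"
   using finite_P by (intro card_mono) auto
  thus ?thesis by (simp only: sum_of_bool[OF finite_P] of_nat_le_iff)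
 qed
 have gd: "of_bool (\<forall>p. prime p --> chi p = -1 --> even (multiplicity p m1)) <= (of_bool (good u v) :: real)"
  using m1 by (auto simp: good_def)
 have J: "(0::real) < 2^J" by simp
 have 1: "2^J*(3*real (card {r. prime r & y < real r & r\<^sup>2 <= Kc & r\<^sup>2 dvd m1})) <= 2^J*(3*(\<Sum>r\<in>RR y Kc. of_bool (int (r^2) dvd mm u v)))"
  using R by (intro mult_left_mono) auto
 have 2: "2*2^J*((\<Sum>q | q >= 2 & real q <= z & q dvd m1. mangoldt q)/ln t + real (card {p. prime p & real p <= z & p^E p dvd m1}))
  <= 2*2^J*((\<Sum>n\<in>QQ z. mangoldt n * of_bool (int n dvd mm u v))/ln t + (\<Sum>p\<in>P z. of_bool (int (p^E p) dvd mm u v)))"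
  using lt by (intro mult_left_mono add_mono B divide_right_mono Q) auto
 have 3: "2^J * of_bool (\<forall>p. prime p --> chi p = -1 --> even (multiplicity p m1)) <= 2^J*(of_bool (good u v) :: real)"
  using gd by (intro mult_left_mono) auto
 show ?thesis using pw 1 2 3 Am unfolding T by linarith
qed

definition SK :: "nat => real => real => nat => real" where
 "SK L z y n = box_sum L (%u v. w0 u v * W z y u v * of_bool (int n dvd mm u v))"

definition NN :: "nat => nat => real" where "NN L n = box_sum L (%u v. of_bool (int n dvd mm u v))"

definition SG :: "nat => real => real => real" where
 "SG L z y = box_sum L (%u v. w0 u v * W z y u v * of_bool (good u v))"

lemma SK_le_NN: "SK L z y n <= NN L n"
 unfolding SK_def NN_def
proof (rule box_sum_mono)
 fix u v
 have "w0 u v * W z y u v <= 1" using w0(3)[of u v] W_range[of z y u v] by (intro mult_le_one) auto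
 thus "w0 u v * W z y u v * of_bool (int n dvd mm u v) <= of_bool (int n dvd mm u v)" by (simp add: of_bool_def)
qed

lemma box_sum_diff: "box_sum L (%u v. F u v - G u v) = box_sum L F - (box_sum L G :: real)"
 by (simp add: box_sum_def sum_subtractf)

lemma box_sum_add: "box_sum L (%u v. F u v + G u v) = box_sum L F + (box_sum L G :: real)"
 by (simp add: box_sum_def sum.distrib)

text \<open>The terms for r^2 and for \<open>p^E p\<close> drop the sieve weight, since their sums
  are smaller than L^4 by a power of L. The prime powers up to z must keep it: their total is only a
  small constant times the main term, so the factor V may not be lost.\<close>

lemma weighted_lower_bound:
 fixes a t y z :: real and L Kc J :: nat
 assumes L: "L > 0" and y: "real M <= y" "1 < y" and t: "1 < t"
  and mK: "!!u v. int L <= u ==> u < 3*int L ==> int L <= v ==> v < 3*int L ==> mm u v <= (int Kc)^2"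
  and KJ: "(real Kc)^2 <= y^J"
  and E: "!!p. p >= 2 ==> real p^E p <= z*real p & E p >= 1"
  and a: "a*(of_int m0*t*real Kc) <= (real L)^2"
 shows "2*(\<Sum>K\<in>KK y Kc. chi (\<Prod>K)*SK L z y (\<Prod>K)) - (\<Sum>K\<in>(KL a y Kc). SK L z y (\<Prod>K))
  - 2^J*(3*(\<Sum>r\<in>RR y Kc. NN L (r^2)))
  - 2*2^J*((\<Sum>n\<in>QQ z. mangoldt n*SK L z y n)/ln t + (\<Sum>p\<in>P z. NN L (p^E p)))
  <= 2^J*SG L z y"
proof -
 define I where "I = (%n u v. of_bool (int n dvd mm u v) :: real)"
 define w where "w = (%u v. w0 u v * W z y u v)"
 have w01: "0 <= w u v" "w u v <= 1" for u v
  unfolding w_def using w0(3)[of u v] W_range[of z y u v] by (auto intro: mult_le_one)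
 define F where "F = (%u v. 2*(\<Sum>K\<in>KK y Kc. chi (\<Prod>K)*I (\<Prod>K) u v) - (\<Sum>K\<in>(KL a y Kc). I (\<Prod>K) u v)
  - 2^J*(3*(\<Sum>r\<in>RR y Kc. I (r^2) u v))
  - 2*2^J*((\<Sum>n\<in>QQ z. mangoldt n*I n u v)/ln t + (\<Sum>p\<in>P z. I (p^E p) u v)))"
 have "box_sum L (%u v. w u v * F u v) <= box_sum L (%u v. 2^J*(w u v * of_bool (good u v)))"
 proof (rule box_sum_mono_range)
  fix u v assume uv: "int L <= u" "u < 3*int L" "int L <= v" "v < 3*int L"
  show "w u v * F u v <= 2^J*(w u v * of_bool (good u v))"
  proof (cases "w u v = 0")
   case False
   hence cl: "in_class u v" and W0: "W z y u v ~= 0" by (auto simp: w_def w0_def)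
   have mj: "real_of_int (mm u v) <= y^J"
   proof -
    have "real_of_int (mm u v) <= real_of_int ((int Kc)^2)" using mK[OF uv] by (simp only: of_int_le_iff)
    thus ?thesis using KJ by simp
   qed
   have "F u v <= 2^J * of_bool (good u v)"
    unfolding F_def I_def by (rule class_pointwise[OF cl W0 L uv(1,3) y t mK[OF uv] mj E a])
   hence "w u v * F u v <= w u v * (2^J * of_bool (good u v))" using w01 by (intro mult_left_mono)
   thus ?thesis by (simp add: mult_ac)
  qed simp
 qed
 also have "... = 2^J*SG L z y" unfolding box_sum_mult SG_def w_def by (simp add: mult.assoc)
 finally have up: "box_sum L (%u v. w u v * F u v) <= 2^J*SG L z y" .
 have SKI: "box_sum L (%u v. w u v * I n u v) = SK L z y n" for n by (simp add: SK_def I_def w_def)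
 have "w u v * F u v = 2*(\<Sum>K\<in>KK y Kc. chi (\<Prod>K)*(w u v * I (\<Prod>K) u v)) - (\<Sum>K\<in>(KL a y Kc). w u v * I (\<Prod>K) u v)
  - 2^J*(3*(\<Sum>r\<in>RR y Kc. w u v * I (r^2) u v))
  - 2*2^J*((\<Sum>n\<in>QQ z. mangoldt n*(w u v * I n u v))/ln t + (\<Sum>p\<in>P z. w u v * I (p^E p) u v))" for u v
  unfolding F_def sum_distrib_left[symmetric] mult.left_commute[of _ "w u v"] by (simp add: algebra_simps)
 hence "box_sum L (%u v. w u v * F u v) = 2*(\<Sum>K\<in>KK y Kc. chi (\<Prod>K)*SK L z y (\<Prod>K)) - (\<Sum>K\<in>(KL a y Kc). SK L z y (\<Prod>K))
  - 2^J*(3*(\<Sum>r\<in>RR y Kc. SK L z y (r^2)))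
  - 2*2^J*((\<Sum>n\<in>QQ z. mangoldt n*SK L z y n)/ln t + (\<Sum>p\<in>P z. SK L z y (p^E p)))"
  by (simp only: box_sum_diff box_sum_add box_sum_mult box_sum_divide box_sum_sum SKI)
 moreover have "2^J*(3*(\<Sum>r\<in>RR y Kc. SK L z y (r^2))) <= 2^J*(3*(\<Sum>r\<in>RR y Kc. NN L (r^2)))"
  by (intro mult_left_mono sum_mono SK_le_NN) auto
 moreover have "2*2^J*((\<Sum>n\<in>QQ z. mangoldt n*SK L z y n)/ln t + (\<Sum>p\<in>P z. SK L z y (p^E p)))
  <= 2*2^J*((\<Sum>n\<in>QQ z. mangoldt n*SK L z y n)/ln t + (\<Sum>p\<in>P z. NN L (p^E p)))"
  by (intro mult_left_mono add_left_mono sum_mono SK_le_NN) auto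
 ultimately show ?thesis using up by linarith
qed

text \<open>The expected value of the weighted box sum, with 1/M^2 for the residue class.\<close>

definition XX :: "nat => real => real => real" where "XX L z y = V z y*real L^4/(real M)^2"

lemma V_nonneg: "0 <= V z y" unfolding V_def using e_range by (intro prod_nonneg ballI wmean_nonneg) auto

lemma XX_nonneg: "0 <= XX L z y" unfolding XX_def using V_nonneg by simp

lemma PD: "p \<in> P y ==> prime p & 8 <= p & real p <= y"
 using prime_not_dvd_M(1) by (auto simp: P_def)

lemma SK_estimate:
 assumes K: "K \<in> KK y Kc" and y: "real M <= y" "1 < y" and J: "real Kc <= y^J"
 shows "\<bar>SK L z y (\<Prod>K) - XX L z y*(\<Prod>p\<in>K. cdens D (- h) p)\<bar> <= sieve_error 30 b*(XX L z y*(\<Prod>p\<in>K. cdens D (- h) p))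
  + (y powr (4*real b + 6))^3*4^J*(real M)^2*(real Kc powr (3/4)*((real L)^2 + 2*real L^3*(1/real (\<Prod>K))))"
proof -
 note d = KK_D[OF K]
 have nM: "~ p dvd M" if "p \<in> K" for p
 proof -
  have "M < p" using d(2)[OF that] y by simp
  thus ?thesis using M_pos by (auto dest: dvd_imp_le)
 qed
 have Kp: "prime p & p > 2 & ~ int p dvd D & ~ int p dvd - h" if "p \<in> K" for p
  using prime_not_dvd_M[OF _ nM[OF that]] d(2)[OF that] by blast
 have KP: "K \<inter> P y = {}" using d(2) by (force simp: P_def)
 have co: "coprime M (\<Prod>K)"
  using nM d(2) prime_imp_coprime coprime_commute by (intro prod_coprime_right) blast
 have eg: "1 - wmean p (e z p) <= 3/real p" if "p \<in> P y" for p
  using that by (intro e_density(2)) (auto simp: P_def)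
 have est: "\<bar>box_sum L (%u v. w0 u v * (\<Prod>p\<in>P y. e z p u v) * of_bool (int (\<Prod>K) dvd quad D u v - (- h)))
   - wmean M w0*(\<Prod>p\<in>K. cdens D (- h) p)*(\<Prod>p\<in>P y. wmean p (e z p))*real L^4\<bar>
  <= sieve_error 30 b*(wmean M w0*(\<Prod>p\<in>K. cdens D (- h) p)*(\<Prod>p\<in>P y. wmean p (e z p))*real L^4) +
   (y powr (4*real b + 6))^3*(4^card K*(real M)^2*((real L)^2*real (\<Prod>K) powr (3/4) + 2*real L^3*real (\<Prod>K) powr (- 1/4)))"
  by (rule sieved_box_sum[OF finite_P PD y(2) per_e e_range eg d(1) Kp KP M_pos co _ w0(1,3)]) (auto simp: P_def)
 have e1: "wmean M w0*(\<Prod>p\<in>K. cdens D (- h) p)*(\<Prod>p\<in>P y. wmean p (e z p))*real L^4 = XX L z y*(\<Prod>p\<in>K. cdens D (- h) p)"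
  by (simp add: w0(2) XX_def V_def)
 have e2: "box_sum L (%u v. w0 u v * (\<Prod>p\<in>P y. e z p u v) * of_bool (int (\<Prod>K) dvd quad D u v - (- h))) = SK L z y (\<Prod>K)"
  by (simp only: SK_def W_def mm_def)
 have e3: "(y powr (4*real b + 6))^3*(4^card K*(real M)^2*((real L)^2*real (\<Prod>K) powr (3/4) + 2*real L^3*real (\<Prod>K) powr (- 1/4)))
   <= (y powr (4*real b + 6))^3*4^J*(real M)^2*(real Kc powr (3/4)*((real L)^2 + 2*real L^3*(1/real (\<Prod>K))))"
 proof -
  define k where "k = real (\<Prod>K)"
  have "0 < real (\<Prod>K)" using d(4) by (simp only: of_nat_0_less_iff)
  hence k0: "k > 0" by (simp only: k_def)
  have "real (\<Prod>K) <= real Kc" using d(3) by (simp only: of_nat_le_iff)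
  hence kK: "k powr (3/4) <= real Kc powr (3/4)" using k0 by (intro powr_mono2) (auto simp only: k_def)
  have "k powr (- 1/4) = k powr (3/4)*(1 / k)"
  proof -
   have "k powr (- 1/4) = k powr (3/4 + (-1))" by simp
   also have "... = k powr (3/4) * k powr (-1)" by (rule powr_add)
   also have "k powr (-1) = 1 / k" using k0 by (simp add: powr_minus_divide)
   finally show ?thesis .
  qed
  hence "(real L)^2 * k powr (3/4) + 2*real L^3 * k powr (- 1/4) = k powr (3/4)*((real L)^2 + 2*real L^3*(1 / k))"
   by (simp add: algebra_simps)
  also have "... <= real Kc powr (3/4)*((real L)^2 + 2*real L^3*(1 / k))"
   using k0 by (intro mult_right_mono kK) auto
  finally have 1: "(real L)^2 * k powr (3/4) + 2*real L^3 * k powr (- 1/4) <= real Kc powr (3/4)*((real L)^2 + 2*real L^3*(1 / k))" .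
  have "card K <= J" by (rule KK_card_le[OF K y(2) J])
  hence 2: "(4::real)^card K <= 4^J" by (intro power_increasing) auto
  have "(y powr (4*real b + 6))^3*(4^card K*(real M)^2*((real L)^2 * k powr (3/4) + 2*real L^3 * k powr (- 1/4)))
   <= (y powr (4*real b + 6))^3*(4^J*(real M)^2*(real Kc powr (3/4)*((real L)^2 + 2*real L^3*(1 / k))))"
   using 1 2 k0 by (intro mult_left_mono mult_mono) auto
  thus ?thesis by (simp only: k_def mult.assoc)
 qed
 show ?thesis by (rule order_trans[OF est[unfolded e1 e2] add_left_mono[OF e3]])
qed

text \<open>The prime p of n lies in the sieving range, so it is taken out of the sieve and n joins
  M in the periodic weight. Omitting p costs a factor 2, as the local mean there is at least 1/2;
  with 4/n for the density and 2 for the sieve this makes 16.\<close>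

lemma SK_prime_power:
 assumes n: "primepow n" "coprime n M" "real n <= z" and z: "z <= y" "1 < y" and eps: "sieve_error 30 b <= 1" "L > 0"
 shows "SK L z y n <= 16*XX L z y/real n + 3*(y powr (4*real b + 6))^3*(real M)^2*z^2*real L^3"
proof -
 obtain p k where p: "prime p" "k > 0" "n = p^k" using n(1) by (auto simp: primepow_def)
 have nM: "~ p dvd M"
 proof
  assume "p dvd M"
  moreover have "p dvd n" using p by simp
  ultimately have "p dvd 1" using n(2) by (metis coprime_common_divisor_nat nat_dvd_1_iff_1)
  thus False using p(1) by simp
 qed
 note pm = prime_not_dvd_M[OF p(1) nM]
 have n0: "n > 0" using p by (simp add: prime_gt_0_nat)
 have "p^1 <= p^k" using p prime_gt_0_nat[OF p(1)] by (intro power_increasing) auto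
 hence pn: "p <= n" using p(3) by simp
 have pP: "p \<in> P y" using p(1) nM pn n(3) z(1) by (simp add: P_def)
 let ?P = "P y - {p}"
 define w where "w = (%u v. w0 u v * of_bool (int n dvd quad D u v - (- h)) :: real)"
 have perw: "per (M*n) w" unfolding w_def by (rule per_times_coprime[OF w0(1) per_conic])
 have mw: "wmean (M*n) w = 1/(real M)^2 * cdens D (- h) n"
 proof -
  have "wmean (M*n) w = wmean M w0*wmean n (%u v. of_bool (int n dvd quad D u v - (- h)))"
   unfolding w_def by (rule wmean_mult[OF _ M_pos n0 w0(1) per_conic]) (use n(2) in \<open>simp add: coprime_commute\<close>)
  thus ?thesis by (simp only: w0(2) wmean_conic)
 qed
 have w1: "0 <= w u v & w u v <= 1" for u v using w0(3)[of u v] by (simp add: w_def of_bool_def)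
 have PD': "prime r & 8 <= r & real r <= y" if "r \<in> ?P" for r using PD that by blast
 have eg: "1 - wmean r (e z r) <= 3/real r" if "r \<in> ?P" for r
  using that by (intro e_density(2)) (auto simp: P_def)
 have Qd: "~ r dvd M*n" if r: "r \<in> ?P" for r
 proof
  assume "r dvd M*n"
  moreover have "prime r" "~ r dvd M" "r ~= p" using r by (auto simp: P_def)
  ultimately have "r dvd p^k" using p(3) by (simp add: prime_dvd_mult_iff)
  hence "r dvd p" using \<open>prime r\<close> prime_dvd_power by blast
  thus False using \<open>prime r\<close> p(1) \<open>r ~= p\<close> by (simp add: primes_dvd_imp_eq)
 qed
 let ?Y = "(y powr (4*real b + 6))^3"
 define V' where "V' = (\<Prod>r\<in>?P. wmean r (e z r))"
 define X' where "X' = 1/(real M)^2 * cdens D (- h) n*V'*real L^4"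
 have "\<bar>box_sum L (%u v. w u v * (\<Prod>r\<in>?P. e z r u v) * of_bool (int (\<Prod>{}) dvd quad D u v - (- h)))
   - wmean (M*n) w*(\<Prod>p\<in>{}. cdens D (- h) p)*(\<Prod>r\<in>?P. wmean r (e z r))*real L^4\<bar>
  <= sieve_error 30 b*(wmean (M*n) w*(\<Prod>p\<in>{}. cdens D (- h) p)*(\<Prod>r\<in>?P. wmean r (e z r))*real L^4) +
   ?Y*(4^card ({} :: nat set)*(real (M*n))^2*((real L)^2*real (\<Prod>{}) powr (3/4) + 2*real L^3*real (\<Prod>{}) powr (- 1/4)))"
  by (rule sieved_box_sum[OF _ PD' z(2) per_e e_range eg _ _ _ _ _ Qd perw w1]) (use finite_P M_pos n0 in auto)
 hence est: "\<bar>box_sum L (%u v. w u v * (\<Prod>r\<in>?P. e z r u v)) - X'\<bar> <= sieve_error 30 b*X' + ?Y*((real (M*n))^2*((real L)^2 + 2*real L^3))"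
  unfolding mw V'_def[symmetric] X'_def by simp
 have "SK L z y n <= box_sum L (%u v. w u v * (\<Prod>r\<in>?P. e z r u v))"
  unfolding SK_def
 proof (rule box_sum_mono)
  fix u v
  have "W z y u v <= (\<Prod>r\<in>?P. e z r u v)"
  proof -
   have "W z y u v = e z p u v * (\<Prod>r\<in>?P. e z r u v)" unfolding W_def using pP finite_P by (rule prod.remove[rotated])
   also have "... <= 1*(\<Prod>r\<in>?P. e z r u v)" using e_range by (intro mult_right_mono prod_nonneg) auto
   finally show ?thesis by simp
  qed
  hence "w u v * W z y u v <= w u v * (\<Prod>r\<in>?P. e z r u v)" using w1 by (intro mult_left_mono) auto
  thus "w0 u v * W z y u v * of_bool (int n dvd mm u v) <= w u v * (\<Prod>r\<in>?P. e z r u v)"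
   by (simp add: w_def mm_def mult_ac)
 qed
 also have "... <= X' + (sieve_error 30 b*X' + ?Y*((real (M*n))^2*((real L)^2 + 2*real L^3)))"
  using est by linarith
 also have "sieve_error 30 b*X' <= 1*X'"
 proof (rule mult_right_mono[OF eps(1)])
  show "0 <= X'" unfolding X'_def V'_def using e_range by (intro mult_nonneg_nonneg prod_nonneg ballI wmean_nonneg) (auto simp: cdens_def)
 qed
 also have "X' + (1*X' + ?Y*((real (M*n))^2*((real L)^2 + 2*real L^3))) = 2*X' + ?Y*((real (M*n))^2*((real L)^2 + 2*real L^3))" by simp
 also have "2*X' <= 16*XX L z y/real n"
 proof -
  have wp: "1/2 <= wmean p (e z p)"
  proof -
   have "3/real p <= 1/2" using pm(1) by (simp add: field_simps)
   thus ?thesis using e_density(2)[OF p(1) nM, of z] by linarith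
  qed
  have V0: "0 <= V'" unfolding V'_def using e_range by (intro prod_nonneg ballI wmean_nonneg) auto
  have "V z y = wmean p (e z p)*V'" unfolding V_def V'_def using pP finite_P by (rule prod.remove[rotated])
  hence V2: "V' <= 2*V z y" using mult_right_mono[OF wp V0] by simp
  have c4: "cdens D (- h) n <= 4/real n"
  proof -
   have "real (card (conic_pts D (- h) n)) <= real (4*n)"
    unfolding p(3) using card_conic_prime_power[OF p(1) pm(2,3,5)] by (simp only: of_nat_le_iff)
   hence "cdens D (- h) n <= real (4*n)/(real n)^2" unfolding cdens_def by (intro divide_right_mono) auto
   thus ?thesis using n0 by (simp add: power2_eq_square)
  qed
  have "X' <= 1/(real M)^2*(4/real n)*(2*V z y)*real L^4"
   unfolding X'_def using c4 V2 V0 by (intro mult_right_mono mult_mono mult_left_mono) (auto simp: cdens_def)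
  also have "... = 8*XX L z y/real n" by (simp add: XX_def)
  finally show ?thesis by simp
 qed
 also have "?Y*((real (M*n))^2*((real L)^2 + 2*real L^3)) <= ?Y*((real M)^2*z^2*(3*real L^3))"
 proof -
  have "(real n)^2 <= z^2" using n(3) by (intro power_mono) auto
  hence 1: "(real (M*n))^2 <= (real M)^2*z^2" by (simp add: power_mult_distrib mult_left_mono)
  have "real L^2 <= real L^3" using eps(2) by (intro power_increasing) auto
  hence "(real L)^2 + 2*real L^3 <= 3*real L^3" by simp
  thus ?thesis using 1 by (intro mult_left_mono mult_mono) auto
 qed
 finally show ?thesis by (simp add: mult_ac)
qed

end

context shifted_form begin

text \<open>The balance of constants: the sum with chi is at least (7/8 - 1/8)*X, by
  \<open>sum_chi_rho\<close> and the sieve error, and enters twice; the divisors near Kc and the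
  smooth parts beyond t take X/4 each. This leaves X, while the equidistribution error enters three
  times.\<close>

lemma core_inequality:
 fixes L b J CK :: nat and y z t a L1 C :: real
 defines "Kc == CK*L" and "Y3 == (y powr (4*real b + 6))^3" and "E1 == exp (L1 + 8)"
 assumes L: "L > 0" and CK: "CK >= 1" and y: "real M <= y" "exp 1 <= y" and z: "1 <= z" "z <= y" "z^2 <= real L" and t: "1 < t" "1 <= ln t"
  and mK: "!!u v. int L <= u ==> u < 3*int L ==> int L <= v ==> v < 3*int L ==> mm u v <= (int Kc)^2"
  and KJ: "(real Kc)^2 <= y^J" and Kc: "y <= real Kc" "ln (real Kc) <= L1*ln y"
  and a: "a*(of_int m0*t*real Kc) <= (real L)^2" "1 < a" "a <= 2*real Kc"
  and C: "C >= 0" "!!a b. a >= 2 ==> \<bar>\<Sum>p\<in>{p\<in>{a<..b}. prime p}. chi p/real p\<bar> <= C/ln (real a)"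
  and h1: "sieve_error 30 b*E1 <= 1/8" "sieve_error 30 b <= 1" "0 <= sieve_error 30 b"
  and h2: "(C/ln (real (nat (floor y))) + 2/y)*E1 <= 1/8"
  and h3: "4*E1*((ln (2*real Kc/a) + 6)/ln y) <= 1/4"
  and h4: "32*2^J*((ln z + 4)/ln t) <= 1/4"
 shows "XX L z y <= 2^J*SG L z y + 3*(Y3*4^J*(real M)^2*(real Kc powr (3/4)*((real L)^2*real Kc + 2*real L^3*E1)))
   + 96*2^J*(real CK)^2*real L^4/y + 2*2^J*(12*z^3*Y3*(real M)^2*real L^3 + 48*real L^4 / sqrt z)"
proof -
 have y1: "1 < y" using y(2) exp_gt_one[of "1::real"] by linarith
 have big: "~ p dvd M" if "y < real p" for p
 proof -
  have "M < p" using that y by simp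
  thus ?thesis using M_pos by (auto dest: dvd_imp_le)
 qed
 interpret cd: conic_density D "- h" y Kc L1
 proof
  fix p :: nat assume "prime p" "y < real p"
  thus "p > 2 & ~ int p dvd D & ~ int p dvd - h" using prime_not_dvd_M[OF _ big] by blast
 qed (use y Kc in auto)
 have Kc1: "real Kc >= 1" using Kc(1) y1 by linarith
 have KJ1: "real Kc <= y^J"
 proof -
  have "real Kc*1 <= real Kc*real Kc" using Kc1 by (intro mult_left_mono) auto
  thus ?thesis using KJ by (simp add: power2_eq_square)
 qed
 obtain E where E: "!!p::nat. p >= 2 ==> z < real p^E p & real p^E p <= z*real p & E p >= 1"
  using next_prime_power[OF z(1)] by blast
 define X where "X = XX L z y"
 define eps where "eps = sieve_error 30 b"
 define R where "R = Y3*4^J*(real M)^2*real Kc powr (3/4)"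
 define ErrT where "ErrT = Y3*4^J*(real M)^2*(real Kc powr (3/4)*((real L)^2*real Kc + 2*real L^3*E1))"
 have X0: "0 <= X" unfolding X_def by (rule XX_nonneg)
 have E0: "0 < E1" by (simp add: E1_def)
 have Y0: "0 <= Y3" by (simp add: Y3_def)
 have R0: "0 <= R" unfolding R_def using Y0 by simp
 define err where "err = (%K. R*((real L)^2 + 2*real L^3*(1/real (\<Prod>K))))"
 have err0: "0 <= err K" for K unfolding err_def using R0 by (simp del: of_nat_prod)
 have est: "\<bar>SK L z y (\<Prod>K) - X * cd.rho K\<bar> <= eps*(X * cd.rho K) + err K" if "K \<in> KK y Kc" for K
  using SK_estimate[OF that y(1) y1 KJ1, of L z b] by (simp only: X_def eps_def err_def R_def Y3_def cd.rho_def mult.assoc)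
 have errS: "(\<Sum>K\<in>KK y Kc. err K) <= ErrT"
 proof -
  have "(\<Sum>K\<in>KK y Kc. err K) = R*((real L)^2*real (card (KK y Kc)) + 2*real L^3*(\<Sum>K\<in>KK y Kc. 1/real (\<Prod>K)))"
   unfolding err_def sum_distrib_left[symmetric] sum.distrib by simp
  also have "... <= R*((real L)^2*real Kc + 2*real L^3*E1)"
   using card_KK cd.sum_inverse_KK R0 by (intro mult_left_mono add_mono) (auto simp: E1_def)
  also have "... = ErrT" by (simp add: R_def ErrT_def)
  finally show ?thesis .
 qed
 have eXr: "eps*(X * s) <= X/8" if "s <= E1" for s
 proof -
  have "eps*(X * s) <= eps*(X*E1)" using that h1(3) X0 by (intro mult_left_mono) (auto simp: eps_def)
  also have "... = X*(eps*E1)" by simp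
  also have "... <= X*(1/8)" using X0 h1(1) by (intro mult_left_mono) (auto simp: eps_def)
  finally show ?thesis by simp
 qed
 have S1: "3/4*X - ErrT <= (\<Sum>K\<in>KK y Kc. chi (\<Prod>K)*SK L z y (\<Prod>K))"
 proof -
  have "\<bar>(\<Sum>K\<in>KK y Kc. chi (\<Prod>K)*SK L z y (\<Prod>K)) - X*(\<Sum>K\<in>KK y Kc. chi (\<Prod>K) * cd.rho K)\<bar>
    = \<bar>\<Sum>K\<in>KK y Kc. chi (\<Prod>K)*(SK L z y (\<Prod>K) - X * cd.rho K)\<bar>"
   unfolding sum_distrib_left sum_subtractf[symmetric] by (simp only: right_diff_distrib mult.left_commute)
  also have "... <= (\<Sum>K\<in>KK y Kc. \<bar>chi (\<Prod>K)*(SK L z y (\<Prod>K) - X * cd.rho K)\<bar>)" by (rule sum_abs)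
  also have "... <= (\<Sum>K\<in>KK y Kc. eps*(X * cd.rho K) + err K)"
  proof (rule sum_mono)
   fix K assume K: "K \<in> KK y Kc"
   have "\<bar>chi (\<Prod>K)\<bar>*\<bar>SK L z y (\<Prod>K) - X * cd.rho K\<bar> <= 1*(eps*(X * cd.rho K) + err K)"
    by (intro mult_mono chi_abs_le est K) auto
   thus "\<bar>chi (\<Prod>K)*(SK L z y (\<Prod>K) - X * cd.rho K)\<bar> <= eps*(X * cd.rho K) + err K" by (simp only: abs_mult mult_1)
  qed
  also have "... = eps*(X*(\<Sum>K\<in>KK y Kc. cd.rho K)) + (\<Sum>K\<in>KK y Kc. err K)"
   by (simp only: sum.distrib sum_distrib_left)
  also have "... <= X/8 + ErrT" using cd.sum_rho errS by (intro add_mono eXr) (simp_all add: E1_def)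
  finally have 1: "\<bar>(\<Sum>K\<in>KK y Kc. chi (\<Prod>K)*SK L z y (\<Prod>K)) - X*(\<Sum>K\<in>KK y Kc. chi (\<Prod>K) * cd.rho K)\<bar> <= X/8 + ErrT" .
  have "\<bar>(\<Sum>K\<in>KK y Kc. chi (\<Prod>K) * cd.rho K) - 1\<bar> <= (C/ln (real (nat (floor y))) + 2/y)*exp (L1 + 8)"
   by (rule cd.sum_chi_rho[OF chi_mult chi_1 chi_abs_le C])
  hence "7/8 <= (\<Sum>K\<in>KK y Kc. chi (\<Prod>K) * cd.rho K)" using h2 unfolding E1_def by linarith
  hence "X*(7/8) <= X*(\<Sum>K\<in>KK y Kc. chi (\<Prod>K) * cd.rho K)" using X0 by (rule mult_left_mono)
  thus ?thesis using 1 by linarith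
 qed
 have S2: "(\<Sum>K\<in>(KL a y Kc). SK L z y (\<Prod>K)) <= X/4 + ErrT"
 proof -
  have "(\<Sum>K\<in>(KL a y Kc). SK L z y (\<Prod>K)) <= (\<Sum>K\<in>(KL a y Kc). 2*X * cd.rho K + err K)"
  proof (rule sum_mono)
   fix K assume "K \<in> (KL a y Kc)"
   hence K: "K \<in> KK y Kc" by blast
   have "eps*(X * cd.rho K) <= 1*(X * cd.rho K)" using h1(2) X0 cd.rho_nonneg by (intro mult_right_mono) (auto simp: eps_def)
   thus "SK L z y (\<Prod>K) <= 2*X * cd.rho K + err K" using est[OF K] by linarith
  qed
  also have "... = 2*X*(\<Sum>K\<in>(KL a y Kc). cd.rho K) + (\<Sum>K\<in>(KL a y Kc). err K)"
   by (simp only: sum.distrib sum_distrib_left)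
  also have "(\<Sum>K\<in>(KL a y Kc). err K) <= (\<Sum>K\<in>KK y Kc. err K)"
   using finite_KK err0 by (intro sum_mono2) auto
  also have "... <= ErrT" by (rule errS)
  also have "2*X*(\<Sum>K\<in>(KL a y Kc). cd.rho K) <= 2*X*(2*((ln (2*real Kc/a) + 6)/ln y)*E1)"
   using cd.sum_rho_large[OF a(2,3)] X0 unfolding E1_def by (intro mult_left_mono) auto
  also have "... = X*(4*E1*((ln (2*real Kc/a) + 6)/ln y))" by simp
  also have "... <= X*(1/4)" using X0 h3 by (rule mult_left_mono[rotated])
  finally show ?thesis by simp
 qed
 have S3: "(\<Sum>r\<in>RR y Kc. NN L (r^2)) <= 32*(real CK)^2*real L^4/y"
 proof -
  let ?S = "(RR y Kc)"
  have fin: "finite ?S"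
   by (rule finite_subset[of _ "{..Kc}"]) (auto simp: power2_eq_square intro: order_trans[OF le_square])
  have "(\<Sum>r\<in>?S. NN L (r^2)) <= (\<Sum>r\<in>?S. 16*(real CK)^2*real L^4*(1/(real r)^2))"
  proof (rule sum_mono)
   fix r assume "r \<in> ?S"
   hence r: "prime r" "y < real r" "r^2 <= Kc" by blast+
   note pm = prime_not_dvd_M[OF r(1) big[OF r(2)]]
   have "real (r^2) <= real Kc" using r(3) by (simp only: of_nat_le_iff)
   hence "real (r^2) <= real CK*real L" by (simp only: Kc_def of_nat_mult)
   hence "NN L (r^2) <= 16*(real CK)^2*real L^4/real (r^2)"
    unfolding NN_def mm_def using CK by (intro box_sum_prime_power_le[OF r(1) pm(2,3,5)]) auto
   thus "NN L (r^2) <= 16*(real CK)^2*real L^4*(1/(real r)^2)" by simp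
  qed
  also have "... = 16*(real CK)^2*real L^4*(\<Sum>r\<in>?S. 1/(real r)^2)" by (simp only: sum_distrib_left)
  also have "... <= 16*(real CK)^2*real L^4*(2/y)"
   using y1 by (intro mult_left_mono sum_inverse_squares_real_le[OF _ fin]) auto
  finally show ?thesis by simp
 qed
 have S4: "(\<Sum>n\<in>QQ z. mangoldt n*SK L z y n) <= 16*X*(ln z + 4) + 12*z^3*Y3*(real M)^2*real L^3"
 proof -
  let ?S = "(QQ z)"
  define N where "N = nat (floor z)"
  have N1: "N >= 1" unfolding N_def using z(1) by linarith
  have Nz: "real N <= z" unfolding N_def using z(1) by (intro of_nat_floor) simp
  have sub: "?S <= {1..N}" using primepow_gt_0_nat by (auto simp: N_def le_nat_floor Suc_le_eq)
  define er where "er = 3*Y3*(real M)^2*z^2*real L^3"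
  have er0: "0 <= er" unfolding er_def using Y0 by simp
  have "(\<Sum>n\<in>?S. mangoldt n*SK L z y n) <= (\<Sum>n\<in>?S. 16*X*(mangoldt n/real n) + er*mangoldt n)"
  proof (rule sum_mono)
   fix n assume n: "n \<in> ?S"
   have "SK L z y n <= 16*X/real n + er"
    unfolding X_def er_def Y3_def by (rule SK_prime_power[OF _ _ _ z(2) y1 h1(2) L]) (use n in auto)
   hence "mangoldt n*SK L z y n <= mangoldt n*(16*X/real n + er)" by (intro mult_left_mono mangoldt_nonneg)
   thus "mangoldt n*SK L z y n <= 16*X*(mangoldt n/real n) + er*mangoldt n" by (simp add: algebra_simps)
  qed
  also have "... <= (\<Sum>n\<in>{1..N}. 16*X*(mangoldt n/real n) + er*mangoldt n)"
   using X0 er0 sub by (intro sum_mono2) (auto intro!: add_nonneg_nonneg mult_nonneg_nonneg mangoldt_nonneg divide_nonneg_nonneg)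
  also have "... = 16*X*(\<Sum>n\<in>{1..N}. mangoldt n/real n) + er*psi N"
   by (simp only: sum.distrib sum_distrib_left psi_def)
  also have "... <= 16*X*(ln z + 4) + er*(4*z)"
  proof (intro add_mono mult_left_mono er0)
   have "(\<Sum>n\<in>{1..N}. mangoldt n/real n) <= ln (real N) + 4" by (rule mertens1(1)[OF N1])
   also have "ln (real N) <= ln z" using N1 Nz by (intro ln_mono) auto
   finally show "(\<Sum>n\<in>{1..N}. mangoldt n/real n) <= ln z + 4" by simp
   show "psi N <= 4*z" using psi_le[of N] Nz by linarith
   show "0 <= 16*X" using X0 by simp
  qed
  also have "er*(4*z) = 12*z^3*Y3*(real M)^2*real L^3" by (simp add: er_def power3_eq_cube power2_eq_square)
  finally show ?thesis .
 qed
 have S5: "(\<Sum>p\<in>P z. NN L (p^E p)) <= 48*real L^4 / sqrt z"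
 proof -
  have "(\<Sum>p\<in>P z. NN L (p^E p)) <= (\<Sum>p\<in>P z. 16*real L^4*(1/real p^E p))"
  proof (rule sum_mono)
   fix p assume p: "p \<in> P z"
   hence pr: "prime p" "~ p dvd M" "real p <= z" by (auto simp: P_def)
   note pm = prime_not_dvd_M[OF pr(1,2)]
   have "real p^E p <= z*real p" using E[of p] pm(2) by simp
   also have "... <= z*z" using pr(3) z(1) by (intro mult_left_mono) auto
   also have "... <= real L" using z(3) by (simp add: power2_eq_square)
   finally have "real (p^E p) <= 1*real L" by simp
   hence "NN L (p^E p) <= 16*1^2*real L^4/real (p^E p)"
    unfolding NN_def mm_def by (intro box_sum_prime_power_le[OF pr(1) pm(2,3,5)]) auto
   thus "NN L (p^E p) <= 16*real L^4*(1/real p^E p)" by simp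
  qed
  also have "... = 16*real L^4*(\<Sum>p\<in>P z. 1/real p^E p)" by (simp only: sum_distrib_left)
  also have "(\<Sum>p\<in>P z. 1/real p^E p) <= (\<Sum>p | prime p & real p <= z. 1/real p^E p)"
   by (rule sum_mono2[OF finite_real_le_set]) (auto simp: P_def)
  also have "... <= 3 / sqrt z" by (rule sum_next_prime_power[OF z(1)]) (use E in blast)
  finally show ?thesis by (simp add: mult_left_mono)
 qed
 have E': "real p^E p <= z*real p & E p >= 1" if "p >= 2" for p using E[OF that] by blast
 note main = weighted_lower_bound[OF L y(1) y1 t(1) mK KJ E' a(1)]
 have A3: "2^J*(3*(\<Sum>r\<in>RR y Kc. NN L (r^2))) <= 96*2^J*(real CK)^2*real L^4/y"
  using mult_left_mono[OF S3, of "3*2^J"] by simp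
 have A4: "2*2^J*((\<Sum>n\<in>QQ z. mangoldt n*SK L z y n)/ln t + (\<Sum>p\<in>P z. NN L (p^E p)))
  <= X/4 + 2*2^J*(12*z^3*Y3*(real M)^2*real L^3 + 48*real L^4 / sqrt z)"
 proof -
  define Er where "Er = 12*z^3*Y3*(real M)^2*real L^3"
  have Er0: "0 <= Er" unfolding Er_def using Y0 z(1) by simp
  have "(\<Sum>n\<in>QQ z. mangoldt n*SK L z y n)/ln t <= (16*X*(ln z + 4) + Er)/ln t"
   using S4 t unfolding Er_def by (intro divide_right_mono) auto
  also have "... = 16*X*((ln z + 4)/ln t) + Er/ln t" by (subst add_divide_distrib) (simp only: times_divide_eq_right)
  also have "Er/ln t <= Er/1" using t Er0 by (intro divide_left_mono) auto
  finally have "(\<Sum>n\<in>QQ z. mangoldt n*SK L z y n)/ln t + (\<Sum>p\<in>P z. NN L (p^E p))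
   <= 16*X*((ln z + 4)/ln t) + (Er + 48*real L^4 / sqrt z)" using S5 by simp
  hence "2*2^J*((\<Sum>n\<in>QQ z. mangoldt n*SK L z y n)/ln t + (\<Sum>p\<in>P z. NN L (p^E p)))
   <= 2*2^J*(16*X*((ln z + 4)/ln t) + (Er + 48*real L^4 / sqrt z))" by (intro mult_left_mono) auto
  also have "... = X*(32*2^J*((ln z + 4)/ln t)) + 2*2^J*(Er + 48*real L^4 / sqrt z)" by (simp add: algebra_simps)
  also have "X*(32*2^J*((ln z + 4)/ln t)) <= X*(1/4)" using X0 h4 by (rule mult_left_mono[rotated])
  finally show ?thesis unfolding Er_def by simp
 qed
 show ?thesis using main S1 S2 A3 A4 unfolding X_def[symmetric] ErrT_def[symmetric] by linarith
qed

text \<open>A deeper sieve has a higher level, hence needs a smaller y, so the exponent of Kc over y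
  grows linearly in b. The factorial in \<open>sieve_error\<close> has to beat the resulting
  geometric growth.\<close>

lemma sieve_error_small: "\<exists>b. sieve_error 30 b*exp (2*real (100*(12*b + 18)) + 8) <= 1/8 & sieve_error 30 b <= 1 & 0 <= sieve_error 30 b"
proof -
 \<comment> \<open>With n = 2*N + 1 the exponent 2*(1200*N + 1800) + 8 is at most 1200*n + 3608,
   whence the base exp 1200 next to G = 30.\<close>
 define Z :: real where "Z = 30*exp 1200"
 define E0 :: real where "E0 = exp (2*30 + 30^2)"
 have E0: "E0 > 0" by (simp add: E0_def)
 define K :: real where "K = 24*E0*exp 3608"
 have K0: "K > 0" using E0 by (simp add: K_def)
 have "(%n. Z^n/fact n) \<longlonglongrightarrow> 0"
  using summable_LIMSEQ_zero[OF summable_exp[of Z]] by (simp add: divide_inverse mult.commute)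
 hence "eventually (%n. Z^n/fact n < 1/K) sequentially" using K0 by (intro order_tendstoD) auto
 then obtain N where N: "!!n. n >= N ==> Z^n/fact n < 1/K" by (auto simp: eventually_sequentially)
 define n where "n = 2*N + 1"
 define s where "s = E0*(30^n/fact n)"
 have se: "sieve_error 30 N = s*exp s" by (simp add: sieve_error_def s_def n_def E0_def Let_def)
 have s0: "0 <= s" using E0 by (simp add: s_def)
 have x1: "1 <= exp (1200::real)" by simp
 have Zn: "Z^n = 30^n*exp 1200^n" by (simp add: Z_def power_mult_distrib)
 have e: "exp (2*real (100*(12*N + 18)) + 8) <= exp 3608*exp (1200::real)^n"
 proof -
  have "exp (2*real (100*(12*N + 18)) + 8) <= exp (3608 + real n*1200)" by (simp add: n_def)
  also have "... = exp 3608*exp (1200::real)^n" by (simp only: exp_add exp_of_nat_mult)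
  finally show ?thesis .
 qed
 have b: "s*(24*(exp 3608*exp (1200::real)^n)) <= 1"
 proof -
  have "s*(24*(exp 3608*exp (1200::real)^n)) = K*(Z^n/fact n)" by (simp add: s_def K_def Zn)
  also have "... <= K*(1/K)" using N[of n] K0 by (intro mult_left_mono) (auto simp: n_def)
  also have "... = 1" using K0 by simp
  finally show ?thesis .
 qed
 have g1: "1 <= exp 3608*exp (1200::real)^n" using mult_mono[of 1 "exp 3608" 1 "exp (1200::real)^n"] x1 by (simp add: one_le_power)
 have "s*(24*1) <= s*(24*(exp 3608*exp (1200::real)^n))" using s0 g1 by (intro mult_left_mono) auto
 hence s1: "s <= 1/24" using b by linarith
 have "exp s <= exp 1" using s1 by simp
 hence es: "exp s <= 3" using exp_le by linarith
 have "sieve_error 30 N*exp (2*real (100*(12*N + 18)) + 8) <= (s*3)*(exp 3608*exp (1200::real)^n)"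
  unfolding se using es s0 e by (intro mult_mono mult_left_mono) auto
 also have "... <= 1/8" using b by simp
 finally have 1: "sieve_error 30 N*exp (2*real (100*(12*N + 18)) + 8) <= 1/8" .
 have "s*exp s <= (1/24)*3" using s1 es s0 by (intro mult_mono) auto
 thus ?thesis using 1 se s0 by (intro exI[of _ N]) auto
qed

end

section \<open>Choice of the parameters\<close>

lemma eventually_real_sequentially: "eventually P (at_top :: real filter) ==> eventually (%n. P (real n)) sequentially"
 using filterlim_real_sequentially by (auto simp: filterlim_iff)

lemma eventually_powr_ge: "p > 0 ==> eventually (%x::real. c <= x powr p) at_top"
proof -
 assume "p > 0"
 hence "filterlim (%x::real. x powr p) at_top at_top" by real_asymp
 thus ?thesis by (simp add: filterlim_at_top)
qed

lemma eventually_ln_ge: "eventually (%x::real. c <= ln x) at_top"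
 using ln_at_top by (simp add: filterlim_at_top)

lemma eventually_powr_negligible:
 fixes s C theta :: real
 assumes "s < 4" "theta > 0"
 shows "eventually (%x::real. C*x powr s <= theta*(x^4/ln x)) at_top"
proof -
 define r where "r = 4 - s"
 have r: "r > 0" using assms by (simp add: r_def)
 have "((%x::real. C*(ln x/x powr r)) \<longlongrightarrow> 0) at_top" using r by real_asymp
 hence "eventually (%x::real. C*(ln x/x powr r) < theta) at_top" using assms(2) by (rule order_tendstoD)
 thus ?thesis using eventually_ge_at_top[of 3]
 proof eventually_elim
  case (elim x)
  have l: "ln x > 0" using elim by simp
  have xs: "x powr s = x^4/x powr r"
   using elim by (simp add: r_def powr_diff)
  have "C*x powr s = C*(ln x/x powr r)*(x^4/ln x)" using l by (simp add: xs)
  also have "... <= theta*(x^4/ln x)" using elim l by (intro mult_right_mono) auto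
  finally show ?case .
 qed
qed

context shifted_form begin

text \<open>The scales are powers of L, fixed in this order: the depth b, then y = L^(1/B), then t =
  L^d, then z = y^(1/A). Each choice secures one of the numerical hypotheses of
  \<open>core_inequality\<close> without disturbing the earlier ones.\<close>

lemma good_weight_lower_bound:
 "\<exists>c>0. \<exists>B::nat. B >= 1 & eventually (%L. \<exists>z. c*(real L^4/ln (real L)) <= SG L z (real L powr (1/real B))) sequentially"
proof -
 obtain b where b: "sieve_error 30 b*exp (2*real (100*(12*b + 18)) + 8) <= 1/8" "sieve_error 30 b <= 1" "0 <= sieve_error 30 b"
  using sieve_error_small by blast
 obtain C where C: "C >= 0" "!!a b. a >= 2 ==> \<bar>\<Sum>p\<in>{p\<in>{a<..b}. prime p}. chi p/real p\<bar> <= C/ln (real a)"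
  using chi_prime_sum by blast
 \<comment> \<open>Makes (y^(4*b + 6))^3 equal to L^(1/100), small against the Fourier saving
   L^(1/4).\<close>
 define B where "B = 100*(12*b + 18)"
 define rB where "rB = real B"
 have rB: "rB >= 1800" by (simp add: rB_def B_def)
 \<comment> \<open>Then y^J = L^3, which exceeds Kc^2.\<close>
 define J where "J = 3*B"
 define E1 where "E1 = exp (2*rB + 8)"
 have E1: "E1 >= 1" using rB by (simp add: E1_def)
 \<comment> \<open>For u, v < 3*L the shifted value is at most (9*(1 + D) + h)*L^2.\<close>
 define CK where "CK = nat (9*(1 + D) + h)"
 have CK1: "CK >= 1" using D_pos h_pos by (simp add: CK_def)
 have CKi: "int CK = 9*(1 + D) + h" using D_pos h_pos by (simp add: CK_def)
 have rCK: "real CK >= 1" using CK1 by simp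
 \<comment> \<open>Makes the share 4*E1*rB*d of the divisors near Kc equal to 1/8.\<close>
 define d where "d = 1/(32*rB*E1)"
 have E1p: "E1 > 0" using E1 by linarith
 have big: "32*rB*E1 >= 32*1800*1" using rB E1 by (intro mult_mono) auto
 have d: "0 < d" "d <= 1/2"
 proof -
  show "0 < d" unfolding d_def using rB E1p by simp
  have "d <= 1/2" unfolding d_def using big by (intro divide_left_mono) auto
  thus "d <= 1/2" .
 qed
 \<comment> \<open>Makes ln z so small against ln t that the leading term 32*2^J/(A*rB*d) of the
   smooth parts beyond t is at most 1/8.\<close>
 define A where "A = 256*2^J/(rB*d) + 1"
 have A1: "A >= 1" unfolding A_def using rB d by simp
 have ArB: "A*rB >= 1800" using mult_mono[OF A1 rB] A1 by simp
 obtain cV where cV: "cV > 0" "!!z. z >= 3 ==> cV/ln z <= V z (z powr A)" using V_lower[OF A1] by blast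
 define c1 where "c1 = cV*(A*rB)/(real M)^2"
 have c1: "c1 > 0" unfolding c1_def using cV ArB M_pos by simp
 define mr where "mr = real_of_int m0"
 have mr: "mr >= 1" using m0_pos by (simp add: mr_def)
 define c2 where "c2 = ln (2*mr*(real CK)^2)"
 have c20: "c2 >= 0"
 proof -
  have "1 <= (real CK)^2" using rCK by (rule one_le_power)
  hence "1*1 <= (2*mr)*(real CK)^2" using mr by (intro mult_mono) auto
  thus ?thesis by (simp add: c2_def)
 qed
 define K1 where "K1 = 3*4^J*(real M)^2*real CK*(real CK + 2*E1)"
 define K2 where "K2 = 96*2^J*(real CK)^2"
 define K3 where "K3 = 2*2^J*12*(real M)^2"
 define K4 where "K4 = (2::real)*2^J*48"
 have e: "1/rB > 0" "1/(A*rB) > 0" "d > 0" "1 - d > 0" "1/(2*(A*rB)) > 0" using rB ArB d by auto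
 \<comment> \<open>The exponents of the four error terms: 3 + 3/4 + 1/100 from equidistribution,
   then squares of large primes, prime powers up to z, and the powers \<open>p^E p\<close>.\<close>
 have s: "376/100 < (4::real)" "4 - 1/rB < 4" "3 + 3/(A*rB) + 1/100 < 4" "4 - 1/(2*(A*rB)) < 4"
  using rB ArB e by (auto simp: field_simps)
 have th: "c1/8 > 0" using c1 by simp
 have ev: "eventually (%x::real. 3 <= x & (real CK)\<^sup>2 <= x & real M <= x powr (1/rB) & exp 1 <= x powr (1/rB)
   & 2*exp (16*C*E1 + 1) <= x powr (1/rB) & 32*E1 <= x powr (1/rB) & 3 <= x powr (1/(A*rB))
   & 1/d <= ln x & 32*E1*rB*(c2 + 6) <= ln x & 1024*2^J/d <= ln x & 2*(mr*real CK) <= x powr (1 - d)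
   & K1*x powr (376/100) <= c1/8*(x^4/ln x) & K2*x powr (4 - 1/rB) <= c1/8*(x^4/ln x)
   & K3*x powr (3 + 3/(A*rB) + 1/100) <= c1/8*(x^4/ln x) & K4*x powr (4 - 1/(2*(A*rB))) <= c1/8*(x^4/ln x)) at_top"
  by (intro eventually_conj eventually_ge_at_top eventually_powr_ge eventually_ln_ge eventually_powr_negligible e s th)
 have "eventually (%L. \<exists>z. c1/2/2^J*(real L^4/ln (real L)) <= SG L z (real L powr (1/real B))) sequentially"
  using eventually_real_sequentially[OF ev]
 proof eventually_elim
  case (elim L)
  define x where "x = real L"
  define y where "y = x powr (1/rB)"
  define z where "z = x powr (1/(A*rB))"
  define t where "t = x powr d"
  define a where "a = x/(mr*real CK*t)"
  have x3: "3 <= x" and xCK: "(real CK)^2 <= x" and yM: "real M <= y" and ye: "exp 1 <= y" and yC: "2*exp (16*C*E1 + 1) <= y"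
   and yE: "32*E1 <= y" and z3: "3 <= z" and l1: "1/d <= ln x" and l2: "32*E1*rB*(c2 + 6) <= ln x" and l3: "1024*2^J/d <= ln x"
   and xm: "2*(mr*real CK) <= x powr (1 - d)"
   and n1: "K1*x powr (376/100) <= c1/8*(x^4/ln x)" and n2: "K2*x powr (4 - 1/rB) <= c1/8*(x^4/ln x)"
   and n3: "K3*x powr (3 + 3/(A*rB) + 1/100) <= c1/8*(x^4/ln x)" and n4: "K4*x powr (4 - 1/(2*(A*rB))) <= c1/8*(x^4/ln x)"
   using elim unfolding x_def[symmetric] y_def[symmetric] z_def[symmetric] by blast+
  have x0: "x > 0" "x >= 1" using x3 by simp_all
  have L0: "L > 0" using x3 by (cases L) (auto simp: x_def)
  have lx: "ln x > 0" using x3 by simp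
  have lny: "ln y = ln x/rB" and lnz: "ln z = ln x/(A*rB)" and lnt: "ln t = d*ln x" using x0 by (simp_all add: y_def z_def t_def ln_powr)
  have zy: "z powr A = y" using A1 by (simp add: z_def y_def powr_powr)
  have mono: "x powr p <= x powr q" if "p <= q" for p q using that x0 by (intro powr_mono) auto
  have x1: "x powr 1 = x" using x0 by simp
  have "1/(A*rB) <= 1/rB" using A1 rB by (intro divide_left_mono) (auto simp: mult_le_cancel_right1)
  hence zley: "z <= y" unfolding z_def y_def by (rule mono)
  have z2: "z^2 <= x"
  proof -
   have "z^2 = x powr (1/(A*rB) + 1/(A*rB))" by (simp only: z_def power2_eq_square powr_add)
   also have "... <= x powr 1" using ArB by (intro mono) (simp add: field_simps)
   finally show ?thesis using x1 by simp
  qed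
  have yx: "y <= x" unfolding y_def using mono[of "1/rB" 1] rB x1 by simp
  have t1: "1 <= ln t" using l1 d unfolding lnt by (simp add: field_simps)
  have t0: "t > 0" using x0 by (simp add: t_def)
  have tg: "1 < t"
  proof -
   have "0 < ln t" using t1 by linarith
   thus ?thesis using t0 by (simp add: ln_gt_zero_iff)
  qed
  have mK: "mm u v <= (int (CK*L))^2" if uv: "int L <= u" "u < 3*int L" "int L <= v" "v < 3*int L" for u v
  proof -
   have "u^2 <= (3*int L)^2" by (rule power_mono) (use uv in linarith)+
   moreover have "v^2 <= (3*int L)^2" by (rule power_mono) (use uv in linarith)+
   ultimately have u9: "u^2 <= 9*(int L)^2" "D * v^2 <= D*(9*(int L)^2)" using D_pos by (auto simp: power_mult_distrib)
   have "(int L)^2 >= 1" using L0 by (simp add: Suc_le_eq)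
   hence "h*1 <= h*(int L)^2" using h_pos by (intro mult_left_mono) auto
   hence "mm u v <= int CK*(int L)^2" using u9 unfolding mm_def quad_def CKi by (simp add: algebra_simps)
   also have "int CK*(int L)^2 <= (int CK)^2*(int L)^2" using CK1 by (intro mult_right_mono) (auto simp: power2_eq_square)
   finally show ?thesis by (simp add: power_mult_distrib)
  qed
  have Kc: "real (CK*L) = real CK*x" by (simp add: x_def)
  have yJ: "y^J = x^3"
  proof -
   have "y^B = x powr (1/rB*real B)" unfolding y_def using x0 by (simp only: powr_realpow[symmetric] powr_gt_zero powr_powr)
   also have "... = x" using rB x0 by (simp add: rB_def)
   finally have "y^B = x" .
   thus ?thesis by (simp add: J_def power_mult mult.commute[of 3])
  qed
  have KJ: "(real (CK*L))^2 <= y^J"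
  proof -
   have "(real CK)^2*x^2 <= x*x^2" using xCK by (intro mult_right_mono) auto
   thus ?thesis unfolding yJ Kc by (simp add: power_mult_distrib power3_eq_cube power2_eq_square mult_ac)
  qed
  have xK: "x <= real CK*x" using rCK x0 by simp
  have yK: "y <= real (CK*L)" unfolding Kc using yx xK by linarith
  have CKx: "real CK <= x"
  proof -
   have "real CK*1 <= real CK*real CK" using rCK by (intro mult_left_mono) auto
   thus ?thesis using xCK by (simp add: power2_eq_square)
  qed
  have lK: "ln (real (CK*L)) <= 2*rB*ln y"
  proof -
   have "ln (real CK*x) = ln (real CK) + ln x" using rCK x0 by (intro ln_mult_pos) auto
   also have "ln (real CK) <= ln x" using CKx rCK by (intro ln_mono) auto
   finally show ?thesis unfolding Kc lny using rB by simp
  qed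
  have mCt: "mr*real CK*t > 0" using mr rCK t0 by simp
  have a1: "a*(of_int m0*t*real (CK*L)) <= (real L)^2"
  proof -
   have "a*(mr*t*(real CK*x)) = a*(mr*real CK*t)*x" by (simp only: mult_ac)
   also have "a*(mr*real CK*t) = x"
   proof -
    have "x/Z*Z = x" if "Z > 0" for Z using that by simp
    from this[OF mCt] show ?thesis unfolding a_def .
   qed
   finally have "a*(mr*t*(real CK*x)) = x*x" .
   hence "a*(mr*t*(real CK*x)) <= x*x" by (rule eq_refl)
   thus ?thesis unfolding Kc mr_def[symmetric] x_def[symmetric] power2_eq_square .
  qed
  have a2: "1 < a"
  proof -
   have "x powr (1 - d)*t = x powr (1 - d + d)" by (simp only: t_def powr_add)
   hence "x powr (1 - d)*t = x" using x0 by simp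
   moreover have "2*(mr*real CK)*t <= x powr (1 - d)*t" using xm t0 by (intro mult_right_mono) auto
   ultimately have "2*(mr*real CK)*t <= x" by linarith
   moreover have "mr*real CK*t < 2*(mr*real CK)*t" using mCt by linarith
   ultimately have "1*(mr*real CK*t) < x" by linarith
   moreover have "1 < x/Z" if "1*Z < x" "Z > 0" for Z using that by (simp add: less_divide_eq)
   ultimately show ?thesis unfolding a_def using mCt by blast
  qed
  have a3: "a <= 2*real (CK*L)"
  proof -
   have "1*1*1 <= mr*real CK*t" using mr rCK tg by (intro mult_mono) auto
   hence "x/(mr*real CK*t) <= x/1" using x0 by (intro divide_left_mono) auto
   hence "x/(mr*real CK*t) <= x" by simp
   thus ?thesis unfolding a_def Kc using xK x0 by linarith
  qed
  have h2: "(C/ln (real (nat (floor y))) + 2/y)*E1 <= 1/8"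
  proof -
   have y2: "y >= 2" using yE E1 by linarith
   define f where "f = real (nat (floor y))"
   have "f = of_int (floor y)" using y2 by (simp add: f_def)
   hence "f >= y/2" using floor_correct[of y] y2 by linarith
   hence f: "f >= exp (16*C*E1 + 1)" using yC by linarith
   have "f > 0" using f exp_gt_zero[of "16*C*E1 + 1"] by linarith
   hence lf: "ln f >= 16*C*E1 + 1" using f by (subst ln_ge_iff) auto
   have CE: "0 <= C*E1" using C(1) E1p by simp
   have "C*E1/ln f <= 1/16" using lf CE by (subst divide_le_eq) auto
   moreover have "2*E1/y <= 1/16" using yE y2 by (subst divide_le_eq) auto
   moreover have "(C/ln f + 2/y)*E1 = C*E1/ln f + 2*E1/y" by (simp add: distrib_right)
   ultimately show ?thesis unfolding f_def[symmetric] by linarith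
  qed
  have h3: "4*E1*((ln (2*real (CK*L)/a) + 6)/ln y) <= 1/4"
  proof -
   have "2*real (CK*L)/a = (2*mr*(real CK)^2)*t" 
   proof -
    have "2*(k*x)/(x/Z) = 2 * k*Z" if "Z > 0" for k Z :: real using that x0 by (simp add: field_simps)
    from this[OF mCt, of "real CK"] show ?thesis unfolding Kc a_def by (simp add: power2_eq_square mult_ac)
   qed
   hence "ln (2*real (CK*L)/a) = c2 + d*ln x"
    unfolding c2_def lnt[symmetric] using mr rCK t0 by (simp add: ln_mult_pos)
   hence "4*E1*((ln (2*real (CK*L)/a) + 6)/ln y) = 4*E1*rB*d + 4*E1*rB*(c2 + 6)/ln x"
    unfolding lny using lx rB by (simp add: field_simps)
   also have "4*E1*rB*d = 1/8" unfolding d_def using rB E1p by simp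
   also have "4*E1*rB*(c2 + 6)/ln x <= 1/8" using l2 lx by (subst divide_le_eq) auto
   finally show ?thesis by simp
  qed
  have h4: "32*2^J*((ln z + 4)/ln t) <= 1/4"
  proof -
   have "32*2^J*((ln z + 4)/ln t) = 32*2^J/(A*rB*d) + 128*2^J/(d*ln x)"
    unfolding lnz lnt using lx d ArB by (simp add: field_simps)
   moreover have "32*2^J/(A*rB*d) <= 1/8"
   proof -
    have "A*(rB*d) = 256*2^J + rB*d" unfolding A_def using rB d by (simp add: distrib_right)
    hence "256*2^J <= A*rB*d" using rB d by (simp add: mult.assoc)
    moreover have "0 < A*rB*d" using ArB d by simp
    ultimately show ?thesis by (subst divide_le_eq) auto
   qed
   moreover have "128*2^J/(d*ln x) <= 1/8"
   proof -
    have "1024*2^J <= d*ln x" using l3 d by (simp add: field_simps)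
    moreover have "0 < d*ln x" using d lx by simp
    ultimately show ?thesis by (subst divide_le_eq) auto
   qed
   ultimately show ?thesis by simp
  qed
  have h1: "sieve_error 30 b*exp (2*rB + 8) <= 1/8" using b(1) by (simp only: rB_def B_def)
  have core: "XX L z y <= 2^J*SG L z y + 3*((y powr (4*real b + 6))^3*4^J*(real M)^2*(real (CK*L) powr (3/4)*((real L)^2*real (CK*L) + 2*real L^3*exp (2*rB + 8))))
   + 96*2^J*(real CK)^2*real L^4/y + 2*2^J*(12*z^3*(y powr (4*real b + 6))^3*(real M)^2*real L^3 + 48*real L^4 / sqrt z)"
   by (rule core_inequality[OF L0 CK1 yM ye _ zley _ tg t1 mK KJ yK lK a1 a2 a3 C h1 b(2,3) h2[unfolded E1_def] h3[unfolded E1_def] h4])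
    (use z3 z2 x_def in auto)
  have Y3: "(y powr (4*real b + 6))^3 = x powr (1/100)"
  proof -
   have "(y powr (4*real b + 6))^3 = y powr ((4*real b + 6)*3)"
    using x0 by (simp add: power3_eq_cube powr_add[symmetric] algebra_simps)
   also have "... = x powr (1/rB*((4*real b + 6)*3))" by (simp only: y_def powr_powr)
   also have "1/rB*((4*real b + 6)*3) = 1/100" by (simp add: rB_def B_def field_simps)
   finally show ?thesis .
  qed
  have r1: "3*(x powr (1/100)*4^J*(real M)^2*((real CK*x) powr (3/4)*(x^2*(real CK*x) + 2*x^3*E1))) <= K1*x powr (376/100)"
  proof -
   have "(real CK) powr (3/4) <= (real CK) powr 1" using rCK by (intro powr_mono) auto
   hence "(real CK*x) powr (3/4) <= real CK*x powr (3/4)" using x0 rCK by (simp add: powr_mult mult_right_mono)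
   hence "3*(x powr (1/100)*4^J*(real M)^2*((real CK*x) powr (3/4)*(x^2*(real CK*x) + 2*x^3*E1)))
    <= 3*(x powr (1/100)*4^J*(real M)^2*((real CK*x powr (3/4))*(x^2*(real CK*x) + 2*x^3*E1)))"
    using x0 E1p by (intro mult_left_mono mult_right_mono) auto
   also have "... = K1*(x powr (1/100)*x powr (3/4)*x^3)" by (simp add: K1_def power2_eq_square power3_eq_cube algebra_simps)
   also have "x powr (1/100)*x powr (3/4)*x^3 = x powr (1/100 + 3/4 + 3)" using x0 by (simp only: powr_add) simp
   finally show ?thesis by simp
  qed
  have r2: "96*2^J*(real CK)^2*x^4/y = K2*x powr (4 - 1/rB)"
   unfolding K2_def y_def using x0 by (simp add: powr_diff)
  have r3: "2*2^J*(12*z^3*x powr (1/100)*(real M)^2*x^3) = K3*x powr (3 + 3/(A*rB) + 1/100)"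
  proof -
   have "z^3 = x powr (3/(A*rB))" unfolding z_def power3_eq_cube powr_add[symmetric] by (simp add: add_divide_distrib[symmetric])
   hence "x powr (3 + 3/(A*rB) + 1/100) = x^3*z^3*x powr (1/100)" using x0 by (simp only: powr_add) simp
   thus ?thesis by (simp add: K3_def)
  qed
  have r4: "2*2^J*(48*x^4 / sqrt z) = K4*x powr (4 - 1/(2*(A*rB)))"
  proof -
   have "sqrt z = x powr (1/(2*(A*rB)))" using x0 by (simp add: z_def powr_half_sqrt[symmetric] powr_powr mult_ac)
   thus ?thesis using x0 by (simp add: K4_def powr_diff)
  qed
  have Xl: "c1*(x^4/ln x) <= XX L z y"
  proof -
   have "cV/ln z <= V z y" using cV(2)[OF z3] unfolding zy .
   hence "cV/ln z*x^4/(real M)^2 <= V z y*x^4/(real M)^2" using x0 by (intro divide_right_mono mult_right_mono) auto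
   moreover have "cV/ln z*x^4/(real M)^2 = c1*(x^4/ln x)" unfolding lnz c1_def by simp
   ultimately show ?thesis by (simp add: XX_def x_def)
  qed
  have "XX L z y <= 2^J*SG L z y + K1*x powr (376/100) + K2*x powr (4 - 1/rB) + (K3*x powr (3 + 3/(A*rB) + 1/100) + K4*x powr (4 - 1/(2*(A*rB))))"
   using core r1 unfolding Y3 Kc x_def[symmetric] E1_def[symmetric] r2 r3[symmetric] r4[symmetric] distrib_left by linarith
  hence "c1/2*(x^4/ln x) <= 2^J*SG L z y" using Xl n1 n2 n3 n4 by linarith
  moreover have "s/2^J <= g" if "s <= 2^J*g" for s g :: real using that by (simp add: pos_divide_le_eq mult.commute)
  ultimately have "c1/2*(x^4/ln x)/2^J <= SG L z y" by blast
  hence "c1/2/2^J*(x^4/ln x) <= SG L z y" by (simp only: times_divide_eq_left)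
  thus ?case unfolding x_def y_def rB_def by blast
 qed
 moreover have "c1/2/2^J > 0" using c1 by simp
 moreover have "B >= 1" by (simp add: B_def)
 ultimately show ?thesis by blast
qed

end

section \<open>From weighted pairs to values of the form\<close>

lemma box_sum_le_square:
 fixes F :: "int => int => real"
 assumes "!!u v. 0 <= F u v"
 shows "box_sum L F <= (real L)^2*(\<Sum>u\<in>{int L..<3*int L}. \<Sum>v\<in>{int L..<3*int L}. F u v)"
proof -
 let ?U = "{int L..<3*int L}"
 have one: "(\<Sum>i'<L. G (int L + int i + int i')) <= (\<Sum>u\<in>?U. G u)" if "i < L" "!!u. 0 <= G u" for i and G :: "int => real"
 proof -
  have "(\<Sum>i'<L. G (int L + int i + int i')) = (\<Sum>u\<in>(%i'. int L + int i + int i') ` {..<L}. G u)"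
   by (subst sum.reindex) (auto simp: inj_on_def)
  also have "... <= (\<Sum>u\<in>?U. G u)" using that by (intro sum_mono2) auto
  finally show ?thesis .
 qed
 have inner: "(\<Sum>j<L. \<Sum>j'<L. F u (int L + int j + int j')) <= real L*(\<Sum>v\<in>?U. F u v)" for u
 proof -
  have "(\<Sum>j<L. \<Sum>j'<L. F u (int L + int j + int j')) <= (\<Sum>j<L. \<Sum>v\<in>?U. F u v)"
   using assms by (intro sum_mono one) auto
  thus ?thesis by simp
 qed
 have "box_sum L F <= (\<Sum>i<L. \<Sum>i'<L. real L*(\<Sum>v\<in>?U. F (int L + int i + int i') v))"
  unfolding box_sum_def by (intro sum_mono inner)
 also have "... <= (\<Sum>i<L. \<Sum>u\<in>?U. real L*(\<Sum>v\<in>?U. F u v))"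
  using assms by (intro sum_mono one[of _ "%u. real L*(\<Sum>v\<in>?U. F u v)"]) (auto intro!: mult_nonneg_nonneg sum_nonneg)
 also have "... = (real L)^2*(\<Sum>u\<in>?U. \<Sum>v\<in>?U. F u v)" by (simp add: sum_distrib_left[symmetric] power2_eq_square)
 finally show ?thesis .
qed

lemma card_large_prime_factors:
 fixes n :: nat and y :: real
 assumes "n > 0" "y > 1" "real n <= y^J"
 shows "card {p\<in>prime_factors n. y < real p} <= J"
proof -
 let ?S = "{p\<in>prime_factors n. y < real p}"
 have "y^card ?S = (\<Prod>p\<in>?S. y)" by simp
 also have "... <= (\<Prod>p\<in>?S. real p)" using assms(2) by (intro prod_mono) auto
 also have "... = real (\<Prod>?S)" by simp
 also have "... <= real n"
 proof -
  have "\<forall>p\<in>?S. int p dvd int n" by auto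
  hence "int (\<Prod>?S) dvd int n" using prod_primes_dvd_iff[of ?S "int n"] by auto
  hence "\<Prod>?S <= n" using assms(1) by (simp only: of_nat_dvd_iff) (rule dvd_imp_le)
  thus ?thesis by (simp only: of_nat_le_iff)
 qed
 also have "... <= y^J" by (rule assms(3))
 finally show ?thesis using power_le_imp_le_exp[OF assms(2)] by blast
qed

context shifted_form begin

definition good_shift :: "int => bool" where
 "good_shift n \<longleftrightarrow> (\<exists>m1::nat. n + h = m0*int m1 & m1 > 0 & coprime m1 M &
   (\<forall>p. prime p --> chi p = -1 --> even (multiplicity p m1)))"

lemma good_iff: "good u v \<longleftrightarrow> good_shift (quad D u v)" by (simp add: good_def good_shift_def)

lemma W_le_half_power:
 fixes S :: "nat set"
 assumes "S <= P y" "!!p. p \<in> S ==> int p dvd quad D u v"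
 shows "W z y u v <= (1/2)^card S"
proof -
 have fin: "finite S" using assms(1) finite_P finite_subset by blast
 have "W z y u v = (\<Prod>p\<in>S. e z p u v)*(\<Prod>p\<in>P y - S. e z p u v)"
  unfolding W_def using finite_P assms(1) by (simp add: prod.subset_diff mult.commute)
 also have "... <= (\<Prod>p\<in>S. 1/2)*1"
 proof (intro mult_mono prod_mono prod_le_1)
  show "0 <= e z p u v & e z p u v <= 1/2" if "p \<in> S" for p using assms(2)[OF that] by (simp add: e_def)
 qed (use e_range in \<open>auto intro!: prod_nonneg prod_le_1\<close>)
 finally show ?thesis by simp
qed

text \<open>The representations of n = n0*n1 number at most a constant times 2 to the number of
  primes of n1, and each has weight at most 1/2 for every such prime up to y. What remains is 2 for
  each prime above y, at most J of them. Primitivity is enforced up to y by the weight and above y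
  by the definition of R.\<close>

lemma representation_weight_le:
 fixes n :: int and y z :: real and L J :: nat
 assumes y: "y > 1" and n: "real_of_int n <= y^J"
 defines "R == {(u, v). (u, v) \<in> {int L..<3*int L} \<times> {int L..<3*int L} & quad D u v = n & in_class u v & W z y u v ~= 0
   & (\<forall>p. prime p --> y < real p --> ~ (int p dvd u & int p dvd v))}"
 shows "(\<Sum>(u, v)\<in>R. W z y u v) <= 2^J*real (nat (2*(2*n0 + 1)))"
proof (cases "R = {}")
 case False
 then obtain u v where uv: "(u, v) \<in> R" by auto
 hence cl: "in_class u v" and qn: "quad D u v = n" by (auto simp: R_def)
 obtain n1 :: nat where n1: "quad D u v = n0*int n1" "n1 > 0" "coprime n1 M" using class_factorization[OF cl] by metis
 have nn: "n = n0*int n1" using n1(1) qn by simp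
 have pM: "~ p dvd M" if "p \<in> prime_factors n1" for p
  using that n1(3) by (metis coprime_common_divisor_nat in_prime_factors_iff not_prime_1)
 have co: "p > 2 & ~ int p dvd D" if "p \<in> prime_factors n1" for p
  using prime_not_dvd_M[OF _ pM[OF that]] that by auto
 define S where "S = {p\<in>prime_factors n1. real p <= y}"
 have SP: "S <= P y" using pM by (auto simp: S_def P_def)
 have dq: "int p dvd n" if "p \<in> prime_factors n1" for p unfolding nn using that by auto
 have prim: "quad D a b = n & (\<forall>p\<in>prime_factors n1. ~ (int p dvd a & int p dvd b))" if ab: "(a, b) \<in> R" for a b
 proof (intro conjI ballI)
  show "quad D a b = n" using ab by (simp add: R_def)
  fix p assume p: "p \<in> prime_factors n1"
  show "~ (int p dvd a & int p dvd b)"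
  proof (cases "real p <= y")
   case True
   hence "p \<in> P y" using SP p by (auto simp: S_def)
   moreover have "W z y a b ~= 0" using ab by (simp add: R_def)
   ultimately have "e z p a b ~= 0" using finite_P by (auto simp: W_def)
   thus ?thesis by (auto simp: e_def)
  next
   case False
   thus ?thesis using ab p by (auto simp: R_def)
  qed
 qed
 have card: "finite R & card R <= 2^card (prime_factors n1)*nat (2*(2*n0 + 1))"
  by (rule card_primitive_representations[OF D_pos nn n0_pos n1(2) co prim])
 have "(\<Sum>(u, v)\<in>R. W z y u v) <= (\<Sum>x\<in>R. (1/2)^card S)"
 proof (rule sum_mono)
  fix x assume "x \<in> R"
  then obtain a b where x: "x = (a, b)" "(a, b) \<in> R" by (cases x) auto
  have "quad D a b = n" using x(2) by (simp add: R_def)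
  hence "W z y a b <= (1/2)^card S" using dq by (intro W_le_half_power[OF SP]) (auto simp: S_def)
  thus "(case x of (u, v) => W z y u v) <= (1/2)^card S" by (simp add: x(1))
 qed
 also have "... = real (card R)*(1/2)^card S" by simp
 also have "... <= real (2^card (prime_factors n1)*nat (2*(2*n0 + 1)))*(1/2)^card S"
  using card by (intro mult_right_mono) (simp_all only: of_nat_le_iff, simp)
 also have "... = 2^card (prime_factors n1)*(1/2)^card S*real (nat (2*(2*n0 + 1)))" by simp
 also have "... <= 2^J*real (nat (2*(2*n0 + 1)))"
 proof (rule mult_right_mono)
  let ?T = "{p\<in>prime_factors n1. y < real p}"
  have "1*int n1 <= n0*int n1" using n0_pos by (intro mult_right_mono) auto
  hence "int n1 <= n" unfolding nn by simp
  hence "real_of_int (int n1) <= real_of_int n" by (simp only: of_int_le_iff)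
  hence "real n1 <= y^J" using n by simp
  hence T: "card ?T <= J" by (rule card_large_prime_factors[OF n1(2) y])
  have "prime_factors n1 = S \<union> ?T" by (auto simp: S_def)
  hence "card (prime_factors n1) <= card S + card ?T" using card_Un_le[of S ?T] by simp
  hence "card (prime_factors n1) <= card S + J" using T by simp
  hence "(2::real)^card (prime_factors n1) <= 2^(card S + J)" by (intro power_increasing) auto
  hence "2^card (prime_factors n1)*(1/2)^card S <= 2^(card S + J)*(1/2 :: real)^card S" by (intro mult_right_mono) auto
  also have "... = 2^J" by (simp add: power_add power_one_over)
  finally show "2^card (prime_factors n1)*(1/2)^card S <= (2::real)^J" .
 qed simp
 finally show ?thesis .
qed (simp only: sum.empty, simp)

text \<open>Pairs with a common prime factor above y are split off at a cost of O(L^4/y). The others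
  are grouped by the value of the form, and each value has bounded total weight; every pair occurs
  at most L^2 times in the box sum.\<close>

lemma SG_le_count:
 fixes y z :: real and L J :: nat and T :: int
 assumes L: "L > 0" and y: "y > 1" and T: "9*(1 + D)*(int L)^2 <= T" "real_of_int (9*(1 + D)*(int L)^2) <= y^J"
 shows "SG L z y <= (real L)^2*(2^J*real (nat (2*(2*n0 + 1)))*real (card {n\<in>{1..T}. (\<exists>u v. quad D u v = n) & good_shift n})) + 72*real L^4/y"
proof -
 let ?U = "{int L..<3*int L}"
 let ?c = "2^J*real (nat (2*(2*n0 + 1)))"
 define N where "N = {n\<in>{1..9*(1 + D)*(int L)^2}. (\<exists>u v. quad D u v = n) & good_shift n}"
 define pr where "pr = (%u v. \<forall>p. prime p --> y < real p --> ~ (int p dvd u & int p dvd v))"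
 define F where "F = (%u v. w0 u v * W z y u v * of_bool (good u v) * of_bool (pr u v))"
 define Q where "Q = {p. prime p & y < real p & real p <= 3*real L}"
 have finQ: "finite Q" unfolding Q_def by (rule finite_subset[OF _ finite_real_le_set[of "%_. True" "3*real L"]]) auto
 have finN: "finite N" unfolding N_def by (rule finite_subset[of _ "{1..9*(1 + D)*(int L)^2}"]) auto
 have F0: "0 <= F u v" for u v unfolding F_def using W_range(1) w0(3) by (intro mult_nonneg_nonneg) auto
 have "SG L z y <= box_sum L (%u v. F u v + (\<Sum>p\<in>Q. of_bool (int p dvd u & int p dvd v)))"
  unfolding SG_def
 proof (rule box_sum_mono_range)
  fix u v assume uv: "int L <= u" "u < 3*int L" "int L <= v" "v < 3*int L"
  have w1: "w0 u v * W z y u v * of_bool (good u v) <= 1"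
   using w0(3)[of u v] W_range[of z y u v] by (intro mult_le_one) auto
  show "w0 u v * W z y u v * of_bool (good u v) <= F u v + (\<Sum>p\<in>Q. of_bool (int p dvd u & int p dvd v))"
  proof (cases "pr u v")
   case True
   thus ?thesis by (simp add: F_def sum_nonneg)
  next
   case False
   then obtain p where p: "prime p" "y < real p" "int p dvd u" "int p dvd v" by (auto simp: pr_def)
   have "int p <= u" using p(3) uv L by (intro zdvd_imp_le) auto
   hence "p \<in> Q" using p uv by (simp add: Q_def)
   hence "(\<Sum>p\<in>{p}. of_bool (int p dvd u & int p dvd v)) <= (\<Sum>p\<in>Q. of_bool (int p dvd u & int p dvd v) :: real)"
    using finQ by (intro sum_mono2) auto
   thus ?thesis using w1 F0[of u v] p by simp
  qed
 qed
 also have "... = box_sum L F + (\<Sum>p\<in>Q. box_sum L (%u v. of_bool (int p dvd u & int p dvd v)))"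
  by (simp only: box_sum_add box_sum_sum)
 also have "(\<Sum>p\<in>Q. box_sum L (%u v. of_bool (int p dvd u & int p dvd v))) <= (\<Sum>p\<in>Q. 36*real L^4*(1/(real p)^2))"
  using box_sum_common_divisor_le[of _ L] by (intro sum_mono) (auto simp: Q_def prime_gt_0_nat)
 also have "... = 36*real L^4*(\<Sum>p\<in>Q. 1/(real p)^2)" by (simp only: sum_distrib_left)
 also have "... <= 36*real L^4*(2/y)"
  using y finQ by (intro mult_left_mono sum_inverse_squares_real_le) (auto simp: Q_def)
 also have "box_sum L F <= (real L)^2*(\<Sum>u\<in>?U. \<Sum>v\<in>?U. F u v)" by (rule box_sum_le_square[OF F0])
 also have "(\<Sum>u\<in>?U. \<Sum>v\<in>?U. F u v) <= ?c*real (card N)"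
 proof -
  define R where "R = (%n. {(u, v). (u, v) \<in> ?U \<times> ?U & quad D u v = n & in_class u v & W z y u v ~= 0 & pr u v})"
  have finU: "finite (?U \<times> ?U)" by simp
  have finR: "finite (R n)" for n unfolding R_def by (rule finite_subset[OF _ finU]) auto
  have "(\<Sum>u\<in>?U. \<Sum>v\<in>?U. F u v) = (\<Sum>(u, v)\<in>?U \<times> ?U. F u v)" by (rule sum.cartesian_product)
  also have "... <= (\<Sum>(u, v)\<in>(\<Union>n\<in>N. R n). W z y u v)"
  proof -
   have "(\<Sum>(u, v)\<in>?U \<times> ?U. F u v) = (\<Sum>(u, v)\<in>{x\<in>?U \<times> ?U. (case x of (u, v) => F u v) ~= 0}. F u v)"
    by (rule sum.mono_neutral_right) auto
   also have "... <= (\<Sum>(u, v)\<in>{x\<in>?U \<times> ?U. (case x of (u, v) => F u v) ~= 0}. W z y u v)"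
   proof (rule sum_mono)
    fix x :: "int \<times> int"
    obtain u v where x: "x = (u, v)" by (cases x)
    have "F u v <= W z y u v" using W_range(1)[of z y u v] by (simp add: F_def w0_def)
    thus "(case x of (u, v) => F u v) <= (case x of (u, v) => W z y u v)" by (simp add: x)
   qed
   also have "... <= (\<Sum>(u, v)\<in>(\<Union>n\<in>N. R n). W z y u v)"
   proof (rule sum_mono2)
    show "finite (\<Union>n\<in>N. R n)" using finN finR by blast
    show "{x\<in>?U \<times> ?U. (case x of (u, v) => F u v) ~= 0} <= (\<Union>n\<in>N. R n)"
    proof
     fix x assume x: "x \<in> {x\<in>?U \<times> ?U. (case x of (u, v) => F u v) ~= 0}"
     obtain u v where xx: "x = (u, v)" by (cases x)
     have uv: "int L <= u" "u < 3*int L" "int L <= v" "v < 3*int L" and Fn: "F u v ~= 0" using x xx by auto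
     have f: "in_class u v" "W z y u v ~= 0" "good u v" "pr u v" using Fn by (auto simp: F_def w0_def)
     have "1 <= quad D u v"
     proof -
      have "1*1 <= u*u" using uv L by (intro mult_mono) auto
      moreover have "0 <= D * v^2" using D_pos by simp
      ultimately show ?thesis by (simp add: quad_def power2_eq_square)
     qed
     moreover have "quad D u v <= 9*(1 + D)*(int L)^2"
     proof -
      have u9: "u^2 <= (3*int L)^2" by (rule power_mono) (use uv in linarith)+
      have v9: "v^2 <= (3*int L)^2" by (rule power_mono) (use uv in linarith)+
      have "D * v^2 <= D*(3*int L)^2" using v9 D_pos by (intro mult_left_mono) auto
      hence "quad D u v <= (3*int L)^2 + D*(3*int L)^2" unfolding quad_def using u9 by linarith
      also have "... = 9*(1 + D)*(int L)^2" by (simp add: power_mult_distrib algebra_simps)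
      finally show ?thesis .
     qed
     ultimately have "quad D u v \<in> N" using f(3) unfolding N_def good_iff by auto
     moreover have "x \<in> R (quad D u v)" using f uv by (simp add: R_def xx)
     ultimately show "x \<in> (\<Union>n\<in>N. R n)" by blast
    qed
    show "0 <= (case x of (u, v) => W z y u v)" for x using W_range(1) by (simp split: prod.split)
   qed
   finally show ?thesis .
  qed
  also have "... = (\<Sum>n\<in>N. \<Sum>(u, v)\<in>R n. W z y u v)"
   using finN finR by (intro sum.UNION_disjoint) (auto simp: R_def)
  also have "... <= (\<Sum>n\<in>N. ?c)"
  proof (rule sum_mono)
   fix n assume "n \<in> N"
   hence "real_of_int n <= real_of_int (9*(1 + D)*(int L)^2)" unfolding N_def by (simp only: of_int_le_iff) simp
   hence "real_of_int n <= y^J" using T(2) by linarith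
   from representation_weight_le[OF y this, where L = L and z = z]
   show "(\<Sum>(u, v)\<in>R n. W z y u v) <= ?c" by (simp only: R_def pr_def)
  qed
  finally show ?thesis by (simp add: mult.commute)
 qed
 also have "?c*real (card N) <= ?c*real (card {n\<in>{1..T}. (\<exists>u v. quad D u v = n) & good_shift n})"
 proof (rule mult_left_mono)
  have "card N <= card {n\<in>{1..T}. (\<exists>u v. quad D u v = n) & good_shift n}"
  proof (rule card_mono)
   show "finite {n\<in>{1..T}. (\<exists>u v. quad D u v = n) & good_shift n}" by (rule finite_subset[of _ "{1..T}"]) auto
  qed (use T(1) in \<open>auto simp: N_def\<close>)
  thus "real (card N) <= real (card {n\<in>{1..T}. (\<exists>u v. quad D u v = n) & good_shift n})" by simp
 qed simp
 finally show ?thesis by (simp add: mult_left_mono)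
qed

text \<open>A box with parameter L produces values up to k*L^2, so x corresponds to L = floor (sqrt
  (x/k)). The error O(L^4/y) is a power below L^4/ln L and takes at most half of the weight.\<close>

theorem count_lower_bound:
 "\<exists>c>0. eventually (%x::real. c*x/ln x <= real (card {n\<in>{1..(floor x)}. (\<exists>u v. quad D u v = n) & good_shift n})) at_top"
proof -
 define CT where "CT = (%T::int. real (card {n\<in>{1..T}. (\<exists>u v. quad D u v = n) & good_shift n}))"
 obtain c B where c: "c > 0" "(B::nat) >= 1"
  and ev: "eventually (%L. \<exists>z. c*(real L^4/ln (real L)) <= SG L z (real L powr (1/real B))) sequentially"
  using good_weight_lower_bound by blast
 define k where "k = 9*(1 + real_of_int D)"
 have k9: "k >= 9" using D_pos by (simp add: k_def)
 define J where "J = 3*B"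
 define H where "H = 2^J*real (nat (2*(2*n0 + 1)))"
 have H: "H > 0" unfolding H_def using n0_pos by simp
 have s: "4 - 1/real B < 4" "c/2 > 0" using c by auto
 have ev2: "eventually (%x::real. 3 <= x & k <= x & 72*x powr (4 - 1/real B) <= c/2*(x^4/ln x)) at_top"
  by (intro eventually_conj eventually_ge_at_top eventually_powr_negligible s)
 have "eventually (%L. L >= 3 & (\<forall>T. real_of_int T >= k*(real L)^2 --> c/(2*H)*((real L)^2/ln (real L)) <= CT T)) sequentially"
  using ev eventually_real_sequentially[OF ev2]
 proof eventually_elim
  case (elim L)
  then obtain z where z: "c*(real L^4/ln (real L)) <= SG L z (real L powr (1/real B))" by blast
  define y where "y = real L powr (1/real B)"
  have L3: "3 <= real L" "k <= real L" and n1: "72*real L powr (4 - 1/real B) <= c/2*(real L^4/ln (real L))" using elim by auto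
  have L0: "L > 0" using L3 by (cases L) auto
  have lL: "ln (real L) > 0" using L3 by simp
  have "real L powr 0 < real L powr (1/real B)" using L3 c by (intro powr_less_mono) auto
  hence y1: "y > 1" using L3 by (simp add: y_def)
  have yJ: "y^J = real L^3"
  proof -
   have "y^B = real L powr (1/real B*real B)" unfolding y_def using L0 by (simp only: powr_realpow[symmetric] powr_gt_zero powr_powr)
   also have "... = real L" using c L0 by simp
   finally have "y^B = real L" .
   thus ?thesis by (simp add: J_def power_mult mult.commute[of 3])
  qed
  have b: "real_of_int (9*(1 + D)*(int L)^2) <= y^J"
  proof -
   have "k*(real L)^2 <= real L*(real L)^2" using L3 by (intro mult_right_mono) auto
   thus ?thesis unfolding yJ k_def by (simp add: power3_eq_cube power2_eq_square)
  qed
  have "c/(2*H)*((real L)^2/ln (real L)) <= CT T" if T: "real_of_int T >= k*(real L)^2" for T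
  proof -
   have "real_of_int (9*(1 + D)*(int L)^2) <= real_of_int T" using T by (simp add: k_def)
   hence T': "9*(1 + D)*(int L)^2 <= T" by (simp only: of_int_le_iff)
   have "SG L z y <= (real L)^2*(H*CT T) + 72*real L^4/y"
    unfolding H_def CT_def by (rule SG_le_count[OF L0 y1 T' b])
   moreover have "72*real L^4/y = 72*real L powr (4 - 1/real B)" unfolding y_def using L0 by (simp add: powr_diff)
   moreover have "2*(c/2*(real L^4/ln (real L))) <= SG L z y" using z by (simp add: y_def)
   moreover have "g <= A" if "S <= A + R" "R = R'" "2*g <= S" "R' <= g" for S A R R' g :: real using that by linarith
   ultimately have "c/2*(real L^4/ln (real L)) <= (real L)^2*(H*CT T)" using n1 by blast
   hence "(real L)^2*(c/2*((real L)^2/ln (real L))) <= (real L)^2*(H*CT T)" by (simp add: power4_eq_xxxx power2_eq_square mult_ac)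
   hence "c/2*((real L)^2/ln (real L)) <= H*CT T" by (rule mult_left_le_imp_le) (use L0 in simp)
   moreover have "s/H <= g" if "s <= H*g" for s g using that H by (simp add: pos_divide_le_eq mult.commute)
   ultimately have "(c/2*((real L)^2/ln (real L)))/H <= CT T" by blast
   thus ?thesis by (simp add: mult_ac)
  qed
  thus ?case using L3 by auto
 qed
 then obtain L0 where L0: "!!L. L >= L0 ==> L >= 3 & (\<forall>T. real_of_int T >= k*(real L)^2 --> c/(2*H)*((real L)^2/ln (real L)) <= CT T)"
  by (auto simp: eventually_sequentially)
 \<comment> \<open>The factor 4 comes from L >= r/2, the loss in taking the integer part of r = sqrt
   (x/k).\<close>
 define c' where "c' = c/(2*H)/(4 * k)"
 have c': "c' > 0" unfolding c'_def using c H k9 by simp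
 have "eventually (%x::real. c'*x/ln x <= CT (floor x)) at_top"
  using eventually_ge_at_top[of "k*(real L0 + 3)^2"]
 proof eventually_elim
  case (elim x)
  define r where "r = sqrt (x / k)"
  define L where "L = nat (floor r)"
  have k0: "k > 0" using k9 by linarith
  have "(real L0 + 3)^2 <= x / k" using elim k0 by (simp add: field_simps)
  hence xk: "0 <= x / k" by (rule order_trans[OF zero_le_power2])
  have "real L0 + 3 <= r" unfolding r_def by (rule real_le_rsqrt) fact
  hence r3: "r >= 3" "real L0 <= r" by simp_all
  have rr: "r*r = x / k" unfolding r_def using xk by (simp only: real_sqrt_mult_self abs_of_nonneg)
  have x: "x = k*(r*r)" using rr k0 by (simp add: field_simps)
  have xr: "r <= x"
  proof -
   have "1*(r*1) <= k*(r*r)" using k9 r3 by (intro mult_mono) auto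
   thus ?thesis using x by simp
  qed
  have Lf: "real L = of_int (floor r)" using r3 by (simp add: L_def)
  have Lr: "real L <= r" "r/2 <= real L" "real L >= 2" unfolding Lf using floor_correct[of r] r3 by linarith+
  have "L0 <= L" unfolding L_def using r3(2) by (simp add: le_nat_floor)
  note LL = L0[OF this]
  have T: "real_of_int (floor x) >= k*(real L)^2"
  proof -
   have "real L*real L <= r*r" using Lr r3 by (intro mult_mono) auto
   hence "k*(real L*real L) <= x" using k0 x by simp
   hence "real_of_int (9*(1 + D)*(int L)^2) <= x" by (simp add: k_def power2_eq_square)
   hence "9*(1 + D)*(int L)^2 <= (floor x)" by (simp only: le_floor_iff)
   hence "real_of_int (9*(1 + D)*(int L)^2) <= real_of_int (floor x)" by (simp only: of_int_le_iff)
   thus ?thesis by (simp add: k_def)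
  qed
  have "c'*x/ln x = c/(2*H)*((r/2)^2/ln x)" unfolding c'_def x using k0 by (simp add: power2_eq_square)
  also have "... <= c/(2*H)*((real L)^2/ln (real L))"
  proof (intro mult_left_mono frac_le)
   show "(r/2)^2 <= (real L)^2" using Lr r3 by (intro power_mono) auto
   show "0 < ln (real L)" using Lr by simp
   show "ln (real L) <= ln x" using Lr xr by (intro ln_mono) auto
   show "0 <= c/(2*H)" using c H by simp
  qed simp
  also have "... <= CT (floor x)" using LL T by blast
  finally show ?case .
 qed
 thus ?thesis using c' unfolding CT_def by blast
qed

end

section \<open>Counting\<close>

text \<open>The base point has to make n0 and n0 + h both values of the form. The difference between
  the squares of u and of u + 1 or u + 2 is linear in u; together with b = 1 or b = 2 it meets every
  h.\<close>

lemma norm_difference_solution: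
 fixes D h :: int
 assumes "D = 1 \<or> D = 2 \<or> odd D"
 shows "\<exists>u a b. u^2 + D + h = a^2 + D*b^2"
proof -
 have "odd D \<or> D = 2" using assms by auto
 then consider "odd h" | "even h" "odd D" | "even h" "D = 2" by blast
 thus ?thesis
 proof cases
  case 1
  then obtain u where "h = 2*u + 1" by (elim oddE)
  hence "u^2 + D + h = (u + 1)^2 + D*1^2" by (simp add: power2_eq_square algebra_simps)
  thus ?thesis by blast
 next
  case 2
  hence "even (h - 1 - 3*D)" by simp
  then obtain u where u: "h - 1 - 3*D = 2*u" by (elim evenE)
  hence h: "h = 2*u + 1 + 3*D" by simp
  have "u^2 + D + h = (u + 1)^2 + D*2^2" unfolding h by (simp add: power2_eq_square algebra_simps)
  thus ?thesis by blast
 next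
  case 3
  hence "h mod 4 = 0 \<or> h mod 4 = 2" by presburger
  thus ?thesis
  proof
   assume "h mod 4 = 0"
   hence "4 dvd h - 4" by presburger
   then obtain u where "h - 4 = 4*u" by (elim dvdE)
   hence h: "h = 4*u + 4" by simp
   have "u^2 + D + h = (u + 2)^2 + D*1^2" unfolding h 3(2) by (simp add: power2_eq_square algebra_simps)
   thus ?thesis by blast
  next
   assume "h mod 4 = 2"
   hence "4 dvd h - 10" by presburger
   then obtain u where "h - 10 = 4*u" by (elim dvdE)
   hence h: "h = 4*u + 10" by simp
   have "u^2 + D + h = (u + 2)^2 + D*2^2" unfolding h 3(2) by (simp add: power2_eq_square algebra_simps)
   thus ?thesis by blast
  qed
 qed
qed

lemma bK_01: "bK d n = 0 \<or> bK d n = 1" by (simp add: bK_def)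

context imag_quad begin

text \<open>A counted n is a value of the form, and n + h is m0, a value of the form by the choice
  of u0, times a cofactor whose inert primes have even exponents; both factors are norms.\<close>

lemma positive_shift:
 assumes cl: "class_number_one d" and h: "h > 0"
 shows "\<exists>c>0. eventually (%x::real. c*x/ln x <= (\<Sum>n\<in>{1..(floor x)}. bK d n*bK d (n + h))) at_top"
proof -
 note dc = discriminant_cases[OF cl]
 obtain chi q where ch: "real_char chi q" and sp: "!!l::nat. prime l ==> l > 2 ==> ~ int l dvd D ==>
  chi l = 1 & (\<exists>s. int l dvd s\<^sup>2 + D) \<or> chi l = -1 & (\<forall>s. ~ int l dvd s\<^sup>2 + D)"
  using splitting_character[OF dc] by blast
 have "odd D" if "D mod 4 = 3" using that by presburger
 hence "D = 1 \<or> D = 2 \<or> odd D" using dc by blast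
 then obtain u0 a b where u0: "u0^2 + D + h = a^2 + D*b^2" using norm_difference_solution by blast
 define n0 where "n0 = u0^2 + D"
 define m0 where "m0 = n0 + h"
 define M where "M = nat (n0*m0*(420*int q*D*h*n0*m0))"
 have pos: "n0 > 0" "m0 > 0" using D_pos h unfolding m0_def n0_def by (simp_all add: add_nonneg_pos add_pos_pos)
 have q: "q > 0" using ch by (simp add: real_char_def)
 have "n0*m0*(420*int q*D*h*n0*m0) > 0" using pos q D_pos h by simp
 hence M: "int M = n0*m0*(420*int q*D*h*n0*m0)" unfolding M_def by (intro int_nat_eq[THEN trans]) simp
 have dM: "2 dvd M & (\<forall>l::nat. int l dvd D --> l dvd M)"
 proof (intro conjI allI impI)
  have "int 2 dvd int M" unfolding M by simp
  thus "2 dvd M" by (simp only: of_nat_dvd_iff)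
  fix l :: nat assume "int l dvd D"
  hence "int l dvd int M" unfolding M by simp
  thus "l dvd M" by (simp only: of_nat_dvd_iff)
 qed
 have sp': "l > 2 & (chi l = 1 & (\<exists>s. int l dvd s\<^sup>2 + D) \<or> chi l = -1 & (\<forall>s. ~ int l dvd s\<^sup>2 + D))" if l: "prime l" "~ l dvd M" for l
 proof -
  have "l ~= 2" using dM l(2) by auto
  hence "l > 2" using prime_ge_2_nat[OF l(1)] by simp
  thus ?thesis using sp[OF l(1)] dM l(2) by blast
 qed
 interpret sf: shifted_form chi q D h u0 n0 m0 M
 proof (rule shifted_form.intro[OF ch], unfold_locales)
  fix l :: nat assume "prime l" "~ l dvd M"
  thus "chi l = 1 \<or> chi l = -1 & (\<forall>s. ~ int l dvd s\<^sup>2 + D)" using sp' by blast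
 qed (use D_pos h M in \<open>simp_all add: n0_def m0_def\<close>)
 obtain c where c: "c > 0" and ev: "eventually (%x::real. c*x/ln x <= real (card {n\<in>{1..(floor x)}. (\<exists>u v. quad D u v = n) & sf.good_shift n})) at_top"
  using sf.count_lower_bound by blast
 have m0n: "is_norm m0" unfolding m0_def n0_def u0 by (rule is_norm_quad)
 have good: "bK d n*bK d (n + h) = 1" if n: "n >= 1" "\<exists>u v. quad D u v = n" "sf.good_shift n" for n
 proof -
  have "is_norm n" using n(2) is_norm_quad by (auto simp: quad_def)
  hence 1: "bK d n = 1" using n(1) by (intro bK_eq_1) auto
  obtain m1 :: nat where m1: "n + h = m0*int m1" "m1 > 0" "coprime m1 M" "!!p. prime p ==> chi p = -1 ==> even (multiplicity p m1)"
   using n(3) unfolding sf.good_shift_def by blast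
  have "is_norm (int m1)"
  proof (rule norm_if_inert_even[OF cl m1(2)])
   fix l assume l: "prime l" "l dvd m1"
   have "~ l dvd M"
   proof
    assume "l dvd M"
    hence "l dvd 1" using l(2) m1(3) by (metis coprime_common_divisor_nat nat_dvd_1_iff_1)
    thus False using l(1) by simp
   qed
   thus "l > 2 & ((\<exists>s. int l dvd s\<^sup>2 + D) \<or> even (multiplicity l m1))" using sp'[OF l(1)] m1(4)[OF l(1)] by blast
  qed
  hence "is_norm (n + h)" unfolding m1(1) by (rule is_norm_mult[OF m0n])
  hence "bK d (n + h) = 1" using n(1) h by (intro bK_eq_1) auto
  thus ?thesis using 1 by simp
 qed
 have "eventually (%x::real. c*x/ln x <= (\<Sum>n\<in>{1..(floor x)}. bK d n*bK d (n + h))) at_top"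
  using ev
 proof eventually_elim
  case (elim x)
  let ?S = "{n\<in>{1..(floor x)}. (\<exists>u v. quad D u v = n) & sf.good_shift n}"
  have "real (card ?S) = (\<Sum>n\<in>?S. 1)" by simp
  also have "... = (\<Sum>n\<in>?S. bK d n*bK d (n + h))" by (intro sum.cong refl) (use good in auto)
  also have "... <= (\<Sum>n\<in>{1..(floor x)}. bK d n*bK d (n + h))"
   by (intro sum_mono2) (auto simp: bK_def)
  finally show ?case using elim by linarith
 qed
 thus ?thesis using c by blast
qed

end

theorem theorem1p5:
  fixes d h :: int
  assumes "d < 0" and "squarefree d" and "class_number_one d"
  shows "\<exists>c>0. eventually (\<lambda>x::real.
           (\<Sum>n\<in>{1..\<lfloor>x\<rfloor>}. bK d n * bK d (n + h)) \<ge> c * x / ln x) at_top"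
proof -
 interpret imag_quad d "- d" by unfold_locales (use assms in auto)
 consider "h > 0" | "h = 0" | "h < 0" by linarith
 thus ?thesis
 proof cases
  case 1
  thus ?thesis using positive_shift[OF assms(3)] by simp
 next
  case 2
  obtain c where c: "c > 0" "eventually (%x::real. c*x/ln x <= (\<Sum>n\<in>{1..(floor x)}. bK d n*bK d (n + 1))) at_top"
   using positive_shift[OF assms(3), of 1] by auto
  \<comment> \<open>The indicator takes only the values 0 and 1, so the sum of its squares dominates
    the sum for the shift 1.\<close>
  have le: "bK d n*bK d (n + 1) <= bK d n*bK d n" for n
   using bK_01[of d n] bK_01[of d "n + 1"] by auto
  have "eventually (%x::real. (\<Sum>n\<in>{1..(floor x)}. bK d n*bK d (n + h)) >= c*x/ln x) at_top"
   using c(2)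
  proof eventually_elim
   case (elim x)
   have "(\<Sum>n\<in>{1..(floor x)}. bK d n*bK d (n + 1)) <= (\<Sum>n\<in>{1..(floor x)}. bK d n*bK d n)" by (intro sum_mono le)
   thus ?case using elim 2 by simp
  qed
  thus ?thesis using c(1) by blast
 next
  case 3
  \<comment> \<open>Substituting n + k for n turns the sum up to x - k for the shift k into a part
    of the sum up to x for the shift -k; halving the constant absorbs the passage from x to x -
    k.\<close>
  define k where "k = - h"
  have k: "k > 0" "h = - k" using 3 by (simp_all add: k_def)
  obtain c where c: "c > 0" "eventually (%x::real. c*x/ln x <= (\<Sum>n\<in>{1..(floor x)}. bK d n*bK d (n + k))) at_top"
   using positive_shift[OF assms(3) k(1)] by auto
  have "filterlim (%x::real. x - of_int k) at_top at_top" by real_asymp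
  hence ev: "eventually (%x::real. c*(x - of_int k)/ln (x - of_int k) <= (\<Sum>n\<in>{1..\<lfloor>x - of_int k\<rfloor>}. bK d n*bK d (n + k))) at_top"
   using c(2) by (auto simp: filterlim_iff)
  have "eventually (%x::real. (\<Sum>n\<in>{1..(floor x)}. bK d n*bK d (n + h)) >= c/2*x/ln x) at_top"
   using ev eventually_ge_at_top[of "2 * of_int k + 4"]
  proof eventually_elim
   case (elim x)
   have x: "x >= 2 * of_int k + 4" "real_of_int k > 0" using elim k by auto
   have fl: "\<lfloor>x - of_int k\<rfloor> = (floor x) - k" by simp
   have "(\<Sum>n\<in>{1..\<lfloor>x - of_int k\<rfloor>}. bK d n*bK d (n + k)) = (\<Sum>n\<in>(%n. n + k) ` {1..(floor x) - k}. bK d n*bK d (n + h))"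
    unfolding fl by (subst sum.reindex) (auto simp: inj_on_def k mult.commute)
   also have "... <= (\<Sum>n\<in>{1..(floor x)}. bK d n*bK d (n + h))"
    using k by (intro sum_mono2) (auto simp: bK_def)
   finally have 1: "(\<Sum>n\<in>{1..\<lfloor>x - of_int k\<rfloor>}. bK d n*bK d (n + k)) <= (\<Sum>n\<in>{1..(floor x)}. bK d n*bK d (n + h))" .
   have "c/2*x/ln x <= c*(x - of_int k)/ln (x - of_int k)"
   proof (rule frac_le)
    show "c/2*x <= c*(x - of_int k)" using x c(1) by (simp add: field_simps)
    show "0 <= c*(x - of_int k)" using x c(1) by simp
    show "0 < ln (x - of_int k)" using x by simp
    show "ln (x - of_int k) <= ln x" using x by (intro ln_mono) auto
   qed
   thus ?case using elim 1 by linarith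
  qed
  thus ?thesis using c(1) by (intro exI[of _ "c/2"]) auto
 qed
qed

end
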